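(* Fix a Hölder exponent $\beta\in(0,1)$. There exist $\epsilon_0>0$, $\delta>0$ and $C>0$, with $\delta,C$ independent of $\epsilon$, such that for every $\epsilon\in(0,\epsilon_0)$ the mean curvature operator on functions $w\in\mathcal C^{2,\beta}_{loc}([S_\epsilon,\infty)\times\mathbb S^1)$ with $|w|_{2,\beta,s}\le\delta$ for all $s\ge S_\epsilon$ admits the expansion $$\mathcal M_\epsilon(w)=\tfrac12+\mathcal J_\epsilon w+\mathcal Q_\epsilon(w),$$ where $\mathcal J_\epsilon=\triangle+|h|^2+Ric(\nu)$ is the Jacobi operator of $\Sigma_\epsilon$, $\mathcal Q_\epsilon(0)=0$, and for all such $v,w$ and all $s\ge S_\epsilon$ $$|\mathcal Q_\epsilon(v)-\mathcal Q_\epsilon(w)|_{0,\beta,s}\le C\left(|v|_{2,\beta,s}+|w|_{2,\beta,s}\right)|v-w|_{2,\beta,s}.$$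
   Context: Use the model $\{(x,y,z):y>0\}$ of $\mathbb H^2\times\mathbb R$ with metric $\frac{dx^2+dy^2}{y^2}+dz^2$. For $\alpha>0$ put $\alpha_*=\sqrt{\alpha^2+1}$ and $\epsilon=\frac{\alpha_*}{\alpha}-1$; $\alpha$ and $\epsilon$ are equivalent parameters ($\epsilon\to0$ iff $\alpha\to\infty$). For $\theta\in\mathbb S^1=\mathbb R/2\pi\mathbb Z$ let $\varphi'=\varphi'(\theta)=-\sqrt{\alpha^2+\cos^2\theta}$, and $$\omega(s,\theta)=\Big(1+\frac{\sin^2\theta}{\alpha_*(\alpha+\alpha_* )(\alpha-\varphi')(\alpha_*-\varphi')}e^{-s}\cosh s\Big)^{-1},$$ $$\mathbf X_\alpha(s,\theta)=\Big(\frac{\sin\theta}{\alpha_*(\alpha-\varphi')}(\cosh s)e^{\epsilon s}\omega,\ e^{\epsilon s}\omega,\ \frac{\cos\theta}{\alpha(\alpha-\varphi')}\cosh s\Big),\quad (s,\theta)\in\mathbb R\times\mathbb S^1 .$$ Its image $\Sigma_\epsilon$ (a horizontal catenoid) has constant mean curvature $\frac12$, meaning that its principal curvatures satisfy $\kappa_1+\kappa_2=1$. $\nu$ is the unit normal with respect to which the principal curvatures (eigenvalues of $X\mapsto-\nabla_X\nu$) sum to $1$; $\triangle$ is the Laplace–Beltrami operator of $\Sigma_\epsilon$, $|h|^2$ the squared norm of its second fundamental form, $Ric(\nu)=Ric(\nu,\nu)$ the ambient Ricci curvature. $S_\epsilon>0$ is defined by $\epsilon\cosh S_\epsilon=1$.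 Functions on the end $\mathbf X_\alpha([S_\epsilon,\infty)\times\mathbb S^1)$ are identified with functions of $(s,\theta)$. $\mathcal M_\epsilon$ is the mean curvature operator for normal graphs off this end: $\mathcal M_\epsilon(w)$ is the mean curvature of the normal graph $(s,\theta)\mapsto\exp_{\mathbf X_\alpha(s,\theta)}(w(s,\theta)\nu(s,\theta))$, with respect to the unit normal obtained by continuous deformation from $\nu$. $|u|_{k,\beta,s}$ is the usual $\mathcal C^{k,\beta}$ norm on $[s,s+1]\times\mathbb S^1$.
   Formalization: Since mean curvature is half the sum of the principal curvatures, the linear term is corrected to one half of the Jacobi operator: M(w) = 1/2 + (1/2) J w + Q(w); with the printed J w the quadratic estimate would force J w = 0 for all small w. *)

theory Defs
  imports "HOL-Analysis.Analysis"
begin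

text \<open>Points and tangent vectors of \<open>H\<^sup>2 \<times> \<real>\<close> are coordinate triples \<open>(x, y, z)\<close> in \<open>real^3\<close>; the
  model is the open half-space \<open>y > 0\<close>, i.e. \<open>0 < p $ 2\<close>.\<close>

definition metric :: "real^3 \<Rightarrow> real^3^3" where
  "metric p = (\<chi> i j. if i \<noteq> j then 0 else if i = 3 then 1 else 1 / (p $ 2)\<^sup>2)"

definition gprod :: "real^3 \<Rightarrow> real^3 \<Rightarrow> real^3 \<Rightarrow> real" where
  "gprod p u v = (\<Sum>i\<in>UNIV. \<Sum>j\<in>UNIV. metric p $ i $ j * u $ i * v $ j)"

definition coord_deriv :: "3 \<Rightarrow> (real^3 \<Rightarrow> real) \<Rightarrow> real^3 \<Rightarrow> real" where
  "coord_deriv k f p = deriv (\<lambda>t. f (p + t *\<^sub>R axis k 1)) 0"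

definition christoffel :: "3 \<Rightarrow> 3 \<Rightarrow> 3 \<Rightarrow> real^3 \<Rightarrow> real" where
  "christoffel k i j p =
     (1/2) * (\<Sum>l\<in>UNIV. matrix_inv (metric p) $ k $ l *
       (coord_deriv i (\<lambda>q. metric q $ j $ l) p + coord_deriv j (\<lambda>q. metric q $ i $ l) p
        - coord_deriv l (\<lambda>q. metric q $ i $ j) p))"

definition christoffel_vec :: "real^3 \<Rightarrow> real^3 \<Rightarrow> real^3 \<Rightarrow> real^3" where
  "christoffel_vec p u v = (\<chi> k. \<Sum>i\<in>UNIV. \<Sum>j\<in>UNIV. christoffel k i j p * u $ i * v $ j)"

definition ricci :: "real^3 \<Rightarrow> real^3 \<Rightarrow> real^3 \<Rightarrow> real" where
  "ricci p u v = (\<Sum>i\<in>UNIV. \<Sum>j\<in>UNIV. u $ i * v $ j *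
     (\<Sum>k\<in>UNIV. coord_deriv k (christoffel k i j) p - coord_deriv j (christoffel k i k) p
       + (\<Sum>l\<in>UNIV. christoffel k k l p * christoffel l i j p
                - christoffel k j l p * christoffel l i k p)))"

definition geodesic :: "(real \<Rightarrow> real^3) \<Rightarrow> (real \<Rightarrow> real^3) \<Rightarrow> bool" where
  "geodesic c v \<longleftrightarrow> (\<forall>t. 0 < c t $ 2 \<and> (c has_vector_derivative v t) (at t) \<and>
      (v has_vector_derivative - christoffel_vec (c t) (v t) (v t)) (at t))"

definition exp_map :: "real^3 \<Rightarrow> real^3 \<Rightarrow> real^3" where
  "exp_map p u = (THE q. \<exists>c v. geodesic c v \<and> c 0 = p \<and> v 0 = u \<and> q = c 1)"

text \<open>A function on \<open>I \<times> \<real>/2\<pi>\<int>\<close> is a function of \<open>(s, \<theta>)\<close>, \<open>2\<pi>\<close>-periodic in \<open>\<theta>\<close>. The index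
  \<open>1 :: 2\<close> stands for \<open>s\<close> and \<open>2 :: 2\<close> for \<open>\<theta>\<close>. Derivatives in \<open>s\<close> are taken within \<open>I\<close>, hence are
  one-sided at the end points of \<open>I\<close>, and values outside of \<open>I\<close> are irrelevant.\<close>

definition pd :: "real set \<Rightarrow> 2 \<Rightarrow> (real \<Rightarrow> real \<Rightarrow> 'a::real_normed_vector) \<Rightarrow> real \<Rightarrow> real \<Rightarrow> 'a" where
  "pd I i f s \<theta> = (if i = 1 then vector_derivative (\<lambda>t. f t \<theta>) (at s within I)
                   else vector_derivative (\<lambda>t. f s t) (at \<theta>))"

primrec Ck :: "nat \<Rightarrow> real set \<Rightarrow> (real \<Rightarrow> real \<Rightarrow> real) \<Rightarrow> bool" where
  "Ck 0 I u \<longleftrightarrow> continuous_on (I \<times> UNIV) (\<lambda>(s, \<theta>). u s \<theta>)"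
| "Ck (Suc k) I u \<longleftrightarrow> continuous_on (I \<times> UNIV) (\<lambda>(s, \<theta>). u s \<theta>) \<and>
     (\<forall>s\<in>I. \<forall>\<theta>. (\<lambda>t. u t \<theta>) differentiable (at s within I) \<and> (\<lambda>t. u s t) differentiable (at \<theta>)) \<and>
     (\<forall>i. Ck k I (pd I i u))"

definition multi_pd :: "real set \<Rightarrow> nat \<Rightarrow> nat \<Rightarrow> (real \<Rightarrow> real \<Rightarrow> real) \<Rightarrow> real \<Rightarrow> real \<Rightarrow> real" where
  "multi_pd I a b u = ((pd I 1) ^^ a) (((pd I 2) ^^ b) u)"

text \<open>The Hoelder quotients are taken on the universal cover \<open>I \<times> \<real>\<close>. For periodic functions their
  supremum is the one over \<open>I \<times> S1\<close> with its product distance, since a pair of points of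
  \<open>I \<times> S1\<close> has lifts realizing its distance and all other lifts are farther apart.
  The norm is valued in \<open>ennreal\<close>, so that \<open>\<infinity>\<close> stands for ``not of class \<open>C^{k,\<beta>}\<close>''.\<close>

definition holder_seminorm :: "real \<Rightarrow> real set \<Rightarrow> (real \<Rightarrow> real \<Rightarrow> real) \<Rightarrow> ennreal" where
  "holder_seminorm \<beta> I u = (SUP (p, q)\<in>(I \<times> UNIV) \<times> (I \<times> UNIV).
      ennreal (\<bar>u (fst p) (snd p) - u (fst q) (snd q)\<bar> / dist p q powr \<beta>))"

definition holder_norm :: "nat \<Rightarrow> real \<Rightarrow> real set \<Rightarrow> (real \<Rightarrow> real \<Rightarrow> real) \<Rightarrow> ennreal" where
  "holder_norm k \<beta> I u =
     (\<Sum>(a, b)\<in>{(a, b). a + b \<le> k}. SUP (s, \<theta>)\<in>I \<times> UNIV. ennreal \<bar>multi_pd I a b u s \<theta>\<bar>)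
   + (\<Sum>(a, b)\<in>{(a, b). a + b = k}. holder_seminorm \<beta> I (multi_pd I a b u))"

definition holder_loc :: "nat \<Rightarrow> real \<Rightarrow> real \<Rightarrow> (real \<Rightarrow> real \<Rightarrow> real) \<Rightarrow> bool" where
  "holder_loc k \<beta> S u \<longleftrightarrow> (\<forall>s\<ge>S. \<forall>\<theta>. u s (\<theta> + 2 * pi) = u s \<theta>) \<and> Ck k {S..} u \<and>
     (\<forall>s\<ge>S. holder_norm k \<beta> {s..s+1} u < \<infinity>)"

definition first_form :: "real set \<Rightarrow> (real \<Rightarrow> real \<Rightarrow> real^3) \<Rightarrow> real \<Rightarrow> real \<Rightarrow> real^2^2" where
  "first_form I Y s \<theta> = (\<chi> i j. gprod (Y s \<theta>) (pd I i Y s \<theta>) (pd I j Y s \<theta>))"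

definition unit_normal ::
  "real set \<Rightarrow> (real \<Rightarrow> real \<Rightarrow> real^3) \<Rightarrow> (real \<Rightarrow> real \<Rightarrow> real^3) \<Rightarrow> bool" where
  "unit_normal I Y n \<longleftrightarrow> (\<forall>s\<in>I. \<forall>\<theta>. gprod (Y s \<theta>) (n s \<theta>) (n s \<theta>) = 1 \<and>
      (\<forall>i. gprod (Y s \<theta>) (n s \<theta>) (pd I i Y s \<theta>) = 0))"

definition cov_deriv ::
  "real set \<Rightarrow> (real \<Rightarrow> real \<Rightarrow> real^3) \<Rightarrow> 2 \<Rightarrow> (real \<Rightarrow> real \<Rightarrow> real^3) \<Rightarrow> real \<Rightarrow> real \<Rightarrow> real^3" where
  "cov_deriv I Y i n s \<theta> = pd I i n s \<theta> + christoffel_vec (Y s \<theta>) (pd I i Y s \<theta>) (n s \<theta>)"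

definition second_form ::
  "real set \<Rightarrow> (real \<Rightarrow> real \<Rightarrow> real^3) \<Rightarrow> (real \<Rightarrow> real \<Rightarrow> real^3) \<Rightarrow> real \<Rightarrow> real \<Rightarrow> real^2^2" where
  "second_form I Y n s \<theta> = (\<chi> i j. gprod (Y s \<theta>) (pd I i Y s \<theta>) (- cov_deriv I Y j n s \<theta>))"

text \<open>The matrix of \<open>X \<mapsto> - \<nabla>\<^sub>X n\<close> in the basis \<open>\<partial>\<^sub>s Y\<close>, \<open>\<partial>\<^sub>\<theta> Y\<close>; its eigenvalues are the principal
  curvatures, so that its trace is their sum.\<close>

definition shape_operator ::
  "real set \<Rightarrow> (real \<Rightarrow> real \<Rightarrow> real^3) \<Rightarrow> (real \<Rightarrow> real \<Rightarrow> real^3) \<Rightarrow> real \<Rightarrow> real \<Rightarrow> real^2^2" where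
  "shape_operator I Y n s \<theta> = matrix_inv (first_form I Y s \<theta>) ** second_form I Y n s \<theta>"

definition mean_curvature ::
  "real set \<Rightarrow> (real \<Rightarrow> real \<Rightarrow> real^3) \<Rightarrow> (real \<Rightarrow> real \<Rightarrow> real^3) \<Rightarrow> real \<Rightarrow> real \<Rightarrow> real" where
  "mean_curvature I Y n s \<theta> = trace (shape_operator I Y n s \<theta>) / 2"

definition second_form_sqnorm ::
  "real set \<Rightarrow> (real \<Rightarrow> real \<Rightarrow> real^3) \<Rightarrow> (real \<Rightarrow> real \<Rightarrow> real^3) \<Rightarrow> real \<Rightarrow> real \<Rightarrow> real" where
  "second_form_sqnorm I Y n s \<theta> =
     (let g = matrix_inv (first_form I Y s \<theta>); h = second_form I Y n s \<theta>
      in \<Sum>i\<in>UNIV. \<Sum>j\<in>UNIV. \<Sum>k\<in>UNIV. \<Sum>l\<in>UNIV. g $ i $ k * g $ j $ l * h $ i $ j * h $ k $ l)"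

definition laplace_beltrami ::
  "real set \<Rightarrow> (real \<Rightarrow> real \<Rightarrow> real^3) \<Rightarrow> (real \<Rightarrow> real \<Rightarrow> real) \<Rightarrow> real \<Rightarrow> real \<Rightarrow> real" where
  "laplace_beltrami I Y u s \<theta> =
     (\<Sum>i\<in>UNIV. pd I i (\<lambda>s \<theta>. sqrt (det (first_form I Y s \<theta>)) *
        (\<Sum>j\<in>UNIV. matrix_inv (first_form I Y s \<theta>) $ i $ j * pd I j u s \<theta>)) s \<theta>)
     / sqrt (det (first_form I Y s \<theta>))"

definition alpha_star :: "real \<Rightarrow> real" where
  "alpha_star \<alpha> = sqrt (\<alpha>\<^sup>2 + 1)"

definition cat_eps :: "real \<Rightarrow> real" where
  "cat_eps \<alpha> = alpha_star \<alpha> / \<alpha> - 1"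

definition dphi :: "real \<Rightarrow> real \<Rightarrow> real" where
  "dphi \<alpha> \<theta> = - sqrt (\<alpha>\<^sup>2 + (cos \<theta>)\<^sup>2)"

definition cat_omega :: "real \<Rightarrow> real \<Rightarrow> real \<Rightarrow> real" where
  "cat_omega \<alpha> s \<theta> =
     inverse (1 + (sin \<theta>)\<^sup>2 /
        (alpha_star \<alpha> * (\<alpha> + alpha_star \<alpha>) * (\<alpha> - dphi \<alpha> \<theta>) * (alpha_star \<alpha> - dphi \<alpha> \<theta>))
        * exp (- s) * cosh s)"

definition catenoid :: "real \<Rightarrow> real \<Rightarrow> real \<Rightarrow> real^3" where
  "catenoid \<alpha> s \<theta> = vector
     [sin \<theta> / (alpha_star \<alpha> * (\<alpha> - dphi \<alpha> \<theta>)) * cosh s * exp (cat_eps \<alpha> * s) * cat_omega \<alpha> s \<theta>,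
      exp (cat_eps \<alpha> * s) * cat_omega \<alpha> s \<theta>,
      cos \<theta> / (\<alpha> * (\<alpha> - dphi \<alpha> \<theta>)) * cosh s]"

definition cat_normal :: "real \<Rightarrow> real \<Rightarrow> real \<Rightarrow> real^3" where
  "cat_normal \<alpha> = (THE n. continuous_on UNIV (\<lambda>(s, \<theta>). n s \<theta>) \<and>
      unit_normal UNIV (catenoid \<alpha>) n \<and>
      (\<forall>s \<theta>. trace (shape_operator UNIV (catenoid \<alpha>) n s \<theta>) = 1))"

definition normal_graph :: "real \<Rightarrow> (real \<Rightarrow> real \<Rightarrow> real) \<Rightarrow> real \<Rightarrow> real \<Rightarrow> real^3" where
  "normal_graph \<alpha> w s \<theta> = exp_map (catenoid \<alpha> s \<theta>) (w s \<theta> *\<^sub>R cat_normal \<alpha> s \<theta>)"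

text \<open>\<open>n\<close> is the end point of a continuous family of unit normals \<open>N t\<close> of the graphs of \<open>t w\<close>,
  \<open>0 \<le> t \<le> 1\<close>, over the end \<open>s \<ge> S\<close>, starting at the unit normal of the catenoid.\<close>

definition deformed_normal ::
  "real \<Rightarrow> real \<Rightarrow> (real \<Rightarrow> real \<Rightarrow> real) \<Rightarrow> (real \<Rightarrow> real \<Rightarrow> real^3) \<Rightarrow> bool" where
  "deformed_normal \<alpha> S w n \<longleftrightarrow> (\<exists>N :: real \<Rightarrow> real \<Rightarrow> real \<Rightarrow> real^3.
      continuous_on ({0..1} \<times> {S..} \<times> UNIV) (\<lambda>(t, s, \<theta>). N t s \<theta>) \<and>
      (\<forall>s\<ge>S. \<forall>\<theta>. N 0 s \<theta> = cat_normal \<alpha> s \<theta>) \<and>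
      (\<forall>t\<in>{0..1}. unit_normal {S..} (normal_graph \<alpha> (\<lambda>s \<theta>. t * w s \<theta>)) (N t)) \<and>
      N 1 = n)"

text \<open>The mean curvature is half the sum of the principal curvatures, in accordance with the
  catenoids (sum \<open>1\<close>) having mean curvature \<open>1/2\<close>.\<close>

definition mean_curvature_op ::
  "real \<Rightarrow> real \<Rightarrow> (real \<Rightarrow> real \<Rightarrow> real) \<Rightarrow> real \<Rightarrow> real \<Rightarrow> real" where
  "mean_curvature_op \<alpha> S w s \<theta> =
     (THE H. \<exists>n. deformed_normal \<alpha> S w n \<and> H = mean_curvature {S..} (normal_graph \<alpha> w) n s \<theta>)"

text \<open>\<open>jacobi_op\<close> is the linearization at \<open>w = 0\<close> of the sum of the principal curvatures of the normal
  graph of \<open>w\<close>; the linearization of \<open>mean_curvature_op\<close>, half of that sum, is half of it.\<close>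

definition jacobi_op ::
  "real \<Rightarrow> real \<Rightarrow> (real \<Rightarrow> real \<Rightarrow> real) \<Rightarrow> real \<Rightarrow> real \<Rightarrow> real" where
  "jacobi_op \<alpha> S w s \<theta> =
     laplace_beltrami {S..} (catenoid \<alpha>) w s \<theta>
   + second_form_sqnorm {S..} (catenoid \<alpha>) (cat_normal \<alpha>) s \<theta> * w s \<theta>
   + ricci (catenoid \<alpha> s \<theta>) (cat_normal \<alpha> s \<theta>) (cat_normal \<alpha> s \<theta>) * w s \<theta>"

definition admissible :: "real \<Rightarrow> real \<Rightarrow> real \<Rightarrow> (real \<Rightarrow> real \<Rightarrow> real) \<Rightarrow> bool" where
  "admissible \<beta> \<delta> S w \<longleftrightarrow> holder_loc 2 \<beta> S w \<and>
     (\<forall>s\<ge>S. holder_norm 2 \<beta> {s..s+1} w \<le> ennreal \<delta>)"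

end

theory Submission
  imports Defs
begin

text \<open>In the left-invariant orthonormal frame \<open>y \<partial>\<^sub>x, y \<partial>\<^sub>y, \<partial>\<^sub>z\<close> the coordinate fields of the catenoid are
  multiples of an orthonormal frame whose components are smooth functions of \<open>\<theta>\<close>, \<open>tanh s\<close> and
  \<open>1 / cosh s\<close>, and geodesics of \<open>H\<^sup>2 \<times> \<real>\<close> are elementary. Hence twice the mean curvature of the normal
  graph of \<open>w\<close> is an explicit expression \<open>gH\<close> in the \<open>2\<close>-jet of \<open>w\<close>. It does not change when the
  tangent vectors are divided by their common factor, which at the end is at least of order
  \<open>\<epsilon> cosh s \<ge> 1\<close>; after this scaling all coefficients have bounds on all derivatives that do not depend on
  \<open>\<epsilon>\<close>. The operators on jets whose difference with their linear part is quadratically small in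
  the Hoelder norm contain the jets and such coefficients and are closed under sums, products and powers,
  so \<open>gH\<close> is one of them. Its linear part is the derivative along rays at the zero jet, which is
  computed with covariant derivatives and is the Jacobi operator.\<close>

section \<open>Bounds in the Hoelder norm\<close>

text \<open>For one fixed surface the estimate is Taylor's formula; the issue is constants that
  survive \<epsilon> tending to 0. With B = \<open>alpha_star\<close> / \<alpha>, p = - \<phi>' /
  \<alpha> and q = 1 / (\<alpha>^2 (1 + p)) the s-derivative of the catenoid has length q cosh s,
  and \<epsilon> (1 + B) = B^2 - 1 = 1 / \<alpha>^2 = q (1 + p). So q and \<epsilon> are comparable,
  which is why \<epsilon> cosh s \<ge> 1 bounds this length from below. The difference for two
  functions is compared with one linear operator, that of the zero jet. Its coefficients stay
  anonymous in sums, products and powers; since a quadratic remainder determines it, it can be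
  identified afterwards, one point and one jet at a time. Two features of the data shape the rest.
  The curvature operator is a definite description over deformations of the normal, so a deformed
  normal must be shown to exist and to be unique. And the horizontal speed that normalizes the
  geodesics vanishes where the normal is vertical, at s = 0 and sin \<theta> = 0; hence the
  restriction to s > 0.\<close>

definition hol :: "real \<Rightarrow> real set \<Rightarrow> (real \<Rightarrow> real \<Rightarrow> real) \<Rightarrow> real \<Rightarrow> bool" where
  "hol \<beta> I u K \<longleftrightarrow> (\<forall>s\<in>I. \<forall>\<theta>. \<bar>u s \<theta>\<bar> \<le> K) \<and>
     (\<forall>s\<in>I. \<forall>\<theta>. \<forall>s'\<in>I. \<forall>\<theta>'. \<bar>u s \<theta> - u s' \<theta>'\<bar> \<le> K * dist (s, \<theta>) (s', \<theta>') powr \<beta>)"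

lemma hol_bound: "hol \<beta> I u K \<Longrightarrow> s \<in> I \<Longrightarrow> \<bar>u s \<theta>\<bar> \<le> K"
  by (simp add: hol_def)

lemma hol_diff: "hol \<beta> I u K \<Longrightarrow> s \<in> I \<Longrightarrow> s' \<in> I \<Longrightarrow>
    \<bar>u s \<theta> - u s' \<theta>'\<bar> \<le> K * dist (s, \<theta>) (s', \<theta>') powr \<beta>"
  by (simp add: hol_def)

lemma holI:
  assumes "\<And>s \<theta>. s \<in> I \<Longrightarrow> \<bar>u s \<theta>\<bar> \<le> K"
    and "\<And>s \<theta> s' \<theta>'. s \<in> I \<Longrightarrow> s' \<in> I \<Longrightarrow>
      \<bar>u s \<theta> - u s' \<theta>'\<bar> \<le> K * dist (s, \<theta>) (s', \<theta>') powr \<beta>"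
  shows "hol \<beta> I u K"
  using assms by (auto simp: hol_def)

lemma hol_mono: "hol \<beta> I u K \<Longrightarrow> K \<le> L \<Longrightarrow> hol \<beta> I u L"
  unfolding hol_def by (meson mult_right_mono order_trans powr_ge_zero)

lemma hol_cong:
  assumes "hol \<beta> I u K" "\<And>s \<theta>. s \<in> I \<Longrightarrow> u s \<theta> = v s \<theta>"
  shows "hol \<beta> I v K"
  using assms by (simp add: hol_def)

lemma hol_zero: "0 \<le> K \<Longrightarrow> hol \<beta> I (\<lambda>s \<theta>. 0) K"
  by (simp add: hol_def)

lemma hol_const: "\<bar>c\<bar> \<le> K \<Longrightarrow> hol \<beta> I (\<lambda>s \<theta>. c) K"
  by (auto simp: hol_def intro!: mult_nonneg_nonneg order_trans[OF abs_ge_zero])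

lemma hol_add: "hol \<beta> I u K \<Longrightarrow> hol \<beta> I v L \<Longrightarrow> hol \<beta> I (\<lambda>s \<theta>. u s \<theta> + v s \<theta>) (K + L)"
  unfolding hol_def by (auto simp: distrib_right intro: order_trans[OF abs_triangle_ineq add_mono])
    (smt (verit, ccfv_threshold))

lemma hol_minus: "hol \<beta> I u K \<Longrightarrow> hol \<beta> I (\<lambda>s \<theta>. - u s \<theta>) K"
  unfolding hol_def by (auto simp: abs_minus_commute)

lemma hol_sub: "hol \<beta> I u K \<Longrightarrow> hol \<beta> I v L \<Longrightarrow> hol \<beta> I (\<lambda>s \<theta>. u s \<theta> - v s \<theta>) (K + L)"
  using hol_add[OF _ hol_minus, of \<beta> I u K v L] by simp

text \<open>A single constant bounds both the values and the Hoelder quotient, so the product rule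
  contributes K L twice. This is the origin of most powers of 2 in later constants.\<close>

lemma hol_mult:
  assumes u: "hol \<beta> I u K" and v: "hol \<beta> I v L" and K: "0 \<le> K" and L: "0 \<le> L"
  shows "hol \<beta> I (\<lambda>s \<theta>. u s \<theta> * v s \<theta>) (2 * (K * L))"
proof (rule holI)
  fix s \<theta> :: real assume s: "s \<in> I"
  have "\<bar>u s \<theta>\<bar> * \<bar>v s \<theta>\<bar> \<le> K * L"
    by (intro mult_mono hol_bound[OF u s] hol_bound[OF v s]) (use K in auto)
  then show "\<bar>u s \<theta> * v s \<theta>\<bar> \<le> 2 * (K * L)"
    using K L by (simp add: abs_mult) (smt (verit) mult_nonneg_nonneg)
next
  fix s \<theta> s' \<theta>' :: real assume s: "s \<in> I" "s' \<in> I"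
  let ?d = "dist (s, \<theta>) (s', \<theta>') powr \<beta>"
  have "\<bar>u s \<theta> * v s \<theta> - u s' \<theta>' * v s' \<theta>'\<bar>
      = \<bar>u s \<theta> * (v s \<theta> - v s' \<theta>') + (u s \<theta> - u s' \<theta>') * v s' \<theta>'\<bar>"
    by (simp add: algebra_simps)
  also have "\<dots> \<le> \<bar>u s \<theta>\<bar> * \<bar>v s \<theta> - v s' \<theta>'\<bar> + \<bar>u s \<theta> - u s' \<theta>'\<bar> * \<bar>v s' \<theta>'\<bar>"
    by (metis abs_mult abs_triangle_ineq)
  also have "\<dots> \<le> K * (L * ?d) + (K * ?d) * L"
    by (intro add_mono mult_mono hol_bound[OF u] hol_bound[OF v] hol_diff[OF u] hol_diff[OF v] s)
      (use K L in auto)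
  finally show "\<bar>u s \<theta> * v s \<theta> - u s' \<theta>' * v s' \<theta>'\<bar> \<le> 2 * (K * L) * ?d"
    by (simp add: algebra_simps)
qed

text \<open>Values and increments are both affine in t. The bound makes estimates on the segment
  between two functions independent of the position t.\<close>

lemma hol_convex:
  assumes a: "hol \<beta> I a K" and b: "hol \<beta> I b K" and t: "0 \<le> t" "t \<le> 1"
  shows "hol \<beta> I (\<lambda>s \<theta>. b s \<theta> + t * (a s \<theta> - b s \<theta>)) K"
proof (rule holI)
  have *: "\<bar>y + t * (x - y)\<bar> \<le> M" if "\<bar>x\<bar> \<le> M" "\<bar>y\<bar> \<le> M" for x y M :: real
  proof -
    have "\<bar>y + t * (x - y)\<bar> = \<bar>t * x + (1 - t) * y\<bar>" by (simp add: algebra_simps)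
    also have "\<dots> \<le> t * \<bar>x\<bar> + (1 - t) * \<bar>y\<bar>"
      using t abs_triangle_ineq[of "t * x" "(1 - t) * y"] by (simp add: abs_mult)
    also have "\<dots> \<le> t * M + (1 - t) * M"
      by (intro add_mono mult_left_mono) (use that t in auto)
    finally show ?thesis by (simp add: algebra_simps)
  qed
  show "\<bar>b s \<theta> + t * (a s \<theta> - b s \<theta>)\<bar> \<le> K" if "s \<in> I" for s \<theta>
    by (rule *) (use hol_bound[OF a that] hol_bound[OF b that] in auto)
  fix s \<theta> s' \<theta>' :: real assume s: "s \<in> I" "s' \<in> I"
  have "b s \<theta> + t * (a s \<theta> - b s \<theta>) - (b s' \<theta>' + t * (a s' \<theta>' - b s' \<theta>'))
     = (b s \<theta> - b s' \<theta>') + t * ((a s \<theta> - a s' \<theta>') - (b s \<theta> - b s' \<theta>'))"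
    by (simp add: algebra_simps)
  also have "\<bar>\<dots>\<bar> \<le> K * dist (s, \<theta>) (s', \<theta>') powr \<beta>"
    by (rule *) (use hol_diff[OF a s] hol_diff[OF b s] in auto)
  finally show "\<bar>b s \<theta> + t * (a s \<theta> - b s \<theta>) - (b s' \<theta>' + t * (a s' \<theta>' - b s' \<theta>'))\<bar>
     \<le> K * dist (s, \<theta>) (s', \<theta>') powr \<beta>" .
qed

section \<open>Composition with a smooth function of one variable\<close>

lemma abs_segment_diff_le:
  fixes F F' G G' :: "real \<Rightarrow> real"
  assumes F: "\<And>t. 0 \<le> t \<Longrightarrow> t \<le> 1 \<Longrightarrow> (F has_real_derivative F' t) (at t)"
    and bd: "\<And>t. 0 \<le> t \<Longrightarrow> t \<le> 1 \<Longrightarrow> \<bar>F' t\<bar> \<le> K"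
  shows "\<bar>F 1 - F 0\<bar> \<le> K"
proof -
  obtain z where z: "0 < z" "z < 1" "F 1 - F 0 = (1 - 0) * F' z"
    using MVT2[of 0 1 F F'] F by auto
  with bd[of z] show ?thesis by simp
qed

text \<open>Both composition estimates reduce the difference at two points to the derivative along the
  segments from \<open>b\<close> to \<open>a\<close>; its Hoelder bound is uniform in the position on the segments.\<close>

lemma hol_comp_diff:
  fixes f f1 f2 :: "real \<Rightarrow> real"
  assumes f: "\<And>x. l \<le> x \<Longrightarrow> x \<le> h \<Longrightarrow> (f has_real_derivative f1 x) (at x)"
    and f1: "\<And>x. l \<le> x \<Longrightarrow> x \<le> h \<Longrightarrow> (f1 has_real_derivative f2 x) (at x)"
    and M: "\<And>x. l \<le> x \<Longrightarrow> x \<le> h \<Longrightarrow> \<bar>f1 x\<bar> \<le> M" "\<And>x. l \<le> x \<Longrightarrow> x \<le> h \<Longrightarrow> \<bar>f2 x\<bar> \<le> M"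
    and a: "hol \<beta> I a A" and b: "hol \<beta> I b A" and d: "hol \<beta> I (\<lambda>s \<theta>. a s \<theta> - b s \<theta>) d"
    and ra: "\<And>s \<theta>. s \<in> I \<Longrightarrow> l \<le> a s \<theta> \<and> a s \<theta> \<le> h"
    and rb: "\<And>s \<theta>. s \<in> I \<Longrightarrow> l \<le> b s \<theta> \<and> b s \<theta> \<le> h"
    and nn: "0 \<le> M" "0 \<le> A" "0 \<le> d"
  shows "hol \<beta> I (\<lambda>s \<theta>. f (a s \<theta>) - f (b s \<theta>)) (2 * (M * (1 + A) * d))"
proof -
  define x where "x t s \<theta> = b s \<theta> + t * (a s \<theta> - b s \<theta>)" for t s \<theta>
  have xr: "l \<le> x t s \<theta> \<and> x t s \<theta> \<le> h" if "0 \<le> t" "t \<le> 1" "s \<in> I" for t s \<theta>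
  proof -
    have "x t s \<theta> = (1 - t) * b s \<theta> + t * a s \<theta>" by (simp add: x_def algebra_simps)
    moreover have "(1 - t) * l + t * l \<le> (1 - t) * b s \<theta> + t * a s \<theta>"
      "(1 - t) * b s \<theta> + t * a s \<theta> \<le> (1 - t) * h + t * h"
      by (intro add_mono mult_left_mono; use that ra[OF that(3)] rb[OF that(3)] in auto)+
    ultimately show ?thesis by (simp add: algebra_simps)
  qed
  have lip: "\<bar>f1 u - f1 v\<bar> \<le> M * \<bar>u - v\<bar>" if "l \<le> u" "u \<le> h" "l \<le> v" "v \<le> h" for u v
    using field_differentiable_bound[of "{l..h}" f1 f2 M v u] that M(2)
      has_field_derivative_at_within[OF f1] by (auto simp: abs_minus_commute)
  have hx: "hol \<beta> I (\<lambda>s \<theta>. f1 (x t s \<theta>)) (M * (1 + A))" if t: "0 \<le> t" "t \<le> 1" for t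
  proof (rule holI)
    fix s \<theta> :: real assume "s \<in> I"
    with xr[OF t] M(1) have "\<bar>f1 (x t s \<theta>)\<bar> \<le> M" by blast
    also have "\<dots> \<le> M * (1 + A)" using nn by (simp add: algebra_simps)
    finally show "\<bar>f1 (x t s \<theta>)\<bar> \<le> M * (1 + A)" .
  next
    fix s \<theta> s' \<theta>' :: real assume s: "s \<in> I" "s' \<in> I"
    have "\<bar>f1 (x t s \<theta>) - f1 (x t s' \<theta>')\<bar> \<le> M * \<bar>x t s \<theta> - x t s' \<theta>'\<bar>"
      using lip xr[OF t] s by blast
    also have "\<dots> \<le> M * (A * dist (s, \<theta>) (s', \<theta>') powr \<beta>)"
      unfolding x_def by (intro mult_left_mono hol_diff[OF hol_convex[OF a b t] s]) (use nn in auto)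
    also have "\<dots> \<le> M * (1 + A) * dist (s, \<theta>) (s', \<theta>') powr \<beta>"
      using nn by (simp add: algebra_simps)
    finally show "\<bar>f1 (x t s \<theta>) - f1 (x t s' \<theta>')\<bar> \<le> M * (1 + A) * dist (s, \<theta>) (s', \<theta>') powr \<beta>" .
  qed
  have hp: "hol \<beta> I (\<lambda>s \<theta>. f1 (x t s \<theta>) * (a s \<theta> - b s \<theta>)) (2 * (M * (1 + A) * d))"
    if "0 \<le> t" "t \<le> 1" for t
    by (rule hol_mult[OF hx[OF that] d]) (use nn in auto)
  have der: "((\<lambda>t. f (x t s \<theta>)) has_real_derivative f1 (x t s \<theta>) * (a s \<theta> - b s \<theta>)) (at t)"
    if "0 \<le> t" "t \<le> 1" "s \<in> I" for t s \<theta>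
  proof -
    have "((\<lambda>t. x t s \<theta>) has_real_derivative (a s \<theta> - b s \<theta>)) (at t)"
      unfolding x_def by (auto intro!: derivative_eq_intros)
    from DERIV_chain2[OF f this] xr[OF that] show ?thesis by blast
  qed
  have e: "x 1 s \<theta> = a s \<theta>" "x 0 s \<theta> = b s \<theta>" for s \<theta> by (simp_all add: x_def)
  show ?thesis
  proof (rule holI)
    fix s \<theta> :: real assume s: "s \<in> I"
    show "\<bar>f (a s \<theta>) - f (b s \<theta>)\<bar> \<le> 2 * (M * (1 + A) * d)"
      using abs_segment_diff_le[where F = "\<lambda>t. f (x t s \<theta>)", OF der[OF _ _ s] hol_bound[OF hp s]]
      by (simp add: e)
  next
    fix s \<theta> s' \<theta>' :: real assume s: "s \<in> I" "s' \<in> I"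
    show "\<bar>f (a s \<theta>) - f (b s \<theta>) - (f (a s' \<theta>') - f (b s' \<theta>'))\<bar>
        \<le> 2 * (M * (1 + A) * d) * dist (s, \<theta>) (s', \<theta>') powr \<beta>"
      using abs_segment_diff_le[where F = "\<lambda>t. f (x t s \<theta>) - f (x t s' \<theta>')",
          OF DERIV_diff[OF der[OF _ _ s(1)] der[OF _ _ s(2)]] hol_diff[OF hp s]]
      by (simp add: e)
  qed
qed

lemma hol_comp_taylor:
  fixes f f1 f2 f3 :: "real \<Rightarrow> real"
  assumes f: "\<And>x. l \<le> x \<Longrightarrow> x \<le> h \<Longrightarrow> (f has_real_derivative f1 x) (at x)"
    and f1: "\<And>x. l \<le> x \<Longrightarrow> x \<le> h \<Longrightarrow> (f1 has_real_derivative f2 x) (at x)"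
    and f2: "\<And>x. l \<le> x \<Longrightarrow> x \<le> h \<Longrightarrow> (f2 has_real_derivative f3 x) (at x)"
    and M: "\<And>x. l \<le> x \<Longrightarrow> x \<le> h \<Longrightarrow> \<bar>f2 x\<bar> \<le> M" "\<And>x. l \<le> x \<Longrightarrow> x \<le> h \<Longrightarrow> \<bar>f3 x\<bar> \<le> M"
    and a: "hol \<beta> I a A" and b: "hol \<beta> I b A" and c: "hol \<beta> I c A"
    and d: "hol \<beta> I (\<lambda>s \<theta>. a s \<theta> - b s \<theta>) d"
    and ac: "hol \<beta> I (\<lambda>s \<theta>. a s \<theta> - c s \<theta>) k" and bc: "hol \<beta> I (\<lambda>s \<theta>. b s \<theta> - c s \<theta>) k"
    and ra: "\<And>s \<theta>. s \<in> I \<Longrightarrow> l \<le> a s \<theta> \<and> a s \<theta> \<le> h"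
    and rb: "\<And>s \<theta>. s \<in> I \<Longrightarrow> l \<le> b s \<theta> \<and> b s \<theta> \<le> h"
    and rc: "\<And>s \<theta>. s \<in> I \<Longrightarrow> l \<le> c s \<theta> \<and> c s \<theta> \<le> h"
    and nn: "0 \<le> M" "0 \<le> A" "0 \<le> d" "0 \<le> k"
  shows "hol \<beta> I (\<lambda>s \<theta>. f (a s \<theta>) - f (b s \<theta>) - f1 (c s \<theta>) * (a s \<theta> - b s \<theta>))
     (4 * (M * (1 + A) * k) * d)"
proof -
  define x where "x t s \<theta> = b s \<theta> + t * (a s \<theta> - b s \<theta>)" for t s \<theta>
  have xr: "l \<le> x t s \<theta> \<and> x t s \<theta> \<le> h" if "0 \<le> t" "t \<le> 1" "s \<in> I" for t s \<theta>
  proof -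
    have "x t s \<theta> = (1 - t) * b s \<theta> + t * a s \<theta>" by (simp add: x_def algebra_simps)
    moreover have "(1 - t) * l + t * l \<le> (1 - t) * b s \<theta> + t * a s \<theta>"
      "(1 - t) * b s \<theta> + t * a s \<theta> \<le> (1 - t) * h + t * h"
      by (intro add_mono mult_left_mono; use that ra[OF that(3)] rb[OF that(3)] in auto)+
    ultimately show ?thesis by (simp add: algebra_simps)
  qed
  \<comment> \<open>The first order estimate, applied to f1 on the pair consisting of a point of the
    segment and c, supplies the factor k; the multiplication by a - b below supplies d.\<close>
  have hx: "hol \<beta> I (\<lambda>s \<theta>. f1 (x t s \<theta>) - f1 (c s \<theta>)) (2 * (M * (1 + A) * k))"
    if t: "0 \<le> t" "t \<le> 1" for t
  proof (rule hol_comp_diff[OF f1 f2 M _ c _ _ rc])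
    show "hol \<beta> I (x t) A" unfolding x_def by (rule hol_convex[OF a b t])
    show "hol \<beta> I (\<lambda>s \<theta>. x t s \<theta> - c s \<theta>) k"
      by (rule hol_cong[OF hol_convex[OF ac bc t]]) (simp add: x_def algebra_simps)
  qed (use xr[OF t] nn in auto)
  have hp: "hol \<beta> I (\<lambda>s \<theta>. (f1 (x t s \<theta>) - f1 (c s \<theta>)) * (a s \<theta> - b s \<theta>)) (4 * (M * (1 + A) * k) * d)"
    if "0 \<le> t" "t \<le> 1" for t
    by (rule hol_mono[OF hol_mult[OF hx[OF that] d]]) (use nn in auto)
  \<comment> \<open>The subtracted term is linear in t with slope frozen at c, so the derivative
    along the segment already has the shape of a Taylor remainder.\<close>
  have der: "((\<lambda>t. f (x t s \<theta>) - f1 (c s \<theta>) * (t * (a s \<theta> - b s \<theta>))) has_real_derivative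
        (f1 (x t s \<theta>) - f1 (c s \<theta>)) * (a s \<theta> - b s \<theta>)) (at t)"
    if "0 \<le> t" "t \<le> 1" "s \<in> I" for t s \<theta>
  proof -
    have "((\<lambda>t. x t s \<theta>) has_real_derivative (a s \<theta> - b s \<theta>)) (at t)"
      unfolding x_def by (auto intro!: derivative_eq_intros)
    from DERIV_chain2[OF f this] xr[OF that]
    have "((\<lambda>t. f (x t s \<theta>)) has_real_derivative f1 (x t s \<theta>) * (a s \<theta> - b s \<theta>)) (at t)"
      by blast
    then show ?thesis by (auto intro!: derivative_eq_intros simp: algebra_simps)
  qed
  have e: "x 1 s \<theta> = a s \<theta>" "x 0 s \<theta> = b s \<theta>" for s \<theta> by (simp_all add: x_def)
  show ?thesis
  proof (rule holI)
    fix s \<theta> :: real assume s: "s \<in> I"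
    show "\<bar>f (a s \<theta>) - f (b s \<theta>) - f1 (c s \<theta>) * (a s \<theta> - b s \<theta>)\<bar> \<le> 4 * (M * (1 + A) * k) * d"
      using abs_segment_diff_le[where F = "\<lambda>t. f (x t s \<theta>) - f1 (c s \<theta>) * (t * (a s \<theta> - b s \<theta>))",
          OF der[OF _ _ s] hol_bound[OF hp s]]
      by (simp add: e)
  next
    fix s \<theta> s' \<theta>' :: real assume s: "s \<in> I" "s' \<in> I"
    show "\<bar>f (a s \<theta>) - f (b s \<theta>) - f1 (c s \<theta>) * (a s \<theta> - b s \<theta>)
        - (f (a s' \<theta>') - f (b s' \<theta>') - f1 (c s' \<theta>') * (a s' \<theta>' - b s' \<theta>'))\<bar>
        \<le> 4 * (M * (1 + A) * k) * d * dist (s, \<theta>) (s', \<theta>') powr \<beta>"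
      using abs_segment_diff_le[where
          F = "\<lambda>t. f (x t s \<theta>) - f1 (c s \<theta>) * (t * (a s \<theta> - b s \<theta>))
            - (f (x t s' \<theta>') - f1 (c s' \<theta>') * (t * (a s' \<theta>' - b s' \<theta>')))",
          OF DERIV_diff[OF der[OF _ _ s(1)] der[OF _ _ s(2)]] hol_diff[OF hp s]]
      by (simp add: e)
  qed
qed

section \<open>Operators with a quadratic remainder\<close>

text \<open>The pairs over which all constants have to be uniform. The bound 1/2 on \<epsilon> keeps
  \<alpha> away from 0, so that \<open>cB\<close> and \<open>cp\<close> stay in compact ranges; with
  the last condition it gives \<open>ck\<close> < 1/2, which keeps the normal away from the
  vertical. Every point beyond S satisfies the condition, so it can be used on each window.\<close>

definition end_pt :: "real \<Rightarrow> real \<Rightarrow> bool" where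
  "end_pt \<alpha> s \<longleftrightarrow> 0 < \<alpha> \<and> cat_eps \<alpha> < 1/2 \<and> 0 < s \<and> 1 \<le> cat_eps \<alpha> * cosh s"

lemma end_pt_mono:
  assumes "end_pt \<alpha> s" "s \<le> t"
  shows "end_pt \<alpha> t"
proof -
  have "0 < cat_eps \<alpha>"
    using assms(1) cosh_real_pos[of s] unfolding end_pt_def
    by (smt (verit) mult_nonpos_nonneg)
  moreover have "cosh s \<le> cosh t"
    using assms cosh_real_nonneg_le_iff[of s t] by (auto simp: end_pt_def)
  ultimately have "cat_eps \<alpha> * cosh s \<le> cat_eps \<alpha> * cosh t" by simp
  with assms show ?thesis unfolding end_pt_def by linarith
qed

text \<open>A jet \<open>j\<close> lists the values of a function and of its derivatives up to order two:
  \<open>w, \<partial>\<^sub>s w, \<partial>\<^sub>\<theta> w, \<partial>\<^sub>s\<^sup>2 w, \<partial>\<^sub>s \<partial>\<^sub>\<theta> w, \<partial>\<^sub>\<theta>\<^sup>2 w\<close> are its entries \<open>0, \<dots>, 5\<close>.\<close>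

type_synonym jet = "nat \<Rightarrow> real"

type_synonym oper = "real \<Rightarrow> real \<Rightarrow> real \<Rightarrow> jet \<Rightarrow> real"

definition jet_bd :: "real \<Rightarrow> real set \<Rightarrow> (real \<Rightarrow> real \<Rightarrow> jet) \<Rightarrow> real \<Rightarrow> bool" where
  "jet_bd \<beta> I j a \<longleftrightarrow> (\<forall>i<6. hol \<beta> I (\<lambda>s \<theta>. j s \<theta> i) a)"

lemma jet_bd_zero: "0 \<le> a \<Longrightarrow> jet_bd \<beta> I (\<lambda>s \<theta> i. 0) a"
  by (simp add: jet_bd_def hol_zero)

lemma jet_bd_nonneg: "jet_bd \<beta> {s..s+1} j a \<Longrightarrow> 0 \<le> a"
proof -
  assume "jet_bd \<beta> {s..s+1} j a"
  then have "hol \<beta> {s..s+1} (\<lambda>s \<theta>. j s \<theta> 0) a" by (simp add: jet_bd_def)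
  from hol_bound[OF this, of s 0] show ?thesis by auto
qed

lemma hol_sum_mult:
  assumes l: "\<And>i. i < n \<Longrightarrow> hol \<beta> I (l i) C" and x: "\<And>i. i < n \<Longrightarrow> hol \<beta> I (x i) e"
    and nn: "0 \<le> C" "0 \<le> e"
  shows "hol \<beta> I (\<lambda>s \<theta>. \<Sum>i<n::nat. l i s \<theta> * x i s \<theta>) (real n * (2 * (C * e)))"
  using l x
proof (induction n)
  case 0
  then show ?case by (simp add: hol_zero)
next
  case (Suc n)
  have "hol \<beta> I (\<lambda>s \<theta>. (\<Sum>i<n. l i s \<theta> * x i s \<theta>) + l n s \<theta> * x n s \<theta>)
      (real n * (2 * (C * e)) + 2 * (C * e))"
    by (intro hol_add Suc.IH hol_mult Suc.prems nn) auto
  then show ?case by (simp add: algebra_simps)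
qed

text \<open>The linear part is that of the zero jet for both arguments; freezing it there costs a
  multiple of a + b, which is the factor in the desired estimate. The constants precede the
  quantifiers over \<alpha> and s0, so uniformity is built in. The six entries of a jet are
  arbitrary functions here, without compatibility conditions between them.\<close>

definition expands ::
  "real \<Rightarrow> real \<Rightarrow> real \<Rightarrow> (nat \<Rightarrow> real \<Rightarrow> real \<Rightarrow> real \<Rightarrow> real) \<Rightarrow> oper \<Rightarrow> bool" where
  "expands \<beta> \<delta> C l T \<longleftrightarrow> (\<forall>\<alpha> s0. end_pt \<alpha> s0 \<longrightarrow>
      hol \<beta> {s0..s0+1} (\<lambda>s \<theta>. T \<alpha> s \<theta> (\<lambda>_. 0)) C \<and>
      (\<forall>i<6. hol \<beta> {s0..s0+1} (l i \<alpha>) C) \<and>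
      (\<forall>j k a b e. jet_bd \<beta> {s0..s0+1} j a \<longrightarrow> jet_bd \<beta> {s0..s0+1} k b \<longrightarrow>
         jet_bd \<beta> {s0..s0+1} (\<lambda>s \<theta> i. j s \<theta> i - k s \<theta> i) e \<longrightarrow> a \<le> \<delta> \<longrightarrow> b \<le> \<delta> \<longrightarrow>
         hol \<beta> {s0..s0+1} (\<lambda>s \<theta>. T \<alpha> s \<theta> (j s \<theta>) - T \<alpha> s \<theta> (k s \<theta>)
            - (\<Sum>i<6. l i \<alpha> s \<theta> * (j s \<theta> i - k s \<theta> i))) (C * (a + b) * e)))"

definition good :: "real \<Rightarrow> oper \<Rightarrow> bool" where
  "good \<beta> T \<longleftrightarrow> (\<exists>\<delta> C l. 0 < \<delta> \<and> \<delta> \<le> 1 \<and> 0 \<le> C \<and> expands \<beta> \<delta> C l T)"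

lemma goodI: "0 < \<delta> \<Longrightarrow> \<delta> \<le> 1 \<Longrightarrow> 0 \<le> C \<Longrightarrow> expands \<beta> \<delta> C l T \<Longrightarrow> good \<beta> T"
  unfolding good_def by blast

text \<open>\<open>expands\<close> with its consequences, the bound on the linear part, the
  Lipschitz estimate and the bounds on values, all with one constant. The closure proofs then
  combine estimates without tracking where each came from.\<close>

definition expands_all ::
  "real \<Rightarrow> real \<Rightarrow> real \<Rightarrow> (nat \<Rightarrow> real \<Rightarrow> real \<Rightarrow> real \<Rightarrow> real) \<Rightarrow> oper \<Rightarrow> bool" where
  "expands_all \<beta> \<delta> C l T \<longleftrightarrow> 0 < \<delta> \<and> \<delta> \<le> 1 \<and> 1 \<le> C \<and>
    (\<forall>\<alpha> s0. end_pt \<alpha> s0 \<longrightarrow> hol \<beta> {s0..s0+1} (\<lambda>s \<theta>. T \<alpha> s \<theta> (\<lambda>_. 0)) C) \<and>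
    (\<forall>\<alpha> s0 i. end_pt \<alpha> s0 \<longrightarrow> i < 6 \<longrightarrow> hol \<beta> {s0..s0+1} (l i \<alpha>) C) \<and>
    (\<forall>\<alpha> s0 x e. end_pt \<alpha> s0 \<longrightarrow> jet_bd \<beta> {s0..s0+1} x e \<longrightarrow>
        hol \<beta> {s0..s0+1} (\<lambda>s \<theta>. \<Sum>i<6. l i \<alpha> s \<theta> * x s \<theta> i) (C * e)) \<and>
    (\<forall>\<alpha> s0 j k a b e. end_pt \<alpha> s0 \<longrightarrow> jet_bd \<beta> {s0..s0+1} j a \<longrightarrow> jet_bd \<beta> {s0..s0+1} k b \<longrightarrow>
         jet_bd \<beta> {s0..s0+1} (\<lambda>s \<theta> i. j s \<theta> i - k s \<theta> i) e \<longrightarrow> a \<le> \<delta> \<longrightarrow> b \<le> \<delta> \<longrightarrow>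
         hol \<beta> {s0..s0+1} (\<lambda>s \<theta>. T \<alpha> s \<theta> (j s \<theta>) - T \<alpha> s \<theta> (k s \<theta>)
            - (\<Sum>i<6. l i \<alpha> s \<theta> * (j s \<theta> i - k s \<theta> i))) (C * (a + b) * e)) \<and>
    (\<forall>\<alpha> s0 j k a b e. end_pt \<alpha> s0 \<longrightarrow> jet_bd \<beta> {s0..s0+1} j a \<longrightarrow> jet_bd \<beta> {s0..s0+1} k b \<longrightarrow>
         jet_bd \<beta> {s0..s0+1} (\<lambda>s \<theta> i. j s \<theta> i - k s \<theta> i) e \<longrightarrow> a \<le> \<delta> \<longrightarrow> b \<le> \<delta> \<longrightarrow>
         hol \<beta> {s0..s0+1} (\<lambda>s \<theta>. T \<alpha> s \<theta> (j s \<theta>) - T \<alpha> s \<theta> (k s \<theta>)) (C * e)) \<and>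
    (\<forall>\<alpha> s0 j a. end_pt \<alpha> s0 \<longrightarrow> jet_bd \<beta> {s0..s0+1} j a \<longrightarrow> a \<le> \<delta> \<longrightarrow>
         hol \<beta> {s0..s0+1} (\<lambda>s \<theta>. T \<alpha> s \<theta> (j s \<theta>) - T \<alpha> s \<theta> (\<lambda>_. 0)) (C * a)) \<and>
    (\<forall>\<alpha> s0 j a. end_pt \<alpha> s0 \<longrightarrow> jet_bd \<beta> {s0..s0+1} j a \<longrightarrow> a \<le> \<delta> \<longrightarrow>
         hol \<beta> {s0..s0+1} (\<lambda>s \<theta>. T \<alpha> s \<theta> (j s \<theta>)) C)"

lemmas expands_all_facts = expands_all_def[THEN iffD1, THEN conjunct2, THEN conjunct2, THEN conjunct2]

lemmas expands_allD =
  expands_all_facts[THEN conjunct1, rule_format]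
  expands_all_facts[THEN conjunct2, THEN conjunct1, rule_format]
  expands_all_facts[THEN conjunct2, THEN conjunct2, THEN conjunct1, rule_format]
  expands_all_facts[THEN conjunct2, THEN conjunct2, THEN conjunct2, THEN conjunct1, rule_format]
  expands_all_facts[THEN conjunct2, THEN conjunct2, THEN conjunct2, THEN conjunct2, THEN conjunct1, rule_format]
  expands_all_facts[THEN conjunct2, THEN conjunct2, THEN conjunct2, THEN conjunct2, THEN conjunct2, THEN conjunct1, rule_format]
  expands_all_facts[THEN conjunct2, THEN conjunct2, THEN conjunct2, THEN conjunct2, THEN conjunct2, THEN conjunct2, rule_format]

lemma expands_all_pos: "expands_all \<beta> \<delta> C l T \<Longrightarrow> 0 < \<delta> \<and> \<delta> \<le> 1 \<and> 1 \<le> C"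
  unfolding expands_all_def by blast

lemma goodE:
  assumes "good \<beta> T"
  obtains \<delta> C l where "expands_all \<beta> \<delta> C l T"
proof -
  obtain \<delta> c l where d: "0 < \<delta>" "\<delta> \<le> 1" and c: "0 \<le> c" and ex: "expands \<beta> \<delta> c l T"
    using assms unfolding good_def by blast
  \<comment> \<open>Six products, each with a factor 2, give 12 c for the linear part; the remainder
    adds 2 c because a + b \<le> 2, and the value at the zero jet adds c. Any constant above these
    sums serves.\<close>
  let ?C = "20 * (c + 1)"
  note ex' = ex[unfolded expands_def, rule_format]
  have lin: "hol \<beta> {s0..s0+1} (\<lambda>s \<theta>. \<Sum>i<6. l i \<alpha> s \<theta> * x s \<theta> i) (12 * c * e)"
    if "end_pt \<alpha> s0" "jet_bd \<beta> {s0..s0+1} x e" for \<alpha> s0 x e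
  proof -
    have "0 \<le> e" using jet_bd_nonneg that(2) by blast
    then have "hol \<beta> {s0..s0+1} (\<lambda>s \<theta>. \<Sum>i<6. l i \<alpha> s \<theta> * x s \<theta> i) (real 6 * (2 * (c * e)))"
      using ex' that c by (intro hol_sum_mult) (auto simp: jet_bd_def)
    then show ?thesis by (simp add: mult.assoc)
  qed
  have dif: "hol \<beta> {s0..s0+1} (\<lambda>s \<theta>. T \<alpha> s \<theta> (j s \<theta>) - T \<alpha> s \<theta> (k s \<theta>)) (14 * c * e)"
    if "end_pt \<alpha> s0" "jet_bd \<beta> {s0..s0+1} j a" "jet_bd \<beta> {s0..s0+1} k b"
         "jet_bd \<beta> {s0..s0+1} (\<lambda>s \<theta> i. j s \<theta> i - k s \<theta> i) e" "a \<le> \<delta>" "b \<le> \<delta>" for \<alpha> s0 j k a b e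
  proof -
    have nn: "0 \<le> e" using jet_bd_nonneg that(4) by blast
    have "hol \<beta> {s0..s0+1} (\<lambda>s \<theta>. (T \<alpha> s \<theta> (j s \<theta>) - T \<alpha> s \<theta> (k s \<theta>)
            - (\<Sum>i<6. l i \<alpha> s \<theta> * (j s \<theta> i - k s \<theta> i)))
            + (\<Sum>i<6. l i \<alpha> s \<theta> * (j s \<theta> i - k s \<theta> i))) (c * (a + b) * e + 12 * c * e)"
      using that ex' by (intro hol_add lin) auto
    moreover have "c * (a + b) * e + 12 * c * e \<le> 14 * c * e"
    proof -
      have "c * e * (a + b) \<le> c * e * 2"
        using that d nn c by (intro mult_left_mono) auto
      then show ?thesis by (simp add: algebra_simps)
    qed
    ultimately show ?thesis using hol_mono by fastforce
  qed
  have dif0: "hol \<beta> {s0..s0+1} (\<lambda>s \<theta>. T \<alpha> s \<theta> (j s \<theta>) - T \<alpha> s \<theta> (\<lambda>_. 0)) (14 * c * a)"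
    if "end_pt \<alpha> s0" "jet_bd \<beta> {s0..s0+1} j a" "a \<le> \<delta>" for \<alpha> s0 j a
    using dif[OF that(1,2) jet_bd_zero[of 0], of a] that d by simp
  have hm: "hol \<beta> I u (?C * e)" if "hol \<beta> I u (k * c * e)" "k \<le> 20" "0 \<le> e" "0 \<le> k" for I u k e
  proof (rule hol_mono[OF that(1)])
    have "k * c \<le> ?C" using that(2) c mult_mono[of k 20 c "c + 1"] by auto
    then show "k * c * e \<le> ?C * e" using that(3) mult_right_mono by blast
  qed
  show thesis
  proof (rule that[of \<delta> ?C l], unfold expands_all_def, intro conjI allI impI)
    show "hol \<beta> {s0..s0+1} (\<lambda>s \<theta>. T \<alpha> s \<theta> (\<lambda>_. 0)) ?C" if "end_pt \<alpha> s0" for \<alpha> s0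
      by (rule hol_mono[of _ _ _ c]) (use ex' that c in auto)
    show "hol \<beta> {s0..s0+1} (l i \<alpha>) ?C" if "end_pt \<alpha> s0" "i < 6" for \<alpha> s0 i
      by (rule hol_mono[of _ _ _ c]) (use ex' that c in auto)
    show "hol \<beta> {s0..s0+1} (\<lambda>s \<theta>. \<Sum>i<6. l i \<alpha> s \<theta> * x s \<theta> i) (?C * e)"
      if "end_pt \<alpha> s0" "jet_bd \<beta> {s0..s0+1} x e" for \<alpha> s0 x e
      by (rule hm[OF lin[OF that]]) (use jet_bd_nonneg[OF that(2)] in auto)
    show "hol \<beta> {s0..s0+1} (\<lambda>s \<theta>. T \<alpha> s \<theta> (j s \<theta>) - T \<alpha> s \<theta> (k s \<theta>)
            - (\<Sum>i<6. l i \<alpha> s \<theta> * (j s \<theta> i - k s \<theta> i))) (?C * (a + b) * e)"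
      if "end_pt \<alpha> s0" "jet_bd \<beta> {s0..s0+1} j a" "jet_bd \<beta> {s0..s0+1} k b"
         "jet_bd \<beta> {s0..s0+1} (\<lambda>s \<theta> i. j s \<theta> i - k s \<theta> i) e" "a \<le> \<delta>" "b \<le> \<delta>" for \<alpha> s0 j k a b e
      unfolding mult.assoc[of ?C]
      by (rule hm[where k = 1])
        (use ex' that jet_bd_nonneg[OF that(2)] jet_bd_nonneg[OF that(3)] jet_bd_nonneg[OF that(4)]
          in \<open>auto simp: mult.assoc\<close>)
    show "hol \<beta> {s0..s0+1} (\<lambda>s \<theta>. T \<alpha> s \<theta> (j s \<theta>) - T \<alpha> s \<theta> (k s \<theta>)) (?C * e)"
      if "end_pt \<alpha> s0" "jet_bd \<beta> {s0..s0+1} j a" "jet_bd \<beta> {s0..s0+1} k b"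
         "jet_bd \<beta> {s0..s0+1} (\<lambda>s \<theta> i. j s \<theta> i - k s \<theta> i) e" "a \<le> \<delta>" "b \<le> \<delta>" for \<alpha> s0 j k a b e
      by (rule hm[OF dif[OF that]]) (use jet_bd_nonneg[OF that(4)] in auto)
    show "hol \<beta> {s0..s0+1} (\<lambda>s \<theta>. T \<alpha> s \<theta> (j s \<theta>) - T \<alpha> s \<theta> (\<lambda>_. 0)) (?C * a)"
      if "end_pt \<alpha> s0" "jet_bd \<beta> {s0..s0+1} j a" "a \<le> \<delta>" for \<alpha> s0 j a
      by (rule hm[OF dif0[OF that]]) (use jet_bd_nonneg[OF that(2)] in auto)
    show "hol \<beta> {s0..s0+1} (\<lambda>s \<theta>. T \<alpha> s \<theta> (j s \<theta>)) ?C"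
      if j: "end_pt \<alpha> s0" "jet_bd \<beta> {s0..s0+1} j a" "a \<le> \<delta>" for \<alpha> s0 j a
    proof -
      have "hol \<beta> {s0..s0+1} (\<lambda>s \<theta>. (T \<alpha> s \<theta> (j s \<theta>) - T \<alpha> s \<theta> (\<lambda>_. 0)) + T \<alpha> s \<theta> (\<lambda>_. 0))
          (14 * c * a + c)"
        using j ex' by (intro hol_add dif0) auto
      moreover have "14 * c * a + c \<le> ?C"
      proof -
        have "c * a \<le> c * 1" using j d c by (intro mult_left_mono) auto
        then show ?thesis using c by simp
      qed
      ultimately show ?thesis using hol_mono by fastforce
    qed
  qed (use c d in auto)
qed

section \<open>Closure properties of operators with a quadratic remainder\<close>

lemma good_cong:
  assumes "good \<beta> T" "\<And>\<alpha> s \<theta> j. end_pt \<alpha> s \<Longrightarrow> T \<alpha> s \<theta> j = U \<alpha> s \<theta> j"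
  shows "good \<beta> U"
proof -
  have *: "T \<alpha> s \<theta> j = U \<alpha> s \<theta> j" if "end_pt \<alpha> s0" "s \<in> {s0..s0+1}" for \<alpha> s0 s \<theta> j
    using assms(2) end_pt_mono that by auto
  have "expands \<beta> \<delta> C l U" if e: "expands \<beta> \<delta> C l T" for \<delta> C l
    unfolding expands_def
  proof (intro allI impI conjI)
    fix \<alpha> s0 assume s: "end_pt \<alpha> s0"
    show "hol \<beta> {s0..s0+1} (\<lambda>s \<theta>. U \<alpha> s \<theta> (\<lambda>_. 0)) C"
      by (rule hol_cong[of _ _ "\<lambda>s \<theta>. T \<alpha> s \<theta> (\<lambda>_. 0)"]) (use e[unfolded expands_def] s * in auto)
    show "hol \<beta> {s0..s0+1} (l i \<alpha>) C" if "i < 6" for i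
      using e[unfolded expands_def] s that by blast
    fix j k a b x
    assume "jet_bd \<beta> {s0..s0+1} j a" "jet_bd \<beta> {s0..s0+1} k b"
         "jet_bd \<beta> {s0..s0+1} (\<lambda>s \<theta> i. j s \<theta> i - k s \<theta> i) x" "a \<le> \<delta>" "b \<le> \<delta>"
    then have "hol \<beta> {s0..s0+1} (\<lambda>s \<theta>. T \<alpha> s \<theta> (j s \<theta>) - T \<alpha> s \<theta> (k s \<theta>)
            - (\<Sum>i<6. l i \<alpha> s \<theta> * (j s \<theta> i - k s \<theta> i))) (C * (a + b) * x)"
      using e[unfolded expands_def] s by blast
    then show "hol \<beta> {s0..s0+1} (\<lambda>s \<theta>. U \<alpha> s \<theta> (j s \<theta>) - U \<alpha> s \<theta> (k s \<theta>)
            - (\<Sum>i<6. l i \<alpha> s \<theta> * (j s \<theta> i - k s \<theta> i))) (C * (a + b) * x)"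
      by (rule hol_cong) (use s * in auto)
  qed
  with assms(1) show ?thesis unfolding good_def by blast
qed

lemma good_jet:
  assumes "i < 6"
  shows "good \<beta> (\<lambda>\<alpha> s \<theta> j. j i)"
proof (rule goodI[of 1 1 _ "\<lambda>n \<alpha> s \<theta>. if n = i then 1 else 0"])
  show "expands \<beta> 1 1 (\<lambda>n \<alpha> s \<theta>. if n = i then 1 else 0) (\<lambda>\<alpha> s \<theta> j. j i)"
    unfolding expands_def
  proof (intro allI impI conjI)
    fix \<alpha> s0 j k a b e
    assume "jet_bd \<beta> {s0..s0+1} j a" "jet_bd \<beta> {s0..s0+1} k b"
         "jet_bd \<beta> {s0..s0+1} (\<lambda>s \<theta> i. j s \<theta> i - k s \<theta> i) e"
    then have "0 \<le> 1 * (a + b) * e"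
      using jet_bd_nonneg by (smt (verit) mult_nonneg_nonneg)
    then have "hol \<beta> {s0..s0+1} (\<lambda>s \<theta>. 0) (1 * (a + b) * e)" by (rule hol_zero)
    moreover have "(\<Sum>n<6. (if n = i then 1 else 0) * (j s \<theta> n - k s \<theta> n)) = j s \<theta> i - k s \<theta> i"
      for s \<theta>
      using assms by (subst sum.cong[OF refl, of _ _ "\<lambda>n. if n = i then j s \<theta> n - k s \<theta> n else 0"])
        (auto simp: sum.delta)
    ultimately show "hol \<beta> {s0..s0+1} (\<lambda>s \<theta>. j s \<theta> i - k s \<theta> i
       - (\<Sum>n<6. (if n = i then 1 else 0) * (j s \<theta> n - k s \<theta> n))) (1 * (a + b) * e)"
      by simp
  qed (auto simp: hol_zero hol_const)
qed auto

lemma good_coeff: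
  assumes "0 \<le> C" "\<And>\<alpha> s0. end_pt \<alpha> s0 \<Longrightarrow> hol \<beta> {s0..s0+1} (c \<alpha>) C"
  shows "good \<beta> (\<lambda>\<alpha> s \<theta> j. c \<alpha> s \<theta>)"
proof (rule goodI[of 1 C _ "\<lambda>n \<alpha> s \<theta>. 0"])
  show "expands \<beta> 1 C (\<lambda>n \<alpha> s \<theta>. 0) (\<lambda>\<alpha> s \<theta> j. c \<alpha> s \<theta>)"
    unfolding expands_def
    using assms by (auto intro!: hol_zero mult_nonneg_nonneg add_nonneg_nonneg dest: jet_bd_nonneg)
qed (use assms in auto)

lemma good_add:
  assumes "good \<beta> T" "good \<beta> U"
  shows "good \<beta> (\<lambda>\<alpha> s \<theta> j. T \<alpha> s \<theta> j + U \<alpha> s \<theta> j)"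
proof -
  obtain d1 C1 l1 where 1: "0 < d1" "d1 \<le> 1" "0 \<le> C1" "expands \<beta> d1 C1 l1 T"
    using assms(1) unfolding good_def by blast
  obtain d2 C2 l2 where 2: "0 < d2" "d2 \<le> 1" "0 \<le> C2" "expands \<beta> d2 C2 l2 U"
    using assms(2) unfolding good_def by blast
  show ?thesis
  proof (rule goodI[of "min d1 d2" "C1 + C2" _ "\<lambda>i \<alpha> s \<theta>. l1 i \<alpha> s \<theta> + l2 i \<alpha> s \<theta>"])
    show "expands \<beta> (min d1 d2) (C1 + C2) (\<lambda>i \<alpha> s \<theta>. l1 i \<alpha> s \<theta> + l2 i \<alpha> s \<theta>)
        (\<lambda>\<alpha> s \<theta> j. T \<alpha> s \<theta> j + U \<alpha> s \<theta> j)"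
      unfolding expands_def
    proof (intro allI impI conjI)
      fix \<alpha> s0 j k a b e
      assume s: "end_pt \<alpha> s0"
      note e1 = 1(4)[unfolded expands_def, rule_format, OF s]
      note e2 = 2(4)[unfolded expands_def, rule_format, OF s]
      show "hol \<beta> {s0..s0+1} (\<lambda>s \<theta>. T \<alpha> s \<theta> (\<lambda>_. 0) + U \<alpha> s \<theta> (\<lambda>_. 0)) (C1 + C2)"
        using e1 e2 by (intro hol_add) auto
      show "hol \<beta> {s0..s0+1} (\<lambda>s \<theta>. l1 i \<alpha> s \<theta> + l2 i \<alpha> s \<theta>) (C1 + C2)" if "i < 6" for i
        using e1 e2 that by (intro hol_add) auto
      assume jk: "jet_bd \<beta> {s0..s0+1} j a" "jet_bd \<beta> {s0..s0+1} k b"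
         "jet_bd \<beta> {s0..s0+1} (\<lambda>s \<theta> i. j s \<theta> i - k s \<theta> i) e" "a \<le> min d1 d2" "b \<le> min d1 d2"
      have "hol \<beta> {s0..s0+1} (\<lambda>s \<theta>. (T \<alpha> s \<theta> (j s \<theta>) - T \<alpha> s \<theta> (k s \<theta>)
            - (\<Sum>i<6. l1 i \<alpha> s \<theta> * (j s \<theta> i - k s \<theta> i)))
          + (U \<alpha> s \<theta> (j s \<theta>) - U \<alpha> s \<theta> (k s \<theta>)
            - (\<Sum>i<6. l2 i \<alpha> s \<theta> * (j s \<theta> i - k s \<theta> i)))) (C1 * (a + b) * e + C2 * (a + b) * e)"
        using e1 e2 jk by (intro hol_add) auto
      then show "hol \<beta> {s0..s0+1} (\<lambda>s \<theta>. T \<alpha> s \<theta> (j s \<theta>) + U \<alpha> s \<theta> (j s \<theta>)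
            - (T \<alpha> s \<theta> (k s \<theta>) + U \<alpha> s \<theta> (k s \<theta>))
            - (\<Sum>i<6. (l1 i \<alpha> s \<theta> + l2 i \<alpha> s \<theta>) * (j s \<theta> i - k s \<theta> i))) ((C1 + C2) * (a + b) * e)"
        by (simp add: distrib_right sum.distrib diff_diff_eq add.assoc add.left_commute diff_add_eq)
          (simp add: algebra_simps)
    qed
  qed (use 1 2 in auto)
qed

lemma good_mult:
  assumes "good \<beta> T" "good \<beta> U"
  shows "good \<beta> (\<lambda>\<alpha> s \<theta> j. T \<alpha> s \<theta> j * U \<alpha> s \<theta> j)"
proof -
  obtain d1 C1 l1 where g1: "expands_all \<beta> d1 C1 l1 T" using goodE[OF assms(1)] .
  obtain d2 C2 l2 where g2: "expands_all \<beta> d2 C2 l2 U" using goodE[OF assms(2)] .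
  have d1: "0 < d1" "d1 \<le> 1" "1 \<le> C1" and d2: "0 < d2" "d2 \<le> 1" "1 \<le> C2"
    using expands_all_pos[OF g1] expands_all_pos[OF g2] by auto
  note T = expands_allD[OF g1] and U = expands_allD[OF g2]
  let ?l = "\<lambda>i \<alpha> s \<theta>. T \<alpha> s \<theta> (\<lambda>_. 0) * l2 i \<alpha> s \<theta> + U \<alpha> s \<theta> (\<lambda>_. 0) * l1 i \<alpha> s \<theta>"
  let ?C = "8 * (C1 * C2)"
  have C12: "1 \<le> C1 * C2" using d1 d2 by (metis mult_mono' mult_1 zero_le_one)
  show ?thesis
  proof (rule goodI[of "min d1 d2" ?C _ ?l])
    show "expands \<beta> (min d1 d2) ?C ?l (\<lambda>\<alpha> s \<theta> j. T \<alpha> s \<theta> j * U \<alpha> s \<theta> j)"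
      unfolding expands_def
    proof (intro allI impI conjI)
      fix \<alpha> s0 j k a b e
      assume s: "end_pt \<alpha> s0"
      show "hol \<beta> {s0..s0+1} (\<lambda>s \<theta>. T \<alpha> s \<theta> (\<lambda>_. 0) * U \<alpha> s \<theta> (\<lambda>_. 0)) ?C"
        by (rule hol_mono[OF hol_mult[OF T(1) U(1)]]) (use s d1 d2 in auto)
      show "hol \<beta> {s0..s0+1} (?l i \<alpha>) ?C" if "i < 6" for i
        by (rule hol_mono[OF hol_add[OF hol_mult[OF T(1) U(2)] hol_mult[OF U(1) T(2)]]])
          (use s that d1 d2 in auto)
      assume j: "jet_bd \<beta> {s0..s0+1} j a" and k: "jet_bd \<beta> {s0..s0+1} k b"
         and e: "jet_bd \<beta> {s0..s0+1} (\<lambda>s \<theta> i. j s \<theta> i - k s \<theta> i) e"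
         and a: "a \<le> min d1 d2" and b: "b \<le> min d1 d2"
      have nn: "0 \<le> a" "0 \<le> b" "0 \<le> e" using jet_bd_nonneg j k e by blast+
      let ?L1 = "\<lambda>s \<theta>. \<Sum>i<6. l1 i \<alpha> s \<theta> * (j s \<theta> i - k s \<theta> i)"
      let ?L2 = "\<lambda>s \<theta>. \<Sum>i<6. l2 i \<alpha> s \<theta> * (j s \<theta> i - k s \<theta> i)"
      \<comment> \<open>Telescoping of the product minus its candidate linear part: each of the four
        summands contains either a remainder or two small factors, hence is of second order.\<close>
      have "hol \<beta> {s0..s0+1} (\<lambda>s \<theta>.
            (T \<alpha> s \<theta> (j s \<theta>) - T \<alpha> s \<theta> (k s \<theta>) - ?L1 s \<theta>) * U \<alpha> s \<theta> (j s \<theta>)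
          + ?L1 s \<theta> * (U \<alpha> s \<theta> (j s \<theta>) - U \<alpha> s \<theta> (\<lambda>_. 0))
          + (T \<alpha> s \<theta> (k s \<theta>) - T \<alpha> s \<theta> (\<lambda>_. 0)) * (U \<alpha> s \<theta> (j s \<theta>) - U \<alpha> s \<theta> (k s \<theta>))
          + T \<alpha> s \<theta> (\<lambda>_. 0) * (U \<alpha> s \<theta> (j s \<theta>) - U \<alpha> s \<theta> (k s \<theta>) - ?L2 s \<theta>))
         (2 * ((C1 * (a + b) * e) * C2) + 2 * ((C1 * e) * (C2 * a)) + 2 * ((C1 * b) * (C2 * e))
           + 2 * (C1 * (C2 * (a + b) * e)))"
      proof (intro hol_add)
        have ab: "a \<le> d1" "a \<le> d2" "b \<le> d1" "b \<le> d2" using a b by auto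
        have nn': "0 \<le> C1 * (a + b) * e" "0 \<le> C2" "0 \<le> C1 * e" "0 \<le> C2 * a" "0 \<le> C1 * b"
          "0 \<le> C2 * e" "0 \<le> C1" "0 \<le> C2 * (a + b) * e"
          using nn d1 d2 by auto
        show "hol \<beta> {s0..s0+1} (\<lambda>s \<theta>. (T \<alpha> s \<theta> (j s \<theta>) - T \<alpha> s \<theta> (k s \<theta>) - ?L1 s \<theta>) * U \<alpha> s \<theta> (j s \<theta>))
            (2 * ((C1 * (a + b) * e) * C2))"
          by (rule hol_mult[OF T(4)[OF s j k e ab(1,3)] U(7)[OF s j ab(2)] nn'(1,2)])
        show "hol \<beta> {s0..s0+1} (\<lambda>s \<theta>. ?L1 s \<theta> * (U \<alpha> s \<theta> (j s \<theta>) - U \<alpha> s \<theta> (\<lambda>_. 0)))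
            (2 * ((C1 * e) * (C2 * a)))"
          by (rule hol_mult[OF T(3)[OF s e] U(6)[OF s j ab(2)] nn'(3,4)])
        show "hol \<beta> {s0..s0+1} (\<lambda>s \<theta>. (T \<alpha> s \<theta> (k s \<theta>) - T \<alpha> s \<theta> (\<lambda>_. 0))
            * (U \<alpha> s \<theta> (j s \<theta>) - U \<alpha> s \<theta> (k s \<theta>))) (2 * ((C1 * b) * (C2 * e)))"
          by (rule hol_mult[OF T(6)[OF s k ab(3)] U(5)[OF s j k e ab(2,4)] nn'(5,6)])
        show "hol \<beta> {s0..s0+1} (\<lambda>s \<theta>. T \<alpha> s \<theta> (\<lambda>_. 0)
            * (U \<alpha> s \<theta> (j s \<theta>) - U \<alpha> s \<theta> (k s \<theta>) - ?L2 s \<theta>)) (2 * (C1 * (C2 * (a + b) * e)))"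
          by (rule hol_mult[OF T(1)[OF s] U(4)[OF s j k e ab(2,4)] nn'(7,8)])
      qed
      moreover have "2 * ((C1 * (a + b) * e) * C2) + 2 * ((C1 * e) * (C2 * a))
           + 2 * ((C1 * b) * (C2 * e)) + 2 * (C1 * (C2 * (a + b) * e)) \<le> ?C * (a + b) * e"
      proof -
        have "0 \<le> C1 * C2 * a * e" "0 \<le> C1 * C2 * b * e" using nn C12 by auto
        then show ?thesis by (simp add: algebra_simps)
      qed
      ultimately have "hol \<beta> {s0..s0+1} (\<lambda>s \<theta>.
            (T \<alpha> s \<theta> (j s \<theta>) - T \<alpha> s \<theta> (k s \<theta>) - ?L1 s \<theta>) * U \<alpha> s \<theta> (j s \<theta>)
          + ?L1 s \<theta> * (U \<alpha> s \<theta> (j s \<theta>) - U \<alpha> s \<theta> (\<lambda>_. 0))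
          + (T \<alpha> s \<theta> (k s \<theta>) - T \<alpha> s \<theta> (\<lambda>_. 0)) * (U \<alpha> s \<theta> (j s \<theta>) - U \<alpha> s \<theta> (k s \<theta>))
          + T \<alpha> s \<theta> (\<lambda>_. 0) * (U \<alpha> s \<theta> (j s \<theta>) - U \<alpha> s \<theta> (k s \<theta>) - ?L2 s \<theta>)) (?C * (a + b) * e)"
        using hol_mono by blast
      moreover have "(\<Sum>i<6. ?l i \<alpha> s \<theta> * (j s \<theta> i - k s \<theta> i))
          = T \<alpha> s \<theta> (\<lambda>_. 0) * ?L2 s \<theta> + U \<alpha> s \<theta> (\<lambda>_. 0) * ?L1 s \<theta>" for s \<theta>
        by (simp add: distrib_right sum.distrib sum_distrib_left mult.assoc)
      ultimately show "hol \<beta> {s0..s0+1} (\<lambda>s \<theta>. T \<alpha> s \<theta> (j s \<theta>) * U \<alpha> s \<theta> (j s \<theta>)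
            - T \<alpha> s \<theta> (k s \<theta>) * U \<alpha> s \<theta> (k s \<theta>)
            - (\<Sum>i<6. ?l i \<alpha> s \<theta> * (j s \<theta> i - k s \<theta> i))) (?C * (a + b) * e)"
        by (simp add: algebra_simps)
    qed
  qed (use d1 d2 C12 in auto)
qed

text \<open>The values at the zero jet keep a margin \<eta> from the ends of the interval on which f
  is controlled; with \<delta> at most \<eta> / C the Lipschitz estimate keeps all values of T
  inside. The third derivative controls Hoelder increments of the Taylor remainder.\<close>

lemma good_comp:
  fixes f f1 f2 f3 :: "real \<Rightarrow> real"
  assumes T: "good \<beta> T" and eta: "0 < \<eta>"
    and T0: "\<And>\<alpha> s \<theta>. end_pt \<alpha> s \<Longrightarrow> l + \<eta> \<le> T \<alpha> s \<theta> (\<lambda>_. 0) \<and> T \<alpha> s \<theta> (\<lambda>_. 0) \<le> h - \<eta>"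
    and lh: "l \<le> h"
    and f: "\<And>x. l \<le> x \<Longrightarrow> x \<le> h \<Longrightarrow> (f has_real_derivative f1 x) (at x)"
    and f1: "\<And>x. l \<le> x \<Longrightarrow> x \<le> h \<Longrightarrow> (f1 has_real_derivative f2 x) (at x)"
    and f2: "\<And>x. l \<le> x \<Longrightarrow> x \<le> h \<Longrightarrow> (f2 has_real_derivative f3 x) (at x)"
    and M: "\<And>x. l \<le> x \<Longrightarrow> x \<le> h \<Longrightarrow> \<bar>f1 x\<bar> \<le> M" "\<And>x. l \<le> x \<Longrightarrow> x \<le> h \<Longrightarrow> \<bar>f2 x\<bar> \<le> M"
      "\<And>x. l \<le> x \<Longrightarrow> x \<le> h \<Longrightarrow> \<bar>f3 x\<bar> \<le> M"
  shows "good \<beta> (\<lambda>\<alpha> s \<theta> j. f (T \<alpha> s \<theta> j))"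
proof -
  obtain d C l1 where g': "expands_all \<beta> d C l1 T" using goodE[OF T] .
  have d: "0 < d" "d \<le> 1" "1 \<le> C" using expands_all_pos[OF g'] by auto
  note g = expands_allD(1,2,4-7)[OF g']
  have M0: "0 \<le> M" using M(1)[of l] lh by auto
  define \<delta> where "\<delta> = min d (\<eta> / C)"
  have \<delta>: "0 < \<delta>" "\<delta> \<le> d" "C * \<delta> \<le> \<eta>"
  proof -
    have "C * \<delta> \<le> C * (\<eta> / C)" using d by (intro mult_left_mono) (auto simp: \<delta>_def)
    then show "0 < \<delta>" "\<delta> \<le> d" "C * \<delta> \<le> \<eta>" using d eta by (auto simp: \<delta>_def)
  qed
  have rng0: "l \<le> T \<alpha> s \<theta> (\<lambda>_. 0) \<and> T \<alpha> s \<theta> (\<lambda>_. 0) \<le> h"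
    if "end_pt \<alpha> s0" "s \<in> {s0..s0+1}" for \<alpha> s0 s \<theta>
    using T0[of \<alpha> s \<theta>] end_pt_mono[OF that(1), of s] that(2) eta by auto
  have rng: "l \<le> T \<alpha> s \<theta> (j s \<theta>) \<and> T \<alpha> s \<theta> (j s \<theta>) \<le> h"
    if "end_pt \<alpha> s0" "s \<in> {s0..s0+1}" "jet_bd \<beta> {s0..s0+1} j a" "a \<le> \<delta>" for \<alpha> s0 s \<theta> j a
  proof -
    have "\<bar>T \<alpha> s \<theta> (j s \<theta>) - T \<alpha> s \<theta> (\<lambda>_. 0)\<bar> \<le> C * a"
      using hol_bound[OF g(5)[OF that(1,3)] that(2)] that(4) \<delta> by auto
    moreover have "C * a \<le> \<eta>" using that(4) \<delta>(3) d by (smt (verit) mult_left_mono)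
    ultimately show ?thesis
      using T0[of \<alpha> s \<theta>] end_pt_mono[OF that(1), of s] that(2) by auto
  qed
  \<comment> \<open>Comparison with the constant function l turns the estimate for differences into
    a bound on F at the zero jet itself.\<close>
  have hf: "hol \<beta> {s0..s0+1} (\<lambda>s \<theta>. F (T \<alpha> s \<theta> (\<lambda>_. 0)))
      (2 * (M * (1 + (C + \<bar>l\<bar>)) * (C + \<bar>l\<bar>)) + \<bar>F l\<bar>)"
    if s: "end_pt \<alpha> s0"
    and F: "\<And>x. l \<le> x \<Longrightarrow> x \<le> h \<Longrightarrow> (F has_real_derivative F1 x) (at x)"
     "\<And>x. l \<le> x \<Longrightarrow> x \<le> h \<Longrightarrow> (F1 has_real_derivative F2 x) (at x)"
     "\<And>x. l \<le> x \<Longrightarrow> x \<le> h \<Longrightarrow> \<bar>F1 x\<bar> \<le> M" "\<And>x. l \<le> x \<Longrightarrow> x \<le> h \<Longrightarrow> \<bar>F2 x\<bar> \<le> M"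
    for \<alpha> s0 and F F1 F2 :: "real \<Rightarrow> real"
  proof -
    have "hol \<beta> {s0..s0+1} (\<lambda>s \<theta>. F (T \<alpha> s \<theta> (\<lambda>_. 0)) - F l) (2 * (M * (1 + (C + \<bar>l\<bar>)) * (C + \<bar>l\<bar>)))"
      by (rule hol_comp_diff[OF F _ _ _ rng0[OF s]])
        (use hol_mono[OF g(1)[OF s], of "C + \<bar>l\<bar>"] hol_const[of l "C + \<bar>l\<bar>"]
          hol_sub[OF g(1)[OF s] hol_const[of l "\<bar>l\<bar>"]] d lh M0 in auto)
    from hol_add[OF this hol_const[of "F l" "\<bar>F l\<bar>"]] show ?thesis by simp
  qed
  define C2 where "C2 = 2 * (M * (1 + (C + \<bar>l\<bar>)) * (C + \<bar>l\<bar>)) + \<bar>f l\<bar> + \<bar>f1 l\<bar>"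
  have C2: "0 \<le> C2" using M0 d by (auto simp: C2_def intro!: add_nonneg_nonneg mult_nonneg_nonneg)
  have hf0: "hol \<beta> {s0..s0+1} (\<lambda>s \<theta>. f (T \<alpha> s \<theta> (\<lambda>_. 0))) C2"
    and hf1: "hol \<beta> {s0..s0+1} (\<lambda>s \<theta>. f1 (T \<alpha> s \<theta> (\<lambda>_. 0))) C2" if s: "end_pt \<alpha> s0" for \<alpha> s0
    using hol_mono[OF hf[OF s f f1 M(1,2)]] hol_mono[OF hf[OF s f1 f2 M(2,3)]]
    by (auto simp: C2_def)
  define K where "K = 4 * (M * (1 + C) * C) * C + 2 * (C2 * C)"
  have K: "0 \<le> K" using M0 d C2 by (auto simp: K_def)
  let ?l = "\<lambda>i \<alpha> s \<theta>. f1 (T \<alpha> s \<theta> (\<lambda>_. 0)) * l1 i \<alpha> s \<theta>"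
  show ?thesis
  proof (rule goodI[of \<delta> "C2 + K" _ ?l])
    show "expands \<beta> \<delta> (C2 + K) ?l (\<lambda>\<alpha> s \<theta> j. f (T \<alpha> s \<theta> j))"
      unfolding expands_def
    proof (intro allI impI conjI)
      fix \<alpha> s0 j k a b e
      assume s: "end_pt \<alpha> s0"
      show "hol \<beta> {s0..s0+1} (\<lambda>s \<theta>. f (T \<alpha> s \<theta> (\<lambda>_. 0))) (C2 + K)"
        by (rule hol_mono[OF hf0[OF s]]) (use K in auto)
      show "hol \<beta> {s0..s0+1} (?l i \<alpha>) (C2 + K)" if "i < 6" for i
        by (rule hol_mono[OF hol_mult[OF hf1[OF s] g(2)[OF s that]]])
          (use C2 K d M0 in \<open>auto simp: K_def\<close>)
      assume j: "jet_bd \<beta> {s0..s0+1} j a" and k: "jet_bd \<beta> {s0..s0+1} k b"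
         and e: "jet_bd \<beta> {s0..s0+1} (\<lambda>s \<theta> i. j s \<theta> i - k s \<theta> i) e"
         and a: "a \<le> \<delta>" and b: "b \<le> \<delta>"
      have nn: "0 \<le> a" "0 \<le> b" "0 \<le> e" using jet_bd_nonneg j k e by blast+
      have ab: "a \<le> d" "b \<le> d" using a b \<delta> by auto
      let ?L = "\<lambda>s \<theta>. \<Sum>i<6. l1 i \<alpha> s \<theta> * (j s \<theta> i - k s \<theta> i)"
      have 1: "hol \<beta> {s0..s0+1} (\<lambda>s \<theta>. f (T \<alpha> s \<theta> (j s \<theta>)) - f (T \<alpha> s \<theta> (k s \<theta>))
          - f1 (T \<alpha> s \<theta> (\<lambda>_. 0)) * (T \<alpha> s \<theta> (j s \<theta>) - T \<alpha> s \<theta> (k s \<theta>)))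
          (4 * (M * (1 + C) * (C * (a + b))) * (C * e))"
      proof (rule hol_comp_taylor[OF f f1 f2 M(2,3)])
        show "hol \<beta> {s0..s0+1} (\<lambda>s \<theta>. T \<alpha> s \<theta> (j s \<theta>)) C"
          "hol \<beta> {s0..s0+1} (\<lambda>s \<theta>. T \<alpha> s \<theta> (k s \<theta>)) C"
          "hol \<beta> {s0..s0+1} (\<lambda>s \<theta>. T \<alpha> s \<theta> (\<lambda>_. 0)) C"
          "hol \<beta> {s0..s0+1} (\<lambda>s \<theta>. T \<alpha> s \<theta> (j s \<theta>) - T \<alpha> s \<theta> (k s \<theta>)) (C * e)"
          by (intro g(6)[OF s j] g(6)[OF s k] g(1)[OF s] g(4)[OF s j k e] ab)+
        show "hol \<beta> {s0..s0+1} (\<lambda>s \<theta>. T \<alpha> s \<theta> (j s \<theta>) - T \<alpha> s \<theta> (\<lambda>_. 0)) (C * (a + b))"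
          by (rule hol_mono[OF g(5)[OF s j ab(1)]]) (use nn d in auto)
        show "hol \<beta> {s0..s0+1} (\<lambda>s \<theta>. T \<alpha> s \<theta> (k s \<theta>) - T \<alpha> s \<theta> (\<lambda>_. 0)) (C * (a + b))"
          by (rule hol_mono[OF g(5)[OF s k ab(2)]]) (use nn d in auto)
      qed (use rng0[OF s] rng[OF s _ j a] rng[OF s _ k b] M0 d nn in auto)
      have 2: "hol \<beta> {s0..s0+1} (\<lambda>s \<theta>. f1 (T \<alpha> s \<theta> (\<lambda>_. 0)) *
          (T \<alpha> s \<theta> (j s \<theta>) - T \<alpha> s \<theta> (k s \<theta>) - ?L s \<theta>)) (2 * (C2 * (C * (a + b) * e)))"
        by (rule hol_mult[OF hf1[OF s] g(3)[OF s j k e ab] C2]) (use nn d in auto)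
      have "hol \<beta> {s0..s0+1} (\<lambda>s \<theta>. f (T \<alpha> s \<theta> (j s \<theta>)) - f (T \<alpha> s \<theta> (k s \<theta>))
          - f1 (T \<alpha> s \<theta> (\<lambda>_. 0)) * ?L s \<theta>) (K * (a + b) * e)"
        using hol_add[OF 1 2] by (simp add: K_def algebra_simps)
      then have "hol \<beta> {s0..s0+1} (\<lambda>s \<theta>. f (T \<alpha> s \<theta> (j s \<theta>)) - f (T \<alpha> s \<theta> (k s \<theta>))
          - f1 (T \<alpha> s \<theta> (\<lambda>_. 0)) * ?L s \<theta>) ((C2 + K) * (a + b) * e)"
        by (rule hol_mono) (use C2 nn in \<open>auto intro!: mult_right_mono\<close>)
      then show "hol \<beta> {s0..s0+1} (\<lambda>s \<theta>. f (T \<alpha> s \<theta> (j s \<theta>)) - f (T \<alpha> s \<theta> (k s \<theta>))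
          - (\<Sum>i<6. ?l i \<alpha> s \<theta> * (j s \<theta> i - k s \<theta> i))) ((C2 + K) * (a + b) * e)"
        by (simp add: sum_distrib_left mult.assoc)
    qed
  qed (use \<delta> d C2 K in auto)
qed

lemma good_minus: "good \<beta> T \<Longrightarrow> good \<beta> (\<lambda>\<alpha> s \<theta> j. - T \<alpha> s \<theta> j)"
  using good_mult[OF good_coeff[of 1 \<beta> "\<lambda>\<alpha> s \<theta>. - 1"], of T] by (simp add: hol_const)

lemma good_diff: "good \<beta> T \<Longrightarrow> good \<beta> U \<Longrightarrow> good \<beta> (\<lambda>\<alpha> s \<theta> j. T \<alpha> s \<theta> j - U \<alpha> s \<theta> j)"
  using good_add[OF _ good_minus, of \<beta> T U] by simp

lemma good_at_zero_bounded:
  assumes "good \<beta> T"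
  shows "\<exists>C\<ge>1. \<forall>\<alpha> s \<theta>. end_pt \<alpha> s \<longrightarrow> \<bar>T \<alpha> s \<theta> (\<lambda>_. 0)\<bar> \<le> C"
proof -
  obtain d C l where g: "expands_all \<beta> d C l T" using goodE[OF assms] .
  have "\<bar>T \<alpha> s \<theta> (\<lambda>_. 0)\<bar> \<le> C" if "end_pt \<alpha> s" for \<alpha> s \<theta>
    using hol_bound[OF expands_allD(1)[OF g that], of s] by simp
  then show ?thesis using expands_all_pos[OF g] by blast
qed

lemma good_cosh_sinh:
  assumes "good \<beta> T"
  shows "good \<beta> (\<lambda>\<alpha> s \<theta> j. cosh (T \<alpha> s \<theta> j))" "good \<beta> (\<lambda>\<alpha> s \<theta> j. sinh (T \<alpha> s \<theta> j))"
proof -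
  obtain C where C: "1 \<le> C" "\<And>\<alpha> s \<theta>. end_pt \<alpha> s \<Longrightarrow> \<bar>T \<alpha> s \<theta> (\<lambda>_. 0)\<bar> \<le> C"
    using good_at_zero_bounded[OF assms] by blast
  have 1: "\<bar>cosh x\<bar> \<le> cosh (C + 1)" "\<bar>sinh x\<bar> \<le> cosh (C + 1)" if "- C - 1 \<le> x" "x \<le> C + 1" for x
  proof -
    have "\<bar>x\<bar> \<le> C + 1" using that by auto
    then have "cosh \<bar>x\<bar> \<le> cosh (C + 1)"
      using cosh_real_nonneg_le_iff[of "\<bar>x\<bar>" "C + 1"] C by (simp del: cosh_real_abs)
    then show c: "\<bar>cosh x\<bar> \<le> cosh (C + 1)" by (simp add: cosh_real_abs)
    have "\<bar>sinh x\<bar> \<le> cosh x"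
      unfolding sinh_def cosh_def by (auto simp: abs_le_iff)
    with c show "\<bar>sinh x\<bar> \<le> cosh (C + 1)" by simp
  qed
  have T0: "(- C - 1) + 1 \<le> T \<alpha> s \<theta> (\<lambda>_. 0) \<and> T \<alpha> s \<theta> (\<lambda>_. 0) \<le> (C + 1) - 1" if "end_pt \<alpha> s" for \<alpha> s \<theta>
    using C(2)[OF that, of \<theta>] by auto
  have dc: "(cosh has_real_derivative sinh x) (at x)" "(sinh has_real_derivative cosh x) (at x)"
    for x :: real
    by (auto intro!: derivative_eq_intros)
  have "- C - 1 \<le> C + 1" using C by simp
  note * = good_comp[OF assms _ T0 this]
  show "good \<beta> (\<lambda>\<alpha> s \<theta> j. cosh (T \<alpha> s \<theta> j))"
    by (rule *[OF zero_less_one _ dc dc(1) 1(2,1,2)])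
  show "good \<beta> (\<lambda>\<alpha> s \<theta> j. sinh (T \<alpha> s \<theta> j))"
    by (rule *[OF zero_less_one _ dc(2,1) dc(2) 1(1,2,1)])
qed

text \<open>Real exponents cover the reciprocal of \<open>D0\<close> and the powers -1/2 and -3/2 of
  a squared length. Besides cosh and sinh these are the only operations on jets that are not
  polynomial.\<close>

lemma good_powr:
  assumes T: "good \<beta> T" and c: "0 < c" "\<And>\<alpha> s \<theta>. end_pt \<alpha> s \<Longrightarrow> c \<le> T \<alpha> s \<theta> (\<lambda>_. 0)"
  shows "good \<beta> (\<lambda>\<alpha> s \<theta> j. T \<alpha> s \<theta> j powr r)"
proof -
  obtain C where C: "1 \<le> C" "\<And>\<alpha> s \<theta>. end_pt \<alpha> s \<Longrightarrow> \<bar>T \<alpha> s \<theta> (\<lambda>_. 0)\<bar> \<le> C"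
    using good_at_zero_bounded[OF T] by blast
  define l h where "l = c / 2" and "h = C + c"
  have lh: "0 < l" "l \<le> h" using c C by (auto simp: l_def h_def)
  \<comment> \<open>A power is monotone in x, in a direction that depends on the sign of t; the sum
    of both end values bounds it in either case.\<close>
  define N where "N t = l powr t + h powr t" for t
  have N: "\<bar>x powr t\<bar> \<le> N t" if "l \<le> x" "x \<le> h" for x t
  proof (cases "0 \<le> t")
    case True
    then show ?thesis using that lh powr_mono2[of t x h] unfolding N_def by (auto intro: add_increasing)
  next
    case False
    then show ?thesis using that lh powr_mono2'[of t l x] unfolding N_def by (auto intro: add_increasing2)
  qed
  define M where "M = \<bar>r\<bar> * N (r - 1) + \<bar>r * (r - 1)\<bar> * N (r - 2) + \<bar>r * (r - 1) * (r - 2)\<bar> * N (r - 3)"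
  have N0: "0 \<le> N t" for t unfolding N_def by (intro add_nonneg_nonneg) auto
  have dp: "((\<lambda>x. k * x powr t) has_real_derivative k * t * x powr (t - 1)) (at x)" if "l \<le> x" for k t x
    using that lh by (auto intro!: derivative_eq_intros)
  have M': "\<bar>r * x powr (r - 1)\<bar> \<le> M" "\<bar>r * (r - 1) * x powr (r - 2)\<bar> \<le> M"
    "\<bar>r * (r - 1) * (r - 2) * x powr (r - 3)\<bar> \<le> M" if "l \<le> x" "x \<le> h" for x
  proof -
    have a: "\<bar>k * x powr t\<bar> \<le> \<bar>k\<bar> * N t" for k t
      using N[OF that, of t] by (simp add: abs_mult mult_left_mono)
    have b: "0 \<le> \<bar>k\<bar> * N t" for k t using N0 by simp
    note b3 = b[of r "r - 1"] b[of "r * (r - 1)" "r - 2"] b[of "r * (r - 1) * (r - 2)" "r - 3"]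
    show "\<bar>r * x powr (r - 1)\<bar> \<le> M" using a[of r "r - 1"] b3 unfolding M_def by linarith
    show "\<bar>r * (r - 1) * x powr (r - 2)\<bar> \<le> M"
      using a[of "r * (r - 1)" "r - 2"] b3 unfolding M_def by linarith
    show "\<bar>r * (r - 1) * (r - 2) * x powr (r - 3)\<bar> \<le> M"
      using a[of "r * (r - 1) * (r - 2)" "r - 3"] b3 unfolding M_def by linarith
  qed
  show ?thesis
  proof (rule good_comp[OF T, of "c / 2" l h])
    show "l + c / 2 \<le> T \<alpha> s \<theta> (\<lambda>_. 0) \<and> T \<alpha> s \<theta> (\<lambda>_. 0) \<le> h - c / 2" if "end_pt \<alpha> s" for \<alpha> s \<theta>
      using C(2)[OF that, of \<theta>] c(2)[OF that, of \<theta>] c(1) by (auto simp: l_def h_def)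
    show "((\<lambda>x. x powr r) has_real_derivative r * x powr (r - 1)) (at x)" if "l \<le> x" for x
      using dp[OF that, of 1 r] by simp
    show "((\<lambda>x. r * x powr (r - 1)) has_real_derivative r * (r - 1) * x powr (r - 2)) (at x)" if "l \<le> x" for x
      using dp[OF that, of r "r - 1"] by simp
    show "((\<lambda>x. r * (r - 1) * x powr (r - 2)) has_real_derivative r * (r - 1) * (r - 2) * x powr (r - 3)) (at x)"
      if "l \<le> x" for x
      using dp[OF that, of "r * (r - 1)" "r - 2"] by simp
  qed (use M' lh c in auto)
qed

text \<open>Pointwise smallness of the jet is enough: the estimate is applied to constant families
  of jets, whose Hoelder quotients vanish.\<close>

lemma good_nonneg_nhd:
  assumes T: "good \<beta> T" and c: "0 < c" "\<And>\<alpha> s \<theta>. end_pt \<alpha> s \<Longrightarrow> c \<le> T \<alpha> s \<theta> (\<lambda>_. 0)"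
  shows "\<exists>\<delta>>0. \<forall>\<alpha> s \<theta> j. end_pt \<alpha> s \<longrightarrow> (\<forall>i<6. \<bar>j i\<bar> \<le> \<delta>) \<longrightarrow> 0 < T \<alpha> s \<theta> j"
proof -
  obtain d C l where g': "expands_all \<beta> d C l T" using goodE[OF T] .
  have d: "0 < d" "1 \<le> C" using expands_all_pos[OF g'] by auto
  note g = expands_allD(6)[OF g']
  define \<delta> where "\<delta> = min d (c / (2 * C))"
  have \<delta>: "0 < \<delta>" "\<delta> \<le> d" using d c by (auto simp: \<delta>_def)
  have "C * \<delta> \<le> C * (c / (2 * C))" using d by (intro mult_left_mono) (auto simp: \<delta>_def)
  then have \<delta>c: "C * \<delta> < c" using d c by simp
  have "0 < T \<alpha> s \<theta> j" if "end_pt \<alpha> s" "\<forall>i<6. \<bar>j i\<bar> \<le> \<delta>" for \<alpha> s \<theta> j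
  proof -
    have "jet_bd \<beta> {s..s+1} (\<lambda>_ _. j) \<delta>" using that(2) by (auto simp: jet_bd_def intro: hol_const)
    from hol_bound[OF g[OF that(1) this \<delta>(2)], of s \<theta>] c(2)[OF that(1), of \<theta>] \<delta>c show ?thesis by auto
  qed
  with \<delta> show ?thesis by blast
qed

text \<open>The linear part of an expansion is the derivative along rays through the zero jet.\<close>

lemma good_remainder:
  assumes "good \<beta> T"
  shows "\<exists>\<delta> C. 0 < \<delta> \<and> 1 \<le> C \<and> (\<forall>\<alpha> s0 j k a b e Lj Lk. end_pt \<alpha> s0 \<longrightarrow>
    jet_bd \<beta> {s0..s0+1} j a \<longrightarrow> jet_bd \<beta> {s0..s0+1} k b \<longrightarrow>
    jet_bd \<beta> {s0..s0+1} (\<lambda>s \<theta> i. j s \<theta> i - k s \<theta> i) e \<longrightarrow> a \<le> \<delta> \<longrightarrow> b \<le> \<delta> \<longrightarrow>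
    (\<forall>s\<in>{s0..s0+1}. \<forall>\<theta>. ((\<lambda>t. T \<alpha> s \<theta> (\<lambda>i. t * j s \<theta> i)) has_real_derivative Lj s \<theta>) (at 0)
       \<and> ((\<lambda>t. T \<alpha> s \<theta> (\<lambda>i. t * k s \<theta> i)) has_real_derivative Lk s \<theta>) (at 0)) \<longrightarrow>
    hol \<beta> {s0..s0+1} (\<lambda>s \<theta>. T \<alpha> s \<theta> (j s \<theta>) - T \<alpha> s \<theta> (k s \<theta>) - (Lj s \<theta> - Lk s \<theta>))
      (C * (a + b) * e))"
proof -
  obtain d C l where g': "expands_all \<beta> d C l T" using goodE[OF assms] .
  have d: "0 < d" "d \<le> 1" "1 \<le> C" using expands_all_pos[OF g'] by auto
  note g = expands_allD(4)[OF g']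
  have der: "((\<lambda>t. T \<alpha> s \<theta> (\<lambda>i. t * J i)) has_real_derivative (\<Sum>i<6. l i \<alpha> s \<theta> * J i)) (at 0)"
    if s: "end_pt \<alpha> s" for \<alpha> s \<theta> J
  proof -
    \<comment> \<open>The constant family t J has Hoelder bound |t| A. The summand 1 keeps A
      positive for the division by it below.\<close>
    define A where "A = 1 + (\<Sum>i<6. \<bar>J i\<bar>)"
    have A: "\<bar>J i\<bar> \<le> A" if "i < 6" for i
      using member_le_sum[of i "{..<6}" "\<lambda>i. \<bar>J i\<bar>"] that by (simp add: A_def)
    have A1: "1 \<le> A" by (simp add: A_def sum_nonneg)
    let ?L = "\<Sum>i<6. l i \<alpha> s \<theta> * J i"
    have bd: "\<bar>T \<alpha> s \<theta> (\<lambda>i. t * J i) - T \<alpha> s \<theta> (\<lambda>i. 0) - t * ?L\<bar> \<le> C * A\<^sup>2 * t\<^sup>2"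
      if t: "\<bar>t\<bar> * A \<le> d" for t
    proof -
      have j: "jet_bd \<beta> {s..s+1} (\<lambda>_ _ i. t * J i) (\<bar>t\<bar> * A)"
        using A by (auto simp: jet_bd_def abs_mult intro!: hol_const mult_left_mono)
      have "hol \<beta> {s..s+1} (\<lambda>s \<theta>. T \<alpha> s \<theta> (\<lambda>i. t * J i) - T \<alpha> s \<theta> (\<lambda>i. 0)
            - (\<Sum>i<6. l i \<alpha> s \<theta> * (t * J i - 0))) (C * (\<bar>t\<bar> * A + 0) * (\<bar>t\<bar> * A))"
        by (rule g[OF s j jet_bd_zero]) (use j t d in auto)
      note this' = this
      show ?thesis
      proof -
        have "(\<Sum>i<6. l i \<alpha> s \<theta> * (t * J i - 0)) = t * ?L"
          by (simp add: sum_distrib_left mult.left_commute)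
        moreover have "C * (\<bar>t\<bar> * A + 0) * (\<bar>t\<bar> * A) = C * A\<^sup>2 * t\<^sup>2"
        proof -
          have "\<bar>t\<bar> * \<bar>t\<bar> = t * t" by simp
          then show ?thesis by (simp add: power2_eq_square algebra_simps)
        qed
        ultimately show ?thesis using hol_bound[OF this', of s \<theta>] by (simp only:) simp
      qed
    qed
    \<comment> \<open>The remainder between t J and the zero jet is quadratic in t, so the error of
      the difference quotient is linear in t.\<close>
    have "((\<lambda>t. (T \<alpha> s \<theta> (\<lambda>i. t * J i) - T \<alpha> s \<theta> (\<lambda>i. 0)) / t - ?L) \<longlongrightarrow> 0) (at 0)"
    proof (rule Lim_null_comparison)
      have "eventually (\<lambda>t. \<bar>t\<bar> < d / A) (at 0)"
        unfolding eventually_at using d A1 by (intro exI[of _ "d / A"]) (auto simp: dist_norm)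
      then show "eventually (\<lambda>t. norm ((T \<alpha> s \<theta> (\<lambda>i. t * J i) - T \<alpha> s \<theta> (\<lambda>i. 0)) / t - ?L)
          \<le> C * A\<^sup>2 * \<bar>t\<bar>) (at 0)"
      proof (rule eventually_elim2[OF _ eventually_neq_at_within[of 0]])
        fix t :: real assume t: "\<bar>t\<bar> < d / A" "t \<noteq> 0"
        have "\<bar>t\<bar> * A \<le> d" using t A1 by (simp add: field_simps)
        from bd[OF this] have "\<bar>T \<alpha> s \<theta> (\<lambda>i. t * J i) - T \<alpha> s \<theta> (\<lambda>i. 0) - t * ?L\<bar> / \<bar>t\<bar>
            \<le> C * A\<^sup>2 * t\<^sup>2 / \<bar>t\<bar>"
          by (intro divide_right_mono) auto
        moreover have "C * A\<^sup>2 * t\<^sup>2 / \<bar>t\<bar> = C * A\<^sup>2 * \<bar>t\<bar>"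
          using t by (simp add: power2_eq_square abs_if)
        moreover have "\<bar>T \<alpha> s \<theta> (\<lambda>i. t * J i) - T \<alpha> s \<theta> (\<lambda>i. 0) - t * ?L\<bar> / \<bar>t\<bar>
            = \<bar>(T \<alpha> s \<theta> (\<lambda>i. t * J i) - T \<alpha> s \<theta> (\<lambda>i. 0)) / t - ?L\<bar>"
          using t by (simp add: abs_divide[symmetric] diff_divide_distrib)
        ultimately show "norm ((T \<alpha> s \<theta> (\<lambda>i. t * J i) - T \<alpha> s \<theta> (\<lambda>i. 0)) / t - ?L) \<le> C * A\<^sup>2 * \<bar>t\<bar>"
          by simp
      qed
      show "((\<lambda>t. C * A\<^sup>2 * \<bar>t\<bar>) \<longlongrightarrow> 0) (at 0)" by (auto intro!: tendsto_eq_intros)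
    qed
    then have "((\<lambda>t. (T \<alpha> s \<theta> (\<lambda>i. t * J i) - T \<alpha> s \<theta> (\<lambda>i. 0)) / t) \<longlongrightarrow> ?L) (at 0)"
      by (simp add: LIM_zero_iff)
    then show ?thesis by (simp add: has_field_derivative_iff)
  qed
  show ?thesis
  proof (intro exI conjI allI impI)
    fix \<alpha> s0 j k a b e Lj Lk
    assume s: "end_pt \<alpha> s0" and j: "jet_bd \<beta> {s0..s0+1} j a" and k: "jet_bd \<beta> {s0..s0+1} k b"
      and e: "jet_bd \<beta> {s0..s0+1} (\<lambda>s \<theta> i. j s \<theta> i - k s \<theta> i) e" and a: "a \<le> d" and b: "b \<le> d"
      and L: "\<forall>s\<in>{s0..s0+1}. \<forall>\<theta>.
         ((\<lambda>t. T \<alpha> s \<theta> (\<lambda>i. t * j s \<theta> i)) has_real_derivative Lj s \<theta>) (at 0)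
       \<and> ((\<lambda>t. T \<alpha> s \<theta> (\<lambda>i. t * k s \<theta> i)) has_real_derivative Lk s \<theta>) (at 0)"
    \<comment> \<open>Derivatives are unique, so whatever expressions are given for the derivatives
      along the two rays must agree with the anonymous linear part.\<close>
    have *: "Lj s \<theta> = (\<Sum>i<6. l i \<alpha> s \<theta> * j s \<theta> i)" "Lk s \<theta> = (\<Sum>i<6. l i \<alpha> s \<theta> * k s \<theta> i)"
      if "s \<in> {s0..s0+1}" for s \<theta>
    proof -
      have "end_pt \<alpha> s" using end_pt_mono[OF s] that by simp
      from DERIV_unique[OF _ der[OF this]] L that
      show "Lj s \<theta> = (\<Sum>i<6. l i \<alpha> s \<theta> * j s \<theta> i)" "Lk s \<theta> = (\<Sum>i<6. l i \<alpha> s \<theta> * k s \<theta> i)"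
        by blast+
    qed
    show "hol \<beta> {s0..s0+1} (\<lambda>s \<theta>. T \<alpha> s \<theta> (j s \<theta>) - T \<alpha> s \<theta> (k s \<theta>) - (Lj s \<theta> - Lk s \<theta>))
      (C * (a + b) * e)"
      by (rule hol_cong[OF g[OF s j k e a b]])
        (simp add: * sum_subtractf[symmetric] right_diff_distrib)
  qed (use d in auto)
qed

section \<open>Partial derivatives and uniformly smooth coefficients\<close>

text \<open>Relational counterpart of \<open>pd\<close>: derivatives are composed by rules and
  turned into values of \<open>pd\<close> once the limit point is known to be nontrivial. Only the
  variable s is confined to I.\<close>

definition has_pd ::
  "real set \<Rightarrow> 2 \<Rightarrow> (real \<Rightarrow> real \<Rightarrow> 'a::real_normed_vector) \<Rightarrow> 'a \<Rightarrow> real \<Rightarrow> real \<Rightarrow> bool" where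
  "has_pd I i f D s \<theta> \<longleftrightarrow>
     (if i = 1 then ((\<lambda>t. f t \<theta>) has_vector_derivative D) (at s within I)
      else ((\<lambda>t. f s t) has_vector_derivative D) (at \<theta>))"

lemma has_pd_const: "has_pd I i (\<lambda>s \<theta>. c) 0 s \<theta>"
  by (simp add: has_pd_def)

lemma has_pd_add:
  "has_pd I i f D s \<theta> \<Longrightarrow> has_pd I i g E s \<theta> \<Longrightarrow> has_pd I i (\<lambda>s \<theta>. f s \<theta> + g s \<theta>) (D + E) s \<theta>"
  by (auto simp: has_pd_def intro: has_vector_derivative_add split: if_splits)

lemma has_pd_minus: "has_pd I i f D s \<theta> \<Longrightarrow> has_pd I i (\<lambda>s \<theta>. - f s \<theta>) (- D) s \<theta>"
  by (auto simp: has_pd_def intro: has_vector_derivative_minus split: if_splits)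

lemma has_pd_diff:
  "has_pd I i f D s \<theta> \<Longrightarrow> has_pd I i g E s \<theta> \<Longrightarrow> has_pd I i (\<lambda>s \<theta>. f s \<theta> - g s \<theta>) (D - E) s \<theta>"
  by (auto simp: has_pd_def intro: has_vector_derivative_diff split: if_splits)

lemma has_pd_mult:
  fixes f g :: "real \<Rightarrow> real \<Rightarrow> real"
  shows "has_pd I i f D s \<theta> \<Longrightarrow> has_pd I i g E s \<theta> \<Longrightarrow>
    has_pd I i (\<lambda>s \<theta>. f s \<theta> * g s \<theta>) (D * g s \<theta> + f s \<theta> * E) s \<theta>"
  by (auto simp: has_pd_def has_real_derivative_iff_has_vector_derivative[symmetric]
      intro!: derivative_eq_intros split: if_splits)

lemma has_pd_chain:
  fixes f :: "real \<Rightarrow> real \<Rightarrow> real"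
  assumes "(h has_real_derivative h') (at (f s \<theta>))" "has_pd I i f D s \<theta>"
  shows "has_pd I i (\<lambda>s \<theta>. h (f s \<theta>)) (h' * D) s \<theta>"
  using assms
  by (auto simp: has_pd_def has_real_derivative_iff_has_vector_derivative[symmetric]
      intro: DERIV_chain2 split: if_splits)

lemma has_pd_inverse:
  fixes f :: "real \<Rightarrow> real \<Rightarrow> real"
  assumes "has_pd I i f D s \<theta>" "f s \<theta> \<noteq> 0"
  shows "has_pd I i (\<lambda>s \<theta>. inverse (f s \<theta>)) (- D * (inverse (f s \<theta>) * inverse (f s \<theta>))) s \<theta>"
proof -
  have "(inverse has_real_derivative - (inverse (f s \<theta>) ^ Suc (Suc 0))) (at (f s \<theta>))"
    by (rule DERIV_inverse[OF assms(2)])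
  from has_pd_chain[OF this assms(1)] show ?thesis by (simp add: mult.commute)
qed

lemma has_pd_sqrt:
  assumes "has_pd I i f D s \<theta>" "0 < f s \<theta>"
  shows "has_pd I i (\<lambda>s \<theta>. sqrt (f s \<theta>)) (D * (inverse (sqrt (f s \<theta>)) / 2)) s \<theta>"
  using has_pd_chain[OF DERIV_real_sqrt[OF assms(2)] assms(1)] by (simp add: mult.commute)

lemma has_vector_derivative_vec3:
  fixes h :: "real \<Rightarrow> real^3"
  shows "(h has_vector_derivative D) (at a within S) \<longleftrightarrow>
      (\<forall>k. ((\<lambda>t. h t $ k) has_vector_derivative (D $ k)) (at a within S))"
  unfolding has_vector_derivative_def has_derivative_componentwise_within[of h]
  by (auto simp: Basis_vec_def inner_axis)

lemma has_pd_vec: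
  fixes f :: "real \<Rightarrow> real \<Rightarrow> real^3"
  shows "has_pd I i f D s \<theta> \<longleftrightarrow> (\<forall>k. has_pd I i (\<lambda>s \<theta>. f s \<theta> $ k) (D $ k) s \<theta>)"
  by (simp add: has_pd_def has_vector_derivative_vec3)

lemma has_pd_cong:
  assumes "has_pd I i f D s \<theta>" "\<And>t \<theta>. t \<in> I \<Longrightarrow> f t \<theta> = g t \<theta>" "s \<in> I"
  shows "has_pd I i g D s \<theta>"
proof (cases "i = 1")
  case True
  then show ?thesis using assms
    by (auto simp: has_pd_def intro: has_vector_derivative_transform[OF assms(3), of "\<lambda>t. g t \<theta>" "\<lambda>t. f t \<theta>"])
next
  case False
  have "f s = g s" using assms(2,3) by auto
  then show ?thesis using assms(1) False by (simp add: has_pd_def)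
qed

lemma has_pd_cong_open:
  assumes "has_pd UNIV i f D s \<theta>" "\<And>t \<theta>. t \<in> T \<Longrightarrow> f t \<theta> = g t \<theta>" "s \<in> T" "open T"
  shows "has_pd UNIV i g D s \<theta>"
  using assms unfolding has_pd_def
  by (auto split: if_splits intro: has_vector_derivative_transform_within_open)

lemma has_pd_subset: "has_pd J i f D s \<theta> \<Longrightarrow> I \<subseteq> J \<Longrightarrow> has_pd I i f D s \<theta>"
  by (auto simp: has_pd_def intro: has_vector_derivative_within_subset split: if_splits)

lemma pd_eq:
  assumes "has_pd I i f D s \<theta>" "at s within I \<noteq> bot"
  shows "pd I i f s \<theta> = D"
proof (cases "i = 1")
  case True
  then show ?thesis
    using assms vector_derivative_within[OF assms(2)] by (simp add: has_pd_def pd_def)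
next
  case False
  then show ?thesis
    using assms vector_derivative_at by (simp add: has_pd_def pd_def)
qed

lemma at_within_atLeast_neq_bot: "S \<le> s \<Longrightarrow> at s within {S..} \<noteq> (bot :: real filter)"
proof -
  assume "S \<le> s"
  then have "at_right s \<le> at s within {S..}" by (intro at_le) auto
  then show ?thesis using trivial_limit_at_right_real[of s] by (metis bot.extremum_unique)
qed

lemma at_within_Icc_neq_bot: "a < b \<Longrightarrow> a \<le> s \<Longrightarrow> s \<le> b \<Longrightarrow> at s within {a..b} \<noteq> (bot :: real filter)"
  by (simp add: trivial_limit_within islimpt_Icc)

text \<open>Uniform C^n bounds with different domains for the two requirements: derivatives exist
  for all \<alpha> > 0 and s > 0, bounds hold at end points. The open condition s > 0 makes the
  derivatives two-sided, hence unique, even on the boundary of the end.\<close>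

primrec bd :: "nat \<Rightarrow> (real \<Rightarrow> real \<Rightarrow> real \<Rightarrow> real) \<Rightarrow> bool" where
  "bd 0 c \<longleftrightarrow> (\<exists>C. \<forall>\<alpha> s \<theta>. end_pt \<alpha> s \<longrightarrow> \<bar>c \<alpha> s \<theta>\<bar> \<le> C)"
| "bd (Suc n) c \<longleftrightarrow> (\<exists>C. \<forall>\<alpha> s \<theta>. end_pt \<alpha> s \<longrightarrow> \<bar>c \<alpha> s \<theta>\<bar> \<le> C) \<and>
     (\<exists>c'. (\<forall>\<alpha> s \<theta> i. 0 < \<alpha> \<longrightarrow> 0 < s \<longrightarrow> has_pd UNIV i (c \<alpha>) (c' i \<alpha> s \<theta>) s \<theta>) \<and> (\<forall>i. bd n (c' i)))"

lemma end_pt_pos: "end_pt \<alpha> s \<Longrightarrow> 0 < \<alpha> \<and> 0 < s"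
  by (simp add: end_pt_def)

lemma bd_bound: "bd n c \<Longrightarrow> \<exists>C. \<forall>\<alpha> s \<theta>. end_pt \<alpha> s \<longrightarrow> \<bar>c \<alpha> s \<theta>\<bar> \<le> C"
  by (cases n) auto

definition bd_der where
  "bd_der n c c' \<longleftrightarrow> (\<forall>\<alpha> s \<theta> i. 0 < \<alpha> \<longrightarrow> 0 < s \<longrightarrow> has_pd UNIV i (c \<alpha>) (c' i \<alpha> s \<theta>) s \<theta>) \<and>
     (\<forall>i. bd n (c' i))"

lemma bd_derD:
  assumes "bd_der n c c'"
  shows "0 < \<alpha> \<Longrightarrow> 0 < s \<Longrightarrow> has_pd UNIV i (c \<alpha>) (c' i \<alpha> s \<theta>) s \<theta>" "bd n (c' i)"
  using assms by (simp_all add: bd_der_def)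

lemma bd_Suc_iff: "bd (Suc n) c \<longleftrightarrow> bd 0 c \<and> (\<exists>c'. bd_der n c c')"
  by (simp add: bd_der_def)

lemma bd_SucE:
  assumes "bd (Suc n) c"
  obtains c' where "bd_der n c c'"
  using assms unfolding bd_Suc_iff by blast

lemma bd_SucI:
  assumes "bd 0 c" "\<And>\<alpha> s \<theta> i. 0 < \<alpha> \<Longrightarrow> 0 < s \<Longrightarrow> has_pd UNIV i (c \<alpha>) (c' i \<alpha> s \<theta>) s \<theta>"
    "\<And>i. bd n (c' i)"
  shows "bd (Suc n) c"
  using assms unfolding bd_Suc_iff bd_der_def by blast

lemma bd_Suc_lower: "bd (Suc n) c \<Longrightarrow> bd n c"
proof (induction n arbitrary: c)
  case (Suc n)
  obtain c' where c'': "bd_der (Suc n) c c'" by (rule bd_SucE[OF Suc.prems])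
  note c' = bd_derD[OF c'']
  show ?case
    by (rule bd_SucI[of _ c']) (use c' Suc.IH bd_bound[OF Suc.prems] in auto)
qed auto

lemma bd_mono: "bd n c \<Longrightarrow> m \<le> n \<Longrightarrow> bd m c"
  by (induction n) (auto simp: le_Suc_eq dest: bd_Suc_lower simp del: bd.simps)

lemma bd_cong:
  assumes "bd n c" "\<And>\<alpha> s \<theta>. 0 < \<alpha> \<Longrightarrow> 0 < s \<Longrightarrow> c \<alpha> s \<theta> = c2 \<alpha> s \<theta>"
  shows "bd n c2"
proof -
  have 0: "\<exists>C. \<forall>\<alpha> s \<theta>. end_pt \<alpha> s \<longrightarrow> \<bar>c2 \<alpha> s \<theta>\<bar> \<le> C"
  proof -
    obtain C where "\<forall>\<alpha> s \<theta>. end_pt \<alpha> s \<longrightarrow> \<bar>c \<alpha> s \<theta>\<bar> \<le> C" using bd_bound[OF assms(1)] by blast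
    then have "\<forall>\<alpha> s \<theta>. end_pt \<alpha> s \<longrightarrow> \<bar>c2 \<alpha> s \<theta>\<bar> \<le> C" using assms(2) end_pt_pos by auto
    then show ?thesis by blast
  qed
  show ?thesis
  proof (cases n)
    case (Suc m)
    obtain c' where c'': "bd_der m c c'" using bd_SucE assms(1) Suc by blast
    note c' = bd_derD[OF c'']
    show ?thesis unfolding Suc
    proof (rule bd_SucI[of _ c'])
      show "has_pd UNIV i (c2 \<alpha>) (c' i \<alpha> s \<theta>) s \<theta>" if "0 < \<alpha>" "0 < s" for \<alpha> s \<theta> i
        by (rule has_pd_cong_open[of i "c \<alpha>" _ _ _ "{0<..}"]) (use c' that assms(2) in auto)
    qed (use 0 c' in auto)
  qed (use 0 in auto)
qed

text \<open>On the open domain the witnessing derivative is unique and therefore equal to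
  \<open>pd\<close>. In this way derivatives of composite coefficients such as \<open>hlen\<close>
  are bounded without being written out.\<close>

lemma bd_pd:
  assumes "bd (Suc n) c"
  shows "bd n (\<lambda>\<alpha>. pd UNIV i (c \<alpha>))"
    and "0 < \<alpha> \<Longrightarrow> 0 < s \<Longrightarrow> has_pd UNIV i (c \<alpha>) (pd UNIV i (c \<alpha>) s \<theta>) s \<theta>"
proof -
  obtain c' where c'': "bd_der n c c'" by (rule bd_SucE[OF assms])
  note c' = bd_derD[OF c'']
  have e: "pd UNIV i (c \<alpha>) s \<theta> = c' i \<alpha> s \<theta>" if "0 < \<alpha>" "0 < s" for \<alpha> s \<theta> i
    using pd_eq[OF c'(1)[OF that]] by simp
  show "bd n (\<lambda>\<alpha>. pd UNIV i (c \<alpha>))" by (rule bd_cong[OF c'(2)]) (simp add: e)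
  show "has_pd UNIV i (c \<alpha>) (pd UNIV i (c \<alpha>) s \<theta>) s \<theta>" if "0 < \<alpha>" "0 < s"
    using c'(1)[OF that] e[OF that] by simp
qed

section \<open>Calculus of coefficients with uniform bounds\<close>

lemma bd_add: "bd n f \<Longrightarrow> bd n g \<Longrightarrow> bd n (\<lambda>\<alpha> s \<theta>. f \<alpha> s \<theta> + g \<alpha> s \<theta>)"
proof (induction n arbitrary: f g)
  case 0
  then obtain C D where "\<forall>\<alpha> s \<theta>. end_pt \<alpha> s \<longrightarrow> \<bar>f \<alpha> s \<theta>\<bar> \<le> C" "\<forall>\<alpha> s \<theta>. end_pt \<alpha> s \<longrightarrow> \<bar>g \<alpha> s \<theta>\<bar> \<le> D"
    by auto
  then have "\<forall>\<alpha> s \<theta>. end_pt \<alpha> s \<longrightarrow> \<bar>f \<alpha> s \<theta> + g \<alpha> s \<theta>\<bar> \<le> C + D"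
    by (meson abs_triangle_ineq add_mono order_trans)
  then show ?case by auto
next
  case (Suc n)
  obtain f' where f'': "bd_der n f f'" by (rule bd_SucE[OF Suc.prems(1)])
  note f' = bd_derD[OF f'']
  obtain g' where g'': "bd_der n g g'" by (rule bd_SucE[OF Suc.prems(2)])
  note g' = bd_derD[OF g'']
  have "bd n (\<lambda>\<alpha> s \<theta>. f \<alpha> s \<theta> + g \<alpha> s \<theta>)"
    by (rule Suc.IH[OF Suc.prems[THEN bd_Suc_lower]])
  then show ?case
    using has_pd_add[OF f'(1) g'(1)] Suc.IH[OF f'(2) g'(2)]
    by (intro bd_SucI[of _ "\<lambda>i \<alpha> s \<theta>. f' i \<alpha> s \<theta> + g' i \<alpha> s \<theta>"] bd_mono[of n _ 0, OF _ le0])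
qed

lemma bd_mult: "bd n f \<Longrightarrow> bd n g \<Longrightarrow> bd n (\<lambda>\<alpha> s \<theta>. f \<alpha> s \<theta> * g \<alpha> s \<theta>)"
proof (induction n arbitrary: f g)
  case 0
  then obtain C D where "\<forall>\<alpha> s \<theta>. end_pt \<alpha> s \<longrightarrow> \<bar>f \<alpha> s \<theta>\<bar> \<le> C" "\<forall>\<alpha> s \<theta>. end_pt \<alpha> s \<longrightarrow> \<bar>g \<alpha> s \<theta>\<bar> \<le> D"
    by auto
  then have "\<forall>\<alpha> s \<theta>. end_pt \<alpha> s \<longrightarrow> \<bar>f \<alpha> s \<theta> * g \<alpha> s \<theta>\<bar> \<le> C * D"
    by (simp add: abs_mult) (meson abs_ge_zero mult_mono order_trans)
  then show ?case by auto
next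
  case (Suc n)
  obtain f' where f'': "bd_der n f f'" by (rule bd_SucE[OF Suc.prems(1)])
  note f' = bd_derD[OF f'']
  obtain g' where g'': "bd_der n g g'" by (rule bd_SucE[OF Suc.prems(2)])
  note g' = bd_derD[OF g'']
  have "bd n (\<lambda>\<alpha> s \<theta>. f \<alpha> s \<theta> * g \<alpha> s \<theta>)"
    by (rule Suc.IH[OF Suc.prems[THEN bd_Suc_lower]])
  then show ?case
    using has_pd_mult[OF f'(1) g'(1)] Suc.prems[THEN bd_Suc_lower] f'(2) g'(2)
    by (intro bd_SucI[of _ "\<lambda>i \<alpha> s \<theta>. f' i \<alpha> s \<theta> * g \<alpha> s \<theta> + f \<alpha> s \<theta> * g' i \<alpha> s \<theta>"]
        bd_add Suc.IH bd_mono[of n _ 0, OF _ le0])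
qed

lemma bd_param:
  assumes "\<And>\<alpha> s. end_pt \<alpha> s \<Longrightarrow> \<bar>c \<alpha>\<bar> \<le> C"
  shows "bd n (\<lambda>\<alpha> s \<theta>. c \<alpha>)"
  using assms
proof (induction n arbitrary: c C)
  case (Suc n)
  show ?case
  proof (rule bd_SucI[of _ "\<lambda>i \<alpha> s \<theta>. 0"])
    show "bd n (\<lambda>\<alpha> s \<theta>. 0)" by (rule Suc.IH[of _ 0]) auto
  qed (use Suc.prems in \<open>auto simp: has_pd_const\<close>)
qed auto

lemma bd_const: "bd n (\<lambda>\<alpha> s \<theta>. c)"
  by (rule bd_param[of _ "\<bar>c\<bar>"]) auto

lemma bd_minus: "bd n f \<Longrightarrow> bd n (\<lambda>\<alpha> s \<theta>. - f \<alpha> s \<theta>)"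
  using bd_mult[OF bd_const[of n "- 1"], of f] by simp

lemma bd_diff: "bd n f \<Longrightarrow> bd n g \<Longrightarrow> bd n (\<lambda>\<alpha> s \<theta>. f \<alpha> s \<theta> - g \<alpha> s \<theta>)"
  using bd_add[OF _ bd_minus, of n f g] by simp

lemma bd_inverse:
  assumes "bd n f" "\<And>\<alpha> s \<theta>. 0 < \<alpha> \<Longrightarrow> 0 < s \<Longrightarrow> f \<alpha> s \<theta> \<noteq> 0" "0 < k"
    "\<And>\<alpha> s \<theta>. end_pt \<alpha> s \<Longrightarrow> k \<le> \<bar>f \<alpha> s \<theta>\<bar>"
  shows "bd n (\<lambda>\<alpha> s \<theta>. inverse (f \<alpha> s \<theta>))"
  using assms(1)
proof (induction n)
  case 0
  have "\<bar>inverse (f \<alpha> s \<theta>)\<bar> \<le> inverse k" if "end_pt \<alpha> s" for \<alpha> s \<theta>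
    using assms(3) assms(4)[OF that, of \<theta>] by (simp add: le_imp_inverse_le)
  then show ?case by auto
next
  case (Suc n)
  obtain f' where f'': "bd_der n f f'" by (rule bd_SucE[OF Suc.prems(1)])
  note f' = bd_derD[OF f'']
  have "bd n (\<lambda>\<alpha> s \<theta>. inverse (f \<alpha> s \<theta>))"
    by (rule Suc.IH[OF Suc.prems[THEN bd_Suc_lower]])
  then show ?case
    by (intro bd_SucI[of _ "\<lambda>i \<alpha> s \<theta>. - f' i \<alpha> s \<theta> * (inverse (f \<alpha> s \<theta>) * inverse (f \<alpha> s \<theta>))"]
        has_pd_inverse bd_mult bd_minus f' assms(2) bd_mono[of n _ 0, OF _ le0])
qed

lemma bd_sqrt:
  assumes "bd n f" "\<And>\<alpha> s \<theta>. 0 < \<alpha> \<Longrightarrow> 0 < s \<Longrightarrow> 0 < f \<alpha> s \<theta>" "0 < k"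
    "\<And>\<alpha> s \<theta>. end_pt \<alpha> s \<Longrightarrow> k \<le> f \<alpha> s \<theta>"
  shows "bd n (\<lambda>\<alpha> s \<theta>. sqrt (f \<alpha> s \<theta>))"
  using assms(1)
proof (induction n)
  case 0
  then obtain C where C: "\<And>\<alpha> s \<theta>. end_pt \<alpha> s \<Longrightarrow> \<bar>f \<alpha> s \<theta>\<bar> \<le> C" by auto
  have "\<bar>sqrt (f \<alpha> s \<theta>)\<bar> \<le> sqrt C" if "end_pt \<alpha> s" for \<alpha> s \<theta>
    using C[OF that, of \<theta>] assms(3) assms(4)[OF that, of \<theta>] by simp
  then show ?case by auto
next
  case (Suc n)
  obtain f' where f'': "bd_der n f f'" by (rule bd_SucE[OF Suc.prems(1)])
  note f' = bd_derD[OF f'']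
  have r: "bd n (\<lambda>\<alpha> s \<theta>. sqrt (f \<alpha> s \<theta>))"
    by (rule Suc.IH[OF Suc.prems[THEN bd_Suc_lower]])
  have i: "bd n (\<lambda>\<alpha> s \<theta>. inverse (sqrt (f \<alpha> s \<theta>)))"
  proof (rule bd_inverse[OF r])
    show "sqrt k \<le> \<bar>sqrt (f \<alpha> s \<theta>)\<bar>" if "end_pt \<alpha> s" for \<alpha> s \<theta>
      using assms(3) assms(4)[OF that, of \<theta>] by simp
  qed (use assms(2,3) in \<open>auto simp: less_imp_neq[THEN not_sym]\<close>)
  have h: "bd n (\<lambda>\<alpha> s \<theta>. inverse (sqrt (f \<alpha> s \<theta>)) / 2)"
    using bd_mult[OF bd_const[of n "1/2"] i] by simp
  show ?case
    by (intro bd_SucI[of _ "\<lambda>i \<alpha> s \<theta>. f' i \<alpha> s \<theta> * (inverse (sqrt (f \<alpha> s \<theta>)) / 2)"]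
        has_pd_sqrt bd_mult h f' assms(2) bd_mono[OF r le0])
qed

text \<open>If the logarithmic derivatives have uniform bounds, a bound on c alone passes to all its
  derivatives. It serves the quotient \<open>ck\<close> / \<epsilon>, which is bounded only because
  of the choice of the end.\<close>

lemma bd_linear_ode:
  assumes "bd 0 c" "\<And>\<alpha> s \<theta> i. 0 < \<alpha> \<Longrightarrow> 0 < s \<Longrightarrow> has_pd UNIV i (c \<alpha>) (l i \<alpha> s \<theta> * c \<alpha> s \<theta>) s \<theta>"
    and "\<And>i. bd n (l i)"
  shows "bd n c"
  using assms(3)
proof (induction n)
  case (Suc n)
  have "bd n c" "\<And>i. bd n (l i)" using Suc bd_Suc_lower by blast+
  then show ?case
    by (intro bd_SucI[of _ "\<lambda>i \<alpha> s \<theta>. l i \<alpha> s \<theta> * c \<alpha> s \<theta>"] assms(1,2) bd_mult)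
qed (use assms(1) in auto)

text \<open>Bounds on the two partial derivatives give a Lipschitz bound, which controls pairs of
  points at distance d \<le> 1 because then d \<le> d powr \<beta>. The window is unbounded in
  \<theta>; pairs farther apart are controlled by the bound on values.\<close>

lemma bd_hol:
  assumes c: "bd 1 c" and \<beta>: "0 < \<beta>" "\<beta> < 1"
  shows "\<exists>C\<ge>0. \<forall>\<alpha> s0. end_pt \<alpha> s0 \<longrightarrow> hol \<beta> {s0..s0+1} (c \<alpha>) C"
proof -
  obtain c' where c'': "bd_der 0 c c'" using bd_SucE c unfolding One_nat_def by blast
  note c' = bd_derD[OF c'']
  obtain C0 where C0: "\<And>\<alpha> s \<theta>. end_pt \<alpha> s \<Longrightarrow> \<bar>c \<alpha> s \<theta>\<bar> \<le> C0" using bd_bound[OF c] by auto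
  obtain C1 where C1: "\<And>\<alpha> s \<theta>. end_pt \<alpha> s \<Longrightarrow> \<bar>c' 1 \<alpha> s \<theta>\<bar> \<le> C1" using c'(2)[of 1] by auto
  obtain C2 where C2: "\<And>\<alpha> s \<theta>. end_pt \<alpha> s \<Longrightarrow> \<bar>c' 2 \<alpha> s \<theta>\<bar> \<le> C2" using c'(2)[of 2] by auto
  define C where "C = 2 * (\<bar>C0\<bar> + \<bar>C1\<bar> + \<bar>C2\<bar>)"
  have "hol \<beta> {s0..s0+1} (c \<alpha>) C" if s0: "end_pt \<alpha> s0" for \<alpha> s0
  proof (rule holI)
    have e: "end_pt \<alpha> s" if "s \<in> {s0..s0+1}" for s using end_pt_mono[OF s0] that by auto
    show "\<bar>c \<alpha> s \<theta>\<bar> \<le> C" if "s \<in> {s0..s0+1}" for s \<theta>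
      using C0[OF e[OF that], of \<theta>] by (auto simp: C_def)
    fix s \<theta> s' \<theta>' :: real assume s: "s \<in> {s0..s0+1}" "s' \<in> {s0..s0+1}"
    let ?d = "dist (s, \<theta>) (s', \<theta>')"
    have "\<bar>c \<alpha> s \<theta> - c \<alpha> s' \<theta>\<bar> \<le> \<bar>C1\<bar> * \<bar>s - s'\<bar>"
    proof -
      have "norm (c \<alpha> s \<theta> - c \<alpha> s' \<theta>) \<le> \<bar>C1\<bar> * norm (s - s')"
      proof (rule field_differentiable_bound[of "{s0..s0+1}"])
        fix z assume z: "z \<in> {s0..s0+1}"
        from e[OF z] have "0 < \<alpha>" "0 < z" using end_pt_pos by auto
        from c'(1)[OF this, of 1 \<theta>]
        show "((\<lambda>s. c \<alpha> s \<theta>) has_field_derivative c' 1 \<alpha> z \<theta>) (at z within {s0..s0+1})"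
          by (auto simp: has_pd_def has_real_derivative_iff_has_vector_derivative
              intro: has_vector_derivative_at_within)
        show "norm (c' 1 \<alpha> z \<theta>) \<le> \<bar>C1\<bar>" using C1[OF e[OF z], of \<theta>] by auto
      qed (use s in auto)
      then show ?thesis by simp
    qed
    moreover have "\<bar>c \<alpha> s' \<theta> - c \<alpha> s' \<theta>'\<bar> \<le> \<bar>C2\<bar> * \<bar>\<theta> - \<theta>'\<bar>"
    proof -
      have "norm (c \<alpha> s' \<theta> - c \<alpha> s' \<theta>') \<le> \<bar>C2\<bar> * norm (\<theta> - \<theta>')"
      proof (rule field_differentiable_bound[of UNIV])
        fix z :: real
        from e[OF s(2)] have "0 < \<alpha>" "0 < s'" using end_pt_pos by auto
        from c'(1)[OF this, of 2 z]
        show "((\<lambda>t. c \<alpha> s' t) has_field_derivative c' 2 \<alpha> s' z) (at z within UNIV)"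
          by (auto simp: has_pd_def has_real_derivative_iff_has_vector_derivative)
        show "norm (c' 2 \<alpha> s' z) \<le> \<bar>C2\<bar>" using C2[OF e[OF s(2)], of z] by auto
      qed auto
      then show ?thesis by simp
    qed
    moreover have "\<bar>s - s'\<bar> \<le> ?d" "\<bar>\<theta> - \<theta>'\<bar> \<le> ?d"
      using dist_fst_le[of "(s, \<theta>)" "(s', \<theta>')"] dist_snd_le[of "(s, \<theta>)" "(s', \<theta>')"]
      by (auto simp: dist_real_def)
    ultimately have lip: "\<bar>c \<alpha> s \<theta> - c \<alpha> s' \<theta>'\<bar> \<le> (\<bar>C1\<bar> + \<bar>C2\<bar>) * ?d"
      by (smt (verit) mult_left_mono distrib_right)
    show "\<bar>c \<alpha> s \<theta> - c \<alpha> s' \<theta>'\<bar> \<le> C * ?d powr \<beta>"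
    proof (cases "?d \<le> 1")
      case True
      have "?d \<le> ?d powr \<beta>"
        using True \<beta> powr_mono'[of \<beta> 1 ?d] by (cases "?d = 0") auto
      then have "(\<bar>C1\<bar> + \<bar>C2\<bar>) * ?d \<le> (\<bar>C1\<bar> + \<bar>C2\<bar>) * ?d powr \<beta>" by (intro mult_left_mono) auto
      also have "\<dots> \<le> C * ?d powr \<beta>" by (intro mult_right_mono) (auto simp: C_def)
      finally show ?thesis using lip by linarith
    next
      case False
      have "1 \<le> ?d powr \<beta>" using False \<beta> ge_one_powr_ge_zero by auto
      moreover have "\<bar>c \<alpha> s \<theta> - c \<alpha> s' \<theta>'\<bar> \<le> C"
        using C0[OF e[OF s(1)], of \<theta>] C0[OF e[OF s(2)], of \<theta>'] by (auto simp: C_def)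
      moreover have "C * 1 \<le> C * ?d powr \<beta>"
        by (rule mult_left_mono[OF \<open>1 \<le> ?d powr \<beta>\<close>]) (auto simp: C_def)
      ultimately show ?thesis by linarith
    qed
  qed
  moreover have "0 \<le> C" by (auto simp: C_def)
  ultimately show ?thesis by blast
qed

lemma good_bd:
  assumes "bd 1 c" "0 < \<beta>" "\<beta> < 1"
  shows "good \<beta> (\<lambda>\<alpha> s \<theta> j. c \<alpha> s \<theta>)"
  using bd_hol[OF assms] good_coeff by metis

section \<open>The geometry of the ambient space in a left-invariant frame\<close>

lemma gprod_eq: "gprod p u v = (u $ 1 * v $ 1 + u $ 2 * v $ 2) / (p $ 2)\<^sup>2 + u $ 3 * v $ 3"
  unfolding gprod_def metric_def by (simp add: sum_3 add_divide_distrib)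

lemma matrix_inv_eqI:
  fixes A B :: "real^'n^'n"
  assumes "A ** B = mat 1"
  shows "matrix_inv A = B"
proof -
  have "B ** A = mat 1" using assms matrix_left_right_inverse by blast
  then have "invertible A" using assms unfolding invertible_def by blast
  then have "matrix_inv A ** A = mat 1"
    unfolding invertible_def matrix_inv_def by (metis (mono_tags, lifting) someI_ex)
  then have "matrix_inv A = matrix_inv A ** (A ** B)" by (simp add: assms)
  also have "\<dots> = B" using \<open>matrix_inv A ** A = mat 1\<close> by (simp add: matrix_mul_assoc)
  finally show ?thesis .
qed

lemma matrix_inv_metric:
  assumes "p $ 2 \<noteq> 0"
  shows "matrix_inv (metric p) = (\<chi> i j. if i \<noteq> j then 0 else if i = 3 then 1 else (p $ 2)\<^sup>2)"
  by (rule matrix_inv_eqI)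
    (use assms in \<open>auto simp: metric_def matrix_matrix_mult_def mat_def vec_eq_iff sum_3 forall_3\<close>)

text \<open>The metric and the Christoffel symbols depend on the height alone, and a derivative sees
  only nearby points, so a formula valid off the plane y = 0 suffices.\<close>

lemma coord_deriv_y:
  assumes "\<And>q. q $ 2 \<noteq> 0 \<Longrightarrow> f q = h (q $ 2)" "(h has_real_derivative D) (at (p $ 2))" "p $ 2 \<noteq> 0"
  shows "coord_deriv k f p = (if k = 2 then D else 0)"
proof -
  let ?y = "\<lambda>t. (p + t *\<^sub>R axis k 1) $ 2"
  have y: "(?y has_real_derivative (if k = 2 then 1 else 0)) (at 0)"
    by (auto simp: axis_def intro!: derivative_eq_intros)
  have "open {t. ?y t \<noteq> 0}" by (intro open_Collect_neq continuous_intros)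
  then have "eventually (\<lambda>t. t \<in> {t. ?y t \<noteq> 0}) (nhds 0)"
    by (rule eventually_nhds_in_open) (use assms(3) in simp)
  then have "eventually (\<lambda>t. f (p + t *\<^sub>R axis k 1) = h (?y t)) (nhds 0)"
    by (rule eventually_mono) (use assms(1) in simp)
  moreover have "((\<lambda>t. h (?y t)) has_real_derivative D * (if k = 2 then 1 else 0)) (at 0)"
    using y assms(2) by (intro DERIV_chain2) auto
  ultimately show ?thesis
    unfolding coord_deriv_def by (subst deriv_cong_ev) (auto intro: DERIV_imp_deriv)
qed

lemma coord_deriv_metric:
  assumes "p $ 2 \<noteq> 0"
  shows "coord_deriv k (\<lambda>q. metric q $ i $ j) p
    = (if k = 2 \<and> i = j \<and> i \<noteq> 3 then - 2 / (p $ 2) ^ 3 else 0)"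
proof -
  have "((\<lambda>y::real. 1 / y\<^sup>2) has_real_derivative - 2 / (p $ 2) ^ 3) (at (p $ 2))"
    using assms by (auto intro!: derivative_eq_intros simp: field_simps power2_eq_square power3_eq_cube)
  note y = coord_deriv_y[OF _ this assms]
  show ?thesis
  proof (cases "i = j \<and> i \<noteq> 3")
    case True
    then show ?thesis by (subst y) (auto simp: metric_def)
  next
    case False
    have "((\<lambda>y::real. if i = j then 1 else 0) has_real_derivative 0) (at (p $ 2))" by simp
    from coord_deriv_y[OF _ this assms] False show ?thesis by (auto simp: metric_def)
  qed
qed

text \<open>The Christoffel symbols of the hyperbolic half-plane at height 1, extended by 0 to the
  line factor; at height y they are divided by y.\<close>

definition chris :: "3 \<Rightarrow> 3 \<Rightarrow> 3 \<Rightarrow> real" where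
  "chris k i j = (if k = 1 \<and> (i = 1 \<and> j = 2 \<or> i = 2 \<and> j = 1) then - 1
     else if k = 2 \<and> i = 1 \<and> j = 1 then 1 else if k = 2 \<and> i = 2 \<and> j = 2 then - 1 else 0)"

lemma christoffel_eq:
  assumes "p $ 2 \<noteq> 0"
  shows "christoffel k i j p = chris k i j / p $ 2"
proof -
  have "\<forall>k i j. christoffel k i j p = chris k i j / p $ 2"
    unfolding christoffel_def coord_deriv_metric[OF assms] matrix_inv_metric[OF assms] chris_def
    using assms by (simp add: sum_3 forall_3 field_simps power2_eq_square power3_eq_cube)
  then show ?thesis by blast
qed

lemma coord_deriv_christoffel:
  assumes "p $ 2 \<noteq> 0"
  shows "coord_deriv m (christoffel k i j) p = (if m = 2 then - chris k i j / (p $ 2)\<^sup>2 else 0)"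
proof -
  have "((\<lambda>y::real. chris k i j / y) has_real_derivative - chris k i j / (p $ 2)\<^sup>2) (at (p $ 2))"
    using assms by (auto intro!: derivative_eq_intros simp: field_simps power2_eq_square)
  from coord_deriv_y[OF christoffel_eq this assms] show ?thesis by simp
qed

lemma christoffel_vec_eq:
  assumes "p $ 2 \<noteq> 0"
  shows "christoffel_vec p u v = vector [- (u $ 1 * v $ 2 + u $ 2 * v $ 1) / p $ 2,
     (u $ 1 * v $ 1 - u $ 2 * v $ 2) / p $ 2, 0]"
  unfolding christoffel_vec_def christoffel_eq[OF assms]
  by (simp add: vec_eq_iff forall_3 sum_3 chris_def diff_divide_distrib add_divide_distrib)

text \<open>The hyperbolic factor has curvature -1 and the line is flat, so the Ricci form is minus
  the horizontal part of the metric.\<close>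

lemma ricci_eq:
  assumes "p $ 2 \<noteq> 0"
  shows "ricci p u v = - (u $ 1 * v $ 1 + u $ 2 * v $ 2) / (p $ 2)\<^sup>2"
  unfolding ricci_def christoffel_eq[OF assms] coord_deriv_christoffel[OF assms]
  using assms by (simp add: sum_3 chris_def power2_eq_square field_simps)

text \<open>\<open>frv y a\<close> has the components \<open>a\<close> in the orthonormal frame \<open>y \<partial>\<^sub>x, y \<partial>\<^sub>y, \<partial>\<^sub>z\<close> at height \<open>y\<close>, and
  \<open>gam u v\<close> is the covariant derivative of the frame field \<open>v\<close> with constant components in the
  direction \<open>u\<close>.\<close>

definition frv :: "real \<Rightarrow> real^3 \<Rightarrow> real^3" where
  "frv y a = vector [y * a $ 1, y * a $ 2, a $ 3]"

definition gam :: "real^3 \<Rightarrow> real^3 \<Rightarrow> real^3" where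
  "gam u v = vector [- u $ 1 * v $ 2, u $ 1 * v $ 1, 0]"

lemma frv_nth [simp]: "frv y a $ 1 = y * a $ 1" "frv y a $ 2 = y * a $ 2" "frv y a $ 3 = a $ 3"
  by (simp_all add: frv_def)

lemma gam_nth [simp]: "gam u v $ 1 = - u $ 1 * v $ 2" "gam u v $ 2 = u $ 1 * v $ 1" "gam u v $ 3 = 0"
  by (simp_all add: gam_def)

lemma inner_3: "(u::real^3) \<bullet> v = u $ 1 * v $ 1 + u $ 2 * v $ 2 + u $ 3 * v $ 3"
  by (simp add: inner_vec_def sum_3)

lemma gprod_frv:
  assumes "p $ 2 \<noteq> 0"
  shows "gprod p (frv (p $ 2) a) (frv (p $ 2) b) = a \<bullet> b"
  using assms by (simp add: gprod_eq inner_3 field_simps power2_eq_square)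

lemma frv_surj:
  assumes "y \<noteq> 0"
  obtains a where "u = frv y a"
proof
  show "u = frv y (vector [u $ 1 / y, u $ 2 / y, u $ 3])"
    using assms by (simp add: vec_eq_iff forall_3)
qed

lemma frv_inj: "y \<noteq> 0 \<Longrightarrow> frv y a = frv y b \<longleftrightarrow> a = b"
  by (simp add: vec_eq_iff forall_3)

lemma frv_minus: "frv y (- a) = - frv y a"
  by (simp add: vec_eq_iff forall_3)

text \<open>The derivative of the height factor in \<open>frv\<close> cancels against part of the
  Christoffel symbols. What remains is the connection in the left-invariant frame, whose
  coefficients are constant.\<close>

lemma cov_deriv_frv:
  assumes y: "\<And>s \<theta>. s \<in> I \<Longrightarrow> Y s \<theta> $ 2 \<noteq> 0" and s: "s \<in> I" "at s within I \<noteq> bot"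
    and A: "has_pd I j Y (frv (Y s \<theta> $ 2) A) s \<theta>"
    and n: "\<And>s \<theta>. s \<in> I \<Longrightarrow> n s \<theta> = frv (Y s \<theta> $ 2) (N s \<theta>)"
    and N: "has_pd I j N N' s \<theta>"
  shows "cov_deriv I Y j n s \<theta> = frv (Y s \<theta> $ 2) (N' + gam A (N s \<theta>))"
proof -
  let ?y = "Y s \<theta> $ 2"
  have Y2: "has_pd I j (\<lambda>s \<theta>. Y s \<theta> $ 2) (?y * A $ 2) s \<theta>"
    using A[unfolded has_pd_vec, rule_format, of 2] by simp
  have Nk: "has_pd I j (\<lambda>s \<theta>. N s \<theta> $ k) (N' $ k) s \<theta>" for k
    using N by (simp add: has_pd_vec)
  have "has_pd I j (\<lambda>s \<theta>. frv (Y s \<theta> $ 2) (N s \<theta>))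
      (vector [?y * A $ 2 * N s \<theta> $ 1 + ?y * N' $ 1, ?y * A $ 2 * N s \<theta> $ 2 + ?y * N' $ 2, N' $ 3]) s \<theta>"
    unfolding has_pd_vec forall_3 using has_pd_mult[OF Y2 Nk] Nk by simp
  then have "has_pd I j n
      (vector [?y * A $ 2 * N s \<theta> $ 1 + ?y * N' $ 1, ?y * A $ 2 * N s \<theta> $ 2 + ?y * N' $ 2, N' $ 3]) s \<theta>"
    by (rule has_pd_cong) (use n s in auto)
  from pd_eq[OF this s(2)] pd_eq[OF A s(2)] show ?thesis
    unfolding cov_deriv_def christoffel_vec_eq[OF y[OF s(1)]]
    using y[OF s(1)] n[OF s(1)] by (simp add: vec_eq_iff forall_3 field_simps)
qed

section \<open>Curvature of a surface in frame components\<close>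

lemma matrix_inv_2:
  fixes g :: "real^2^2"
  assumes "det g \<noteq> 0"
  shows "matrix_inv g = (\<chi> i j. (if i = j then g $ (if i = 1 then 2 else 1) $ (if i = 1 then 2 else 1)
     else - g $ i $ j) / det g)"
proof -
  define d where "d = det g"
  have d: "g $ 1 $ 1 * g $ 2 $ 2 - g $ 1 $ 2 * g $ 2 $ 1 = d" "d \<noteq> 0"
    using assms by (simp_all add: d_def det_2)
  have "g $ 1 $ 1 * (g $ 2 $ 2 / d) - g $ 1 $ 2 * (g $ 2 $ 1 / d) = d / d"
    "g $ 2 $ 2 * (g $ 1 $ 1 / d) - g $ 2 $ 1 * (g $ 1 $ 2 / d) = d / d"
    by (metis d(1) diff_divide_distrib times_divide_eq_right mult.commute)+
  then show ?thesis
    unfolding d_def[symmetric] using d(2)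
    by (intro matrix_inv_eqI)
      (simp add: matrix_matrix_mult_def mat_def vec_eq_iff sum_2 forall_2 algebra_simps)
qed

text \<open>Twice the mean curvature of a surface with tangent vectors \<open>a, b\<close> (frame components) and
  \<open>p, q, r\<close> for \<open>\<nabla>\<^sub>1 Y\<^sub>1\<close>, \<open>\<nabla>\<^sub>1 Y\<^sub>2 + \<nabla>\<^sub>2 Y\<^sub>1\<close>, \<open>\<nabla>\<^sub>2 Y\<^sub>2\<close>, with respect to the unit normal
  \<open>cross3 a b / |cross3 a b|\<close>.\<close>

definition twoH :: "real^3 \<Rightarrow> real^3 \<Rightarrow> real^3 \<Rightarrow> real^3 \<Rightarrow> real^3 \<Rightarrow> real" where
  "twoH a b p q r = ((b \<bullet> b) * (p \<bullet> (cross3 a b)) - (a \<bullet> b) * (q \<bullet> (cross3 a b)) + (a \<bullet> a) * (r \<bullet> (cross3 a b)))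
     * ((cross3 a b) \<bullet> (cross3 a b)) powr (- 3 / 2)"

text \<open>Tangent vectors have weight 1 and second derivatives weight 2, so the numerator and the
  power of the cross product have weights 6 and -6. The factor c is a number at one point; it may
  vary from point to point although no change of parameters is involved.\<close>

lemma twoH_scale:
  assumes "0 < c"
  shows "twoH (c *\<^sub>R a) (c *\<^sub>R b) (c\<^sup>2 *\<^sub>R p) (c\<^sup>2 *\<^sub>R q) (c\<^sup>2 *\<^sub>R r) = twoH a b p q r"
proof -
  have X: "cross3 (c *\<^sub>R a) (c *\<^sub>R b) = c\<^sup>2 *\<^sub>R cross3 a b"
    by (simp add: cross_mult_left cross_mult_right power2_eq_square)
  have P: "(c ^ 4 * X) powr (- 3 / 2) = inverse (c ^ 6) * X powr (- 3 / 2)" if "0 \<le> X" for X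
  proof -
    have "(c ^ 4 * X) powr (- 3 / 2) = (c powr 4) powr (- 3 / 2) * X powr (- 3 / 2)"
      using assms that by (simp add: powr_mult powr_numeral)
    also have "(c powr 4) powr (- 3 / 2) = c powr - 6" by (simp add: powr_powr)
    finally show ?thesis using assms by (simp add: powr_minus powr_numeral)
  qed
  have i: "c\<^sup>2 *\<^sub>R u \<bullet> c\<^sup>2 *\<^sub>R v = c ^ 4 * (u \<bullet> v)" "c *\<^sub>R u \<bullet> c *\<^sub>R v = c ^ 2 * (u \<bullet> v)" for u v :: "real^3"
    by (simp_all add: power2_eq_square power4_eq_xxxx)
  have k: "c\<^sup>2 * k * (c ^ 4 * l) = c ^ 6 * (k * l)" for k l :: real
    by (simp add: eval_nat_numeral)
  show ?thesis
    unfolding twoH_def X i P[OF inner_ge_zero] k using assms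
    by (simp add: right_diff_distrib[symmetric] distrib_left[symmetric])
qed

text \<open>Explicit inversion of the Gram matrix of the tangent vectors, whose determinant is the
  squared length of their cross product.\<close>

lemma trace_shape:
  fixes I Y n s \<theta> and A :: "2 \<Rightarrow> real^3"
  assumes y: "Y s \<theta> $ 2 \<noteq> 0" and s: "at s within I \<noteq> bot"
    and A: "\<And>i. has_pd I i Y (frv (Y s \<theta> $ 2) (A i)) s \<theta>"
    and D: "\<And>j. cov_deriv I Y j n s \<theta> = frv (Y s \<theta> $ 2) (D j)"
    and nz: "cross3 (A 1) (A 2) \<noteq> 0"
  shows "trace (shape_operator I Y n s \<theta>) =
    - ((A 2 \<bullet> A 2) * (A 1 \<bullet> D 1) - (A 1 \<bullet> A 2) * (A 1 \<bullet> D 2 + A 2 \<bullet> D 1) + (A 1 \<bullet> A 1) * (A 2 \<bullet> D 2))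
      / ((cross3 (A 1) (A 2)) \<bullet> (cross3 (A 1) (A 2)))"
    and "first_form I Y s \<theta> = (\<chi> i j. A i \<bullet> A j)"
    and "second_form I Y n s \<theta> = (\<chi> i j. - (A i \<bullet> D j))"
proof -
  have pd: "pd I i Y s \<theta> = frv (Y s \<theta> $ 2) (A i)" for i by (rule pd_eq[OF A s])
  show g: "first_form I Y s \<theta> = (\<chi> i j. A i \<bullet> A j)"
    unfolding first_form_def pd gprod_frv[OF y] ..
  show h: "second_form I Y n s \<theta> = (\<chi> i j. - (A i \<bullet> D j))"
    unfolding second_form_def pd D frv_minus[symmetric] gprod_frv[OF y] by simp
  have d: "det (\<chi> i j. A i \<bullet> A j) = (cross3 (A 1) (A 2)) \<bullet> (cross3 (A 1) (A 2))"
    by (simp add: det_2 inner_3 cross3_def algebra_simps)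
  have d0: "det (\<chi> i j. A i \<bullet> A j) \<noteq> 0" unfolding d using nz by simp
  show "trace (shape_operator I Y n s \<theta>) =
    - ((A 2 \<bullet> A 2) * (A 1 \<bullet> D 1) - (A 1 \<bullet> A 2) * (A 1 \<bullet> D 2 + A 2 \<bullet> D 1) + (A 1 \<bullet> A 1) * (A 2 \<bullet> D 2))
      / ((cross3 (A 1) (A 2)) \<bullet> (cross3 (A 1) (A 2)))"
    unfolding shape_operator_def g h matrix_inv_2[OF d0] d
    using d0[unfolded d]
    by (simp add: trace_def matrix_matrix_mult_def sum_2 inner_commute[of "A 2" "A 1"] field_simps)
qed

section \<open>The catenoid in the left-invariant frame\<close>

text \<open>The relations among \<open>x = sin \<theta>\<close>, \<open>c = cos \<theta>\<close>, \<open>k = 1 / cosh s\<close>, \<open>t = tanh s\<close>, \<open>B = \<alpha>\<^sub>* / \<alpha>\<close>,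
  \<open>p = - \<phi>' / \<alpha>\<close> and \<open>q = 1 / (\<alpha>\<^sup>2 (1 + p))\<close>. In terms of these the catenoid is
  \<open>(e\<^bsup>B s\<^esup> x q / d, e\<^bsup>B s\<^esup> B k / d, c q / k)\<close>.\<close>

locale cat_rel =
  fixes x c k t B p q d :: real
  assumes xc: "x\<^sup>2 = 1 - c\<^sup>2" and kt: "k\<^sup>2 = 1 - t\<^sup>2" and BB: "B\<^sup>2 = 1 + 2 * q + q\<^sup>2 * c\<^sup>2"
    and p_eq: "p = 1 + q * c\<^sup>2" and d_eq: "d = 1 + q + B * t"
    and p0: "p \<noteq> 0" and d0: "d \<noteq> 0" and k0: "k \<noteq> 0" and q0: "q \<noteq> 0"
begin

text \<open>The coordinate fields of the catenoid divided by their lengths \<open>q / k\<close> and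
  \<open>q / (k * p)\<close>, and their cross product. That these are the right vectors is the
  content of \<open>log_y_derivs\<close>.\<close>

definition E1 :: "real^3" where
  "E1 = vector [x * (1 - k\<^sup>2 / d), k * (B + p * t) / d, c * t]"

definition E2 :: "real^3" where
  "E2 = vector [c * ((1 + q) * t + B) / d, - (x * c * q * k / d), - x]"

definition nn :: "real^3" where
  "nn = vector [- (x * k * (B + t) / d), 1 - p * k\<^sup>2 / d, - (c * k)]"

lemma E_nth [simp]:
  "E1 $ 1 = x * (1 - k\<^sup>2 / d)" "E1 $ 2 = k * (B + p * t) / d" "E1 $ 3 = c * t"
  "E2 $ 1 = c * ((1 + q) * t + B) / d" "E2 $ 2 = - (x * c * q * k / d)" "E2 $ 3 = - x"
  "nn $ 1 = - (x * k * (B + t) / d)" "nn $ 2 = 1 - p * k\<^sup>2 / d" "nn $ 3 = - (c * k)"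
  by (simp_all add: E1_def E2_def nn_def)

text \<open>All identities of the frame are memberships in a polynomial ideal. Each reciprocal is
  treated as a variable of its own, tied down by one of these relations.\<close>

lemma inverse_rel:
  "inverse d * (1 + q + B * t) = 1" "inverse p * (1 + q * c\<^sup>2) = 1" "inverse k * k = 1" "inverse q * q = 1"
  using p0 d0 k0 q0 p_eq d_eq by (metis left_inverse)+

lemmas rels = xc kt BB inverse_rel(1) p_eq

lemma E1_E1: "E1 \<bullet> E1 = 1"
  using rels unfolding inner_3 E_nth divide_inverse by algebra

lemma E2_E2: "E2 \<bullet> E2 = 1"
  using rels unfolding inner_3 E_nth divide_inverse by algebra

lemma E1_E2: "E1 \<bullet> E2 = 0"
  using rels unfolding inner_3 E_nth divide_inverse by algebra

lemma E1_cross_E2: "cross3 E1 E2 = nn"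
proof -
  have "E1 $ 2 * E2 $ 3 - E1 $ 3 * E2 $ 2 = nn $ 1"
    using rels unfolding E_nth divide_inverse by algebra
  moreover have "E1 $ 3 * E2 $ 1 - E1 $ 1 * E2 $ 3 = nn $ 2"
    using rels unfolding E_nth divide_inverse by algebra
  moreover have "E1 $ 1 * E2 $ 2 - E1 $ 2 * E2 $ 1 = nn $ 3"
    using rels unfolding E_nth divide_inverse by algebra
  ultimately show ?thesis by (simp add: cross3_def vec_eq_iff forall_3 del: E_nth)
qed

text \<open>Derivatives of \<open>E1\<close> and \<open>E2\<close> by the chain rule, from t_s =
  k^2, k_s = - k t, d_s = B k^2, q_\<theta> = d_\<theta> = q^2 x c / p and p_\<theta> = - q (1 + p)
  x c / p.\<close>

definition E1s :: "real^3" where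
  "E1s = vector [x * (2 * k\<^sup>2 * t / d + B * k ^ 4 / d\<^sup>2),
     - (k * t * (B + p * t) / d) + k ^ 3 * p / d - k ^ 3 * (B + p * t) * B / d\<^sup>2, c * k\<^sup>2]"

definition E1t :: "real^3" where
  "E1t = vector [c * (1 - k\<^sup>2 / d) + x * k\<^sup>2 * (q\<^sup>2 * x * c / p) / d\<^sup>2,
     - (k * t * (q * (1 + p) * x * c / p) / d) - k * (B + p * t) * (q\<^sup>2 * x * c / p) / d\<^sup>2, - (x * t)]"

definition E2s :: "real^3" where
  "E2s = vector [c * ((1 + q) * k\<^sup>2) / d - c * ((1 + q) * t + B) * B * k\<^sup>2 / d\<^sup>2,
     x * c * q * k * t / d + x * c * q * k ^ 3 * B / d\<^sup>2, 0]"

definition E2t :: "real^3" where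
  "E2t = vector [- (x * ((1 + q) * t + B) / d) + c * t * (q\<^sup>2 * x * c / p) / d
        - c * ((1 + q) * t + B) * (q\<^sup>2 * x * c / p) / d\<^sup>2,
     - ((c\<^sup>2 - x\<^sup>2) * q * k / d) - x * c * k * (q\<^sup>2 * x * c / p) / d
        + x * c * q * k * (q\<^sup>2 * x * c / p) / d\<^sup>2, - c]"

lemma Ed_nth:
  "E1s $ 1 = x * (2 * k\<^sup>2 * t / d + B * k ^ 4 / d\<^sup>2)"
  "E1s $ 2 = - (k * t * (B + p * t) / d) + k ^ 3 * p / d - k ^ 3 * (B + p * t) * B / d\<^sup>2"
  "E1s $ 3 = c * k\<^sup>2"
  "E1t $ 1 = c * (1 - k\<^sup>2 / d) + x * k\<^sup>2 * (q\<^sup>2 * x * c / p) / d\<^sup>2"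
  "E1t $ 2 = - (k * t * (q * (1 + p) * x * c / p) / d) - k * (B + p * t) * (q\<^sup>2 * x * c / p) / d\<^sup>2"
  "E1t $ 3 = - (x * t)"
  "E2s $ 1 = c * ((1 + q) * k\<^sup>2) / d - c * ((1 + q) * t + B) * B * k\<^sup>2 / d\<^sup>2"
  "E2s $ 2 = x * c * q * k * t / d + x * c * q * k ^ 3 * B / d\<^sup>2"
  "E2s $ 3 = 0"
  "E2t $ 1 = - (x * ((1 + q) * t + B) / d) + c * t * (q\<^sup>2 * x * c / p) / d
        - c * ((1 + q) * t + B) * (q\<^sup>2 * x * c / p) / d\<^sup>2"
  "E2t $ 2 = - ((c\<^sup>2 - x\<^sup>2) * q * k / d) - x * c * k * (q\<^sup>2 * x * c / p) / d
        + x * c * q * k * (q\<^sup>2 * x * c / p) / d\<^sup>2"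
  "E2t $ 3 = - c"
  by (simp_all add: E1s_def E1t_def E2s_def E2t_def)

text \<open>With the next two lemmas these are the components of \<nabla>_\<theta> X_s = \<nabla>_s
  X_\<theta>, divided by the length \<open>q / k\<close> of X_s. The connection coefficients enter
  only the first component; in the second they are symmetric and in the third they vanish.\<close>

lemma torsion_1:
  "q * x * c / p * E1 $ 1 + E1t $ 1 - q / (k * p) * (E2 $ 1 * E1 $ 2)
   = t / p * E2 $ 1 + E2s $ 1 / p - q / (k * p) * (E1 $ 1 * E2 $ 2)"
  using rels inverse_rel(2,3) unfolding E_nth Ed_nth divide_inverse power_inverse[symmetric] inverse_mult_distrib
  by algebra

lemma torsion_2:
  "q * x * c / p * E1 $ 2 + E1t $ 2 = t / p * E2 $ 2 + E2s $ 2 / p"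
  using rels inverse_rel(2,3) unfolding E_nth Ed_nth divide_inverse power_inverse[symmetric] inverse_mult_distrib
  by algebra

lemma torsion_3:
  "q * x * c / p * E1 $ 3 + E1t $ 3 = t / p * E2 $ 3 + E2s $ 3 / p"
  using rels inverse_rel(2,3) unfolding E_nth Ed_nth divide_inverse power_inverse[symmetric] inverse_mult_distrib
  by algebra

text \<open>The sum of the principal curvatures: in orthogonal coordinates each direction
  contributes the normal part of its covariant second derivative over the squared length, here with
  the lengths \<open>q / k\<close> and \<open>q / (k * p)\<close>.\<close>

lemma mean_curvature_identity:
  "k / q * (E1s \<bullet> nn) + E1 $ 1 * (E1 $ 1 * nn $ 2 - E1 $ 2 * nn $ 1)
    + p * k / q * (E2t \<bullet> nn) + E2 $ 1 * (E2 $ 1 * nn $ 2 - E2 $ 2 * nn $ 1) = 1"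
  using rels inverse_rel(2-4)
  unfolding inner_3 E_nth Ed_nth divide_inverse power_inverse[symmetric] inverse_mult_distrib
  by algebra

text \<open>It simplifies the coefficient in \<open>cat_omega\<close>, after which the denominator
  of that function is a multiple of d.\<close>

lemma omega_identity: "(1 + q - B) * ((1 + B) * (B + p)) = x\<^sup>2 * (q * (1 + p)) * q"
  using rels unfolding p_eq by algebra

text \<open>Up to factors common to both sides: each derivative of a component of the catenoid is
  length times frame component, times the height for x and y. In order these are y in s and
  \<theta>, x in s and \<theta>, and z in \<theta>.\<close>

lemma log_y_derivs:
  "B * inverse d * k - k * t * inverse d - k * (B * k\<^sup>2) * (inverse d)\<^sup>2 = k * inverse d * (q / k * E1 $ 2)"
  "- (k * (q\<^sup>2 * x * c / p) * (inverse d)\<^sup>2) = k * inverse d * (q / k / p * E2 $ 2)"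
  "x * q * inverse d * B - x * q * (B * k\<^sup>2) * (inverse d)\<^sup>2 = B * k * inverse d * (q / k * E1 $ 1)"
  "c * q * inverse d + x * (q\<^sup>2 * x * c / p) * inverse d - x * q * (q\<^sup>2 * x * c / p) * (inverse d)\<^sup>2
    = B * k * inverse d * (q / k / p * E2 $ 1)"
  "c * (q / k * (q * x * c / p)) - x * (q / k) = q / k / p * E2 $ 3"
  subgoal using rels inverse_rel(2,3) unfolding E_nth divide_inverse by algebra
  subgoal using rels inverse_rel(2,3) unfolding E_nth divide_inverse by algebra
  subgoal using rels inverse_rel(2,3) unfolding E_nth divide_inverse by algebra
  subgoal using rels inverse_rel(2,3) unfolding E_nth divide_inverse by algebra
  subgoal using rels inverse_rel(2,3) unfolding E_nth divide_inverse by algebra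
  done

end

section \<open>The catenoid and its frame as functions of s and \<theta>\<close>

definition cp :: "real \<Rightarrow> real \<Rightarrow> real \<Rightarrow> real" where
  "cp \<alpha> s \<theta> = sqrt (1 + (cos \<theta>)\<^sup>2 / \<alpha>\<^sup>2)"

definition cq :: "real \<Rightarrow> real \<Rightarrow> real \<Rightarrow> real" where
  "cq \<alpha> s \<theta> = 1 / (\<alpha>\<^sup>2 * (1 + cp \<alpha> s \<theta>))"

definition cB :: "real \<Rightarrow> real" where
  "cB \<alpha> = alpha_star \<alpha> / \<alpha>"

definition cd :: "real \<Rightarrow> real \<Rightarrow> real \<Rightarrow> real" where
  "cd \<alpha> s \<theta> = 1 + cq \<alpha> s \<theta> + cB \<alpha> * tanh s"

definition ck :: "real \<Rightarrow> real \<Rightarrow> real \<Rightarrow> real" where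
  "ck \<alpha> s \<theta> = inverse (cosh s)"

lemma cp_ge1: "1 \<le> cp \<alpha> s \<theta>"
  by (simp add: cp_def)

lemma cp_sq: "0 < \<alpha> \<Longrightarrow> (cp \<alpha> s \<theta>)\<^sup>2 = 1 + (cos \<theta>)\<^sup>2 / \<alpha>\<^sup>2"
  by (simp add: cp_def)

lemma cq_pos: "0 < \<alpha> \<Longrightarrow> 0 < cq \<alpha> s \<theta>"
  using cp_ge1[of \<alpha> s \<theta>] by (simp add: cq_def)

lemma cq_nu: "0 < \<alpha> \<Longrightarrow> cq \<alpha> s \<theta> * (1 + cp \<alpha> s \<theta>) = 1 / \<alpha>\<^sup>2"
  using cp_ge1[of \<alpha> s \<theta>] by (simp add: cq_def)

lemma cB_pos: "0 < \<alpha> \<Longrightarrow> 0 < cB \<alpha>"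
  by (simp add: cB_def alpha_star_def add_nonneg_pos)

lemma cB_sq: "0 < \<alpha> \<Longrightarrow> (cB \<alpha>)\<^sup>2 = 1 + 1 / \<alpha>\<^sup>2"
  by (simp add: cB_def alpha_star_def power_divide add_divide_distrib)

lemma cp_cq:
  assumes "0 < \<alpha>"
  shows "cp \<alpha> s \<theta> = 1 + cq \<alpha> s \<theta> * (cos \<theta>)\<^sup>2"
proof -
  have "(1 + cp \<alpha> s \<theta>) * (cp \<alpha> s \<theta> - 1) = (1 + cp \<alpha> s \<theta>) * (cq \<alpha> s \<theta> * (cos \<theta>)\<^sup>2)"
    using cp_sq[OF assms, of s \<theta>] cq_nu[OF assms, of s \<theta>]
    by (simp add: power2_eq_square algebra_simps)
  then show ?thesis using cp_ge1[of \<alpha> s \<theta>] by simp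
qed

lemma cB_cq:
  assumes "0 < \<alpha>"
  shows "(cB \<alpha>)\<^sup>2 = 1 + 2 * cq \<alpha> s \<theta> + (cq \<alpha> s \<theta>)\<^sup>2 * (cos \<theta>)\<^sup>2"
  using cq_nu[OF assms, of s \<theta>] cp_cq[OF assms, of s \<theta>] unfolding cB_sq[OF assms]
  by (simp add: power2_eq_square algebra_simps)

text \<open>B \<le> 1 + q because (1 + q)^2 - B^2 = (q sin \<theta>)^2, and tanh > -1. The claim
  covers negative s too, since the unit normal is fixed by conditions on the whole surface.\<close>

lemma cd_pos:
  assumes "0 < \<alpha>"
  shows "0 < cd \<alpha> s \<theta>"
proof -
  have "(cB \<alpha>)\<^sup>2 \<le> (1 + cq \<alpha> s \<theta>)\<^sup>2"
  proof -
    have "(1 + cq \<alpha> s \<theta>)\<^sup>2 = (cB \<alpha>)\<^sup>2 + (cq \<alpha> s \<theta> * sin \<theta>)\<^sup>2"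
      unfolding cB_cq[OF assms, of s \<theta>] power_mult_distrib sin_squared_eq
      by (simp add: power2_eq_square algebra_simps)
    then show ?thesis by simp
  qed
  then have 1: "cB \<alpha> \<le> 1 + cq \<alpha> s \<theta>"
    using cq_pos[OF assms, of s \<theta>] power2_le_imp_le by fastforce
  have "- 1 < tanh s" by (rule tanh_real_gt_neg1)
  then have "- cB \<alpha> < cB \<alpha> * tanh s"
    using cB_pos[OF assms] by (metis mult.right_neutral mult_minus_right mult_strict_left_mono)
  with 1 show ?thesis by (simp add: cd_def)
qed

lemma ck_pos: "0 < ck \<alpha> s \<theta>"
  by (simp add: ck_def cosh_real_pos)

lemma ck_sq: "(ck \<alpha> s \<theta>)\<^sup>2 = 1 - (tanh s)\<^sup>2"
proof -
  have "(cosh s)\<^sup>2 * (inverse (cosh s))\<^sup>2 = 1"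
    using cosh_real_pos[of s] by (simp add: power_mult_distrib[symmetric])
  then have "(inverse (cosh s))\<^sup>2 + (sinh s)\<^sup>2 * (inverse (cosh s))\<^sup>2 = 1"
    by (simp add: cosh_square_eq algebra_simps)
  then show ?thesis
    unfolding ck_def tanh_def divide_inverse power_mult_distrib by linarith
qed

lemma cat_rel:
  assumes "0 < \<alpha>"
  shows "cat_rel (sin \<theta>) (cos \<theta>) (ck \<alpha> s \<theta>) (tanh s) (cB \<alpha>) (cp \<alpha> s \<theta>) (cq \<alpha> s \<theta>) (cd \<alpha> s \<theta>)"
proof
  show "cp \<alpha> s \<theta> \<noteq> 0" using cp_ge1[of \<alpha> s \<theta>] by linarith
  show "cd \<alpha> s \<theta> \<noteq> 0" using cd_pos[OF assms, of s \<theta>] by linarith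
  show "ck \<alpha> s \<theta> \<noteq> 0" using ck_pos[of \<alpha> s \<theta>] by linarith
  show "cq \<alpha> s \<theta> \<noteq> 0" using cq_pos[OF assms, of s \<theta>] by linarith
qed (simp_all add: sin_squared_eq ck_sq cd_def cB_cq[OF assms, of s \<theta>] cp_cq[OF assms])

definition tfr :: "2 \<Rightarrow> real \<Rightarrow> real \<Rightarrow> real \<Rightarrow> real^3" where
  "tfr i \<alpha> s \<theta> = (if i = 1
     then cat_rel.E1 (sin \<theta>) (cos \<theta>) (ck \<alpha> s \<theta>) (tanh s) (cB \<alpha>) (cp \<alpha> s \<theta>) (cd \<alpha> s \<theta>)
     else cat_rel.E2 (sin \<theta>) (cos \<theta>) (ck \<alpha> s \<theta>) (tanh s) (cB \<alpha>) (cq \<alpha> s \<theta>) (cd \<alpha> s \<theta>))"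

definition nfr :: "real \<Rightarrow> real \<Rightarrow> real \<Rightarrow> real^3" where
  "nfr \<alpha> s \<theta> = cat_rel.nn (sin \<theta>) (cos \<theta>) (ck \<alpha> s \<theta>) (tanh s) (cB \<alpha>) (cp \<alpha> s \<theta>) (cd \<alpha> s \<theta>)"

text \<open>The lengths of the coordinate vectors \<open>\<partial>\<^sub>s X\<close> and \<open>\<partial>\<^sub>\<theta> X\<close>, which are orthogonal.\<close>

definition lam :: "2 \<Rightarrow> real \<Rightarrow> real \<Rightarrow> real \<Rightarrow> real" where
  "lam i \<alpha> s \<theta> = (if i = 1 then cq \<alpha> s \<theta> / ck \<alpha> s \<theta> else cq \<alpha> s \<theta> / ck \<alpha> s \<theta> / cp \<alpha> s \<theta>)"

definition tfr' :: "2 \<Rightarrow> 2 \<Rightarrow> real \<Rightarrow> real \<Rightarrow> real \<Rightarrow> real^3" where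
  "tfr' i j \<alpha> s \<theta> = (let x = sin \<theta>; c = cos \<theta>; k = ck \<alpha> s \<theta>; t = tanh s; B = cB \<alpha>; p = cp \<alpha> s \<theta>;
      q = cq \<alpha> s \<theta>; d = cd \<alpha> s \<theta>
    in if i = 1 then (if j = 1 then cat_rel.E1s x c k t B p d else cat_rel.E1t x c k t B p q d)
       else (if j = 1 then cat_rel.E2s x c k t B q d else cat_rel.E2t x c k t B p q d))"

text \<open>The coefficient K of exp (- s) cosh s in \<open>cat_omega\<close> satisfies K B = 1 + q
  - B. Hence the denominator of \<omega> is d exp (- s) / (B k), and exp (\<epsilon> s) exp s = exp
  (B s) does the rest.\<close>

lemma catenoid_eq:
  assumes "0 < \<alpha>"
  shows "catenoid \<alpha> s \<theta> = vector [exp (cB \<alpha> * s) * (sin \<theta> * cq \<alpha> s \<theta> * inverse (cd \<alpha> s \<theta>)),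
      exp (cB \<alpha> * s) * (cB \<alpha> * ck \<alpha> s \<theta> * inverse (cd \<alpha> s \<theta>)), cos \<theta> * (cq \<alpha> s \<theta> / ck \<alpha> s \<theta>)]"
proof -
  define x c k t B p q d where "x = sin \<theta>" "c = cos \<theta>" "k = ck \<alpha> s \<theta>" "t = tanh s" "B = cB \<alpha>"
    "p = cp \<alpha> s \<theta>" "q = cq \<alpha> s \<theta>" "d = cd \<alpha> s \<theta>"
  note defs = this
  interpret R: cat_rel x c k t B p q d unfolding defs by (rule cat_rel[OF assms])
  have pos: "0 < k" "0 < B" "1 \<le> p" "0 < q" "0 < d"
    unfolding defs using ck_pos cB_pos[OF assms] cp_ge1 cq_pos[OF assms] cd_pos[OF assms] by auto
  have ph: "dphi \<alpha> \<theta> = - (\<alpha> * p)"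
  proof -
    have "\<alpha>\<^sup>2 + (cos \<theta>)\<^sup>2 = \<alpha>\<^sup>2 * (1 + (cos \<theta>)\<^sup>2 / \<alpha>\<^sup>2)" using assms by (simp add: field_simps)
    then show ?thesis using assms by (simp add: dphi_def defs cp_def real_sqrt_mult)
  qed
  have as: "alpha_star \<alpha> = \<alpha> * B" using assms by (simp add: defs cB_def)
  have nu: "\<alpha>\<^sup>2 * (q * (1 + p)) = 1"
    unfolding defs cq_nu[OF assms] using assms by simp
  have ek: "exp s * k = 1 + t" "exp (- s) * k = 1 - t"
  proof -
    have "exp s = cosh s + sinh s" "exp (- s) = cosh s - sinh s" by (simp_all add: cosh_plus_sinh cosh_minus_sinh)
    then show "exp s * k = 1 + t" "exp (- s) * k = 1 - t"
      using cosh_real_pos[of s] by (simp_all add: defs ck_def tanh_def field_simps)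
  qed
  have ch: "cosh s = 1 / k" by (simp add: defs ck_def divide_inverse)
  define Q where "Q = alpha_star \<alpha> * (\<alpha> + alpha_star \<alpha>) * (\<alpha> - dphi \<alpha> \<theta>) * (alpha_star \<alpha> - dphi \<alpha> \<theta>)"
  define K where "K = x\<^sup>2 / Q"
  have KB: "K * B = 1 + q - B"
  proof -
    have "Q = \<alpha>\<^sup>2 * (1 + p) * (\<alpha>\<^sup>2 * (B * ((1 + B) * (B + p))))"
      unfolding Q_def as ph by (simp add: power2_eq_square algebra_simps)
    then have Q: "Q * (q * (q * (1 + p))) = B * ((1 + B) * (B + p))"
      using nu by algebra
    have "B * ((1 + B) * (B + p)) \<noteq> 0" using pos by auto
    then have "Q \<noteq> 0" using Q by auto
    then have "K * Q = x\<^sup>2" by (simp add: K_def)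
    then have "K * (B * ((1 + B) * (B + p))) = x\<^sup>2 * (q * (q * (1 + p)))"
      unfolding Q[symmetric] by (metis mult.assoc)
    then have "K * B * ((1 + B) * (B + p)) = (1 + q - B) * ((1 + B) * (B + p))"
      unfolding R.omega_identity by (simp add: mult_ac)
    moreover have "(1 + B) * (B + p) \<noteq> 0" using pos by auto
    ultimately show ?thesis by (metis mult_cancel_right)
  qed
  have "(1 + K * exp (- s) * cosh s) * (exp s * (B * k * inverse d)) = 1"
  proof -
    have "d = B * (1 + t) + K * B" unfolding KB R.d_eq by (simp add: algebra_simps)
    moreover have "exp (- s) * exp s = 1" by (simp flip: exp_add)
    ultimately have "(1 + K * exp (- s) * cosh s) * (exp s * (B * k)) = d"
      using ek pos unfolding ch by (simp add: field_simps) algebra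
    then show ?thesis using pos by (simp add: field_simps)
  qed
  then have om: "cat_omega \<alpha> s \<theta> = exp s * (B * k * inverse d)"
    unfolding cat_omega_def Q_def[symmetric] defs(1)[symmetric] K_def[symmetric] by (simp add: inverse_unique)
  have ex: "exp (cat_eps \<alpha> * s) * exp s = exp (B * s)"
    by (simp add: cat_eps_def defs cB_def algebra_simps flip: exp_add)
  have y: "exp (cat_eps \<alpha> * s) * cat_omega \<alpha> s \<theta> = exp (B * s) * (B * k * inverse d)"
    unfolding om ex[symmetric] by simp
  have "sin \<theta> / (alpha_star \<alpha> * (\<alpha> - dphi \<alpha> \<theta>)) * cosh s * exp (cat_eps \<alpha> * s) * cat_omega \<alpha> s \<theta>
     = x / (\<alpha> * B * (\<alpha> + \<alpha> * p)) * (1 / k) * (exp (B * s) * (B * k * inverse d))"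
    unfolding y[symmetric] as ph ch by (simp add: defs)
  also have "\<dots> = x / (\<alpha>\<^sup>2 * (1 + p)) * exp (B * s) * inverse d"
  proof -
    have "x / (B * M) * (1 / k) * (E * (B * k * D)) = x / M * E * D" for M E D
      using pos by simp
    moreover have "\<alpha> * B * (\<alpha> + \<alpha> * p) = B * (\<alpha>\<^sup>2 * (1 + p))"
      by (simp add: power2_eq_square algebra_simps)
    ultimately show ?thesis by (simp only:)
  qed
  also have "\<dots> = exp (B * s) * (x * q * inverse d)" by (simp add: defs cq_def)
  finally have 1: "sin \<theta> / (alpha_star \<alpha> * (\<alpha> - dphi \<alpha> \<theta>)) * cosh s * exp (cat_eps \<alpha> * s) * cat_omega \<alpha> s \<theta>
     = exp (B * s) * (x * q * inverse d)" .
  have "cos \<theta> / (\<alpha> * (\<alpha> - dphi \<alpha> \<theta>)) * cosh s = c / (\<alpha>\<^sup>2 * (1 + p)) * (1 / k)"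
    unfolding ph ch by (simp add: defs power2_eq_square algebra_simps)
  also have "\<dots> = c * (q / k)" by (simp add: defs cq_def)
  finally show ?thesis using 1 y unfolding catenoid_def defs by simp
qed


section \<open>Derivatives of the catenoid, of its frame and of the lengths\<close>

lemma has_pd_eq: "has_pd I i f D s \<theta> \<Longrightarrow> D = E \<Longrightarrow> has_pd I i f E s \<theta>"
  by simp

lemma has_pd_1_fst: "(f has_real_derivative D) (at s) \<Longrightarrow> has_pd UNIV 1 (\<lambda>s \<theta>. f s) D s \<theta>"
  and has_pd_1_snd: "has_pd UNIV 1 (\<lambda>s \<theta>. g \<theta>) 0 s \<theta>"
  and has_pd_2_fst: "has_pd UNIV 2 (\<lambda>s \<theta>. g s) 0 s \<theta>"
  and has_pd_2_snd: "(f has_real_derivative D) (at \<theta>) \<Longrightarrow> has_pd UNIV 2 (\<lambda>s \<theta>. f \<theta>) D s \<theta>"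
  for f :: "real \<Rightarrow> real" and g :: "real \<Rightarrow> real"
  by (simp_all add: has_pd_def has_real_derivative_iff_has_vector_derivative)

lemma has_pd_sin_cos:
  "has_pd UNIV 1 (\<lambda>s \<theta>. sin \<theta>) 0 s \<theta>" "has_pd UNIV 1 (\<lambda>s \<theta>. cos \<theta>) 0 s \<theta>"
  "has_pd UNIV 2 (\<lambda>s \<theta>. sin \<theta>) (cos \<theta>) s \<theta>" "has_pd UNIV 2 (\<lambda>s \<theta>. cos \<theta>) (- sin \<theta>) s \<theta>"
  by (intro has_pd_1_snd has_pd_2_snd DERIV_sin DERIV_cos)+

lemma has_pd_tanh: "has_pd UNIV 1 (\<lambda>s \<theta>. tanh s) ((ck \<alpha> s \<theta>)\<^sup>2) s \<theta>"
    "has_pd UNIV 2 (\<lambda>s \<theta>. tanh s) 0 s \<theta>"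
proof -
  have "(tanh has_real_derivative (ck \<alpha> s \<theta>)\<^sup>2) (at s)"
    unfolding ck_sq using cosh_real_pos[of s] by (auto intro!: derivative_eq_intros)
  then show "has_pd UNIV 1 (\<lambda>s \<theta>. tanh s) ((ck \<alpha> s \<theta>)\<^sup>2) s \<theta>" by (rule has_pd_1_fst)
qed (rule has_pd_2_fst)

lemma has_pd_ck: "has_pd UNIV 1 (ck \<alpha>) (- (ck \<alpha> s \<theta> * tanh s)) s \<theta>" "has_pd UNIV 2 (ck \<alpha>) 0 s \<theta>"
proof -
  have "((\<lambda>s. inverse (cosh s)) has_real_derivative - (inverse (cosh s) * tanh s)) (at s)"
    using cosh_real_pos[of s]
    by (auto intro!: derivative_eq_intros simp: tanh_def field_simps)
  then show "has_pd UNIV 1 (ck \<alpha>) (- (ck \<alpha> s \<theta> * tanh s)) s \<theta>"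
    unfolding ck_def by (rule has_pd_1_fst)
  show "has_pd UNIV 2 (ck \<alpha>) 0 s \<theta>" unfolding ck_def by (rule has_pd_2_fst)
qed

context
  fixes \<alpha> :: real
  assumes \<alpha>: "0 < \<alpha>"
begin

lemma has_pd_cp: "has_pd UNIV 1 (cp \<alpha>) 0 s \<theta>"
  "has_pd UNIV 2 (cp \<alpha>) (- (cq \<alpha> s \<theta> * (1 + cp \<alpha> s \<theta>) * sin \<theta> * cos \<theta> / cp \<alpha> s \<theta>)) s \<theta>"
proof -
  have e: "cp \<alpha> = (\<lambda>s \<theta>. sqrt (1 + cos \<theta> * cos \<theta> * (1 / \<alpha>\<^sup>2)))"
    by (intro ext) (simp add: cp_def power2_eq_square)
  have pos: "0 < 1 + cos \<theta> * cos \<theta> * (1 / \<alpha>\<^sup>2)" by (simp add: add_pos_nonneg)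
  have "has_pd UNIV 2 (\<lambda>s \<theta>. 1 + cos \<theta> * cos \<theta> * (1 / \<alpha>\<^sup>2))
      (0 + ((- sin \<theta> * cos \<theta> + cos \<theta> * (- sin \<theta>)) * (1 / \<alpha>\<^sup>2) + cos \<theta> * cos \<theta> * 0)) s \<theta>"
    by (intro has_pd_add has_pd_mult has_pd_const has_pd_sin_cos)
  note sq = has_pd_sqrt[OF this pos]
  have "(0 + ((- x * c + c * (- x)) * n + c * c * 0)) * (r / 2) = - (n * x * c * r)" for x c n r :: real
    by (simp add: algebra_simps)
  from has_pd_eq[OF sq this]
  show "has_pd UNIV 2 (cp \<alpha>) (- (cq \<alpha> s \<theta> * (1 + cp \<alpha> s \<theta>) * sin \<theta> * cos \<theta> / cp \<alpha> s \<theta>)) s \<theta>"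
    unfolding cq_nu[OF \<alpha>] unfolding e divide_inverse[of _ "sqrt _"] .
  show "has_pd UNIV 1 (cp \<alpha>) 0 s \<theta>" unfolding cp_def by (rule has_pd_1_snd)
qed

lemma has_pd_cq: "has_pd UNIV 1 (cq \<alpha>) 0 s \<theta>"
  "has_pd UNIV 2 (cq \<alpha>) ((cq \<alpha> s \<theta>)\<^sup>2 * sin \<theta> * cos \<theta> / cp \<alpha> s \<theta>) s \<theta>"
proof -
  interpret R: cat_rel "sin \<theta>" "cos \<theta>" "ck \<alpha> s \<theta>" "tanh s" "cB \<alpha>" "cp \<alpha> s \<theta>" "cq \<alpha> s \<theta>" "cd \<alpha> s \<theta>"
    by (rule cat_rel[OF \<alpha>])
  have e: "cq \<alpha> = (\<lambda>s \<theta>. 1 / \<alpha>\<^sup>2 * inverse (1 + cp \<alpha> s \<theta>))"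
    by (intro ext) (simp add: cq_def divide_inverse)
  have nz: "1 + cp \<alpha> s \<theta> \<noteq> 0" using cp_ge1[of \<alpha> s \<theta>] by linarith
  note r = has_pd_mult[OF has_pd_const has_pd_inverse[where f = "\<lambda>s \<theta>. 1 + cp \<alpha> s \<theta>",
      OF has_pd_add[OF has_pd_const] nz]]
  show "has_pd UNIV 1 (cq \<alpha>) 0 s \<theta>"
    unfolding e by (rule has_pd_eq[OF r[OF has_pd_cp(1)]]) simp
  have 1: "1 / \<alpha>\<^sup>2 * inverse (1 + cp \<alpha> s \<theta>) = cq \<alpha> s \<theta>" by (simp add: cq_def divide_inverse)
  have 2: "inverse (1 + cp \<alpha> s \<theta>) * (1 + cp \<alpha> s \<theta>) = 1" using nz by simp
  have "n * (- (0 + - (q * (1 + p) * x * c / P)) * (i * i)) = q\<^sup>2 * x * c / P"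
    if "n * i = q" "i * (1 + p) = 1" for n i q p x c P :: real
  proof -
    have "n * (- (0 + - (q * (1 + p) * x * c / P)) * (i * i)) = (n * i) * (i * (1 + p)) * q * x * c / P"
      by simp
    then show ?thesis unfolding that by (simp add: power2_eq_square)
  qed
  from this[OF 1 2, of "sin \<theta>" "cos \<theta>" "cp \<alpha> s \<theta>"]
  show "has_pd UNIV 2 (cq \<alpha>) ((cq \<alpha> s \<theta>)\<^sup>2 * sin \<theta> * cos \<theta> / cp \<alpha> s \<theta>) s \<theta>"
    by (subst e) (rule has_pd_eq[OF r[OF has_pd_cp(2)]], simp)
qed

lemma has_pd_cd: "has_pd UNIV 1 (cd \<alpha>) (cB \<alpha> * (ck \<alpha> s \<theta>)\<^sup>2) s \<theta>"
  "has_pd UNIV 2 (cd \<alpha>) ((cq \<alpha> s \<theta>)\<^sup>2 * sin \<theta> * cos \<theta> / cp \<alpha> s \<theta>) s \<theta>"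
proof -
  have e: "cd \<alpha> = (\<lambda>s \<theta>. 1 + cq \<alpha> s \<theta> + cB \<alpha> * tanh s)"
    by (intro ext) (simp add: cd_def)
  note r = has_pd_add[OF has_pd_add[OF has_pd_const] has_pd_mult[OF has_pd_const]]
  show "has_pd UNIV 1 (cd \<alpha>) (cB \<alpha> * (ck \<alpha> s \<theta>)\<^sup>2) s \<theta>"
    "has_pd UNIV 2 (cd \<alpha>) ((cq \<alpha> s \<theta>)\<^sup>2 * sin \<theta> * cos \<theta> / cp \<alpha> s \<theta>) s \<theta>"
    unfolding e
    by (rule has_pd_eq[OF r[OF has_pd_cq(1) has_pd_tanh(1)[of \<alpha>]]], simp)
      (rule has_pd_eq[OF r[OF has_pd_cq(2) has_pd_tanh(2)]], simp)
qed

lemmas has_pd_atoms =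
  has_pd_sin_cos has_pd_tanh(1)[of \<alpha>] has_pd_tanh(2) has_pd_ck has_pd_cp has_pd_cq has_pd_cd
  has_pd_inverse[OF has_pd_ck(1)] has_pd_inverse[OF has_pd_ck(2)]
  has_pd_inverse[OF has_pd_cd(1)] has_pd_inverse[OF has_pd_cd(2)]
  has_pd_inverse[OF has_pd_cp(1)] has_pd_inverse[OF has_pd_cp(2)]

lemma atoms_nz: "ck \<alpha> s \<theta> \<noteq> 0" "cd \<alpha> s \<theta> \<noteq> 0" "cp \<alpha> s \<theta> \<noteq> 0"
  using ck_pos[of \<alpha> s \<theta>] cd_pos[OF \<alpha>, of s \<theta>] cp_ge1[of \<alpha> s \<theta>] by linarith+

lemma index_cases: "i = 1 \<or> i = (2::2)" using exhaust_2 .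

lemma has_pd_tfr: "has_pd UNIV j (tfr i \<alpha>) (tfr' i j \<alpha> s \<theta>) s \<theta>"
proof -
  interpret R: cat_rel "sin \<theta>" "cos \<theta>" "ck \<alpha> s \<theta>" "tanh s" "cB \<alpha>" "cp \<alpha> s \<theta>" "cq \<alpha> s \<theta>" "cd \<alpha> s \<theta>" for s \<theta>
    by (rule cat_rel[OF \<alpha>])
  note rules = has_pd_mult has_pd_add has_pd_diff has_pd_minus has_pd_const has_pd_atoms atoms_nz
  have two_neq_one: "(2 = (1::2)) = False" by simp
  have 11: "has_pd UNIV 1 (tfr 1 \<alpha>) (R.E1s \<theta> s) s \<theta>" for s \<theta>
    unfolding tfr_def has_pd_vec forall_3 two_neq_one simp_thms if_True if_False R.E_nth R.Ed_nth
      divide_inverse power2_eq_square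
    by (intro conjI; (rule has_pd_eq, (rule rules)+, simp add: algebra_simps eval_nat_numeral divide_inverse))
  have 12: "has_pd UNIV 2 (tfr 1 \<alpha>) (R.E1t \<theta> s) s \<theta>" for s \<theta>
    unfolding tfr_def has_pd_vec forall_3 two_neq_one simp_thms if_True if_False R.E_nth R.Ed_nth
      divide_inverse power2_eq_square
    by (intro conjI; (rule has_pd_eq, (rule rules)+, simp add: algebra_simps eval_nat_numeral divide_inverse))
  have 21: "has_pd UNIV 1 (tfr 2 \<alpha>) (R.E2s \<theta> s) s \<theta>" for s \<theta>
    unfolding tfr_def has_pd_vec forall_3 two_neq_one simp_thms if_True if_False R.E_nth R.Ed_nth
      divide_inverse power2_eq_square
    by (intro conjI; (rule has_pd_eq, (rule rules)+, simp add: algebra_simps eval_nat_numeral divide_inverse))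
  have 22: "has_pd UNIV 2 (tfr 2 \<alpha>) (R.E2t \<theta> s) s \<theta>" for s \<theta>
    unfolding tfr_def has_pd_vec forall_3 two_neq_one simp_thms if_True if_False R.E_nth R.Ed_nth
      divide_inverse power2_eq_square
    by (intro conjI; (rule has_pd_eq, (rule rules)+, simp add: algebra_simps eval_nat_numeral divide_inverse))
  have t: "tfr' 1 1 \<alpha> s \<theta> = R.E1s \<theta> s" "tfr' 1 2 \<alpha> s \<theta> = R.E1t \<theta> s"
    "tfr' 2 1 \<alpha> s \<theta> = R.E2s \<theta> s" "tfr' 2 2 \<alpha> s \<theta> = R.E2t \<theta> s" for s \<theta>
    by (simp_all add: tfr'_def)
  note all = 11[folded t(1)] 12[folded t(2)] 21[folded t(3)] 22[folded t(4)]
  show ?thesis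
  proof (cases "i = 1")
    case True
    then show ?thesis using index_cases[of j] all by auto
  next
    case False
    then have "i = 2" using index_cases[of i] by simp
    then show ?thesis using index_cases[of j] all by auto
  qed
qed

lemma has_pd_lam:
  "has_pd UNIV 1 (lam i \<alpha>) (lam i \<alpha> s \<theta> * tanh s) s \<theta>"
  "has_pd UNIV 2 (lam 1 \<alpha>) (lam 1 \<alpha> s \<theta> * (cq \<alpha> s \<theta> * sin \<theta> * cos \<theta> / cp \<alpha> s \<theta>)) s \<theta>"
  "has_pd UNIV 2 (lam 2 \<alpha>) (lam 2 \<alpha> s \<theta> * (cq \<alpha> s \<theta> * sin \<theta> * cos \<theta> / cp \<alpha> s \<theta>
     + cq \<alpha> s \<theta> * (1 + cp \<alpha> s \<theta>) * sin \<theta> * cos \<theta> / (cp \<alpha> s \<theta>)\<^sup>2)) s \<theta>"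
proof -
  note rules = has_pd_mult has_pd_atoms atoms_nz
  have e: "lam 1 \<alpha> = (\<lambda>s \<theta>. cq \<alpha> s \<theta> * inverse (ck \<alpha> s \<theta>))"
    "lam 2 \<alpha> = (\<lambda>s \<theta>. cq \<alpha> s \<theta> * inverse (ck \<alpha> s \<theta>) * inverse (cp \<alpha> s \<theta>))"
    by (intro ext, simp add: lam_def divide_inverse)+
  have k: "inverse (ck \<alpha> s \<theta>) * ck \<alpha> s \<theta> = 1" "inverse (cp \<alpha> s \<theta>) * cp \<alpha> s \<theta> = 1"
    using atoms_nz by simp_all
  have "has_pd UNIV 1 (lam 1 \<alpha>) (lam 1 \<alpha> s \<theta> * tanh s) s \<theta>"
    unfolding e divide_inverse
    by (rule has_pd_eq, (rule rules)+) ((simp only: divide_inverse)?, use k in algebra)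
  moreover have "has_pd UNIV 1 (lam 2 \<alpha>) (lam 2 \<alpha> s \<theta> * tanh s) s \<theta>"
    unfolding e divide_inverse
    by (rule has_pd_eq, (rule rules)+) ((simp only: divide_inverse)?, use k in algebra)
  ultimately show "has_pd UNIV 1 (lam i \<alpha>) (lam i \<alpha> s \<theta> * tanh s) s \<theta>"
    using index_cases[of i] by auto
  show "has_pd UNIV 2 (lam 1 \<alpha>) (lam 1 \<alpha> s \<theta> * (cq \<alpha> s \<theta> * sin \<theta> * cos \<theta> / cp \<alpha> s \<theta>)) s \<theta>"
    unfolding e divide_inverse
    by (rule has_pd_eq, (rule rules)+) (simp add: divide_inverse power2_eq_square algebra_simps)
  show "has_pd UNIV 2 (lam 2 \<alpha>) (lam 2 \<alpha> s \<theta> * (cq \<alpha> s \<theta> * sin \<theta> * cos \<theta> / cp \<alpha> s \<theta>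
     + cq \<alpha> s \<theta> * (1 + cp \<alpha> s \<theta>) * sin \<theta> * cos \<theta> / (cp \<alpha> s \<theta>)\<^sup>2)) s \<theta>"
    unfolding e
    by (rule has_pd_eq, (rule rules)+) (simp add: divide_inverse power2_eq_square algebra_simps)
qed

lemma has_pd_catenoid:
  "has_pd UNIV i (catenoid \<alpha>) (frv (catenoid \<alpha> s \<theta> $ 2) (lam i \<alpha> s \<theta> *\<^sub>R tfr i \<alpha> s \<theta>)) s \<theta>"
proof -
  interpret R: cat_rel "sin \<theta>" "cos \<theta>" "ck \<alpha> s \<theta>" "tanh s" "cB \<alpha>" "cp \<alpha> s \<theta>" "cq \<alpha> s \<theta>" "cd \<alpha> s \<theta>"
    by (rule cat_rel[OF \<alpha>])
  have e: "catenoid \<alpha> = (\<lambda>s \<theta>. vector [exp (cB \<alpha> * s) * (sin \<theta> * cq \<alpha> s \<theta> * inverse (cd \<alpha> s \<theta>)),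
      exp (cB \<alpha> * s) * (cB \<alpha> * ck \<alpha> s \<theta> * inverse (cd \<alpha> s \<theta>)), cos \<theta> * lam 1 \<alpha> s \<theta>])"
    by (intro ext) (simp add: catenoid_eq[OF \<alpha>] lam_def)
  have ex: "has_pd UNIV 1 (\<lambda>s \<theta>. exp (cB \<alpha> * s)) (cB \<alpha> * exp (cB \<alpha> * s)) s \<theta>"
    by (rule has_pd_1_fst) (auto intro!: derivative_eq_intros)
  have ex2: "has_pd UNIV 2 (\<lambda>s \<theta>. exp (cB \<alpha> * s)) 0 s \<theta>" by (rule has_pd_2_fst)
  note rules = has_pd_mult has_pd_const ex ex2 has_pd_atoms atoms_nz has_pd_lam
  have t: "lam 1 \<alpha> s \<theta> = cq \<alpha> s \<theta> / ck \<alpha> s \<theta>"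
    "lam 2 \<alpha> s \<theta> = cq \<alpha> s \<theta> / ck \<alpha> s \<theta> / cp \<alpha> s \<theta>" by (simp_all add: lam_def)
  let ?E = "exp (cB \<alpha> * s)"
  note id = R.log_y_derivs
  have 1: "has_pd UNIV 1 (catenoid \<alpha>) (frv (catenoid \<alpha> s \<theta> $ 2) (lam 1 \<alpha> s \<theta> *\<^sub>R R.E1)) s \<theta>"
    unfolding e has_pd_vec forall_3 vector_3 frv_nth vector_scaleR_component real_scaleR_def
    apply (intro conjI)
      apply (rule has_pd_eq, (rule rules)+) subgoal using id(3) unfolding t by algebra
     apply (rule has_pd_eq, (rule rules)+) subgoal using id(1) unfolding t by algebra
    apply (rule has_pd_eq, (rule rules)+) subgoal by (simp add: R.E_nth)
    done
  have 2: "has_pd UNIV 2 (catenoid \<alpha>) (frv (catenoid \<alpha> s \<theta> $ 2) (lam 2 \<alpha> s \<theta> *\<^sub>R R.E2)) s \<theta>"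
    unfolding e has_pd_vec forall_3 vector_3 frv_nth vector_scaleR_component real_scaleR_def
    apply (intro conjI)
      apply (rule has_pd_eq, (rule rules)+) subgoal using id(4) unfolding t by algebra
     apply (rule has_pd_eq, (rule rules)+) subgoal using id(2) unfolding t by algebra
    apply (rule has_pd_eq, (rule rules)+) subgoal using id(5) unfolding t by algebra
    done
  show ?thesis using index_cases[of i] 1 2 by (auto simp: tfr_def)
qed

end

section \<open>The unit normal and the curvature of the catenoid\<close>

lemma has_pd_bilinear:
  assumes "bounded_bilinear bm" "has_pd I i f D s \<theta>" "has_pd I i g E s \<theta>"
  shows "has_pd I i (\<lambda>s \<theta>. bm (f s \<theta>) (g s \<theta>)) (bm (f s \<theta>) E + bm D (g s \<theta>)) s \<theta>"
  using assms(2,3) unfolding has_pd_def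
  by (auto split: if_splits intro: bounded_bilinear.has_vector_derivative[OF assms(1)])

lemmas has_pd_inner = has_pd_bilinear[OF bounded_bilinear_inner]

lemmas has_pd_scaleR = has_pd_bilinear[OF bounded_bilinear_scaleR]

lemma has_pd_cross3:
  fixes f g :: "real \<Rightarrow> real \<Rightarrow> real^3"
  assumes "has_pd I i f D s \<theta>" "has_pd I i g E s \<theta>"
  shows "has_pd I i (\<lambda>s \<theta>. cross3 (f s \<theta>) (g s \<theta>)) (cross3 (f s \<theta>) E + cross3 D (g s \<theta>)) s \<theta>"
  by (rule has_pd_bilinear[OF _ assms])
    (simp add: bilinear_conv_bounded_bilinear[symmetric] bilinear_def linear_iff
      cross_add_left cross_add_right cross_mult_left cross_mult_right)

lemma has_pd_unique:
  assumes "has_pd I i f D s \<theta>" "has_pd I i f E s \<theta>" "at s within I \<noteq> bot"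
  shows "D = E"
  using pd_eq[OF assms(1,3)] pd_eq[OF assms(2,3)] by simp

lemma cross_inner_self: "cross3 a b \<bullet> cross3 a b = (a \<bullet> a) * (b \<bullet> b) - (a \<bullet> b)\<^sup>2"
  by (simp add: inner_3 cross3_def power2_eq_square algebra_simps)

lemma gam_skew: "gam u v \<bullet> w = - (v \<bullet> gam u w)"
  by (simp add: inner_3)

lemma gam_self: "gam u v \<bullet> v = 0"
  by (simp add: inner_3)

lemma gam_scaleR: "gam (c *\<^sub>R u) v = c *\<^sub>R gam u v" "gam u (c *\<^sub>R v) = c *\<^sub>R gam u v"
  by (simp_all add: vec_eq_iff forall_3)

lemma gam_add: "gam (u + v) w = gam u w + gam v w" "gam u (v + w) = gam u v + gam u w"
  by (simp_all add: vec_eq_iff forall_3 algebra_simps)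

section \<open>Covariant derivatives of the coordinate fields\<close>

definition dlam :: "2 \<Rightarrow> 2 \<Rightarrow> real \<Rightarrow> real \<Rightarrow> real \<Rightarrow> real" where
  "dlam i j \<alpha> s \<theta> = lam i \<alpha> s \<theta> * (if j = 1 then tanh s
     else cq \<alpha> s \<theta> * sin \<theta> * cos \<theta> / cp \<alpha> s \<theta>
       + (if i = 1 then 0 else cq \<alpha> s \<theta> * (1 + cp \<alpha> s \<theta>) * sin \<theta> * cos \<theta> / (cp \<alpha> s \<theta>)\<^sup>2))"

definition tang :: "2 \<Rightarrow> real \<Rightarrow> real \<Rightarrow> real \<Rightarrow> real^3" where
  "tang i \<alpha> s \<theta> = lam i \<alpha> s \<theta> *\<^sub>R tfr i \<alpha> s \<theta>"

definition tang' :: "2 \<Rightarrow> 2 \<Rightarrow> real \<Rightarrow> real \<Rightarrow> real \<Rightarrow> real^3" where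
  "tang' i j \<alpha> s \<theta> = lam i \<alpha> s \<theta> *\<^sub>R tfr' i j \<alpha> s \<theta> + dlam i j \<alpha> s \<theta> *\<^sub>R tfr i \<alpha> s \<theta>"

text \<open>The covariant derivative of the i-th coordinate field in the j-th coordinate direction,
  in frame components.\<close>

definition covd :: "2 \<Rightarrow> 2 \<Rightarrow> real \<Rightarrow> real \<Rightarrow> real \<Rightarrow> real^3" where
  "covd i j \<alpha> s \<theta> = tang' i j \<alpha> s \<theta> + gam (tang j \<alpha> s \<theta>) (tang i \<alpha> s \<theta>)"

definition nfr' :: "2 \<Rightarrow> real \<Rightarrow> real \<Rightarrow> real \<Rightarrow> real^3" where
  "nfr' j \<alpha> s \<theta> = cross3 (tfr 1 \<alpha> s \<theta>) (tfr' 2 j \<alpha> s \<theta>) + cross3 (tfr' 1 j \<alpha> s \<theta>) (tfr 2 \<alpha> s \<theta>)"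

context
  fixes \<alpha> :: real
  assumes \<alpha>: "0 < \<alpha>"
begin

lemma lam_pos: "0 < lam i \<alpha> s \<theta>"
  using cq_pos[OF \<alpha>, of s \<theta>] ck_pos[of \<alpha> s \<theta>] cp_ge1[of \<alpha> s \<theta>] by (auto simp: lam_def)

lemma lam_quot: "lam 1 \<alpha> s \<theta> = cp \<alpha> s \<theta> * lam 2 \<alpha> s \<theta>"
  using atoms_nz(3)[OF \<alpha>, of s \<theta>] by (simp add: lam_def)

lemma tfr_orthonormal:
  "tfr i \<alpha> s \<theta> \<bullet> tfr j \<alpha> s \<theta> = (if i = j then 1 else 0)"
  "cross3 (tfr 1 \<alpha> s \<theta>) (tfr 2 \<alpha> s \<theta>) = nfr \<alpha> s \<theta>"
proof -
  interpret R: cat_rel "sin \<theta>" "cos \<theta>" "ck \<alpha> s \<theta>" "tanh s" "cB \<alpha>" "cp \<alpha> s \<theta>" "cq \<alpha> s \<theta>" "cd \<alpha> s \<theta>"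
    by (rule cat_rel[OF \<alpha>])
  have e: "tfr 1 \<alpha> s \<theta> = R.E1" "tfr 2 \<alpha> s \<theta> = R.E2" "nfr \<alpha> s \<theta> = R.nn"
    by (simp_all add: tfr_def nfr_def)
  show "cross3 (tfr 1 \<alpha> s \<theta>) (tfr 2 \<alpha> s \<theta>) = nfr \<alpha> s \<theta>" unfolding e by (rule R.E1_cross_E2)
  show "tfr i \<alpha> s \<theta> \<bullet> tfr j \<alpha> s \<theta> = (if i = j then 1 else 0)"
    using exhaust_2[of i] exhaust_2[of j] R.E1_E1 R.E2_E2 R.E1_E2
    by (auto simp: e inner_commute)
qed

lemma nfr_unit: "nfr \<alpha> s \<theta> \<bullet> nfr \<alpha> s \<theta> = 1" "nfr \<alpha> s \<theta> \<bullet> tfr i \<alpha> s \<theta> = 0" "tfr i \<alpha> s \<theta> \<bullet> nfr \<alpha> s \<theta> = 0"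
proof -
  show "nfr \<alpha> s \<theta> \<bullet> nfr \<alpha> s \<theta> = 1"
    unfolding tfr_orthonormal(2)[symmetric] cross_inner_self by (simp add: tfr_orthonormal(1))
  show "nfr \<alpha> s \<theta> \<bullet> tfr i \<alpha> s \<theta> = 0"
    using exhaust_2[of i] by (auto simp: tfr_orthonormal(2)[symmetric] dot_cross_self)
  then show "tfr i \<alpha> s \<theta> \<bullet> nfr \<alpha> s \<theta> = 0" by (simp add: inner_commute)
qed

lemma tfr_cross_nfr:
  "cross3 (tfr 2 \<alpha> s \<theta>) (nfr \<alpha> s \<theta>) = tfr 1 \<alpha> s \<theta>" "cross3 (nfr \<alpha> s \<theta>) (tfr 1 \<alpha> s \<theta>) = tfr 2 \<alpha> s \<theta>"
  unfolding tfr_orthonormal(2)[symmetric] Lagrange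
  using cross_skew[of "cross3 (tfr 1 \<alpha> s \<theta>) (tfr 2 \<alpha> s \<theta>)" "tfr 1 \<alpha> s \<theta>"]
  by (simp_all add: Lagrange tfr_orthonormal(1))

lemma has_pd_dlam: "has_pd UNIV j (lam i \<alpha>) (dlam i j \<alpha> s \<theta>) s \<theta>"
  using exhaust_2[of i] exhaust_2[of j] has_pd_lam(1)[OF \<alpha>, of i s \<theta>] has_pd_lam(2,3)[OF \<alpha>, of s \<theta>]
  by (auto simp: dlam_def)

lemma has_pd_tang: "has_pd UNIV j (tang i \<alpha>) (tang' i j \<alpha> s \<theta>) s \<theta>"
  unfolding tang_def tang'_def by (intro has_pd_scaleR has_pd_dlam has_pd_tfr[OF \<alpha>])

lemma has_pd_nfr: "has_pd UNIV j (nfr \<alpha>) (nfr' j \<alpha> s \<theta>) s \<theta>"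
proof -
  have "nfr \<alpha> = (\<lambda>s \<theta>. cross3 (tfr 1 \<alpha> s \<theta>) (tfr 2 \<alpha> s \<theta>))"
    by (intro ext) (simp add: tfr_orthonormal(2))
  then show ?thesis unfolding nfr'_def by (simp add: has_pd_cross3 has_pd_tfr[OF \<alpha>])
qed

lemma catenoid_tang: "has_pd UNIV i (catenoid \<alpha>) (frv (catenoid \<alpha> s \<theta> $ 2) (tang i \<alpha> s \<theta>)) s \<theta>"
  unfolding tang_def by (rule has_pd_catenoid[OF \<alpha>])

lemma catenoid_y_pos: "0 < catenoid \<alpha> s \<theta> $ 2"
  using cB_pos[OF \<alpha>] ck_pos[of \<alpha> s \<theta>] cd_pos[OF \<alpha>, of s \<theta>] by (simp add: catenoid_eq[OF \<alpha>])

lemma tfr_skew: "tfr i \<alpha> s \<theta> \<bullet> tfr' k j \<alpha> s \<theta> + tfr' i j \<alpha> s \<theta> \<bullet> tfr k \<alpha> s \<theta> = 0"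
proof -
  have "has_pd UNIV j (\<lambda>s \<theta>. tfr i \<alpha> s \<theta> \<bullet> tfr k \<alpha> s \<theta>)
     (tfr i \<alpha> s \<theta> \<bullet> tfr' k j \<alpha> s \<theta> + tfr' i j \<alpha> s \<theta> \<bullet> tfr k \<alpha> s \<theta>) s \<theta>"
    by (intro has_pd_inner has_pd_tfr[OF \<alpha>])
  moreover have "has_pd UNIV j (\<lambda>s \<theta>. tfr i \<alpha> s \<theta> \<bullet> tfr k \<alpha> s \<theta>) 0 s \<theta>"
    by (simp add: tfr_orthonormal(1) has_pd_const)
  ultimately show ?thesis by (rule has_pd_unique) simp
qed

lemma nfr_skew: "tfr i \<alpha> s \<theta> \<bullet> nfr' j \<alpha> s \<theta> = - (tfr' i j \<alpha> s \<theta> \<bullet> nfr \<alpha> s \<theta>)"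
  and nfr_nfr': "nfr \<alpha> s \<theta> \<bullet> nfr' j \<alpha> s \<theta> = 0"
proof -
  have "has_pd UNIV j (\<lambda>s \<theta>. tfr i \<alpha> s \<theta> \<bullet> nfr \<alpha> s \<theta>)
     (tfr i \<alpha> s \<theta> \<bullet> nfr' j \<alpha> s \<theta> + tfr' i j \<alpha> s \<theta> \<bullet> nfr \<alpha> s \<theta>) s \<theta>"
    by (intro has_pd_inner has_pd_tfr[OF \<alpha>] has_pd_nfr)
  moreover have "has_pd UNIV j (\<lambda>s \<theta>. tfr i \<alpha> s \<theta> \<bullet> nfr \<alpha> s \<theta>) 0 s \<theta>"
    by (simp add: nfr_unit has_pd_const)
  ultimately have "tfr i \<alpha> s \<theta> \<bullet> nfr' j \<alpha> s \<theta> + tfr' i j \<alpha> s \<theta> \<bullet> nfr \<alpha> s \<theta> = 0"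
    by (rule has_pd_unique) simp
  then show "tfr i \<alpha> s \<theta> \<bullet> nfr' j \<alpha> s \<theta> = - (tfr' i j \<alpha> s \<theta> \<bullet> nfr \<alpha> s \<theta>)" by simp
  have "has_pd UNIV j (\<lambda>s \<theta>. nfr \<alpha> s \<theta> \<bullet> nfr \<alpha> s \<theta>)
     (nfr \<alpha> s \<theta> \<bullet> nfr' j \<alpha> s \<theta> + nfr' j \<alpha> s \<theta> \<bullet> nfr \<alpha> s \<theta>) s \<theta>"
    by (intro has_pd_inner has_pd_nfr)
  moreover have "has_pd UNIV j (\<lambda>s \<theta>. nfr \<alpha> s \<theta> \<bullet> nfr \<alpha> s \<theta>) 0 s \<theta>"
    by (simp add: nfr_unit has_pd_const)
  ultimately have "nfr \<alpha> s \<theta> \<bullet> nfr' j \<alpha> s \<theta> + nfr' j \<alpha> s \<theta> \<bullet> nfr \<alpha> s \<theta> = 0"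
    by (rule has_pd_unique) simp
  then show "nfr \<alpha> s \<theta> \<bullet> nfr' j \<alpha> s \<theta> = 0" by (simp add: inner_commute)
qed

text \<open>The torsion identities multiplied back by the length. The symmetry also gives access to
  the tangential parts of \<open>covd 1 1\<close> and \<open>covd 2 2\<close>.\<close>

lemma covd_sym: "covd 1 2 \<alpha> s \<theta> = covd 2 1 \<alpha> s \<theta>"
proof -
  interpret R: cat_rel "sin \<theta>" "cos \<theta>" "ck \<alpha> s \<theta>" "tanh s" "cB \<alpha>" "cp \<alpha> s \<theta>" "cq \<alpha> s \<theta>" "cd \<alpha> s \<theta>"
    by (rule cat_rel[OF \<alpha>])
  have e: "tfr 1 \<alpha> s \<theta> = R.E1" "tfr 2 \<alpha> s \<theta> = R.E2" "tfr' 1 2 \<alpha> s \<theta> = R.E1t" "tfr' 2 1 \<alpha> s \<theta> = R.E2s"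
    by (simp_all add: tfr_def tfr'_def)
  define l where "l = cq \<alpha> s \<theta> / ck \<alpha> s \<theta>"
  have l: "lam 1 \<alpha> s \<theta> = l" "lam 2 \<alpha> s \<theta> = l / cp \<alpha> s \<theta>" by (simp_all add: lam_def l_def)
  have l': "cq \<alpha> s \<theta> / (ck \<alpha> s \<theta> * cp \<alpha> s \<theta>) = l / cp \<alpha> s \<theta>" by (simp add: l_def)
  note t1 = arg_cong[OF R.torsion_1, of "\<lambda>z. l * z", unfolded l']
  note t2 = arg_cong[OF R.torsion_2, of "\<lambda>z. l * z"]
  note t3 = arg_cong[OF R.torsion_3, of "\<lambda>z. l * z"]
  show ?thesis
    unfolding covd_def tang'_def tang_def gam_scaleR dlam_def l e vec_eq_iff forall_3
    using t1 t2 t3 by (simp del: R.E_nth add: algebra_simps)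
qed

text \<open>Christoffel symbols of a metric that is diagonal in the coordinates. Orthonormality of
  the frame relates the product of \<nabla>_i X_i with E_k to that of \<nabla>_i X_k with E_i, up to
  sign and the ratio of lengths; by symmetry the latter is the derivative of a length.\<close>

lemma covd_inner:
  "covd i j \<alpha> s \<theta> \<bullet> tfr i \<alpha> s \<theta> = dlam i j \<alpha> s \<theta>"
  "covd 1 1 \<alpha> s \<theta> \<bullet> tfr 2 \<alpha> s \<theta> = - (dlam 1 2 \<alpha> s \<theta> * lam 1 \<alpha> s \<theta> / lam 2 \<alpha> s \<theta>)"
  "covd 2 2 \<alpha> s \<theta> \<bullet> tfr 1 \<alpha> s \<theta> = - (dlam 2 1 \<alpha> s \<theta> * lam 2 \<alpha> s \<theta> / lam 1 \<alpha> s \<theta>)"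
proof -
  have un: "tfr' i j \<alpha> s \<theta> \<bullet> tfr i \<alpha> s \<theta> = 0" for i j
    using tfr_skew[of i s \<theta> i j] by (simp add: inner_commute)
  show d: "covd i j \<alpha> s \<theta> \<bullet> tfr i \<alpha> s \<theta> = dlam i j \<alpha> s \<theta>" for i j
    unfolding covd_def tang'_def tang_def
    by (simp add: inner_add_left gam_scaleR gam_self un tfr_orthonormal(1))
  have "covd i i \<alpha> s \<theta> \<bullet> tfr k \<alpha> s \<theta> = - (lam i \<alpha> s \<theta> / lam k \<alpha> s \<theta> * (covd k i \<alpha> s \<theta> \<bullet> tfr i \<alpha> s \<theta>))"
    if "i \<noteq> k" for i k
  proof -
    let ?l = "lam i \<alpha> s \<theta>" and ?m = "lam k \<alpha> s \<theta>"
    let ?a = "tfr' i i \<alpha> s \<theta> \<bullet> tfr k \<alpha> s \<theta>"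
    let ?g = "gam (tfr i \<alpha> s \<theta>) (tfr i \<alpha> s \<theta>) \<bullet> tfr k \<alpha> s \<theta>"
    have 1: "covd i i \<alpha> s \<theta> \<bullet> tfr k \<alpha> s \<theta> = ?l * ?a + ?l\<^sup>2 * ?g"
      unfolding covd_def tang'_def tang_def using that
      by (simp add: inner_add_left gam_scaleR tfr_orthonormal(1) power2_eq_square)
    have "tfr' k i \<alpha> s \<theta> \<bullet> tfr i \<alpha> s \<theta> = - ?a"
      using tfr_skew[of k s \<theta> i i] by (simp add: inner_commute)
    moreover have "gam (tfr i \<alpha> s \<theta>) (tfr k \<alpha> s \<theta>) \<bullet> tfr i \<alpha> s \<theta> = - ?g"
      by (simp add: inner_3)
    ultimately have 2: "covd k i \<alpha> s \<theta> \<bullet> tfr i \<alpha> s \<theta> = - (?m * ?a) - ?l * ?m * ?g"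
      unfolding covd_def tang'_def tang_def using that
      by (simp add: inner_add_left gam_scaleR tfr_orthonormal(1))
    have "?m \<noteq> 0" using lam_pos[of k s \<theta>] by simp
    then show ?thesis unfolding 1 2 by (simp add: power2_eq_square field_simps)
  qed
  from this[of 1 2] this[of 2 1] d[of 1 2] d[of 2 1] covd_sym
  show "covd 1 1 \<alpha> s \<theta> \<bullet> tfr 2 \<alpha> s \<theta> = - (dlam 1 2 \<alpha> s \<theta> * lam 1 \<alpha> s \<theta> / lam 2 \<alpha> s \<theta>)"
    "covd 2 2 \<alpha> s \<theta> \<bullet> tfr 1 \<alpha> s \<theta> = - (dlam 2 1 \<alpha> s \<theta> * lam 2 \<alpha> s \<theta> / lam 1 \<alpha> s \<theta>)"
    by simp_all
qed

lemma catenoid_H: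
  "(lam 2 \<alpha> s \<theta>)\<^sup>2 * (covd 1 1 \<alpha> s \<theta> \<bullet> nfr \<alpha> s \<theta>) + (lam 1 \<alpha> s \<theta>)\<^sup>2 * (covd 2 2 \<alpha> s \<theta> \<bullet> nfr \<alpha> s \<theta>)
   = (lam 1 \<alpha> s \<theta>)\<^sup>2 * (lam 2 \<alpha> s \<theta>)\<^sup>2"
proof -
  interpret R: cat_rel "sin \<theta>" "cos \<theta>" "ck \<alpha> s \<theta>" "tanh s" "cB \<alpha>" "cp \<alpha> s \<theta>" "cq \<alpha> s \<theta>" "cd \<alpha> s \<theta>"
    by (rule cat_rel[OF \<alpha>])
  have e: "tfr 1 \<alpha> s \<theta> = R.E1" "tfr 2 \<alpha> s \<theta> = R.E2" "tfr' 1 1 \<alpha> s \<theta> = R.E1s" "tfr' 2 2 \<alpha> s \<theta> = R.E2t"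
     "nfr \<alpha> s \<theta> = R.nn"
    by (simp_all add: tfr_def tfr'_def nfr_def)
  let ?l = "lam 1 \<alpha> s \<theta>" and ?m = "lam 2 \<alpha> s \<theta>"
  have c: "covd i i \<alpha> s \<theta> \<bullet> nfr \<alpha> s \<theta> = lam i \<alpha> s \<theta> * (tfr' i i \<alpha> s \<theta> \<bullet> nfr \<alpha> s \<theta>)
     + (lam i \<alpha> s \<theta>)\<^sup>2 * (tfr i \<alpha> s \<theta> $ 1 * (tfr i \<alpha> s \<theta> $ 1 * nfr \<alpha> s \<theta> $ 2 - tfr i \<alpha> s \<theta> $ 2 * nfr \<alpha> s \<theta> $ 1))" for i
  proof -
    have "gam u u \<bullet> v = u $ 1 * (u $ 1 * v $ 2 - u $ 2 * v $ 1)" for u v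
      by (simp add: inner_3 algebra_simps)
    then show ?thesis
      unfolding covd_def tang'_def tang_def
      by (simp add: inner_add_left gam_scaleR nfr_unit power2_eq_square)
  qed
  have 1: "ck \<alpha> s \<theta> / cq \<alpha> s \<theta> = 1 / ?l" "cp \<alpha> s \<theta> * ck \<alpha> s \<theta> / cq \<alpha> s \<theta> = 1 / ?m"
    by (simp_all add: lam_def)
  have "1 / ?l * a + b + 1 / ?m * a' + b' = 1 \<Longrightarrow>
     ?m\<^sup>2 * (?l * a + ?l\<^sup>2 * b) + ?l\<^sup>2 * (?m * a' + ?m\<^sup>2 * b') = ?l\<^sup>2 * ?m\<^sup>2" for a b a' b'
  proof -
    assume "1 / ?l * a + b + 1 / ?m * a' + b' = 1"
    then have "?l\<^sup>2 * ?m\<^sup>2 * (1 / ?l * a + b + 1 / ?m * a' + b') = ?l\<^sup>2 * ?m\<^sup>2" by simp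
    then show ?thesis using lam_pos[of 1 s \<theta>] lam_pos[of 2 s \<theta>]
      by (simp add: power2_eq_square algebra_simps)
  qed
  from this[OF R.mean_curvature_identity[unfolded 1]]
  show ?thesis unfolding c unfolding e .
qed

lemma tang_inner: "tang i \<alpha> s \<theta> \<bullet> tang j \<alpha> s \<theta> = (if i = j then (lam i \<alpha> s \<theta>)\<^sup>2 else 0)"
  by (simp add: tang_def tfr_orthonormal(1) power2_eq_square)

lemma tang_cross: "cross3 (tang 1 \<alpha> s \<theta>) (tang 2 \<alpha> s \<theta>) = (lam 1 \<alpha> s \<theta> * lam 2 \<alpha> s \<theta>) *\<^sub>R nfr \<alpha> s \<theta>"
  by (simp add: tang_def cross_mult_left cross_mult_right tfr_orthonormal(2))

text \<open>Weingarten's equation, from differentiating the orthogonality of frame and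
  normal.\<close>

lemma tang_dn: "tang i \<alpha> s \<theta> \<bullet> (nfr' j \<alpha> s \<theta> + gam (tang j \<alpha> s \<theta>) (nfr \<alpha> s \<theta>)) = - (covd i j \<alpha> s \<theta> \<bullet> nfr \<alpha> s \<theta>)"
  unfolding covd_def tang'_def tang_def inner_add_left inner_add_right gam_scaleR
  using nfr_skew[of i s \<theta> j] gam_skew[of "tfr j \<alpha> s \<theta>" "tfr i \<alpha> s \<theta>" "nfr \<alpha> s \<theta>"]
  by (simp add: nfr_unit)

context
  fixes I :: "real set" and s \<theta> :: real and \<sigma> :: real and n :: "real \<Rightarrow> real \<Rightarrow> real^3"
  assumes s: "s \<in> I" "at s within I \<noteq> bot"
    and n: "\<And>s \<theta>. s \<in> I \<Longrightarrow> n s \<theta> = frv (catenoid \<alpha> s \<theta> $ 2) (\<sigma> *\<^sub>R nfr \<alpha> s \<theta>)"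
begin

text \<open>The factor \<sigma> is left open because the trace then equals \<sigma>; this is what
  decides the orientation of the normal.\<close>

lemma catenoid_forms:
  "first_form I (catenoid \<alpha>) s \<theta> = (\<chi> i j. if i = j then (lam i \<alpha> s \<theta>)\<^sup>2 else 0)"
  "second_form I (catenoid \<alpha>) n s \<theta> = (\<chi> i j. \<sigma> * (covd i j \<alpha> s \<theta> \<bullet> nfr \<alpha> s \<theta>))"
  "trace (shape_operator I (catenoid \<alpha>) n s \<theta>) = \<sigma>"
proof -
  have y: "catenoid \<alpha> s \<theta> $ 2 \<noteq> 0" for s \<theta> using catenoid_y_pos[of s \<theta>] by simp
  have A: "has_pd I i (catenoid \<alpha>) (frv (catenoid \<alpha> s \<theta> $ 2) (tang i \<alpha> s \<theta>)) s \<theta>" for i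
    by (rule has_pd_subset[OF catenoid_tang]) simp
  have N: "has_pd I j (\<lambda>s \<theta>. \<sigma> *\<^sub>R nfr \<alpha> s \<theta>) (\<sigma> *\<^sub>R nfr' j \<alpha> s \<theta>) s \<theta>" for j
    by (rule has_pd_eq[OF has_pd_scaleR[OF has_pd_const has_pd_subset[OF has_pd_nfr]]]) simp_all
  have D: "cov_deriv I (catenoid \<alpha>) j n s \<theta>
      = frv (catenoid \<alpha> s \<theta> $ 2) (\<sigma> *\<^sub>R (nfr' j \<alpha> s \<theta> + gam (tang j \<alpha> s \<theta>) (nfr \<alpha> s \<theta>)))" for j
    using cov_deriv_frv[OF y s A n N] by (simp add: gam_scaleR scaleR_add_right)
  have nz: "cross3 (tang 1 \<alpha> s \<theta>) (tang 2 \<alpha> s \<theta>) \<noteq> 0"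
    using lam_pos[of 1 s \<theta>] lam_pos[of 2 s \<theta>] nfr_unit(1)[of s \<theta>] by (auto simp: tang_cross)
  note t = trace_shape[OF y s(2) A D nz]
  show "first_form I (catenoid \<alpha>) s \<theta> = (\<chi> i j. if i = j then (lam i \<alpha> s \<theta>)\<^sup>2 else 0)"
    unfolding t(2) by (simp add: tang_inner)
  show "second_form I (catenoid \<alpha>) n s \<theta> = (\<chi> i j. \<sigma> * (covd i j \<alpha> s \<theta> \<bullet> nfr \<alpha> s \<theta>))"
    unfolding t(3) inner_scaleR_right tang_dn by simp
  have l: "0 < (lam 1 \<alpha> s \<theta>)\<^sup>2 * (lam 2 \<alpha> s \<theta>)\<^sup>2"
    using lam_pos[of 1 s \<theta>] lam_pos[of 2 s \<theta>] by simp
  have "trace (shape_operator I (catenoid \<alpha>) n s \<theta>)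
     = \<sigma> * ((lam 2 \<alpha> s \<theta>)\<^sup>2 * (covd 1 1 \<alpha> s \<theta> \<bullet> nfr \<alpha> s \<theta>) + (lam 1 \<alpha> s \<theta>)\<^sup>2 * (covd 2 2 \<alpha> s \<theta> \<bullet> nfr \<alpha> s \<theta>))
        / ((lam 1 \<alpha> s \<theta>)\<^sup>2 * (lam 2 \<alpha> s \<theta>)\<^sup>2)"
    unfolding t(1) inner_scaleR_right tang_dn tang_inner tang_cross
    by (simp add: nfr_unit power2_eq_square algebra_simps)
  then show "trace (shape_operator I (catenoid \<alpha>) n s \<theta>) = \<sigma>"
    unfolding catenoid_H using l by (metis nonzero_mult_div_cancel_right less_irrefl)
qed

end

lemma nfr_continuous: "continuous_on UNIV (\<lambda>(s, \<theta>). nfr \<alpha> s \<theta>)"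
  and catenoid_continuous: "continuous_on UNIV (\<lambda>(s, \<theta>). catenoid \<alpha> s \<theta>)"
proof -
  have nz: "1 + cp \<alpha> s \<theta> \<noteq> 0" for s \<theta> using cp_ge1[of \<alpha> s \<theta>] by linarith
  have p: "continuous_on UNIV (\<lambda>z. cp \<alpha> (fst z) (snd z))"
    unfolding cp_def using \<alpha> by (intro continuous_intros) auto
  have q: "continuous_on UNIV (\<lambda>z. cq \<alpha> (fst z) (snd z))"
    unfolding cq_def using \<alpha> nz by (intro continuous_intros p) auto
  have t: "continuous_on UNIV (\<lambda>z::real \<times> real. tanh (fst z))"
    using cosh_real_pos by (intro continuous_intros) (auto simp: less_imp_neq[THEN not_sym])
  have d: "continuous_on UNIV (\<lambda>z. cd \<alpha> (fst z) (snd z))"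
    unfolding cd_def by (intro continuous_intros q t)
  have k: "continuous_on UNIV (\<lambda>z. ck \<alpha> (fst z) (snd z))"
    unfolding ck_def using cosh_real_pos by (intro continuous_intros) (auto simp: less_imp_neq[THEN not_sym])
  interpret R: cat_rel "sin \<theta>" "cos \<theta>" "ck \<alpha> s \<theta>" "tanh s" "cB \<alpha>" "cp \<alpha> s \<theta>" "cq \<alpha> s \<theta>" "cd \<alpha> s \<theta>" for s \<theta>
    by (rule cat_rel[OF \<alpha>])
  have vec: "continuous_on UNIV f" if "\<And>k. continuous_on UNIV (\<lambda>z. f z $ k)" for f :: "real \<times> real \<Rightarrow> real^3"
    using continuous_on_vec_lambda[of UNIV "\<lambda>k z. f z $ k"] that by simp
  show "continuous_on UNIV (\<lambda>(s, \<theta>). nfr \<alpha> s \<theta>)"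
    unfolding case_prod_beta
  proof (rule vec)
    have "\<forall>k. continuous_on UNIV (\<lambda>z. nfr \<alpha> (fst z) (snd z) $ k)"
      unfolding forall_3 nfr_def R.E_nth using atoms_nz[OF \<alpha>]
      by (intro conjI continuous_intros p q t d k) auto
    then show "continuous_on UNIV (\<lambda>z. nfr \<alpha> (fst z) (snd z) $ k)" for k by blast
  qed
  show "continuous_on UNIV (\<lambda>(s, \<theta>). catenoid \<alpha> s \<theta>)"
    unfolding case_prod_beta
  proof (rule vec)
    have "\<forall>k. continuous_on UNIV (\<lambda>z. catenoid \<alpha> (fst z) (snd z) $ k)"
      unfolding forall_3 catenoid_eq[OF \<alpha>] vector_3 using atoms_nz[OF \<alpha>]
      by (intro conjI continuous_intros p q t d k) auto
    then show "continuous_on UNIV (\<lambda>z. catenoid \<alpha> (fst z) (snd z) $ k)" for k by blast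
  qed
qed

end

section \<open>Uniqueness of the unit normal of the catenoid\<close>

lemma unit_normal_frame:
  fixes a b N M :: "real^3"
  assumes "N \<bullet> N = 1" "M \<bullet> M = 1" "N \<bullet> a = 0" "N \<bullet> b = 0" "M \<bullet> a = 0" "M \<bullet> b = 0" "cross3 a b \<noteq> 0"
  shows "M = N \<or> M = - N"
proof -
  have "\<exists>x. cross3 a b = x *\<^sub>R v" if "v \<bullet> v = 1" "v \<bullet> a = 0" "v \<bullet> b = 0" for v
  proof -
    \<comment> \<open>Lagrange's formula expands the double cross product into terms with v
      \<bullet> a and v \<bullet> b, so v is parallel to the cross product of a and b.\<close>
    have "cross3 v (cross3 a b) = 0" unfolding Lagrange using that by simp
    then have "v = 0 \<or> cross3 a b = 0 \<or> (\<exists>x. cross3 a b = x *\<^sub>R v)"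
      unfolding cross_eq_0 collinear_lemma .
    then show ?thesis using that(1) assms(7) by auto
  qed
  then obtain x y where c: "cross3 a b = x *\<^sub>R M" "cross3 a b = y *\<^sub>R N" using assms by metis
  then have "x \<noteq> 0" using assms(7) by auto
  then have "M = (y / x) *\<^sub>R N"
    using c by (metis divide_inverse_commute left_inverse scaleR_one scaleR_scaleR)
  then obtain k where M: "M = k *\<^sub>R N" by blast
  then have "k\<^sup>2 = 1" using assms(1,2) by (simp add: power2_eq_square)
  then have "k = 1 \<or> k = - 1" by (simp only: power2_eq_1_iff)
  then show ?thesis unfolding M by auto
qed

lemma sign_constant:
  fixes g :: "'a::topological_space \<Rightarrow> real"
  assumes "continuous_on S g" "connected S" "\<And>x. x \<in> S \<Longrightarrow> g x = 1 \<or> g x = - 1" "a \<in> S" "b \<in> S"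
  shows "g a = g b"
proof -
  have "connected (g ` S)" by (rule connected_continuous_image[OF assms(1,2)])
  moreover have "finite (g ` S)" by (rule finite_subset[of _ "{1, - 1}"]) (use assms(3) in auto)
  ultimately show ?thesis using connected_finite_iff_sing assms(4,5) by (metis empty_iff imageI singletonD)
qed

text \<open>A competing normal is \<open>nfr\<close> up to a sign at each point. The sign is
  continuous on the connected parameter plane, hence constant, and the condition on the trace makes
  it 1.\<close>

lemma cat_normal_eq:
  assumes \<alpha>: "0 < \<alpha>"
  shows "cat_normal \<alpha> s \<theta> = frv (catenoid \<alpha> s \<theta> $ 2) (nfr \<alpha> s \<theta>)"
proof -
  let ?y = "\<lambda>s \<theta>. catenoid \<alpha> s \<theta> $ 2"
  let ?n = "\<lambda>s \<theta>. frv (?y s \<theta>) (nfr \<alpha> s \<theta>)"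
  let ?P = "\<lambda>n. continuous_on UNIV (\<lambda>(s, \<theta>). n s \<theta>) \<and> unit_normal UNIV (catenoid \<alpha>) n \<and>
      (\<forall>s \<theta>. trace (shape_operator UNIV (catenoid \<alpha>) n s \<theta>) = 1)"
  have y: "?y s \<theta> \<noteq> 0" for s \<theta> using catenoid_y_pos[OF \<alpha>, of s \<theta>] by simp
  have pd: "pd UNIV i (catenoid \<alpha>) s \<theta> = frv (?y s \<theta>) (tang i \<alpha> s \<theta>)" for i s \<theta>
    by (rule pd_eq[OF catenoid_tang[OF \<alpha>]]) simp
  note fr = gprod_frv[OF y]
  have nc: "continuous_on UNIV (\<lambda>z. nfr \<alpha> (fst z) (snd z))" "continuous_on UNIV (\<lambda>z. catenoid \<alpha> (fst z) (snd z))"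
    using nfr_continuous[OF \<alpha>] catenoid_continuous[OF \<alpha>] by (simp_all add: case_prod_beta)
  have 1: "?P ?n"
  proof (intro conjI allI)
    have "\<forall>k. continuous_on UNIV (\<lambda>z. ?n (fst z) (snd z) $ k)"
      unfolding forall_3 frv_nth by (intro conjI continuous_intros nc)
    then show "continuous_on UNIV (\<lambda>(s, \<theta>). ?n s \<theta>)"
      using continuous_on_vec_lambda[of UNIV "\<lambda>k z. ?n (fst z) (snd z) $ k"] by (simp add: case_prod_beta)
    show "unit_normal UNIV (catenoid \<alpha>) ?n"
      unfolding unit_normal_def pd fr by (simp add: nfr_unit[OF \<alpha>] tang_def)
    show "trace (shape_operator UNIV (catenoid \<alpha>) ?n s \<theta>) = 1" for s \<theta>
      using catenoid_forms(3)[OF \<alpha>, of s UNIV ?n 1 \<theta>] by simp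
  qed
  have 2: "n = ?n" if n: "?P n" for n
  proof -
    have "\<exists>m. n s \<theta> = frv (?y s \<theta>) m" for s \<theta> by (rule frv_surj[OF y]) blast
    then obtain m where m: "\<And>s \<theta>. n s \<theta> = frv (?y s \<theta>) (m s \<theta>)" by metis
    have mm: "m s \<theta> = nfr \<alpha> s \<theta> \<or> m s \<theta> = - nfr \<alpha> s \<theta>" for s \<theta>
    proof (rule unit_normal_frame[of _ _ "tang 1 \<alpha> s \<theta>" "tang 2 \<alpha> s \<theta>"])
      have "unit_normal UNIV (catenoid \<alpha>) n" using n by blast
      then show "m s \<theta> \<bullet> m s \<theta> = 1" "m s \<theta> \<bullet> tang 1 \<alpha> s \<theta> = 0" "m s \<theta> \<bullet> tang 2 \<alpha> s \<theta> = 0"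
        unfolding unit_normal_def pd m fr by auto
      show "cross3 (tang 1 \<alpha> s \<theta>) (tang 2 \<alpha> s \<theta>) \<noteq> 0"
        using lam_pos[OF \<alpha>, of 1 s \<theta>] lam_pos[OF \<alpha>, of 2 s \<theta>] nfr_unit(1)[OF \<alpha>, of s \<theta>]
        by (auto simp: tang_cross[OF \<alpha>])
    qed (simp_all add: nfr_unit[OF \<alpha>] tang_def)
    \<comment> \<open>The sign written as a product in the metric: in this form its continuity
      follows from that of n, while the frame components m were merely chosen pointwise.\<close>
    let ?g = "\<lambda>z. gprod (catenoid \<alpha> (fst z) (snd z)) (n (fst z) (snd z)) (?n (fst z) (snd z))"
    have g: "?g z = m (fst z) (snd z) \<bullet> nfr \<alpha> (fst z) (snd z)" for z unfolding m fr ..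
    have nc': "continuous_on UNIV (\<lambda>z. n (fst z) (snd z))" using n by (simp add: case_prod_beta)
    have "continuous_on UNIV ?g"
      unfolding gprod_eq frv_nth using y by (intro continuous_intros nc nc') auto
    moreover have pm: "?g z = 1 \<or> ?g z = - 1" for z
      unfolding g using mm[of "fst z" "snd z"] nfr_unit(1)[OF \<alpha>] by auto
    ultimately have const: "?g z = ?g w" for z w
      using sign_constant[of UNIV ?g z w] by (simp only: UNIV_I connected_UNIV simp_thms)
    define \<sigma> where "\<sigma> = ?g (0, 0)"
    have "m s \<theta> = \<sigma> *\<^sub>R nfr \<alpha> s \<theta>" for s \<theta>
    proof -
      have "\<sigma> = m s \<theta> \<bullet> nfr \<alpha> s \<theta>" using const[of "(0, 0)" "(s, \<theta>)"] unfolding \<sigma>_def g by simp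
      then show ?thesis using mm[of s \<theta>] nfr_unit(1)[OF \<alpha>, of s \<theta>] by auto
    qed
    then have ns: "n s \<theta> = frv (?y s \<theta>) (\<sigma> *\<^sub>R nfr \<alpha> s \<theta>)" for s \<theta> by (simp add: m)
    have "trace (shape_operator UNIV (catenoid \<alpha>) n 0 0) = \<sigma>"
      by (rule catenoid_forms(3)[OF \<alpha>]) (simp_all add: ns)
    then have "\<sigma> = 1" using n by simp
    then show ?thesis by (intro ext) (simp add: ns)
  qed
  have "cat_normal \<alpha> = ?n" unfolding cat_normal_def by (rule the_equality[of ?P, OF 1 2])
  then show ?thesis by simp
qed

section \<open>The three terms of the Jacobi operator on the catenoid\<close>

lemma catenoid_sqnorm:
  assumes \<alpha>: "0 < \<alpha>" and s: "S \<le> s"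
  shows "second_form_sqnorm {S..} (catenoid \<alpha>) (cat_normal \<alpha>) s \<theta>
    = (covd 1 1 \<alpha> s \<theta> \<bullet> nfr \<alpha> s \<theta>)\<^sup>2 / (lam 1 \<alpha> s \<theta>) ^ 4
    + 2 * (covd 1 2 \<alpha> s \<theta> \<bullet> nfr \<alpha> s \<theta>)\<^sup>2 / ((lam 1 \<alpha> s \<theta>)\<^sup>2 * (lam 2 \<alpha> s \<theta>)\<^sup>2)
    + (covd 2 2 \<alpha> s \<theta> \<bullet> nfr \<alpha> s \<theta>)\<^sup>2 / (lam 2 \<alpha> s \<theta>) ^ 4"
proof -
  have n: "cat_normal \<alpha> s \<theta> = frv (catenoid \<alpha> s \<theta> $ 2) (1 *\<^sub>R nfr \<alpha> s \<theta>)" for s \<theta>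
    using cat_normal_eq[OF \<alpha>] by simp
  have s': "s \<in> {S..}" "at s within {S..} \<noteq> bot" using s at_within_atLeast_neq_bot by auto
  note f = catenoid_forms[where n = "cat_normal \<alpha>" and \<sigma> = 1, OF \<alpha> s' n]
  let ?g = "(\<chi> i j. if i = j then (lam i \<alpha> s \<theta>)\<^sup>2 else 0) :: real^2^2"
  have l: "lam 1 \<alpha> s \<theta> \<noteq> 0" "lam 2 \<alpha> s \<theta> \<noteq> 0"
    using lam_pos[OF \<alpha>, of 1 s \<theta>] lam_pos[OF \<alpha>, of 2 s \<theta>] by auto
  have inv: "matrix_inv ?g = (\<chi> i j. if i = j then inverse ((lam i \<alpha> s \<theta>)\<^sup>2) else 0)"
    by (rule matrix_inv_eqI)
      (use l in \<open>simp add: matrix_matrix_mult_def mat_def vec_eq_iff sum_2 forall_2\<close>)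
  show ?thesis
    unfolding second_form_sqnorm_def Let_def f inv
    by (simp add: sum_2 covd_sym[OF \<alpha>, symmetric] divide_inverse power2_eq_square power4_eq_xxxx algebra_simps)
qed

lemma catenoid_ricci:
  assumes \<alpha>: "0 < \<alpha>"
  shows "ricci (catenoid \<alpha> s \<theta>) (cat_normal \<alpha> s \<theta>) (cat_normal \<alpha> s \<theta>)
    = - ((nfr \<alpha> s \<theta> $ 1)\<^sup>2 + (nfr \<alpha> s \<theta> $ 2)\<^sup>2)"
  using catenoid_y_pos[OF \<alpha>, of s \<theta>]
  by (simp add: ricci_eq cat_normal_eq[OF \<alpha>] power2_eq_square field_simps)

text \<open>In orthogonal coordinates the two fluxes carry only the ratios of the lengths, 1 / p and
  p. The lengths themselves survive in a single overall factor, and p does not depend on s.\<close>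

lemma catenoid_laplace:
  assumes \<alpha>: "0 < \<alpha>" and s: "S \<le> s"
    and w1: "\<And>i s \<theta>. S \<le> s \<Longrightarrow> has_pd {S..} i w (w1 i s \<theta>) s \<theta>"
    and w2: "\<And>i. has_pd {S..} i (w1 i) (w2 i) s \<theta>"
  shows "laplace_beltrami {S..} (catenoid \<alpha>) w s \<theta>
     = (w2 1 + (cp \<alpha> s \<theta>)\<^sup>2 * w2 2 - cq \<alpha> s \<theta> * (1 + cp \<alpha> s \<theta>) * sin \<theta> * cos \<theta> * w1 2 s \<theta>) / (lam 1 \<alpha> s \<theta>)\<^sup>2"
proof -
  have n: "cat_normal \<alpha> s \<theta> = frv (catenoid \<alpha> s \<theta> $ 2) (1 *\<^sub>R nfr \<alpha> s \<theta>)" for s \<theta>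
    using cat_normal_eq[OF \<alpha>] by simp
  have nb: "at s within {S..} \<noteq> bot" if "S \<le> s" for s using that at_within_atLeast_neq_bot by auto
  let ?l = "\<lambda>i s \<theta>. lam i \<alpha> s \<theta>"
  have f: "first_form {S..} (catenoid \<alpha>) s \<theta> = (\<chi> i j. if i = j then (?l i s \<theta>)\<^sup>2 else 0)"
    if "S \<le> s" for s \<theta>
    using catenoid_forms(1)[where n = "cat_normal \<alpha>" and \<sigma> = 1, OF \<alpha> _ nb[OF that] n] that by simp
  have pos: "0 < ?l i s \<theta>" for i s \<theta> by (rule lam_pos[OF \<alpha>])
  have inv: "matrix_inv ((\<chi> i j. if i = j then (?l i s \<theta>)\<^sup>2 else 0) :: real^2^2)
      = (\<chi> i j. if i = j then inverse ((?l i s \<theta>)\<^sup>2) else 0)" for s \<theta>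
    by (rule matrix_inv_eqI)
      (use pos[of 1 s \<theta>] pos[of 2 s \<theta>] in \<open>simp add: matrix_matrix_mult_def mat_def vec_eq_iff sum_2 forall_2\<close>)
  have dt: "sqrt (det ((\<chi> i j. if i = j then (?l i s \<theta>)\<^sup>2 else 0) :: real^2^2)) = ?l 1 s \<theta> * ?l 2 s \<theta>" for s \<theta>
    using pos[of 1 s \<theta>] pos[of 2 s \<theta>] by (simp add: det_2 real_sqrt_mult)
  let ?F = "\<lambda>i s \<theta>. sqrt (det (first_form {S..} (catenoid \<alpha>) s \<theta>)) *
        (\<Sum>j\<in>UNIV. matrix_inv (first_form {S..} (catenoid \<alpha>) s \<theta>) $ i $ j * pd {S..} j w s \<theta>)"
  have F: "?F i s \<theta> = ?l 1 s \<theta> * ?l 2 s \<theta> / (?l i s \<theta>)\<^sup>2 * w1 i s \<theta>" if "S \<le> s" for i s \<theta>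
    unfolding f[OF that] inv dt using pd_eq[OF w1[OF that] nb[OF that]] exhaust_2[of i]
    by (auto simp: sum_2 divide_inverse)
  have p: "cp \<alpha> s \<theta> \<noteq> 0" "?l 1 s \<theta> = cp \<alpha> s \<theta> * ?l 2 s \<theta>" for s \<theta>
    using atoms_nz(3)[OF \<alpha>] lam_quot[OF \<alpha>] by auto
  have F1: "inverse (cp \<alpha> s \<theta>) * w1 1 s \<theta> = ?F 1 s \<theta>" if "S \<le> s" for s \<theta>
    unfolding F[OF that] using p[of s \<theta>] pos[of 2 s \<theta>] by (simp add: field_simps power2_eq_square)
  have F2: "cp \<alpha> s \<theta> * w1 2 s \<theta> = ?F 2 s \<theta>" if "S \<le> s" for s \<theta>
    unfolding F[OF that] using p[of s \<theta>] pos[of 2 s \<theta>] by (simp add: field_simps power2_eq_square)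
  have "has_pd {S..} 1 (\<lambda>s \<theta>. inverse (cp \<alpha> s \<theta>) * w1 1 s \<theta>) (inverse (cp \<alpha> s \<theta>) * w2 1) s \<theta>"
    by (rule has_pd_eq[OF has_pd_mult[OF has_pd_subset[OF has_pd_inverse[OF has_pd_cp(1)[OF \<alpha>]]] w2]])
      (use p in auto)
  then have "has_pd {S..} 1 (?F 1) (inverse (cp \<alpha> s \<theta>) * w2 1) s \<theta>"
    by (rule has_pd_cong) (use s F1 in auto)
  then have 1: "pd {S..} 1 (?F 1) s \<theta> = inverse (cp \<alpha> s \<theta>) * w2 1"
    by (rule pd_eq) (rule nb[OF s])
  have "has_pd {S..} 2 (\<lambda>s \<theta>. cp \<alpha> s \<theta> * w1 2 s \<theta>)
     (- (cq \<alpha> s \<theta> * (1 + cp \<alpha> s \<theta>) * sin \<theta> * cos \<theta> / cp \<alpha> s \<theta>) * w1 2 s \<theta> + cp \<alpha> s \<theta> * w2 2) s \<theta>"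
    by (rule has_pd_mult[OF has_pd_subset[OF has_pd_cp(2)[OF \<alpha>]] w2]) simp
  then have "has_pd {S..} 2 (?F 2)
     (- (cq \<alpha> s \<theta> * (1 + cp \<alpha> s \<theta>) * sin \<theta> * cos \<theta> / cp \<alpha> s \<theta>) * w1 2 s \<theta> + cp \<alpha> s \<theta> * w2 2) s \<theta>"
    by (rule has_pd_cong) (use s F2 in auto)
  then have 2: "pd {S..} 2 (?F 2) s \<theta> =
     - (cq \<alpha> s \<theta> * (1 + cp \<alpha> s \<theta>) * sin \<theta> * cos \<theta> / cp \<alpha> s \<theta>) * w1 2 s \<theta> + cp \<alpha> s \<theta> * w2 2"
    by (rule pd_eq) (rule nb[OF s])
  show ?thesis
  proof -
    have "laplace_beltrami {S..} (catenoid \<alpha>) w s \<theta>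
        = (pd {S..} 1 (?F 1) s \<theta> + pd {S..} 2 (?F 2) s \<theta>) / sqrt (det (first_form {S..} (catenoid \<alpha>) s \<theta>))"
      by (simp only: laplace_beltrami_def sum_2)
    also have "\<dots> = (inverse (cp \<alpha> s \<theta>) * w2 1 +
        (- (cq \<alpha> s \<theta> * (1 + cp \<alpha> s \<theta>) * sin \<theta> * cos \<theta> / cp \<alpha> s \<theta>) * w1 2 s \<theta> + cp \<alpha> s \<theta> * w2 2))
         / (?l 1 s \<theta> * ?l 2 s \<theta>)"
      unfolding 1 2 f[OF s] dt ..
    also have "\<dots> = (w2 1 + (cp \<alpha> s \<theta>)\<^sup>2 * w2 2 - cq \<alpha> s \<theta> * (1 + cp \<alpha> s \<theta>) * sin \<theta> * cos \<theta> * w1 2 s \<theta>)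
        / (?l 1 s \<theta>)\<^sup>2"
      using p[of s \<theta>] pos[of 2 s \<theta>] by (simp add: field_simps power2_eq_square)
    finally show ?thesis .
  qed
qed

section \<open>Uniform smoothness of the coefficients\<close>

lemma bd_sin_cos: "bd n (\<lambda>\<alpha> s \<theta>. sin \<theta>)" "bd n (\<lambda>\<alpha> s \<theta>. cos \<theta>)"
proof -
  have 0: "bd 0 (\<lambda>\<alpha> s \<theta>. sin \<theta>)" "bd 0 (\<lambda>\<alpha> s \<theta>. cos \<theta>)"
    by (auto intro!: exI[of _ 1])
  have "bd n (\<lambda>\<alpha> s \<theta>. sin \<theta>) \<and> bd n (\<lambda>\<alpha> s \<theta>. cos \<theta>)"
  proof (induction n)
    case (Suc n)
    let ?s' = "\<lambda>(i::2) \<alpha> s \<theta>. if i = 1 then 0 else cos \<theta>"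
    let ?c' = "\<lambda>(i::2) \<alpha> s \<theta>. if i = 1 then 0 else - sin \<theta>"
    have h: "bd n (?s' i)" "bd n (?c' i)" for i
      using Suc bd_const[of n 0] bd_minus[of n "\<lambda>\<alpha> s \<theta>. sin \<theta>"] by (cases "i = 1"; simp)+
    have h': "has_pd UNIV i (\<lambda>s \<theta>. sin \<theta>) (?s' i \<alpha> s \<theta>) s \<theta>"
      "has_pd UNIV i (\<lambda>s \<theta>. cos \<theta>) (?c' i \<alpha> s \<theta>) s \<theta>" for i s \<theta> and \<alpha> :: real
      using exhaust_2[of i] by (auto simp: has_pd_sin_cos)
    show ?case by (rule conjI[OF bd_SucI[OF 0(1) h'(1) h(1)] bd_SucI[OF 0(2) h'(2) h(2)]])
  qed (use 0 in auto)
  then show "bd n (\<lambda>\<alpha> s \<theta>. sin \<theta>)" "bd n (\<lambda>\<alpha> s \<theta>. cos \<theta>)" by auto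
qed

lemma ck_le1: "ck \<alpha> s \<theta> \<le> 1"
  by (simp add: ck_def cosh_real_ge_1 inverse_le_1_iff)

lemma bd_tanh_ck: "bd n (\<lambda>\<alpha> s \<theta>. tanh s)" "bd n ck"
proof -
  have "\<bar>tanh s\<bar> \<le> 1" for s :: real
    using tanh_real_gt_neg1[of s] tanh_real_lt_1[of s] by (auto simp: abs_le_iff)
  moreover have "\<bar>ck \<alpha> s \<theta>\<bar> \<le> 1" for \<alpha> s \<theta> using ck_pos[of \<alpha> s \<theta>] ck_le1[of \<alpha> s \<theta>] by simp
  ultimately have 0: "bd 0 (\<lambda>\<alpha> s \<theta>. tanh s)" "bd 0 ck"
    by (auto intro!: exI[of _ 1])
  have "bd n (\<lambda>\<alpha> s \<theta>. tanh s) \<and> bd n ck"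
  proof (induction n)
    case (Suc n)
    let ?s' = "\<lambda>(i::2) \<alpha> s \<theta>. if i = 1 then ck \<alpha> s \<theta> * ck \<alpha> s \<theta> else 0"
    let ?c' = "\<lambda>(i::2) \<alpha> s \<theta>. if i = 1 then - (ck \<alpha> s \<theta> * tanh s) else 0"
    have h: "bd n (?s' i)" "bd n (?c' i)" for i
      using Suc bd_const[of n 0] bd_mult[of n ck ck] bd_minus[OF bd_mult[of n ck "\<lambda>\<alpha> s \<theta>. tanh s"]]
      by (cases "i = 1"; simp)+
    have h': "has_pd UNIV i (\<lambda>s \<theta>. tanh s) (?s' i \<alpha> s \<theta>) s \<theta>"
      "has_pd UNIV i (ck \<alpha>) (?c' i \<alpha> s \<theta>) s \<theta>" for i s \<theta> \<alpha>
      using exhaust_2[of i] by (auto simp: has_pd_tanh[unfolded power2_eq_square] has_pd_ck)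
    show ?case by (rule conjI[OF bd_SucI[OF 0(1) h'(1) h(1)] bd_SucI[OF 0(2) h'(2) h(2)]])
  qed (use 0 in auto)
  then show "bd n (\<lambda>\<alpha> s \<theta>. tanh s)" "bd n ck" by auto
qed

lemma cat_eps_cB: "0 < \<alpha> \<Longrightarrow> cB \<alpha> = 1 + cat_eps \<alpha>"
  by (simp add: cB_def cat_eps_def)

lemma cat_eps_pos: "0 < \<alpha> \<Longrightarrow> 0 < cat_eps \<alpha>"
proof -
  assume \<alpha>: "0 < \<alpha>"
  have "1\<^sup>2 < (cB \<alpha>)\<^sup>2" using \<alpha> by (simp add: cB_sq)
  then have "1 < cB \<alpha>" by (rule power2_less_imp_less) (use cB_pos[OF \<alpha>] in simp)
  then show ?thesis using cat_eps_cB[OF \<alpha>] by simp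
qed

text \<open>From B = 1 + \<epsilon> < 3/2 and 1 / \<alpha>^2 = B^2 - 1; the last bound is \<epsilon>
  cosh s \<ge> 1 solved for \<open>ck\<close>.\<close>

lemma end_pt_param:
  assumes "end_pt \<alpha> s"
  shows "0 < 1 / \<alpha>\<^sup>2" "1 / \<alpha>\<^sup>2 \<le> 5 / 4" "1 \<le> cB \<alpha>" "cB \<alpha> \<le> 3 / 2" "ck \<alpha> s \<theta> \<le> cat_eps \<alpha>"
proof -
  have \<alpha>: "0 < \<alpha>" and e: "cat_eps \<alpha> < 1 / 2" and c: "1 \<le> cat_eps \<alpha> * cosh s"
    using assms by (auto simp: end_pt_def)
  show "0 < 1 / \<alpha>\<^sup>2" using \<alpha> by simp
  show B: "1 \<le> cB \<alpha>" "cB \<alpha> \<le> 3 / 2" using e cat_eps_pos[OF \<alpha>] cat_eps_cB[OF \<alpha>] by auto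
  then have "(cB \<alpha>)\<^sup>2 \<le> (3 / 2)\<^sup>2" by (intro power_mono) auto
  then show "1 / \<alpha>\<^sup>2 \<le> 5 / 4" unfolding cB_sq[OF \<alpha>] by (simp add: power2_eq_square)
  show "ck \<alpha> s \<theta> \<le> cat_eps \<alpha>"
    using c cosh_real_pos[of s] by (simp add: ck_def field_simps)
qed

lemma bd_params: "bd n (\<lambda>\<alpha> s \<theta>. 1 / \<alpha>\<^sup>2)" "bd n (\<lambda>\<alpha> s \<theta>. cB \<alpha>)" "bd n (\<lambda>\<alpha> s \<theta>. inverse (1 + cB \<alpha>))"
proof -
  have "\<bar>1 / \<alpha>\<^sup>2\<bar> \<le> 5 / 4" "\<bar>cB \<alpha>\<bar> \<le> 3 / 2" "\<bar>inverse (1 + cB \<alpha>)\<bar> \<le> 1" if "end_pt \<alpha> s" for \<alpha> s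
    using end_pt_param[OF that] by (auto simp: inverse_le_1_iff)
  then show "bd n (\<lambda>\<alpha> s \<theta>. 1 / \<alpha>\<^sup>2)" "bd n (\<lambda>\<alpha> s \<theta>. cB \<alpha>)" "bd n (\<lambda>\<alpha> s \<theta>. inverse (1 + cB \<alpha>))"
    using bd_param[of "\<lambda>\<alpha>. 1 / \<alpha>\<^sup>2" "5 / 4"] bd_param[of cB "3 / 2"] bd_param[of "\<lambda>\<alpha>. inverse (1 + cB \<alpha>)" 1]
    by blast+
qed

lemma bd_cp: "bd n cp" "bd n (\<lambda>\<alpha> s \<theta>. inverse (cp \<alpha> s \<theta>))"
proof -
  have "bd n (\<lambda>\<alpha> s \<theta>. sqrt (1 + cos \<theta> * cos \<theta> * (1 / \<alpha>\<^sup>2)))"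
    by (rule bd_sqrt[of _ _ 1]) (intro bd_add bd_mult bd_const bd_sin_cos bd_params, auto simp: add_pos_nonneg)
  then show p: "bd n cp" by (rule bd_cong) (simp add: cp_def power2_eq_square)
  have "1 \<le> \<bar>cp \<alpha> s \<theta>\<bar>" for \<alpha> s \<theta> using cp_ge1[of \<alpha> s \<theta>] by simp
  then show "bd n (\<lambda>\<alpha> s \<theta>. inverse (cp \<alpha> s \<theta>))"
    by (intro bd_inverse[OF p, of 1] atoms_nz) auto
qed

lemma bd_cq: "bd n cq"
proof -
  have nz: "1 \<le> 1 + cp \<alpha> s \<theta>" for \<alpha> s \<theta> using cp_ge1[of \<alpha> s \<theta>] by linarith
  have "bd n (\<lambda>\<alpha> s \<theta>. 1 / \<alpha>\<^sup>2 * inverse (1 + cp \<alpha> s \<theta>))"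
    by (intro bd_mult bd_params bd_inverse[of _ _ 1] bd_add bd_const bd_cp)
      (use nz in \<open>auto simp: less_imp_neq[THEN not_sym] less_le_trans[OF zero_less_one] intro: order_trans[OF _ abs_ge_self]\<close>)
  then show ?thesis by (rule bd_cong) (simp add: cq_def divide_inverse)
qed

lemma bd_cd: "bd n cd" "bd n (\<lambda>\<alpha> s \<theta>. inverse (cd \<alpha> s \<theta>))"
proof -
  have "bd n (\<lambda>\<alpha> s \<theta>. 1 + cq \<alpha> s \<theta> + cB \<alpha> * tanh s)"
    by (intro bd_add bd_mult bd_const bd_cq bd_params bd_tanh_ck)
  then show d: "bd n cd" by (rule bd_cong) (simp add: cd_def)
  \<comment> \<open>On the end tanh s > 0, so d exceeds 1 uniformly, which positivity of d alone
    would not give.\<close>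
  have "1 \<le> \<bar>cd \<alpha> s \<theta>\<bar>" if "end_pt \<alpha> s" for \<alpha> s \<theta>
  proof -
    have "0 < \<alpha>" "0 < s" using end_pt_pos[OF that] by auto
    then have "0 < cq \<alpha> s \<theta>" "0 < cB \<alpha> * tanh s" using cq_pos cB_pos by auto
    then show ?thesis by (simp add: cd_def)
  qed
  then show "bd n (\<lambda>\<alpha> s \<theta>. inverse (cd \<alpha> s \<theta>))"
    by (intro bd_inverse[OF d, of 1] atoms_nz) auto
qed

lemmas bd_atoms = bd_sin_cos bd_tanh_ck bd_params bd_cp bd_cq bd_cd bd_const

lemma bd_tfr: "bd n (\<lambda>\<alpha> s \<theta>. tfr i \<alpha> s \<theta> $ k)"
  and bd_nfr: "bd n (\<lambda>\<alpha> s \<theta>. nfr \<alpha> s \<theta> $ k)"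
proof -
  let ?E1 = "\<lambda>\<alpha> s \<theta>. vector [sin \<theta> * (1 - ck \<alpha> s \<theta> * ck \<alpha> s \<theta> * inverse (cd \<alpha> s \<theta>)),
       ck \<alpha> s \<theta> * (cB \<alpha> + cp \<alpha> s \<theta> * tanh s) * inverse (cd \<alpha> s \<theta>), cos \<theta> * tanh s] :: real^3"
  let ?E2 = "\<lambda>\<alpha> s \<theta>. vector [cos \<theta> * ((1 + cq \<alpha> s \<theta>) * tanh s + cB \<alpha>) * inverse (cd \<alpha> s \<theta>),
       - (sin \<theta> * cos \<theta> * cq \<alpha> s \<theta> * ck \<alpha> s \<theta> * inverse (cd \<alpha> s \<theta>)), - sin \<theta>] :: real^3"
  let ?N = "\<lambda>\<alpha> s \<theta>. vector [- (sin \<theta> * ck \<alpha> s \<theta> * (cB \<alpha> + tanh s) * inverse (cd \<alpha> s \<theta>)),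
       1 - cp \<alpha> s \<theta> * (ck \<alpha> s \<theta> * ck \<alpha> s \<theta>) * inverse (cd \<alpha> s \<theta>), - (cos \<theta> * ck \<alpha> s \<theta>)] :: real^3"
  have e: "?E1 \<alpha> s \<theta> = tfr 1 \<alpha> s \<theta>" "?E2 \<alpha> s \<theta> = tfr 2 \<alpha> s \<theta>" "?N \<alpha> s \<theta> = nfr \<alpha> s \<theta>"
    if "0 < \<alpha>" for \<alpha> s \<theta>
  proof -
    interpret R: cat_rel "sin \<theta>" "cos \<theta>" "ck \<alpha> s \<theta>" "tanh s" "cB \<alpha>" "cp \<alpha> s \<theta>" "cq \<alpha> s \<theta>" "cd \<alpha> s \<theta>"
      by (rule cat_rel[OF that])
    show "?E1 \<alpha> s \<theta> = tfr 1 \<alpha> s \<theta>" "?E2 \<alpha> s \<theta> = tfr 2 \<alpha> s \<theta>" "?N \<alpha> s \<theta> = nfr \<alpha> s \<theta>"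
      by (simp_all add: tfr_def nfr_def R.E1_def R.E2_def R.nn_def divide_inverse power2_eq_square)
  qed
  have "\<forall>k. bd n (\<lambda>\<alpha> s \<theta>. ?E1 \<alpha> s \<theta> $ k)"
    unfolding forall_3 vector_3 by (intro conjI bd_mult bd_add bd_diff bd_minus bd_atoms)
  then have 1: "bd n (\<lambda>\<alpha> s \<theta>. tfr 1 \<alpha> s \<theta> $ k)" for k
    using bd_cong[of n "\<lambda>\<alpha> s \<theta>. ?E1 \<alpha> s \<theta> $ k" "\<lambda>\<alpha> s \<theta>. tfr 1 \<alpha> s \<theta> $ k"] e(1) by simp
  have "\<forall>k. bd n (\<lambda>\<alpha> s \<theta>. ?E2 \<alpha> s \<theta> $ k)"
    unfolding forall_3 vector_3 by (intro conjI bd_mult bd_add bd_diff bd_minus bd_atoms)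
  then have 2: "bd n (\<lambda>\<alpha> s \<theta>. tfr 2 \<alpha> s \<theta> $ k)" for k
    using bd_cong[of n "\<lambda>\<alpha> s \<theta>. ?E2 \<alpha> s \<theta> $ k" "\<lambda>\<alpha> s \<theta>. tfr 2 \<alpha> s \<theta> $ k"] e(2) by simp
  show "bd n (\<lambda>\<alpha> s \<theta>. tfr i \<alpha> s \<theta> $ k)" using exhaust_2[of i] 1 2 by auto
  have "\<forall>k. bd n (\<lambda>\<alpha> s \<theta>. ?N \<alpha> s \<theta> $ k)"
    unfolding forall_3 vector_3 by (intro conjI bd_mult bd_add bd_diff bd_minus bd_atoms)
  then show "bd n (\<lambda>\<alpha> s \<theta>. nfr \<alpha> s \<theta> $ k)"
    using bd_cong[of n "\<lambda>\<alpha> s \<theta>. ?N \<alpha> s \<theta> $ k" "\<lambda>\<alpha> s \<theta>. nfr \<alpha> s \<theta> $ k"] e(3) by simp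
qed

definition ilam :: "real \<Rightarrow> real \<Rightarrow> real \<Rightarrow> real" where
  "ilam \<alpha> s \<theta> = inverse (lam 1 \<alpha> s \<theta>)"

text \<open>On the end \<open>ck \<le> cat_eps\<close>, whereas \<open>cq\<close> is comparable to \<open>cat_eps\<close>.\<close>

lemma bd_ilam: "bd n ilam"
proof -
  let ?K = "\<lambda>\<alpha> s \<theta>. ck \<alpha> s \<theta> * inverse (cat_eps \<alpha>)"
  have "\<bar>?K \<alpha> s \<theta>\<bar> \<le> 1" if "end_pt \<alpha> s" for \<alpha> s \<theta>
    using end_pt_param(5)[OF that, of \<theta>] ck_pos[of \<alpha> s \<theta>] by (simp add: field_simps)
  then have K0: "bd 0 ?K" by auto
  \<comment> \<open>The quotient solves K_s = - tanh s K and is independent of \<theta>, so its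
    bound at end points extends to all derivatives.\<close>
  have "bd n ?K"
  proof (rule bd_linear_ode[OF K0])
    let ?l = "\<lambda>(i::2) \<alpha> s \<theta>. if i = 1 then - tanh s else 0"
    show "bd n (?l i)" for i
      using bd_minus[OF bd_tanh_ck(1)] bd_const[of n 0] by (cases "i = 1") auto
    show "has_pd UNIV i (?K \<alpha>) (?l i \<alpha> s \<theta> * ?K \<alpha> s \<theta>) s \<theta>" for i \<alpha> s \<theta>
      using has_pd_mult[OF has_pd_ck(1)[where \<alpha> = \<alpha> and s = s and \<theta> = \<theta>] has_pd_const[where c = "inverse (cat_eps \<alpha>)"]]
        has_pd_mult[OF has_pd_ck(2)[where \<alpha> = \<alpha> and s = s and \<theta> = \<theta>] has_pd_const[where c = "inverse (cat_eps \<alpha>)"]]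
        exhaust_2[of i]
      by (auto simp: algebra_simps)
  qed
  then have "bd n (\<lambda>\<alpha> s \<theta>. ?K \<alpha> s \<theta> * ((1 + cp \<alpha> s \<theta>) * inverse (1 + cB \<alpha>)))"
    by (rule bd_mult) (intro bd_mult bd_add bd_atoms)
  then show ?thesis
  proof (rule bd_cong)
    fix \<alpha> s \<theta> :: real assume \<alpha>: "0 < \<alpha>"
    \<comment> \<open>Both sides equal B^2 - 1 = 1 / \<alpha>^2. This converts \<open>ck\<close> /
      \<epsilon> into \<open>ck / cq\<close>, the reciprocal of the length.\<close>
    have "cat_eps \<alpha> * (1 + cB \<alpha>) = cq \<alpha> s \<theta> * (1 + cp \<alpha> s \<theta>)"
      using cB_sq[OF \<alpha>] cat_eps_cB[OF \<alpha>] unfolding cq_nu[OF \<alpha>] by (simp add: power2_eq_square algebra_simps)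
    then have "inverse (cat_eps \<alpha>) * inverse (1 + cB \<alpha>) = inverse (cq \<alpha> s \<theta> * (1 + cp \<alpha> s \<theta>))"
      by (metis inverse_mult_distrib)
    then have "?K \<alpha> s \<theta> * ((1 + cp \<alpha> s \<theta>) * inverse (1 + cB \<alpha>))
        = ck \<alpha> s \<theta> * inverse (cq \<alpha> s \<theta>) * ((1 + cp \<alpha> s \<theta>) * inverse (1 + cp \<alpha> s \<theta>))"
      unfolding inverse_mult_distrib[of "cq \<alpha> s \<theta>"] by algebra
    moreover have "(1 + cp \<alpha> s \<theta>) * inverse (1 + cp \<alpha> s \<theta>) = 1"
      using cp_ge1[of \<alpha> s \<theta>] by (intro right_inverse) linarith
    ultimately show "?K \<alpha> s \<theta> * ((1 + cp \<alpha> s \<theta>) * inverse (1 + cB \<alpha>)) = ilam \<alpha> s \<theta>"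
      by (simp add: ilam_def lam_def divide_inverse)
  qed
qed

lemma bd_dlam: "bd n (\<lambda>\<alpha> s \<theta>. ilam \<alpha> s \<theta> * lam i \<alpha> s \<theta>)" "bd n (\<lambda>\<alpha> s \<theta>. ilam \<alpha> s \<theta> * dlam i j \<alpha> s \<theta>)"
proof -
  let ?r = "\<lambda>\<alpha> s \<theta>. if i = 1 then 1 else inverse (cp \<alpha> s \<theta>)"
  let ?m = "\<lambda>\<alpha> s \<theta>. if j = 1 then tanh s
     else cq \<alpha> s \<theta> * sin \<theta> * cos \<theta> * inverse (cp \<alpha> s \<theta>)
       + (if i = 1 then 0 else cq \<alpha> s \<theta> * (1 + cp \<alpha> s \<theta>) * sin \<theta> * cos \<theta> * (inverse (cp \<alpha> s \<theta>) * inverse (cp \<alpha> s \<theta>)))"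
  have r: "bd n ?r" using exhaust_2[of i] bd_const[of n 1] bd_cp(2)[of n] by auto
  have m: "bd n ?m"
    using exhaust_2[of i] exhaust_2[of j]
    by (auto intro!: bd_mult bd_add bd_atoms)
  have e: "ilam \<alpha> s \<theta> * lam i \<alpha> s \<theta> = ?r \<alpha> s \<theta>" if "0 < \<alpha>" for \<alpha> s \<theta>
  proof -
    have "ilam \<alpha> s \<theta> * lam 1 \<alpha> s \<theta> = 1" using lam_pos[OF that, of 1 s \<theta>] by (simp add: ilam_def)
    moreover have "lam 2 \<alpha> s \<theta> = lam 1 \<alpha> s \<theta> * inverse (cp \<alpha> s \<theta>)" by (simp add: lam_def divide_inverse)
    ultimately show ?thesis using exhaust_2[of i] by auto
  qed
  show "bd n (\<lambda>\<alpha> s \<theta>. ilam \<alpha> s \<theta> * lam i \<alpha> s \<theta>)" by (rule bd_cong[OF r]) (simp add: e)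
  have "bd n (\<lambda>\<alpha> s \<theta>. ?r \<alpha> s \<theta> * ?m \<alpha> s \<theta>)" by (rule bd_mult[OF r m])
  then show "bd n (\<lambda>\<alpha> s \<theta>. ilam \<alpha> s \<theta> * dlam i j \<alpha> s \<theta>)"
    by (rule bd_cong) (simp add: dlam_def e[symmetric] divide_inverse power2_eq_square)
qed

lemma bd_tfr': "bd n (\<lambda>\<alpha> s \<theta>. tfr' i j \<alpha> s \<theta> $ k)"
proof -
  note b = bd_pd(1)[OF bd_tfr[of "Suc n" i k], of j]
  have "tfr' i j \<alpha> s \<theta> $ k = pd UNIV j (\<lambda>s \<theta>. tfr i \<alpha> s \<theta> $ k) s \<theta>" if "0 < \<alpha>" for \<alpha> s \<theta>
    using pd_eq[OF has_pd_tfr[OF that, unfolded has_pd_vec, rule_format]] by simp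
  then show ?thesis by (intro bd_cong[OF b]) simp
qed

lemma bd_tang: "bd n (\<lambda>\<alpha> s \<theta>. ilam \<alpha> s \<theta> * tang i \<alpha> s \<theta> $ k)"
proof -
  have "bd n (\<lambda>\<alpha> s \<theta>. ilam \<alpha> s \<theta> * lam i \<alpha> s \<theta> * tfr i \<alpha> s \<theta> $ k)"
    by (intro bd_mult bd_dlam bd_tfr)
  then show ?thesis by (rule bd_cong) (simp add: tang_def)
qed

text \<open>One factor \<open>ilam\<close> compensates the length, the other is bounded by itself.
  The square is the weight of second derivatives under the scaling of \<open>twoH\<close>.\<close>

lemma bd_tang': "bd n (\<lambda>\<alpha> s \<theta>. (ilam \<alpha> s \<theta>)\<^sup>2 * tang' i j \<alpha> s \<theta> $ k)"
proof -
  have "bd n (\<lambda>\<alpha> s \<theta>. ilam \<alpha> s \<theta> * (ilam \<alpha> s \<theta> * lam i \<alpha> s \<theta> * tfr' i j \<alpha> s \<theta> $ k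
      + ilam \<alpha> s \<theta> * dlam i j \<alpha> s \<theta> * tfr i \<alpha> s \<theta> $ k))"
    by (intro bd_mult bd_add bd_dlam bd_tfr bd_tfr' bd_ilam)
  then show ?thesis by (rule bd_cong) (simp add: tang'_def power2_eq_square algebra_simps)
qed

text \<open>Length of the horizontal part of the unit normal. Since the vertical component is - cos
  \<theta> / cosh s, it can vanish only for s = 0.\<close>

definition hlen :: "real \<Rightarrow> real \<Rightarrow> real \<Rightarrow> real" where
  "hlen \<alpha> s \<theta> = sqrt (1 - (nfr \<alpha> s \<theta> $ 3)\<^sup>2)"

lemma hlen_sq_pos:
  assumes "0 < \<alpha>" "0 < s"
  shows "0 < 1 - (nfr \<alpha> s \<theta> $ 3)\<^sup>2" "end_pt \<alpha> s \<Longrightarrow> 3 / 4 \<le> 1 - (nfr \<alpha> s \<theta> $ 3)\<^sup>2"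
proof -
  interpret R: cat_rel "sin \<theta>" "cos \<theta>" "ck \<alpha> s \<theta>" "tanh s" "cB \<alpha>" "cp \<alpha> s \<theta>" "cq \<alpha> s \<theta>" "cd \<alpha> s \<theta>"
    by (rule cat_rel[OF assms(1)])
  have "(nfr \<alpha> s \<theta> $ 3)\<^sup>2 = (cos \<theta>)\<^sup>2 * (ck \<alpha> s \<theta>)\<^sup>2" by (simp add: nfr_def power_mult_distrib)
  also have "\<dots> \<le> 1 * (ck \<alpha> s \<theta>)\<^sup>2"
    by (intro mult_right_mono) (auto simp: abs_square_le_1)
  finally have n: "(nfr \<alpha> s \<theta> $ 3)\<^sup>2 \<le> (ck \<alpha> s \<theta>)\<^sup>2" by simp
  have "0 < tanh s" using assms by simp
  then have "(ck \<alpha> s \<theta>)\<^sup>2 < 1" unfolding ck_sq by simp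
  with n show "0 < 1 - (nfr \<alpha> s \<theta> $ 3)\<^sup>2" by linarith
  assume e: "end_pt \<alpha> s"
  have "ck \<alpha> s \<theta> \<le> 1 / 2" using end_pt_param(5)[OF e, of \<theta>] e by (auto simp: end_pt_def)
  then have "(ck \<alpha> s \<theta>)\<^sup>2 \<le> (1 / 2)\<^sup>2" using ck_pos[of \<alpha> s \<theta>] by (intro power_mono) auto
  with n show "3 / 4 \<le> 1 - (nfr \<alpha> s \<theta> $ 3)\<^sup>2" by (simp add: power2_eq_square)
qed

lemma hlen_pos: "0 < \<alpha> \<Longrightarrow> 0 < s \<Longrightarrow> 0 < hlen \<alpha> s \<theta>"
  using hlen_sq_pos(1) by (simp add: hlen_def)

lemma bd_hlen: "bd n hlen" "bd n (\<lambda>\<alpha> s \<theta>. inverse (hlen \<alpha> s \<theta>))"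
proof -
  have "bd n (\<lambda>\<alpha> s \<theta>. sqrt (1 - nfr \<alpha> s \<theta> $ 3 * nfr \<alpha> s \<theta> $ 3))"
    by (rule bd_sqrt[of _ _ "3 / 4"], intro bd_diff bd_const bd_mult bd_nfr)
      (use hlen_sq_pos end_pt_pos in \<open>auto simp: power2_eq_square\<close>)
  then show h: "bd n hlen" by (rule bd_cong) (simp add: hlen_def power2_eq_square)
  have "sqrt (3 / 4) \<le> \<bar>hlen \<alpha> s \<theta>\<bar>" if "end_pt \<alpha> s" for \<alpha> s \<theta>
    using hlen_sq_pos(2)[OF _ _ that, of \<theta>] end_pt_pos[OF that]
    by (auto simp: hlen_def intro: order_trans[OF real_sqrt_le_mono abs_ge_self])
  then show "bd n (\<lambda>\<alpha> s \<theta>. inverse (hlen \<alpha> s \<theta>))"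
    using hlen_pos by (intro bd_inverse[OF h, of "sqrt (3 / 4)"]) (auto simp: less_imp_neq[THEN not_sym])
qed

text \<open>The geodesic in direction \<open>w nfr\<close> has horizontal speed \<open>W = hlen w\<close>; \<open>hdir\<close> is its initial
  velocity divided by \<open>W\<close>, so that the horizontal part of \<open>hdir\<close> is a unit vector.\<close>

definition hdir :: "real \<Rightarrow> real \<Rightarrow> real \<Rightarrow> real^3" where
  "hdir \<alpha> s \<theta> = inverse (hlen \<alpha> s \<theta>) *\<^sub>R nfr \<alpha> s \<theta>"

lemma bd_hdir: "bd n (\<lambda>\<alpha> s \<theta>. hdir \<alpha> s \<theta> $ k)"
  using bd_mult[OF bd_hlen(2) bd_nfr] by (simp add: hdir_def)

lemma hdir_unit:
  assumes "0 < \<alpha>" "0 < s"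
  shows "(hdir \<alpha> s \<theta> $ 1)\<^sup>2 + (hdir \<alpha> s \<theta> $ 2)\<^sup>2 = 1" "hlen \<alpha> s \<theta> *\<^sub>R hdir \<alpha> s \<theta> = nfr \<alpha> s \<theta>"
proof -
  have h: "hlen \<alpha> s \<theta> \<noteq> 0" using hlen_pos[OF assms, of \<theta>] by simp
  show "hlen \<alpha> s \<theta> *\<^sub>R hdir \<alpha> s \<theta> = nfr \<alpha> s \<theta>" using h by (simp add: hdir_def)
  have "(nfr \<alpha> s \<theta> $ 1)\<^sup>2 + (nfr \<alpha> s \<theta> $ 2)\<^sup>2 = (hlen \<alpha> s \<theta>)\<^sup>2"
    using nfr_unit(1)[OF assms(1), of s \<theta>] hlen_sq_pos(1)[OF assms, of \<theta>]
    by (simp add: hlen_def inner_3 power2_eq_square)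
  then show "(hdir \<alpha> s \<theta> $ 1)\<^sup>2 + (hdir \<alpha> s \<theta> $ 2)\<^sup>2 = 1"
    using h by (simp add: hdir_def power_mult_distrib distrib_left[symmetric])
      (simp add: power_mult_distrib[symmetric])
qed

section \<open>Geodesics and normal graphs\<close>

lemma linear_ode_zero:
  fixes u :: "real \<Rightarrow> real"
  assumes "\<And>t. (u has_real_derivative r * u t) (at t)" "u 0 = 0"
  shows "u t = 0"
proof -
  have "\<forall>t. ((\<lambda>t. exp (- r * t) * u t) has_real_derivative 0) (at t)"
    by (auto intro!: derivative_eq_intros assms simp: algebra_simps)
  from DERIV_isconst_all[OF this, of t 0] assms(2) show ?thesis by simp
qed

text \<open>With r^2 = E the equation factors: u = g' + r g solves u' = r u, and once u vanishes, g
  solves g' = - r g.\<close>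

lemma linear_ode2_zero:
  fixes g g' :: "real \<Rightarrow> real"
  assumes g: "\<And>t. (g has_real_derivative g' t) (at t)"
    and g': "\<And>t. (g' has_real_derivative E * g t) (at t)"
    and E: "0 \<le> E" and 0: "g 0 = 0" "g' 0 = 0"
  shows "g t = 0"
proof -
  define r where "r = sqrt E"
  have r: "r * r = E" using E by (simp add: r_def)
  have "g' t + r * g t = 0" for t
    by (rule linear_ode_zero[of "\<lambda>t. g' t + r * g t" r])
      (auto intro!: derivative_eq_intros g g' simp: 0 r[symmetric] algebra_simps)
  then have "g' t = - r * g t" for t by (simp add: add_eq_0_iff)
  then have "\<And>t. (g has_real_derivative - r * g t) (at t)" using g by simp
  from linear_ode_zero[of g, OF this 0(1)] show ?thesis .
qed

lemma christoffel_vec_diag: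
  "0 < p $ 2 \<Longrightarrow> - christoffel_vec p v v
     = vector [2 * v $ 1 * v $ 2 / p $ 2, ((v $ 2)\<^sup>2 - (v $ 1)\<^sup>2) / p $ 2, 0]"
  by (simp add: christoffel_vec_eq vec_eq_iff forall_3 power2_eq_square field_simps)

lemma geodesicD:
  assumes "geodesic c v"
  shows "0 < c t $ 2" "((\<lambda>t. c t $ k) has_real_derivative v t $ k) (at t)"
    "((\<lambda>t. v t $ 1) has_real_derivative 2 * v t $ 1 * v t $ 2 / c t $ 2) (at t)"
    "((\<lambda>t. v t $ 2) has_real_derivative ((v t $ 2)\<^sup>2 - (v t $ 1)\<^sup>2) / c t $ 2) (at t)"
    "((\<lambda>t. v t $ 3) has_real_derivative 0) (at t)"
proof -
  show y: "0 < c t $ 2" using assms by (simp add: geodesic_def)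
  have "(c has_vector_derivative v t) (at t)" using assms by (simp add: geodesic_def)
  then show "((\<lambda>t. c t $ k) has_real_derivative v t $ k) (at t)"
    unfolding has_vector_derivative_vec3 has_real_derivative_iff_has_vector_derivative by blast
  have "(v has_vector_derivative - christoffel_vec (c t) (v t) (v t)) (at t)"
    using assms by (simp add: geodesic_def)
  then show "((\<lambda>t. v t $ 1) has_real_derivative 2 * v t $ 1 * v t $ 2 / c t $ 2) (at t)"
    "((\<lambda>t. v t $ 2) has_real_derivative ((v t $ 2)\<^sup>2 - (v t $ 1)\<^sup>2) / c t $ 2) (at t)"
    "((\<lambda>t. v t $ 3) has_real_derivative 0) (at t)"
    unfolding christoffel_vec_diag[OF y] has_vector_derivative_vec3 forall_3 vector_3
      has_real_derivative_iff_has_vector_derivative by blast+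
qed

lemma geodesicI:
  assumes "\<And>t. 0 < c t $ 2" "\<And>t k. ((\<lambda>t. c t $ k) has_real_derivative v t $ k) (at t)"
    "\<And>t. ((\<lambda>t. v t $ 1) has_real_derivative 2 * v t $ 1 * v t $ 2 / c t $ 2) (at t)"
    "\<And>t. ((\<lambda>t. v t $ 2) has_real_derivative ((v t $ 2)\<^sup>2 - (v t $ 1)\<^sup>2) / c t $ 2) (at t)"
    "\<And>t. ((\<lambda>t. v t $ 3) has_real_derivative 0) (at t)"
  shows "geodesic c v"
  unfolding geodesic_def
proof (intro allI conjI)
  show y: "0 < c t $ 2" for t by (rule assms(1))
  show "(c has_vector_derivative v t) (at t)" for t
    using assms(2) unfolding has_vector_derivative_vec3 has_real_derivative_iff_has_vector_derivative by blast
  show "(v has_vector_derivative - christoffel_vec (c t) (v t) (v t)) (at t)" for t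
    using assms(3-5) unfolding christoffel_vec_diag[OF y] has_vector_derivative_vec3 forall_3 vector_3
      has_real_derivative_iff_has_vector_derivative by blast
qed

text \<open>Besides \<open>v\<^sub>3\<close>, also \<open>v\<^sub>1 / y\<^sup>2\<close> and the horizontal energy \<open>E\<close> are conserved, and \<open>1 / y\<close> solves the
  linear equation \<open>f'' = E f\<close>.\<close>

lemma geodesic_conserved:
  assumes g: "geodesic c v"
  shows "v t $ 3 = v 0 $ 3" "v t $ 1 / (c t $ 2)\<^sup>2 = v 0 $ 1 / (c 0 $ 2)\<^sup>2"
    "((v t $ 1)\<^sup>2 + (v t $ 2)\<^sup>2) / (c t $ 2)\<^sup>2 = ((v 0 $ 1)\<^sup>2 + (v 0 $ 2)\<^sup>2) / (c 0 $ 2)\<^sup>2"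
proof -
  note D = geodesicD[OF g]
  have y: "c t $ 2 \<noteq> 0" for t using D(1)[of t] by simp
  show "v t $ 3 = v 0 $ 3" by (rule DERIV_isconst_all) (use D(5) in blast)
  show "v t $ 1 / (c t $ 2)\<^sup>2 = v 0 $ 1 / (c 0 $ 2)\<^sup>2"
    by (rule DERIV_isconst_all[of "\<lambda>t. v t $ 1 / (c t $ 2)\<^sup>2"])
      (auto intro!: derivative_eq_intros D y simp: y field_simps power2_eq_square)
  show "((v t $ 1)\<^sup>2 + (v t $ 2)\<^sup>2) / (c t $ 2)\<^sup>2 = ((v 0 $ 1)\<^sup>2 + (v 0 $ 2)\<^sup>2) / (c 0 $ 2)\<^sup>2"
    by (rule DERIV_isconst_all[of "\<lambda>t. ((v t $ 1)\<^sup>2 + (v t $ 2)\<^sup>2) / (c t $ 2)\<^sup>2"])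
      (auto intro!: derivative_eq_intros D y simp: y field_simps power2_eq_square)
qed

text \<open>The first integrals decouple the system. The difference of the two functions 1 / y
  solves a linear equation with the common constant E, so the heights agree; the conserved
  quantities then give the first and third velocities, and integration the remaining
  coordinates.\<close>

lemma geodesic_unique:
  assumes g: "geodesic c v" and g': "geodesic c' v'" and i: "c 0 = c' 0" "v 0 = v' 0"
  shows "c t = c' t"
proof -
  note D = geodesicD[OF g] and D' = geodesicD[OF g']
  have y: "c t $ 2 \<noteq> 0" "c' t $ 2 \<noteq> 0" for t using D(1)[of t] D'(1)[of t] by simp_all
  define E where "E = ((v 0 $ 1)\<^sup>2 + (v 0 $ 2)\<^sup>2) / (c 0 $ 2)\<^sup>2"
  have f: "((\<lambda>t. 1 / c t $ 2) has_real_derivative - (v t $ 2 / (c t $ 2)\<^sup>2)) (at t)" if "geodesic c v" for c v t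
    using geodesicD(1)[OF that, of t] by (auto intro!: derivative_eq_intros geodesicD[OF that] simp: power2_eq_square)
  have f': "((\<lambda>t. - (v t $ 2 / (c t $ 2)\<^sup>2)) has_real_derivative
      ((v t $ 1)\<^sup>2 + (v t $ 2)\<^sup>2) / (c t $ 2)\<^sup>2 * (1 / c t $ 2)) (at t)" if "geodesic c v" for c v t
    using geodesicD(1)[OF that, of t]
    by (auto intro!: derivative_eq_intros geodesicD[OF that] simp: field_simps power2_eq_square)
  have "1 / c t $ 2 - 1 / c' t $ 2 = 0" for t
  proof (rule linear_ode2_zero[of "\<lambda>t. 1 / c t $ 2 - 1 / c' t $ 2"
        "\<lambda>t. - (v t $ 2 / (c t $ 2)\<^sup>2) - - (v' t $ 2 / (c' t $ 2)\<^sup>2)" E])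
    show "((\<lambda>t. - (v t $ 2 / (c t $ 2)\<^sup>2) - - (v' t $ 2 / (c' t $ 2)\<^sup>2)) has_real_derivative
        E * (1 / c t $ 2 - 1 / c' t $ 2)) (at t)" for t
      using DERIV_diff[OF f'[OF g, of t] f'[OF g', of t]] geodesic_conserved(3)[OF g, of t]
        geodesic_conserved(3)[OF g', of t] i by (simp add: E_def right_diff_distrib)
    show "((\<lambda>t. 1 / c t $ 2 - 1 / c' t $ 2) has_real_derivative
        - (v t $ 2 / (c t $ 2)\<^sup>2) - - (v' t $ 2 / (c' t $ 2)\<^sup>2)) (at t)" for t
      by (rule DERIV_diff[OF f[OF g] f[OF g']])
  qed (use i in \<open>auto simp: E_def\<close>)
  then have y2: "c t $ 2 = c' t $ 2" for t using y[of t] by (simp add: field_simps)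
  have "v t $ 1 = v' t $ 1" for t
  proof -
    have "v t $ 1 / (c' t $ 2)\<^sup>2 = v' t $ 1 / (c' t $ 2)\<^sup>2"
      using geodesic_conserved(2)[OF g, of t] geodesic_conserved(2)[OF g', of t] i y2 by simp
    then show ?thesis using y(2)[of t] by simp
  qed
  moreover have "v t $ 3 = v' t $ 3" for t
    using geodesic_conserved(1)[OF g, of t] geodesic_conserved(1)[OF g', of t] i by simp
  ultimately have vk: "v t $ k = v' t $ k" if "k \<noteq> 2" for t k using that exhaust_3[of k] by auto
  have "c t $ k - c' t $ k = c 0 $ k - c' 0 $ k" if "k \<noteq> 2" for t k
  proof (rule DERIV_isconst_all[of "\<lambda>t. c t $ k - c' t $ k"], rule allI)
    fix t show "((\<lambda>t. c t $ k - c' t $ k) has_real_derivative 0) (at t)"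
      using DERIV_diff[OF D(2)[of k t] D'(2)[of k t]] vk[OF that] by simp
  qed
  then show ?thesis using i y2 by (simp add: vec_eq_iff forall_3)
qed

lemma cosh_minus_sinh_pos:
  fixes W b :: real
  assumes "\<bar>b\<bar> \<le> 1"
  shows "0 < cosh W - b * sinh W"
proof -
  have "\<bar>b * sinh W\<bar> \<le> \<bar>sinh W\<bar>" using mult_right_mono[OF assms, of "\<bar>sinh W\<bar>"] by (simp add: abs_mult)
  moreover have "\<bar>sinh W\<bar> < cosh W" by (auto simp: abs_less_iff sinh_less_cosh_real sinh_def cosh_def)
  ultimately show ?thesis by linarith
qed

text \<open>The height is that of p divided by the solution of f'' = W^2 f with f(0) = 1 and f'(0) =
  - W h_2; conservation of v_1 / y^2 then integrates x, and z is linear. Normalizing the horizontal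
  part of h makes the formula smooth in W, also at W = 0.\<close>

lemma exp_map_eq:
  fixes h :: "real^3"
  assumes p: "0 < p $ 2" and h: "(h $ 1)\<^sup>2 + (h $ 2)\<^sup>2 = 1"
  shows "exp_map p (frv (p $ 2) (W *\<^sub>R h)) = vector [p $ 1 + p $ 2 * (h $ 1 * sinh W / (cosh W - h $ 2 * sinh W)),
      p $ 2 / (cosh W - h $ 2 * sinh W), p $ 3 + W * h $ 3]"
proof -
  let ?y = "p $ 2" and ?a = "h $ 1" and ?b = "h $ 2"
  have b: "\<bar>?b\<bar> \<le> 1" using h by (metis abs_square_le_1 le_add_same_cancel2 zero_le_power2)
  define D where "D t = cosh (W * t) - ?b * sinh (W * t)" for t
  define D' where "D' t = W * (sinh (W * t) - ?b * cosh (W * t))" for t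
  have D0: "0 < D t" for t unfolding D_def by (rule cosh_minus_sinh_pos[OF b])
  have dD: "(D has_real_derivative D' t) (at t)" "(D' has_real_derivative W\<^sup>2 * D t) (at t)" for t
    unfolding D_def D'_def by (auto intro!: derivative_eq_intros simp: power2_eq_square algebra_simps)
  \<comment> \<open>The first identity is conservation of energy, the second the Wronskian of sinh
    (W t) and D.\<close>
  have id: "(D' t)\<^sup>2 = W\<^sup>2 * (D t)\<^sup>2 - W\<^sup>2 * ?a\<^sup>2"
    "W * cosh (W * t) * D t - sinh (W * t) * D' t = W" for t
  proof -
    have e: "(cosh (W * t))\<^sup>2 = (sinh (W * t))\<^sup>2 + 1" by (rule cosh_square_eq)
    show "(D' t)\<^sup>2 = W\<^sup>2 * (D t)\<^sup>2 - W\<^sup>2 * ?a\<^sup>2" unfolding D_def D'_def using e h by algebra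
    show "W * cosh (W * t) * D t - sinh (W * t) * D' t = W"
      unfolding D_def D'_def using e by algebra
  qed
  define c :: "real \<Rightarrow> real^3" where
    "c t = vector [p $ 1 + ?y * (?a * sinh (W * t) / D t), ?y / D t, p $ 3 + W * t * h $ 3]" for t
  define v :: "real \<Rightarrow> real^3" where
    "v t = vector [?y * ?a * W / (D t)\<^sup>2, - ?y * D' t / (D t)\<^sup>2, W * h $ 3]" for t
  have g: "geodesic c v"
  proof (rule geodesicI)
    fix t
    have Dt: "D t \<noteq> 0" using D0[of t] by simp
    show "0 < c t $ 2" using p D0[of t] by (simp add: c_def)
    have "((\<lambda>t. sinh (W * t) / D t) has_real_derivative W / (D t)\<^sup>2) (at t)"
    proof -
      have "((\<lambda>t. sinh (W * t) / D t) has_real_derivative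
          (W * cosh (W * t) * D t - sinh (W * t) * D' t) / (D t * D t)) (at t)"
        by (auto intro!: derivative_eq_intros dD simp: Dt)
      then show ?thesis unfolding id(2) by (simp add: power2_eq_square)
    qed
    from DERIV_add[OF DERIV_const DERIV_cmult[OF DERIV_cmult[OF this]], of "p $ 1" ?y ?a]
    have 1: "((\<lambda>t. c t $ 1) has_real_derivative v t $ 1) (at t)"
      unfolding c_def v_def vector_3 by (simp add: mult.assoc)
    have 2: "((\<lambda>t. c t $ 2) has_real_derivative v t $ 2) (at t)"
      unfolding c_def v_def vector_3
      by (auto intro!: derivative_eq_intros dD simp: Dt power2_eq_square)
    have "((\<lambda>t. c t $ 3) has_real_derivative v t $ 3) (at t)"
      unfolding c_def v_def vector_3 by (auto intro!: derivative_eq_intros)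
    then show "((\<lambda>t. c t $ k) has_real_derivative v t $ k) (at t)" for k
      using exhaust_3[of k] 1 2 by auto
    show "((\<lambda>t. v t $ 1) has_real_derivative 2 * v t $ 1 * v t $ 2 / c t $ 2) (at t)"
      unfolding c_def v_def vector_3 using p
      by (auto intro!: derivative_eq_intros dD simp: Dt field_simps power2_eq_square)
    show "((\<lambda>t. v t $ 3) has_real_derivative 0) (at t)"
      unfolding v_def vector_3 by simp
    have "((\<lambda>t. - ?y * D' t / (D t)\<^sup>2) has_real_derivative
       - ?y * (W\<^sup>2 * D t) / (D t)\<^sup>2 + 2 * ?y * (D' t)\<^sup>2 / (D t) ^ 3) (at t)"
      by (auto intro!: derivative_eq_intros dD simp: Dt field_simps power2_eq_square power3_eq_cube)
    moreover have "- ?y * (W\<^sup>2 * D t) / (D t)\<^sup>2 + 2 * ?y * (D' t)\<^sup>2 / (D t) ^ 3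
       = ((- ?y * D' t / (D t)\<^sup>2)\<^sup>2 - (?y * ?a * W / (D t)\<^sup>2)\<^sup>2) / (?y / D t)"
    proof -
      have "- ?y * (W\<^sup>2 * D t) / (D t)\<^sup>2 + 2 * ?y * (D' t)\<^sup>2 / (D t) ^ 3
         = ?y * ((D' t)\<^sup>2 - W\<^sup>2 * ?a\<^sup>2) / (D t) ^ 3"
        unfolding id(1) using Dt by (simp add: field_simps power2_eq_square power3_eq_cube)
      also have "\<dots> = ((- ?y * D' t / (D t)\<^sup>2)\<^sup>2 - (?y * ?a * W / (D t)\<^sup>2)\<^sup>2) / (?y / D t)"
        using Dt p by (simp add: field_simps power2_eq_square power3_eq_cube)
      finally show ?thesis .
    qed
    ultimately show "((\<lambda>t. v t $ 2) has_real_derivative ((v t $ 2)\<^sup>2 - (v t $ 1)\<^sup>2) / c t $ 2) (at t)"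
      unfolding c_def v_def vector_3 by simp
  qed
  have c0: "c 0 = p" "v 0 = frv (p $ 2) (W *\<^sub>R h)"
    by (simp_all add: c_def v_def D_def D'_def vec_eq_iff forall_3)
  have "exp_map p (frv (p $ 2) (W *\<^sub>R h)) = c 1"
    unfolding exp_map_def
  proof (rule the_equality)
    show "\<exists>c' v'. geodesic c' v' \<and> c' 0 = p \<and> v' 0 = frv (p $ 2) (W *\<^sub>R h) \<and> c 1 = c' 1"
      using g c0 by blast
    fix q assume "\<exists>c' v'. geodesic c' v' \<and> c' 0 = p \<and> v' 0 = frv (p $ 2) (W *\<^sub>R h) \<and> q = c' 1"
    then obtain c' v' where "geodesic c' v'" "c' 0 = p" "v' 0 = frv (p $ 2) (W *\<^sub>R h)" "q = c' 1" by blast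
    then show "q = c 1" using geodesic_unique[OF _ g, of c' v' 1] c0 by simp
  qed
  then show ?thesis by (simp add: c_def D_def)
qed

section \<open>The normal graph as an expression in the jet of w\<close>

definition idx1 :: "2 \<Rightarrow> nat" where
  "idx1 i = (if i = 1 then 1 else 2)"

definition idx2 :: "2 \<Rightarrow> 2 \<Rightarrow> nat" where
  "idx2 i j = (if i = 1 \<and> j = 1 then 3 else if i = 2 \<and> j = 2 then 5 else 4)"

text \<open>Both mixed derivatives have to equal the same entry 4, so the symmetry of second
  derivatives is part of the notion.\<close>

definition is_jet :: "real set \<Rightarrow> (real \<Rightarrow> real \<Rightarrow> jet) \<Rightarrow> bool" where
  "is_jet I j \<longleftrightarrow> (\<forall>s\<in>I. \<forall>\<theta> i. has_pd I i (\<lambda>s \<theta>. j s \<theta> 0) (j s \<theta> (idx1 i)) s \<theta> \<and>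
     (\<forall>k. has_pd I k (\<lambda>s \<theta>. j s \<theta> (idx1 i)) (j s \<theta> (idx2 i k)) s \<theta>))"

text \<open>With \<open>W = hlen w\<close>, the normal graph of \<open>w\<close> is the translate by \<open>X\<close> of \<open>(m / D, 1 / D, u)\<close>.\<close>

definition hlen1 where "hlen1 i \<alpha> = pd UNIV i (hlen \<alpha>)"
definition hlen2 where "hlen2 i j \<alpha> = pd UNIV j (hlen1 i \<alpha>)"
definition hd0 where "hd0 k \<alpha> s \<theta> = hdir \<alpha> s \<theta> $ k"
definition hd1 where "hd1 k i \<alpha> = pd UNIV i (hd0 k \<alpha>)"
definition hd2 where "hd2 k i j \<alpha> = pd UNIV j (hd1 k i \<alpha>)"

text \<open>The suffixes 0, 1, 2 count derivatives. Each function is followed by its formal first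
  and second derivatives, written in the entries of a jet, so that they are meaningful for jets that
  come from no function.\<close>

definition W0 :: oper where
  "W0 \<alpha> s \<theta> J = hlen \<alpha> s \<theta> * J 0"
definition W1 :: "2 \<Rightarrow> oper" where
  "W1 i \<alpha> s \<theta> J = hlen1 i \<alpha> s \<theta> * J 0 + hlen \<alpha> s \<theta> * J (idx1 i)"
definition W2 :: "2 \<Rightarrow> 2 \<Rightarrow> oper" where
  "W2 i j \<alpha> s \<theta> J = hlen2 i j \<alpha> s \<theta> * J 0 + hlen1 i \<alpha> s \<theta> * J (idx1 j)
     + (hlen1 j \<alpha> s \<theta> * J (idx1 i) + hlen \<alpha> s \<theta> * J (idx2 i j))"

definition D0 :: oper where
  "D0 \<alpha> s \<theta> J = cosh (W0 \<alpha> s \<theta> J) - hd0 2 \<alpha> s \<theta> * sinh (W0 \<alpha> s \<theta> J)"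
definition D1 :: "2 \<Rightarrow> oper" where
  "D1 i \<alpha> s \<theta> J = (sinh (W0 \<alpha> s \<theta> J) - hd0 2 \<alpha> s \<theta> * cosh (W0 \<alpha> s \<theta> J)) * W1 i \<alpha> s \<theta> J
     - hd1 2 i \<alpha> s \<theta> * sinh (W0 \<alpha> s \<theta> J)"
definition D2 :: "2 \<Rightarrow> 2 \<Rightarrow> oper" where
  "D2 i j \<alpha> s \<theta> J = D0 \<alpha> s \<theta> J * W1 i \<alpha> s \<theta> J * W1 j \<alpha> s \<theta> J
     + (sinh (W0 \<alpha> s \<theta> J) - hd0 2 \<alpha> s \<theta> * cosh (W0 \<alpha> s \<theta> J)) * W2 i j \<alpha> s \<theta> J
     - hd1 2 j \<alpha> s \<theta> * cosh (W0 \<alpha> s \<theta> J) * W1 i \<alpha> s \<theta> J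
     - hd1 2 i \<alpha> s \<theta> * cosh (W0 \<alpha> s \<theta> J) * W1 j \<alpha> s \<theta> J
     - hd2 2 i j \<alpha> s \<theta> * sinh (W0 \<alpha> s \<theta> J)"

definition m0 :: oper where
  "m0 \<alpha> s \<theta> J = hd0 1 \<alpha> s \<theta> * sinh (W0 \<alpha> s \<theta> J)"
definition m1 :: "2 \<Rightarrow> oper" where
  "m1 i \<alpha> s \<theta> J = hd1 1 i \<alpha> s \<theta> * sinh (W0 \<alpha> s \<theta> J) + hd0 1 \<alpha> s \<theta> * cosh (W0 \<alpha> s \<theta> J) * W1 i \<alpha> s \<theta> J"
definition m2 :: "2 \<Rightarrow> 2 \<Rightarrow> oper" where
  "m2 i j \<alpha> s \<theta> J = hd2 1 i j \<alpha> s \<theta> * sinh (W0 \<alpha> s \<theta> J)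
     + hd1 1 i \<alpha> s \<theta> * cosh (W0 \<alpha> s \<theta> J) * W1 j \<alpha> s \<theta> J
     + hd1 1 j \<alpha> s \<theta> * cosh (W0 \<alpha> s \<theta> J) * W1 i \<alpha> s \<theta> J
     + m0 \<alpha> s \<theta> J * W1 i \<alpha> s \<theta> J * W1 j \<alpha> s \<theta> J
     + hd0 1 \<alpha> s \<theta> * cosh (W0 \<alpha> s \<theta> J) * W2 i j \<alpha> s \<theta> J"

definition u0 :: oper where
  "u0 \<alpha> s \<theta> J = W0 \<alpha> s \<theta> J * hd0 3 \<alpha> s \<theta>"
definition u1 :: "2 \<Rightarrow> oper" where
  "u1 i \<alpha> s \<theta> J = W1 i \<alpha> s \<theta> J * hd0 3 \<alpha> s \<theta> + W0 \<alpha> s \<theta> J * hd1 3 i \<alpha> s \<theta>"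
definition u2 :: "2 \<Rightarrow> 2 \<Rightarrow> oper" where
  "u2 i j \<alpha> s \<theta> J = W2 i j \<alpha> s \<theta> J * hd0 3 \<alpha> s \<theta> + W1 i \<alpha> s \<theta> J * hd1 3 j \<alpha> s \<theta>
     + (W1 j \<alpha> s \<theta> J * hd1 3 i \<alpha> s \<theta> + W0 \<alpha> s \<theta> J * hd2 3 i j \<alpha> s \<theta>)"

text \<open>Logarithmic derivative of the height of the graph, which is the height of the catenoid
  over \<open>D0\<close>. It is the second frame component of a tangent vector of the graph and also
  enters the first one.\<close>

definition A2 :: "2 \<Rightarrow> oper" where
  "A2 i \<alpha> s \<theta> J = tang i \<alpha> s \<theta> $ 2 - D1 i \<alpha> s \<theta> J * inverse (D0 \<alpha> s \<theta> J)"
definition A2' :: "2 \<Rightarrow> 2 \<Rightarrow> oper" where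
  "A2' i j \<alpha> s \<theta> J = tang' i j \<alpha> s \<theta> $ 2 - D2 i j \<alpha> s \<theta> J * inverse (D0 \<alpha> s \<theta> J)
     + D1 i \<alpha> s \<theta> J * D1 j \<alpha> s \<theta> J * (inverse (D0 \<alpha> s \<theta> J) * inverse (D0 \<alpha> s \<theta> J))"

definition gA :: "2 \<Rightarrow> real \<Rightarrow> real \<Rightarrow> real \<Rightarrow> jet \<Rightarrow> real^3" where
  "gA i \<alpha> s \<theta> J = vector [D0 \<alpha> s \<theta> J * tang i \<alpha> s \<theta> $ 1 + m0 \<alpha> s \<theta> J * A2 i \<alpha> s \<theta> J + m1 i \<alpha> s \<theta> J,
     A2 i \<alpha> s \<theta> J, tang i \<alpha> s \<theta> $ 3 + u1 i \<alpha> s \<theta> J]"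
definition gA' :: "2 \<Rightarrow> 2 \<Rightarrow> real \<Rightarrow> real \<Rightarrow> real \<Rightarrow> jet \<Rightarrow> real^3" where
  "gA' i j \<alpha> s \<theta> J = vector [D1 j \<alpha> s \<theta> J * tang i \<alpha> s \<theta> $ 1 + D0 \<alpha> s \<theta> J * tang' i j \<alpha> s \<theta> $ 1
       + (m1 j \<alpha> s \<theta> J * A2 i \<alpha> s \<theta> J + m0 \<alpha> s \<theta> J * A2' i j \<alpha> s \<theta> J) + m2 i j \<alpha> s \<theta> J,
     A2' i j \<alpha> s \<theta> J, tang' i j \<alpha> s \<theta> $ 3 + u2 i j \<alpha> s \<theta> J]"
text \<open>The covariant derivative of the i-th tangent vector of the graph in direction j,
  analogous to \<open>covd\<close>.\<close>

definition gC :: "2 \<Rightarrow> 2 \<Rightarrow> real \<Rightarrow> real \<Rightarrow> real \<Rightarrow> jet \<Rightarrow> real^3" where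
  "gC i j \<alpha> s \<theta> J = gA' i j \<alpha> s \<theta> J + gam (gA j \<alpha> s \<theta> J) (gA i \<alpha> s \<theta> J)"

definition gH :: oper where
  "gH \<alpha> s \<theta> J = twoH (gA 1 \<alpha> s \<theta> J) (gA 2 \<alpha> s \<theta> J) (gC 1 1 \<alpha> s \<theta> J)
     (gC 1 2 \<alpha> s \<theta> J + gC 2 1 \<alpha> s \<theta> J) (gC 2 2 \<alpha> s \<theta> J)"

lemma hdir_abs_le1:
  assumes "0 < \<alpha>" "0 < s"
  shows "\<bar>hdir \<alpha> s \<theta> $ 2\<bar> \<le> 1"
  using hdir_unit(1)[OF assms, of \<theta>] by (metis abs_square_le_1 le_add_same_cancel2 zero_le_power2)

lemma D0_pos: "0 < \<alpha> \<Longrightarrow> 0 < s \<Longrightarrow> 0 < D0 \<alpha> s \<theta> J"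
  unfolding D0_def hd0_def by (intro cosh_minus_sinh_pos hdir_abs_le1)

lemma normal_graph_eq:
  assumes "0 < \<alpha>" "0 < s" "w s \<theta> = J 0"
  shows "normal_graph \<alpha> w s \<theta> = vector
    [catenoid \<alpha> s \<theta> $ 1 + catenoid \<alpha> s \<theta> $ 2 * (m0 \<alpha> s \<theta> J * inverse (D0 \<alpha> s \<theta> J)),
     catenoid \<alpha> s \<theta> $ 2 * inverse (D0 \<alpha> s \<theta> J), catenoid \<alpha> s \<theta> $ 3 + u0 \<alpha> s \<theta> J]"
proof -
  have "w s \<theta> *\<^sub>R cat_normal \<alpha> s \<theta> = frv (catenoid \<alpha> s \<theta> $ 2) (W0 \<alpha> s \<theta> J *\<^sub>R hdir \<alpha> s \<theta>)"
    unfolding cat_normal_eq[OF assms(1)] hdir_unit(2)[OF assms(1,2), symmetric] W0_def assms(3)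
    by (simp add: vec_eq_iff forall_3)
  then show ?thesis
    unfolding normal_graph_def
    using exp_map_eq[OF catenoid_y_pos[OF assms(1)] hdir_unit(1)[OF assms(1,2)], where W = "W0 \<alpha> s \<theta> J"]
    by (simp add: m0_def D0_def u0_def hd0_def divide_inverse)
qed

section \<open>Derivatives of the normal graph\<close>

context
  fixes \<alpha> S :: real and I :: "real set" and j :: "real \<Rightarrow> real \<Rightarrow> jet"
  assumes \<alpha>: "0 < \<alpha>" and S: "0 < S" and I: "I = {S..}" and j: "is_jet I j"
begin

lemma pos: "s \<in> I \<Longrightarrow> 0 < s"
  using S I by auto

lemma has_pd_coeffs:
  assumes "s \<in> I"
  shows "has_pd I i (hlen \<alpha>) (hlen1 i \<alpha> s \<theta>) s \<theta>"
    "has_pd I k (hlen1 i \<alpha>) (hlen2 i k \<alpha> s \<theta>) s \<theta>"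
    "has_pd I i (hd0 n \<alpha>) (hd1 n i \<alpha> s \<theta>) s \<theta>"
    "has_pd I k (hd1 n i \<alpha>) (hd2 n i k \<alpha> s \<theta>) s \<theta>"
proof -
  note a = \<alpha> pos[OF assms]
  show "has_pd I i (hlen \<alpha>) (hlen1 i \<alpha> s \<theta>) s \<theta>"
    unfolding hlen1_def by (rule has_pd_subset[OF bd_pd(2)[OF bd_hlen(1)[of 1, unfolded One_nat_def] a]]) simp
  show "has_pd I k (hlen1 i \<alpha>) (hlen2 i k \<alpha> s \<theta>) s \<theta>"
    unfolding hlen2_def hlen1_def
    by (rule has_pd_subset[OF bd_pd(2)[OF bd_pd(1)[OF bd_hlen(1)[of "Suc (Suc 0)"]] a]]) simp
  have h: "bd n (hd0 k)" for n k using bd_hdir[of n k] by (simp add: hd0_def[abs_def])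
  show "has_pd I i (hd0 n \<alpha>) (hd1 n i \<alpha> s \<theta>) s \<theta>"
    unfolding hd1_def by (rule has_pd_subset[OF bd_pd(2)[OF h[of "Suc 0"] a]]) simp
  show "has_pd I k (hd1 n i \<alpha>) (hd2 n i k \<alpha> s \<theta>) s \<theta>"
    unfolding hd2_def hd1_def
    by (rule has_pd_subset[OF bd_pd(2)[OF bd_pd(1)[OF h[of "Suc (Suc 0)"]] a]]) simp
qed

lemma has_pd_jet:
  assumes "s \<in> I"
  shows "has_pd I i (\<lambda>s \<theta>. j s \<theta> 0) (j s \<theta> (idx1 i)) s \<theta>"
    "has_pd I k (\<lambda>s \<theta>. j s \<theta> (idx1 i)) (j s \<theta> (idx2 i k)) s \<theta>"
  using j assms unfolding is_jet_def by blast+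

lemma has_pd_W0: "s \<in> I \<Longrightarrow> has_pd I i (\<lambda>s \<theta>. W0 \<alpha> s \<theta> (j s \<theta>)) (W1 i \<alpha> s \<theta> (j s \<theta>)) s \<theta>"
  unfolding W0_def W1_def by (intro has_pd_mult has_pd_coeffs has_pd_jet)

lemma has_pd_W1: "s \<in> I \<Longrightarrow> has_pd I k (\<lambda>s \<theta>. W1 i \<alpha> s \<theta> (j s \<theta>)) (W2 i k \<alpha> s \<theta> (j s \<theta>)) s \<theta>"
  unfolding W1_def W2_def by (intro has_pd_add has_pd_mult has_pd_coeffs has_pd_jet)

lemma has_pd_cosh_sinh:
  assumes "s \<in> I"
  shows "has_pd I i (\<lambda>s \<theta>. cosh (W0 \<alpha> s \<theta> (j s \<theta>))) (sinh (W0 \<alpha> s \<theta> (j s \<theta>)) * W1 i \<alpha> s \<theta> (j s \<theta>)) s \<theta>"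
    "has_pd I i (\<lambda>s \<theta>. sinh (W0 \<alpha> s \<theta> (j s \<theta>))) (cosh (W0 \<alpha> s \<theta> (j s \<theta>)) * W1 i \<alpha> s \<theta> (j s \<theta>)) s \<theta>"
  by (rule has_pd_chain[OF _ has_pd_W0[OF assms]], auto intro!: derivative_eq_intros)+

lemmas pd_rules = has_pd_add has_pd_diff has_pd_mult has_pd_coeffs has_pd_W0 has_pd_W1 has_pd_cosh_sinh

lemma has_pd_D0: "s \<in> I \<Longrightarrow> has_pd I i (\<lambda>s \<theta>. D0 \<alpha> s \<theta> (j s \<theta>)) (D1 i \<alpha> s \<theta> (j s \<theta>)) s \<theta>"
  unfolding D0_def D1_def
  by (rule has_pd_eq, (rule pd_rules | assumption)+) (simp add: algebra_simps)

lemma has_pd_D1: "s \<in> I \<Longrightarrow> has_pd I k (\<lambda>s \<theta>. D1 i \<alpha> s \<theta> (j s \<theta>)) (D2 i k \<alpha> s \<theta> (j s \<theta>)) s \<theta>"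
  unfolding D1_def D2_def D0_def
  by (rule has_pd_eq, (rule pd_rules | assumption)+) (simp add: algebra_simps)

lemma has_pd_m0: "s \<in> I \<Longrightarrow> has_pd I i (\<lambda>s \<theta>. m0 \<alpha> s \<theta> (j s \<theta>)) (m1 i \<alpha> s \<theta> (j s \<theta>)) s \<theta>"
  unfolding m0_def m1_def
  by (rule has_pd_eq, (rule pd_rules | assumption)+) (simp add: algebra_simps)

lemma has_pd_m1: "s \<in> I \<Longrightarrow> has_pd I k (\<lambda>s \<theta>. m1 i \<alpha> s \<theta> (j s \<theta>)) (m2 i k \<alpha> s \<theta> (j s \<theta>)) s \<theta>"
  unfolding m1_def m2_def m0_def
  by (rule has_pd_eq, (rule pd_rules | assumption)+) (simp add: algebra_simps)

lemma has_pd_u0: "s \<in> I \<Longrightarrow> has_pd I i (\<lambda>s \<theta>. u0 \<alpha> s \<theta> (j s \<theta>)) (u1 i \<alpha> s \<theta> (j s \<theta>)) s \<theta>"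
  unfolding u0_def u1_def
  by (rule has_pd_eq, (rule pd_rules | assumption)+) (simp add: algebra_simps)

lemma has_pd_u1: "s \<in> I \<Longrightarrow> has_pd I k (\<lambda>s \<theta>. u1 i \<alpha> s \<theta> (j s \<theta>)) (u2 i k \<alpha> s \<theta> (j s \<theta>)) s \<theta>"
  unfolding u1_def u2_def
  by (rule has_pd_eq, (rule pd_rules | assumption)+) (simp add: algebra_simps)

lemma has_pd_invD: "s \<in> I \<Longrightarrow> has_pd I i (\<lambda>s \<theta>. inverse (D0 \<alpha> s \<theta> (j s \<theta>)))
    (- D1 i \<alpha> s \<theta> (j s \<theta>) * (inverse (D0 \<alpha> s \<theta> (j s \<theta>)) * inverse (D0 \<alpha> s \<theta> (j s \<theta>)))) s \<theta>"
  by (rule has_pd_inverse[OF has_pd_D0]) (use D0_pos[OF \<alpha> pos, of s \<theta> "j s \<theta>"] in auto)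

lemma has_pd_tangk: "has_pd I k (\<lambda>s \<theta>. tang i \<alpha> s \<theta> $ n) (tang' i k \<alpha> s \<theta> $ n) s \<theta>"
  by (rule has_pd_subset[OF has_pd_tang[OF \<alpha>, unfolded has_pd_vec, rule_format]]) simp

lemma has_pd_A2: "s \<in> I \<Longrightarrow> has_pd I k (\<lambda>s \<theta>. A2 i \<alpha> s \<theta> (j s \<theta>)) (A2' i k \<alpha> s \<theta> (j s \<theta>)) s \<theta>"
  unfolding A2_def A2'_def
  by (rule has_pd_eq, (rule has_pd_diff has_pd_mult has_pd_tangk has_pd_D1 has_pd_invD | assumption)+)
    (simp add: algebra_simps)

lemma has_pd_gA: "s \<in> I \<Longrightarrow> has_pd I k (\<lambda>s \<theta>. gA i \<alpha> s \<theta> (j s \<theta>)) (gA' i k \<alpha> s \<theta> (j s \<theta>)) s \<theta>"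
  unfolding has_pd_vec forall_3 gA_def gA'_def vector_3
  by (intro conjI; (rule has_pd_eq,
      (rule has_pd_add has_pd_mult has_pd_tangk has_pd_D0 has_pd_m0 has_pd_m1 has_pd_A2 has_pd_u1 | assumption)+,
      simp add: algebra_simps))

lemma normal_graph_jet:
  assumes "s \<in> I" "\<And>s \<theta>. s \<in> I \<Longrightarrow> w s \<theta> = j s \<theta> 0"
  shows "normal_graph \<alpha> w s \<theta> = vector
    [catenoid \<alpha> s \<theta> $ 1 + catenoid \<alpha> s \<theta> $ 2 * (m0 \<alpha> s \<theta> (j s \<theta>) * inverse (D0 \<alpha> s \<theta> (j s \<theta>))),
     catenoid \<alpha> s \<theta> $ 2 * inverse (D0 \<alpha> s \<theta> (j s \<theta>)), catenoid \<alpha> s \<theta> $ 3 + u0 \<alpha> s \<theta> (j s \<theta>)]"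
  by (rule normal_graph_eq[where w = w and J = "j s \<theta>", OF \<alpha> pos[OF assms(1)] assms(2)[OF assms(1)]])

lemma normal_graph_y_pos:
  assumes "s \<in> I" "\<And>s \<theta>. s \<in> I \<Longrightarrow> w s \<theta> = j s \<theta> 0"
  shows "0 < normal_graph \<alpha> w s \<theta> $ 2"
  using catenoid_y_pos[OF \<alpha>, of s \<theta>] D0_pos[OF \<alpha> pos[OF assms(1)], of \<theta> "j s \<theta>"]
  by (simp add: normal_graph_jet[of s w, OF assms])

text \<open>Frame components refer to the height of the graph rather than to that of the catenoid;
  dividing by the new height is what produces the factor \<open>D0\<close> and the terms with
  \<open>A2\<close>.\<close>

lemma has_pd_normal_graph:
  assumes s: "s \<in> I" and w: "\<And>s \<theta>. s \<in> I \<Longrightarrow> w s \<theta> = j s \<theta> 0"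
  shows "has_pd I i (normal_graph \<alpha> w) (frv (normal_graph \<alpha> w s \<theta> $ 2) (gA i \<alpha> s \<theta> (j s \<theta>))) s \<theta>"
proof -
  let ?Y = "\<lambda>s \<theta>. vector [catenoid \<alpha> s \<theta> $ 1 + catenoid \<alpha> s \<theta> $ 2 * (m0 \<alpha> s \<theta> (j s \<theta>) * inverse (D0 \<alpha> s \<theta> (j s \<theta>))),
     catenoid \<alpha> s \<theta> $ 2 * inverse (D0 \<alpha> s \<theta> (j s \<theta>)), catenoid \<alpha> s \<theta> $ 3 + u0 \<alpha> s \<theta> (j s \<theta>)] :: real^3"
  have c: "has_pd I i (\<lambda>s \<theta>. catenoid \<alpha> s \<theta> $ n) (frv (catenoid \<alpha> s \<theta> $ 2) (tang i \<alpha> s \<theta>) $ n) s \<theta>" for n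
    by (rule has_pd_subset[OF catenoid_tang[OF \<alpha>, unfolded has_pd_vec, rule_format]]) simp
  have D: "inverse (D0 \<alpha> s \<theta> (j s \<theta>)) * D0 \<alpha> s \<theta> (j s \<theta>) = 1"
    using D0_pos[OF \<alpha> pos[OF s], of \<theta> "j s \<theta>"] by simp
  have "has_pd I i ?Y (frv (catenoid \<alpha> s \<theta> $ 2 * inverse (D0 \<alpha> s \<theta> (j s \<theta>))) (gA i \<alpha> s \<theta> (j s \<theta>))) s \<theta>"
    unfolding has_pd_vec forall_3 vector_3 frv_nth gA_def A2_def
    apply (intro conjI)
      apply (rule has_pd_eq, (rule has_pd_add has_pd_mult c has_pd_m0 has_pd_invD | rule s)+)
    subgoal unfolding frv_nth using D by algebra
     apply (rule has_pd_eq, (rule has_pd_add has_pd_mult c has_pd_invD | rule s)+)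
    subgoal unfolding frv_nth by (simp add: algebra_simps)
    apply (rule has_pd_eq, (rule has_pd_add c has_pd_u0 | rule s)+)
    subgoal unfolding frv_nth ..
    done
  then have "has_pd I i (normal_graph \<alpha> w) (frv (catenoid \<alpha> s \<theta> $ 2 * inverse (D0 \<alpha> s \<theta> (j s \<theta>))) (gA i \<alpha> s \<theta> (j s \<theta>))) s \<theta>"
    by (rule has_pd_cong) (use normal_graph_jet[of _ w, OF _ w] s in auto)
  then show ?thesis by (simp add: normal_graph_jet[of s w, OF s w])
qed

end

section \<open>The mean curvature of a normal graph expands\<close>

lemma hol_cmult: "hol \<beta> I u K \<Longrightarrow> hol \<beta> I (\<lambda>s \<theta>. c * u s \<theta>) (\<bar>c\<bar> * K)"
  unfolding hol_def
  by (auto simp: abs_mult right_diff_distrib[symmetric] mult.assoc intro!: mult_left_mono)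

lemma jet_bd_cmult: "jet_bd \<beta> I j a \<Longrightarrow> jet_bd \<beta> I (\<lambda>s \<theta> i. c * j s \<theta> i) (\<bar>c\<bar> * a)"
  unfolding jet_bd_def by (intro allI impI hol_cmult) simp

lemma jet_bd_mono: "jet_bd \<beta> I j a \<Longrightarrow> a \<le> b \<Longrightarrow> jet_bd \<beta> I j b"
  unfolding jet_bd_def by (intro allI impI, rule hol_mono) auto

text \<open>A deformed normal has to be continuous jointly in the deformation parameter and the
  point. The Lipschitz estimate in the jet handles t, the Hoelder bound on the values handles s and
  \<theta>.\<close>

lemma good_continuous:
  assumes T: "good \<beta> T" and \<beta>: "0 < \<beta>"
  shows "\<exists>\<delta>>0. \<forall>\<alpha> S j. end_pt \<alpha> S \<longrightarrow> (\<forall>s\<ge>S. jet_bd \<beta> {s..s+1} j \<delta>) \<longrightarrow>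
    continuous_on ({0..1} \<times> {S..} \<times> UNIV) (\<lambda>(t, s, \<theta>). T \<alpha> s \<theta> (\<lambda>i. t * j s \<theta> i))"
proof -
  obtain \<delta> C l where g: "expands_all \<beta> \<delta> C l T" using goodE[OF T] .
  have d: "0 < \<delta>" "\<delta> \<le> 1" "1 \<le> C" using expands_all_pos[OF g] by auto
  have "continuous_on ({0..1} \<times> {S..} \<times> UNIV) (\<lambda>(t, s, \<theta>). T \<alpha> s \<theta> (\<lambda>i. t * j s \<theta> i))"
    if S: "end_pt \<alpha> S" and j: "\<forall>s\<ge>S. jet_bd \<beta> {s..s+1} j \<delta>" for \<alpha> S j
    unfolding continuous_on_def
  proof
    fix z :: "real \<times> real \<times> real" assume z: "z \<in> {0..1} \<times> {S..} \<times> UNIV"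
    obtain t s \<theta> where zt: "z = (t, s, \<theta>)" by (metis surj_pair)
    let ?f = "\<lambda>z. case z of (t, s, \<theta>) \<Rightarrow> T \<alpha> s \<theta> (\<lambda>i. t * j s \<theta> i)"
    let ?A = "{0..1} \<times> {S..} \<times> (UNIV :: real set)"
    \<comment> \<open>A window of length 1 that contains all points of the end within distance 1/2
      of s, also when s is close to S.\<close>
    define s0 where "s0 = max S (s - 1/2)"
    have e: "end_pt \<alpha> s0" using end_pt_mono[OF S] by (simp add: s0_def)
    have j0: "jet_bd \<beta> {s0..s0+1} j \<delta>" using j by (simp add: s0_def)
    have s: "s \<in> {s0..s0+1}" using z zt by (auto simp: s0_def)
    have t: "0 \<le> t" "t \<le> 1" using z zt by auto
    have le: "dist (?f (t', s', \<theta>')) (?f z) \<le> C * (\<bar>t' - t\<bar> * \<delta>) + C * dist (s', \<theta>') (s, \<theta>) powr \<beta>"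
      if "0 \<le> t'" "t' \<le> 1" "s' \<in> {s0..s0+1}" for t' s' \<theta>'
    proof -
      have jt: "jet_bd \<beta> {s0..s0+1} (\<lambda>s \<theta> i. t * j s \<theta> i) \<delta>" if "0 \<le> t" "t \<le> 1" for t
        by (rule jet_bd_mono[OF jet_bd_cmult[OF j0]]) (use that d in \<open>auto simp: mult_left_le_one_le\<close>)
      have jd: "jet_bd \<beta> {s0..s0+1} (\<lambda>s \<theta> i. t' * j s \<theta> i - t * j s \<theta> i) (\<bar>t' - t\<bar> * \<delta>)"
        using jet_bd_cmult[OF j0, of "t' - t"] by (simp add: left_diff_distrib)
      have "\<bar>T \<alpha> s' \<theta>' (\<lambda>i. t' * j s' \<theta>' i) - T \<alpha> s' \<theta>' (\<lambda>i. t * j s' \<theta>' i)\<bar> \<le> C * (\<bar>t' - t\<bar> * \<delta>)"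
        using hol_bound[OF expands_allD(5)[OF g e jt[OF that(1,2)] jt[OF t] jd] that(3)] by simp
      moreover have "\<bar>T \<alpha> s' \<theta>' (\<lambda>i. t * j s' \<theta>' i) - T \<alpha> s \<theta> (\<lambda>i. t * j s \<theta> i)\<bar>
          \<le> C * dist (s', \<theta>') (s, \<theta>) powr \<beta>"
        using hol_diff[OF expands_allD(7)[OF g e jt[OF t]] that(3) s] by simp
      ultimately show ?thesis by (simp add: zt dist_real_def)
    qed
    have "(?f \<longlongrightarrow> ?f z) (at z within ?A)"
    proof (rule tendsto_dist_iff[THEN iffD2], rule Lim_null_comparison)
      let ?g = "\<lambda>z'. C * (\<bar>fst z' - t\<bar> * \<delta>) + C * dist (snd z') (s, \<theta>) powr \<beta>"
      have "eventually (\<lambda>z'. dist z' z < 1/2) (at z within ?A)"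
        by (auto simp: eventually_at intro!: exI[of _ "1/2"])
      moreover have "eventually (\<lambda>z'. z' \<in> ?A) (at z within ?A)"
        by (auto simp: eventually_at intro!: exI[of _ 1])
      ultimately show "eventually (\<lambda>z'. norm (dist (?f z') (?f z)) \<le> ?g z') (at z within ?A)"
      proof eventually_elim
        case (elim z')
        obtain t' s' \<theta>' where z': "z' = (t', s', \<theta>')" by (metis surj_pair)
        have "\<bar>s' - s\<bar> \<le> dist z' z"
          using dist_fst_le[of "snd z'" "snd z"] dist_snd_le[of z' z] by (auto simp: z' zt dist_real_def)
        then have "s' \<in> {s0..s0+1}" using elim by (auto simp: z' s0_def abs_if split: if_splits)
        then show ?case using le[of t' s' \<theta>'] elim by (auto simp: z')
      qed
      have "(?g \<longlongrightarrow> C * (\<bar>fst z - t\<bar> * \<delta>) + C * dist (snd z) (s, \<theta>) powr \<beta>) (at z within ?A)"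
        using \<beta> by (intro tendsto_intros tendsto_powr') (auto simp: zt)
      then show "(?g \<longlongrightarrow> 0) (at z within ?A)" using \<beta> by (simp add: zt)
    qed
    then show "(?f \<longlongrightarrow> ?f z) (at z within ?A)" .
  qed
  with d show ?thesis by blast
qed

section \<open>Unit normals and vector-valued operators\<close>

definition unit_cross :: "real^3 \<Rightarrow> real^3 \<Rightarrow> real^3" where
  "unit_cross a b = ((cross3 a b \<bullet> cross3 a b) powr (- 1 / 2)) *\<^sub>R cross3 a b"

lemma unit_cross_scale:
  assumes "0 < c"
  shows "unit_cross (c *\<^sub>R a) (c *\<^sub>R b) = unit_cross a b"
proof -
  have X: "cross3 (c *\<^sub>R a) (c *\<^sub>R b) = c\<^sup>2 *\<^sub>R cross3 a b"
    by (simp add: cross_mult_left cross_mult_right power2_eq_square)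
  have "((c\<^sup>2)\<^sup>2 * x) powr (- 1 / 2) = inverse (c\<^sup>2) * x powr (- 1 / 2)" if "0 \<le> x" for x
  proof -
    have "((c\<^sup>2)\<^sup>2 * x) powr (- 1 / 2) = ((c\<^sup>2) powr 2) powr (- 1 / 2) * x powr (- 1 / 2)"
      using assms that by (simp add: powr_mult powr_numeral)
    also have "((c\<^sup>2) powr 2) powr (- 1 / 2) = (c\<^sup>2) powr - 1" by (simp only: powr_powr) simp
    finally show ?thesis using assms by (simp add: powr_minus)
  qed
  note P = this[OF inner_ge_zero[of "cross3 a b"]]
  have i: "c\<^sup>2 *\<^sub>R cross3 a b \<bullet> c\<^sup>2 *\<^sub>R cross3 a b = (c\<^sup>2)\<^sup>2 * (cross3 a b \<bullet> cross3 a b)"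
    by (simp add: power2_eq_square)
  have "inverse (c\<^sup>2) * c\<^sup>2 = 1" using assms by simp
  then show ?thesis unfolding unit_cross_def X i P scaleR_scaleR by simp
qed

lemma unit_cross_unit:
  assumes "cross3 a b \<noteq> 0"
  shows "unit_cross a b \<bullet> unit_cross a b = 1" "unit_cross a b \<bullet> a = 0" "unit_cross a b \<bullet> b = 0"
proof -
  let ?x = "cross3 a b \<bullet> cross3 a b"
  have x: "0 < ?x" using assms by simp
  have "?x powr (- 1 / 2) * (?x powr (- 1 / 2) * ?x powr 1) = 1"
    unfolding powr_add[symmetric] using x by simp
  then show "unit_cross a b \<bullet> unit_cross a b = 1" using x by (simp add: unit_cross_def)
  show "unit_cross a b \<bullet> a = 0" "unit_cross a b \<bullet> b = 0"
    by (simp_all add: unit_cross_def dot_cross_self)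
qed

definition gN :: "real \<Rightarrow> real \<Rightarrow> real \<Rightarrow> jet \<Rightarrow> real^3" where
  "gN \<alpha> s \<theta> J = unit_cross (gA 1 \<alpha> s \<theta> J) (gA 2 \<alpha> s \<theta> J)"

definition vgood :: "real \<Rightarrow> (real \<Rightarrow> real \<Rightarrow> real \<Rightarrow> jet \<Rightarrow> real^3) \<Rightarrow> bool" where
  "vgood \<beta> F \<longleftrightarrow> (\<forall>k. good \<beta> (\<lambda>\<alpha> s \<theta> J. F \<alpha> s \<theta> J $ k))"

lemma vgood_inner: "vgood \<beta> F \<Longrightarrow> vgood \<beta> G \<Longrightarrow> good \<beta> (\<lambda>\<alpha> s \<theta> J. F \<alpha> s \<theta> J \<bullet> G \<alpha> s \<theta> J)"
  unfolding vgood_def inner_3 by (intro good_add good_mult) blast+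

lemma vgood_add: "vgood \<beta> F \<Longrightarrow> vgood \<beta> G \<Longrightarrow> vgood \<beta> (\<lambda>\<alpha> s \<theta> J. F \<alpha> s \<theta> J + G \<alpha> s \<theta> J)"
  unfolding vgood_def vector_add_component by (intro allI good_add) blast+

lemma vgood_scaleR: "good \<beta> f \<Longrightarrow> vgood \<beta> G \<Longrightarrow> vgood \<beta> (\<lambda>\<alpha> s \<theta> J. f \<alpha> s \<theta> J *\<^sub>R G \<alpha> s \<theta> J)"
  unfolding vgood_def vector_scaleR_component real_scaleR_def by (intro allI good_mult) blast+

lemma vgood_cross3: "vgood \<beta> F \<Longrightarrow> vgood \<beta> G \<Longrightarrow> vgood \<beta> (\<lambda>\<alpha> s \<theta> J. cross3 (F \<alpha> s \<theta> J) (G \<alpha> s \<theta> J))"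
  unfolding vgood_def forall_3 cross3_def vector_3 by (intro conjI good_diff good_mult) blast+

lemma vgood_gam: "vgood \<beta> F \<Longrightarrow> vgood \<beta> G \<Longrightarrow> vgood \<beta> (\<lambda>\<alpha> s \<theta> J. gam (F \<alpha> s \<theta> J) (G \<alpha> s \<theta> J))"
  unfolding vgood_def forall_3 gam_nth
  using good_coeff[of 0 \<beta> "\<lambda>\<alpha> s \<theta>. 0"]
  by (intro conjI good_mult good_minus) (auto simp: hol_zero)

lemma ilam_pos: "0 < \<alpha> \<Longrightarrow> 0 < ilam \<alpha> s \<theta>"
  by (simp add: ilam_def lam_pos)

lemma zero_jet:
  assumes "J = (\<lambda>_. 0)"
  shows "gA i \<alpha> s \<theta> J = tang i \<alpha> s \<theta>" "gC i j \<alpha> s \<theta> J = covd i j \<alpha> s \<theta>" "D0 \<alpha> s \<theta> J = 1"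
proof -
  have W: "W0 \<alpha> s \<theta> J = 0" "W1 i \<alpha> s \<theta> J = 0" "W2 i j \<alpha> s \<theta> J = 0" for i j
    unfolding W0_def W1_def W2_def assms by simp_all
  show A: "gA i \<alpha> s \<theta> J = tang i \<alpha> s \<theta>" for i
    unfolding gA_def A2_def D0_def D1_def m0_def m1_def u1_def W by (simp add: vec_eq_iff forall_3)
  show "D0 \<alpha> s \<theta> J = 1" unfolding D0_def W by simp
  show "gC i j \<alpha> s \<theta> J = covd i j \<alpha> s \<theta>"
    unfolding gC_def covd_def A gA'_def A2'_def A2_def D0_def D1_def D2_def m0_def m1_def m2_def u2_def W
    by (simp add: vec_eq_iff forall_3)
qed

context
  fixes \<beta> :: real
  assumes \<beta>: "0 < \<beta>" "\<beta> < 1"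
begin

section \<open>Quadratic remainders for the graph, its normal and its mean curvature\<close>

lemma good_coefs:
  "good \<beta> (\<lambda>\<alpha> s \<theta> J. hlen \<alpha> s \<theta>)" "good \<beta> (\<lambda>\<alpha> s \<theta> J. hlen1 i \<alpha> s \<theta>)" "good \<beta> (\<lambda>\<alpha> s \<theta> J. hlen2 i j \<alpha> s \<theta>)"
  "good \<beta> (\<lambda>\<alpha> s \<theta> J. hd0 k \<alpha> s \<theta>)" "good \<beta> (\<lambda>\<alpha> s \<theta> J. hd1 k i \<alpha> s \<theta>)" "good \<beta> (\<lambda>\<alpha> s \<theta> J. hd2 k i j \<alpha> s \<theta>)"
  "good \<beta> (\<lambda>\<alpha> s \<theta> J. ilam \<alpha> s \<theta>)" "good \<beta> (\<lambda>\<alpha> s \<theta> J. ilam \<alpha> s \<theta> * tang i \<alpha> s \<theta> $ k)"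
  "good \<beta> (\<lambda>\<alpha> s \<theta> J. (ilam \<alpha> s \<theta>)\<^sup>2 * tang' i j \<alpha> s \<theta> $ k)"
proof -
  note gb = good_bd[OF _ \<beta>]
  have h0: "bd n (hd0 k)" for n k using bd_hdir[of n k] by (simp add: hd0_def[abs_def])
  have h1: "bd n (hd1 k i)" for n k i using bd_pd(1)[OF h0] by (simp add: hd1_def[abs_def])
  have h2: "bd n (hd2 k i j)" for n k i j using bd_pd(1)[OF h1] by (simp add: hd2_def[abs_def])
  have l1: "bd n (hlen1 i)" for n i using bd_pd(1)[OF bd_hlen(1)] by (simp add: hlen1_def[abs_def])
  have l2: "bd n (hlen2 i j)" for n i j using bd_pd(1)[OF l1] by (simp add: hlen2_def[abs_def])
  show "good \<beta> (\<lambda>\<alpha> s \<theta> J. hlen \<alpha> s \<theta>)" "good \<beta> (\<lambda>\<alpha> s \<theta> J. hlen1 i \<alpha> s \<theta>)" "good \<beta> (\<lambda>\<alpha> s \<theta> J. hlen2 i j \<alpha> s \<theta>)"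
  "good \<beta> (\<lambda>\<alpha> s \<theta> J. hd0 k \<alpha> s \<theta>)" "good \<beta> (\<lambda>\<alpha> s \<theta> J. hd1 k i \<alpha> s \<theta>)" "good \<beta> (\<lambda>\<alpha> s \<theta> J. hd2 k i j \<alpha> s \<theta>)"
  "good \<beta> (\<lambda>\<alpha> s \<theta> J. ilam \<alpha> s \<theta>)" "good \<beta> (\<lambda>\<alpha> s \<theta> J. ilam \<alpha> s \<theta> * tang i \<alpha> s \<theta> $ k)"
  "good \<beta> (\<lambda>\<alpha> s \<theta> J. (ilam \<alpha> s \<theta>)\<^sup>2 * tang' i j \<alpha> s \<theta> $ k)"
    by (intro gb bd_hlen l1 l2 h0 h1 h2 bd_ilam bd_tang bd_tang')+
qed

lemma good_jets: "good \<beta> (\<lambda>\<alpha> s \<theta> J. J 0)" "good \<beta> (\<lambda>\<alpha> s \<theta> J. J (idx1 i))" "good \<beta> (\<lambda>\<alpha> s \<theta> J. J (idx2 i j))"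
  by (intro good_jet, simp add: idx1_def idx2_def)+

lemma good_W: "good \<beta> W0" "good \<beta> (W1 i)" "good \<beta> (W2 i j)"
  unfolding W0_def[abs_def] W1_def[abs_def] W2_def[abs_def]
  by (intro good_add good_mult good_coefs good_jets)+

lemmas good_rules = good_add good_diff good_mult good_coefs good_cosh_sinh good_W

lemma good_D: "good \<beta> D0" "good \<beta> (D1 i)" "good \<beta> (D2 i j)"
proof -
  show D: "good \<beta> D0" unfolding D0_def[abs_def] by (intro good_rules)
  show "good \<beta> (D1 i)" unfolding D1_def[abs_def] by (intro good_rules)
  show "good \<beta> (D2 i j)" unfolding D2_def[abs_def] by (intro good_rules D)
qed

lemma good_invD: "good \<beta> (\<lambda>\<alpha> s \<theta> J. inverse (D0 \<alpha> s \<theta> J))"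
proof -
  have "good \<beta> (\<lambda>\<alpha> s \<theta> J. D0 \<alpha> s \<theta> J powr - 1)"
    by (rule good_powr[OF good_D(1), of 1]) (simp_all add: zero_jet)
  then show ?thesis
    by (rule good_cong) (use D0_pos end_pt_pos in \<open>simp add: powr_minus less_imp_le\<close>)
qed

lemma good_m: "good \<beta> m0" "good \<beta> (m1 i)" "good \<beta> (m2 i j)"
proof -
  show m: "good \<beta> m0" unfolding m0_def[abs_def] by (intro good_rules)
  show "good \<beta> (m1 i)" unfolding m1_def[abs_def] by (intro good_rules)
  show "good \<beta> (m2 i j)" unfolding m2_def[abs_def] by (intro good_rules m)
qed

lemma good_u: "good \<beta> (u1 i)" "good \<beta> (u2 i j)"
  unfolding u1_def[abs_def] u2_def[abs_def] by (intro good_rules)+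

lemma good_A2:
  "good \<beta> (\<lambda>\<alpha> s \<theta> J. ilam \<alpha> s \<theta> * A2 i \<alpha> s \<theta> J)"
  "good \<beta> (\<lambda>\<alpha> s \<theta> J. (ilam \<alpha> s \<theta>)\<^sup>2 * A2' i j \<alpha> s \<theta> J)"
proof -
  have "good \<beta> (\<lambda>\<alpha> s \<theta> J. ilam \<alpha> s \<theta> * tang i \<alpha> s \<theta> $ 2
      - ilam \<alpha> s \<theta> * (D1 i \<alpha> s \<theta> J * inverse (D0 \<alpha> s \<theta> J)))"
    by (intro good_rules good_D good_invD)
  then show "good \<beta> (\<lambda>\<alpha> s \<theta> J. ilam \<alpha> s \<theta> * A2 i \<alpha> s \<theta> J)"
    by (rule good_cong) (simp add: A2_def right_diff_distrib)
  have "good \<beta> (\<lambda>\<alpha> s \<theta> J. (ilam \<alpha> s \<theta>)\<^sup>2 * tang' i j \<alpha> s \<theta> $ 2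
      + ilam \<alpha> s \<theta> * ilam \<alpha> s \<theta> * (D1 i \<alpha> s \<theta> J * D1 j \<alpha> s \<theta> J * (inverse (D0 \<alpha> s \<theta> J) * inverse (D0 \<alpha> s \<theta> J))
       - D2 i j \<alpha> s \<theta> J * inverse (D0 \<alpha> s \<theta> J)))"
    by (intro good_rules good_D good_invD)
  then show "good \<beta> (\<lambda>\<alpha> s \<theta> J. (ilam \<alpha> s \<theta>)\<^sup>2 * A2' i j \<alpha> s \<theta> J)"
    by (rule good_cong) (simp add: A2'_def power2_eq_square algebra_simps)
qed

lemma vgood_gA: "vgood \<beta> (\<lambda>\<alpha> s \<theta> J. ilam \<alpha> s \<theta> *\<^sub>R gA i \<alpha> s \<theta> J)"
  unfolding vgood_def forall_3
proof (intro conjI)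
  have "good \<beta> (\<lambda>\<alpha> s \<theta> J. D0 \<alpha> s \<theta> J * (ilam \<alpha> s \<theta> * tang i \<alpha> s \<theta> $ 1)
     + m0 \<alpha> s \<theta> J * (ilam \<alpha> s \<theta> * A2 i \<alpha> s \<theta> J) + ilam \<alpha> s \<theta> * m1 i \<alpha> s \<theta> J)"
    by (intro good_rules good_D good_m good_A2)
  then show "good \<beta> (\<lambda>\<alpha> s \<theta> J. (ilam \<alpha> s \<theta> *\<^sub>R gA i \<alpha> s \<theta> J) $ 1)"
    by (rule good_cong) (simp add: gA_def algebra_simps)
  show "good \<beta> (\<lambda>\<alpha> s \<theta> J. (ilam \<alpha> s \<theta> *\<^sub>R gA i \<alpha> s \<theta> J) $ 2)"
    using good_A2(1) by (simp add: gA_def)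
  have "good \<beta> (\<lambda>\<alpha> s \<theta> J. ilam \<alpha> s \<theta> * tang i \<alpha> s \<theta> $ 3 + ilam \<alpha> s \<theta> * u1 i \<alpha> s \<theta> J)"
    by (intro good_rules good_u)
  then show "good \<beta> (\<lambda>\<alpha> s \<theta> J. (ilam \<alpha> s \<theta> *\<^sub>R gA i \<alpha> s \<theta> J) $ 3)"
    by (rule good_cong) (simp add: gA_def algebra_simps)
qed

lemma vgood_gA': "vgood \<beta> (\<lambda>\<alpha> s \<theta> J. (ilam \<alpha> s \<theta>)\<^sup>2 *\<^sub>R gA' i j \<alpha> s \<theta> J)"
  unfolding vgood_def forall_3
proof (intro conjI)
  have "good \<beta> (\<lambda>\<alpha> s \<theta> J. ilam \<alpha> s \<theta> * D1 j \<alpha> s \<theta> J * (ilam \<alpha> s \<theta> * tang i \<alpha> s \<theta> $ 1)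
     + D0 \<alpha> s \<theta> J * ((ilam \<alpha> s \<theta>)\<^sup>2 * tang' i j \<alpha> s \<theta> $ 1)
     + ilam \<alpha> s \<theta> * m1 j \<alpha> s \<theta> J * (ilam \<alpha> s \<theta> * A2 i \<alpha> s \<theta> J)
     + m0 \<alpha> s \<theta> J * ((ilam \<alpha> s \<theta>)\<^sup>2 * A2' i j \<alpha> s \<theta> J) + ilam \<alpha> s \<theta> * ilam \<alpha> s \<theta> * m2 i j \<alpha> s \<theta> J)"
    by (intro good_rules good_D good_m good_A2)
  then show "good \<beta> (\<lambda>\<alpha> s \<theta> J. ((ilam \<alpha> s \<theta>)\<^sup>2 *\<^sub>R gA' i j \<alpha> s \<theta> J) $ 1)"
    by (rule good_cong) (simp add: gA'_def power2_eq_square algebra_simps)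
  show "good \<beta> (\<lambda>\<alpha> s \<theta> J. ((ilam \<alpha> s \<theta>)\<^sup>2 *\<^sub>R gA' i j \<alpha> s \<theta> J) $ 2)"
    using good_A2(2) by (simp add: gA'_def)
  have "good \<beta> (\<lambda>\<alpha> s \<theta> J. (ilam \<alpha> s \<theta>)\<^sup>2 * tang' i j \<alpha> s \<theta> $ 3 + ilam \<alpha> s \<theta> * ilam \<alpha> s \<theta> * u2 i j \<alpha> s \<theta> J)"
    by (intro good_rules good_u)
  then show "good \<beta> (\<lambda>\<alpha> s \<theta> J. ((ilam \<alpha> s \<theta>)\<^sup>2 *\<^sub>R gA' i j \<alpha> s \<theta> J) $ 3)"
    by (rule good_cong) (simp add: gA'_def power2_eq_square algebra_simps)
qed

lemma vgood_gC: "vgood \<beta> (\<lambda>\<alpha> s \<theta> J. (ilam \<alpha> s \<theta>)\<^sup>2 *\<^sub>R gC i j \<alpha> s \<theta> J)"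
proof -
  have "vgood \<beta> (\<lambda>\<alpha> s \<theta> J. (ilam \<alpha> s \<theta>)\<^sup>2 *\<^sub>R gA' i j \<alpha> s \<theta> J
     + gam (ilam \<alpha> s \<theta> *\<^sub>R gA j \<alpha> s \<theta> J) (ilam \<alpha> s \<theta> *\<^sub>R gA i \<alpha> s \<theta> J))"
    by (intro vgood_add vgood_gam vgood_gA vgood_gA')
  then show ?thesis by (simp add: gC_def gam_scaleR power2_eq_square scaleR_add_right)
qed

abbreviation gX :: "real \<Rightarrow> real \<Rightarrow> real \<Rightarrow> jet \<Rightarrow> real^3" where
  "gX \<alpha> s \<theta> J \<equiv> cross3 (ilam \<alpha> s \<theta> *\<^sub>R gA 1 \<alpha> s \<theta> J) (ilam \<alpha> s \<theta> *\<^sub>R gA 2 \<alpha> s \<theta> J)"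

lemma vgood_gX: "vgood \<beta> gX"
  by (intro vgood_cross3 vgood_gA)

text \<open>At the zero jet the scaled tangent vectors are orthogonal with lengths 1 and 1 / p, so
  the squared length of their cross product is 1 / p^2; and p^2 \<le> 1 + 1 / \<alpha>^2 \<le>
  9/4.\<close>

lemma gX_zero_lower:
  assumes e: "end_pt \<alpha> s" and J: "J = (\<lambda>_. 0)"
  shows "4 / 9 \<le> gX \<alpha> s \<theta> J \<bullet> gX \<alpha> s \<theta> J"
proof -
  have \<alpha>: "0 < \<alpha>" using end_pt_pos[OF e] by simp
  have p: "0 < cp \<alpha> s \<theta>" using cp_ge1[of \<alpha> s \<theta>] by simp
  have il: "ilam \<alpha> s \<theta> * lam 1 \<alpha> s \<theta> = 1" "ilam \<alpha> s \<theta> * lam 2 \<alpha> s \<theta> = 1 / cp \<alpha> s \<theta>"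
    using lam_pos[OF \<alpha>, of 1 s \<theta>] lam_pos[OF \<alpha>, of 2 s \<theta>] lam_quot[OF \<alpha>, of s \<theta>] p
    by (simp_all add: ilam_def divide_simps)
  have "gX \<alpha> s \<theta> J = ((ilam \<alpha> s \<theta> * lam 1 \<alpha> s \<theta>) * (ilam \<alpha> s \<theta> * lam 2 \<alpha> s \<theta>)) *\<^sub>R nfr \<alpha> s \<theta>"
    unfolding zero_jet[OF J] cross_mult_left cross_mult_right tang_cross[OF \<alpha>] by simp
  then have "gX \<alpha> s \<theta> J \<bullet> gX \<alpha> s \<theta> J = 1 / (cp \<alpha> s \<theta>)\<^sup>2"
    unfolding il by (simp add: nfr_unit(1)[OF \<alpha>] power2_eq_square)
  moreover have "(cp \<alpha> s \<theta>)\<^sup>2 \<le> 9 / 4"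
  proof -
    have "(cos \<theta>)\<^sup>2 / \<alpha>\<^sup>2 \<le> 1 / \<alpha>\<^sup>2" by (intro divide_right_mono) (auto simp: abs_square_le_1)
    then show ?thesis using cp_sq[OF \<alpha>, of s \<theta>] end_pt_param(2)[OF e] by linarith
  qed
  moreover have "1 / (9 / 4) \<le> 1 / (cp \<alpha> s \<theta>)\<^sup>2"
    using p calculation(2) by (intro divide_left_mono) auto
  ultimately show ?thesis by simp
qed

text \<open>The unit normal does not see a common factor of the tangent vectors, so it is formed
  from the scaled ones, whose cross product stays away from 0.\<close>

lemma vgood_gN: "vgood \<beta> gN"
proof -
  have "vgood \<beta> (\<lambda>\<alpha> s \<theta> J. (gX \<alpha> s \<theta> J \<bullet> gX \<alpha> s \<theta> J) powr (- 1 / 2) *\<^sub>R gX \<alpha> s \<theta> J)"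
    by (intro vgood_scaleR vgood_gX good_powr[where c = "4 / 9"] vgood_inner)
      (assumption | rule gX_zero_lower[OF _ refl] | simp)+
  then have "vgood \<beta> (\<lambda>\<alpha> s \<theta> J. unit_cross (ilam \<alpha> s \<theta> *\<^sub>R gA 1 \<alpha> s \<theta> J) (ilam \<alpha> s \<theta> *\<^sub>R gA 2 \<alpha> s \<theta> J))"
    by (simp add: unit_cross_def)
  then show ?thesis
    unfolding vgood_def gN_def
    by (intro allI) (rule good_cong, blast, simp add: unit_cross_scale ilam_pos end_pt_pos)
qed

text \<open>The unscaled tangent vectors have no uniform bounds. Scale invariance replaces them by
  their multiples with \<open>ilam\<close>, and the second derivatives by multiples with its square,
  without changing the value.\<close>

lemma good_gH: "good \<beta> gH"
proof -
  let ?a = "\<lambda>i \<alpha> s \<theta> J. ilam \<alpha> s \<theta> *\<^sub>R gA i \<alpha> s \<theta> J"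
  let ?c = "\<lambda>i j \<alpha> s \<theta> J. (ilam \<alpha> s \<theta>)\<^sup>2 *\<^sub>R gC i j \<alpha> s \<theta> J"
  have "good \<beta> (\<lambda>\<alpha> s \<theta> J. twoH (?a 1 \<alpha> s \<theta> J) (?a 2 \<alpha> s \<theta> J) (?c 1 1 \<alpha> s \<theta> J)
      (?c 1 2 \<alpha> s \<theta> J + ?c 2 1 \<alpha> s \<theta> J) (?c 2 2 \<alpha> s \<theta> J))"
    unfolding twoH_def
    by (intro good_add good_diff good_mult vgood_inner vgood_add vgood_gA vgood_gC vgood_gX
        good_powr[where c = "4 / 9"])
      (assumption | rule gX_zero_lower[OF _ refl] | simp)+
  then show ?thesis
    by (rule good_cong)
      (simp add: gH_def scaleR_add_right[symmetric] twoH_scale ilam_pos end_pt_pos)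
qed

text \<open>The whole deformation from the catenoid to the graph must consist of immersions; a
  neighbourhood of the zero jet provides this for all small jets at once.\<close>

lemma gA_immersed:
  "\<exists>\<delta>>0. \<forall>\<alpha> s \<theta> J. end_pt \<alpha> s \<longrightarrow> (\<forall>i<6. \<bar>J i\<bar> \<le> \<delta>) \<longrightarrow> cross3 (gA 1 \<alpha> s \<theta> J) (gA 2 \<alpha> s \<theta> J) \<noteq> 0"
proof -
  have "\<exists>\<delta>>0. \<forall>\<alpha> s \<theta> J. end_pt \<alpha> s \<longrightarrow> (\<forall>i<6. \<bar>J i\<bar> \<le> \<delta>) \<longrightarrow> 0 < gX \<alpha> s \<theta> J \<bullet> gX \<alpha> s \<theta> J"
    by (rule good_nonneg_nhd[OF vgood_inner[OF vgood_gX vgood_gX], of "4 / 9"])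
      (assumption | rule gX_zero_lower[OF _ refl] | simp)+
  then obtain \<delta> where \<delta>: "\<delta> > 0"
    "\<And>\<alpha> s \<theta> J. end_pt \<alpha> s \<Longrightarrow> \<forall>i<6. \<bar>J i\<bar> \<le> \<delta> \<Longrightarrow> 0 < gX \<alpha> s \<theta> J \<bullet> gX \<alpha> s \<theta> J"
    by blast
  have "cross3 (gA 1 \<alpha> s \<theta> J) (gA 2 \<alpha> s \<theta> J) \<noteq> 0" if "end_pt \<alpha> s" "\<forall>i<6. \<bar>J i\<bar> \<le> \<delta>" for \<alpha> s \<theta> J
    using \<delta>(2)[OF that, of \<theta>] by (auto simp: cross_mult_left cross_mult_right)
  with \<delta>(1) show ?thesis by blast
qed

end

section \<open>The mean curvature of a graph with respect to the normalized cross product\<close>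

lemma is_jet_cmult: "is_jet I j \<Longrightarrow> is_jet I (\<lambda>s \<theta> i. c * j s \<theta> i)"
proof -
  assume "is_jet I j"
  moreover have "has_pd I k (\<lambda>s \<theta>. c * f s \<theta>) (c * D) s \<theta>" if "has_pd I k f D s \<theta>" for k f D s \<theta>
    using has_pd_mult[OF has_pd_const that, of c] by simp
  ultimately show ?thesis unfolding is_jet_def by blast
qed

lemma graph_mean_curvature:
  assumes \<alpha>: "0 < \<alpha>" and S: "0 < S" and j: "is_jet {S..} j"
    and w: "\<And>s \<theta>. s \<in> {S..} \<Longrightarrow> w s \<theta> = j s \<theta> 0"
    and nz: "\<And>s \<theta>. s \<in> {S..} \<Longrightarrow> cross3 (gA 1 \<alpha> s \<theta> (j s \<theta>)) (gA 2 \<alpha> s \<theta> (j s \<theta>)) \<noteq> 0"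
    and n: "\<And>s \<theta>. s \<in> {S..} \<Longrightarrow> n s \<theta> = frv (normal_graph \<alpha> w s \<theta> $ 2) (gN \<alpha> s \<theta> (j s \<theta>))"
    and s: "s \<in> {S..}"
  shows "mean_curvature {S..} (normal_graph \<alpha> w) n s \<theta> = gH \<alpha> s \<theta> (j s \<theta>) / 2"
proof -
  let ?A = "\<lambda>i s \<theta>. gA i \<alpha> s \<theta> (j s \<theta>)" and ?A' = "\<lambda>i k s \<theta>. gA' i k \<alpha> s \<theta> (j s \<theta>)"
  let ?N = "\<lambda>s \<theta>. gN \<alpha> s \<theta> (j s \<theta>)" and ?C = "\<lambda>i k. gC i k \<alpha> s \<theta> (j s \<theta>)"
  let ?X = "\<lambda>s \<theta>. cross3 (?A 1 s \<theta>) (?A 2 s \<theta>)"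
  have nb: "at s within {S..} \<noteq> bot" using s at_within_atLeast_neq_bot by auto
  note dA = has_pd_gA[OF \<alpha> S refl j s]
  \<comment> \<open>The derivative of the normal stays implicit: its products with the tangent
    vectors follow from differentiating their orthogonality to the normal.\<close>
  have "\<exists>N'. has_pd {S..} k ?N N' s \<theta>" for k
  proof -
    let ?X' = "cross3 (?A 1 s \<theta>) (?A' 2 k s \<theta>) + cross3 (?A' 1 k s \<theta>) (?A 2 s \<theta>)"
    have X: "has_pd {S..} k ?X ?X' s \<theta>" by (rule has_pd_cross3[OF dA dA])
    have "0 < ?X s \<theta> \<bullet> ?X s \<theta>" using nz[OF s] by simp
    then have "((\<lambda>x. x powr (- 1 / 2)) has_real_derivative (- 1 / 2) * (?X s \<theta> \<bullet> ?X s \<theta>) powr (- 1 / 2 - 1))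
        (at (?X s \<theta> \<bullet> ?X s \<theta>))"
      by (auto intro!: derivative_eq_intros)
    from has_pd_scaleR[OF has_pd_chain[OF this has_pd_inner[OF X X]] X]
    show ?thesis unfolding gN_def unit_cross_def by blast
  qed
  then obtain N' where N': "\<And>k. has_pd {S..} k ?N (N' k) s \<theta>" by metis
  have y: "normal_graph \<alpha> w s \<theta> $ 2 \<noteq> 0" if "s \<in> {S..}" for s \<theta>
    using normal_graph_y_pos[OF \<alpha> S refl j that w, of \<theta>] by simp
  note dY = has_pd_normal_graph[OF \<alpha> S refl j s w]
  have D: "cov_deriv {S..} (normal_graph \<alpha> w) k n s \<theta>
      = frv (normal_graph \<alpha> w s \<theta> $ 2) (N' k + gam (?A k s \<theta>) (?N s \<theta>))" for k
    by (rule cov_deriv_frv[OF y s nb dY n N'])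
  have AN: "?A i s \<theta> \<bullet> (N' k + gam (?A k s \<theta>) (?N s \<theta>)) = - (?C i k \<bullet> ?N s \<theta>)" for i k
  proof -
    have "has_pd {S..} k (\<lambda>s \<theta>. ?A i s \<theta> \<bullet> ?N s \<theta>) (?A i s \<theta> \<bullet> N' k + ?A' i k s \<theta> \<bullet> ?N s \<theta>) s \<theta>"
      by (rule has_pd_inner[OF dA N'])
    moreover have "0 = ?A i s \<theta> \<bullet> ?N s \<theta>" if "s \<in> {S..}" for s \<theta>
      using unit_cross_unit(2,3)[OF nz[OF that]] exhaust_2[of i] by (auto simp: gN_def inner_commute)
    then have "has_pd {S..} k (\<lambda>s \<theta>. ?A i s \<theta> \<bullet> ?N s \<theta>) 0 s \<theta>"
      by (intro has_pd_cong[OF has_pd_const[of _ _ 0] _ s]) auto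
    ultimately have "?A i s \<theta> \<bullet> N' k + ?A' i k s \<theta> \<bullet> ?N s \<theta> = 0" by (rule has_pd_unique[OF _ _ nb])
    then show ?thesis
      unfolding gC_def inner_add_left inner_add_right using gam_skew[of "?A k s \<theta>" "?A i s \<theta>" "?N s \<theta>"] by simp
  qed
  let ?x = "?X s \<theta> \<bullet> ?X s \<theta>"
  have x: "0 < ?x" using nz[OF s] by simp
  have "?x powr (- 1 / 2 - 1) = ?x powr (- 1 / 2) / ?x"
    using x powr_diff[of ?x "- 1 / 2" 1] by simp
  then have p: "?x powr (- 1 / 2) * v / ?x = v * ?x powr (- 3 / 2)" for v
    by simp
  have "trace (shape_operator {S..} (normal_graph \<alpha> w) n s \<theta>)
    = ?x powr (- 1 / 2) * ((?A 2 s \<theta> \<bullet> ?A 2 s \<theta>) * (?C 1 1 \<bullet> ?X s \<theta>)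
       - (?A 1 s \<theta> \<bullet> ?A 2 s \<theta>) * ((?C 1 2 + ?C 2 1) \<bullet> ?X s \<theta>)
       + (?A 1 s \<theta> \<bullet> ?A 1 s \<theta>) * (?C 2 2 \<bullet> ?X s \<theta>)) / ?x"
  proof -
    have e: "?C i k \<bullet> ?N s \<theta> = ?x powr (- 1 / 2) * (?C i k \<bullet> ?X s \<theta>)" for i k
      by (simp add: gN_def unit_cross_def)
    have "- (b * - (r * c1) - a * (- (r * c2) + - (r * c3)) + d * - (r * c4))
        = r * (b * c1 - a * (c2 + c3) + d * c4)" for a b d r c1 c2 c3 c4 :: real
      by (simp add: algebra_simps)
    note a = this
    show ?thesis
      by (rule trans[OF trace_shape(1)[where A = "\<lambda>i. ?A i s \<theta>", OF y[OF s] nb dY D nz[OF s]]])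
        (simp_all only: AN e inner_add_left a)
  qed
  then show ?thesis
    unfolding mean_curvature_def p gH_def twoH_def by simp
qed

lemma gN_zero:
  assumes \<alpha>: "0 < \<alpha>"
  shows "gN \<alpha> s \<theta> (\<lambda>_. 0) = nfr \<alpha> s \<theta>"
proof -
  have l: "0 < lam 1 \<alpha> s \<theta> * lam 2 \<alpha> s \<theta>" using lam_pos[OF \<alpha>] by simp
  have "(l * l) powr (- 1 / 2) * l = 1" if "0 < l" for l :: real
  proof -
    have "(l * l) powr (- 1 / 2) = (l powr 2) powr (- 1 / 2)" using that by (simp add: powr_numeral power2_eq_square)
    also have "\<dots> = l powr - 1" by (simp only: powr_powr) simp
    finally show ?thesis using that by (simp add: powr_minus)
  qed
  from this[OF l] show ?thesis
    unfolding gN_def unit_cross_def zero_jet[OF refl] tang_cross[OF \<alpha>]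
    by (simp add: nfr_unit(1)[OF \<alpha>])
qed

section \<open>Existence and uniqueness of the deformed normal\<close>

context
  fixes \<alpha> S :: real and j :: "real \<Rightarrow> real \<Rightarrow> jet" and w :: "real \<Rightarrow> real \<Rightarrow> real"
  assumes \<alpha>: "0 < \<alpha>" and S: "0 < S" and j: "is_jet {S..} j"
    and w: "\<And>s \<theta>. s \<in> {S..} \<Longrightarrow> w s \<theta> = j s \<theta> 0"
    and nz: "\<And>t s \<theta>. t \<in> {0..1} \<Longrightarrow> s \<in> {S..} \<Longrightarrow>
      cross3 (gA 1 \<alpha> s \<theta> (\<lambda>i. t * j s \<theta> i)) (gA 2 \<alpha> s \<theta> (\<lambda>i. t * j s \<theta> i)) \<noteq> 0"
    and cN: "\<And>k. continuous_on ({0..1} \<times> {S..} \<times> UNIV) (\<lambda>(t, s, \<theta>). gN \<alpha> s \<theta> (\<lambda>i. t * j s \<theta> i) $ k)"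
    and cD: "continuous_on ({0..1} \<times> {S..} \<times> UNIV) (\<lambda>(t, s, \<theta>). D0 \<alpha> s \<theta> (\<lambda>i. t * j s \<theta> i))"
begin

abbreviation graph_t :: "real \<Rightarrow> real \<Rightarrow> real \<Rightarrow> real^3" where
  "graph_t t \<equiv> normal_graph \<alpha> (\<lambda>s \<theta>. t * w s \<theta>)"

abbreviation normal_t :: "real \<Rightarrow> real \<Rightarrow> real \<Rightarrow> real^3" where
  "normal_t t s \<theta> \<equiv> frv (graph_t t s \<theta> $ 2) (gN \<alpha> s \<theta> (\<lambda>i. t * j s \<theta> i))"

lemma wt: "s \<in> {S..} \<Longrightarrow> t * w s \<theta> = t * j s \<theta> 0"
  using w by simp

lemma graph_t_y: "s \<in> {S..} \<Longrightarrow> graph_t t s \<theta> $ 2 \<noteq> 0"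
  using normal_graph_y_pos[OF \<alpha> S refl is_jet_cmult[OF j], of s "\<lambda>s \<theta>. t * w s \<theta>" t \<theta>] wt by simp

lemma graph_t_y_eq: "s \<in> {S..} \<Longrightarrow> graph_t t s \<theta> $ 2
    = catenoid \<alpha> s \<theta> $ 2 * inverse (D0 \<alpha> s \<theta> (\<lambda>i. t * j s \<theta> i))"
  using normal_graph_jet[OF \<alpha> S refl is_jet_cmult[OF j], of s "\<lambda>s \<theta>. t * w s \<theta>" t \<theta>] wt by simp

lemma graph_t_pd:
  assumes "s \<in> {S..}"
  shows "pd {S..} i (graph_t t) s \<theta> = frv (graph_t t s \<theta> $ 2) (gA i \<alpha> s \<theta> (\<lambda>i. t * j s \<theta> i))"
  by (rule pd_eq[OF has_pd_normal_graph[OF \<alpha> S refl is_jet_cmult[OF j] assms]])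
    (use wt assms at_within_atLeast_neq_bot in auto)

lemma normal_t_unit: "t \<in> {0..1} \<Longrightarrow> unit_normal {S..} (graph_t t) (normal_t t)"
  unfolding unit_normal_def
proof (intro ballI allI conjI)
  fix s \<theta> i assume t: "t \<in> {0..1}" and s: "s \<in> {S..}"
  note u = unit_cross_unit[OF nz[OF t s]]
  show "gprod (graph_t t s \<theta>) (normal_t t s \<theta>) (normal_t t s \<theta>) = 1"
    unfolding gprod_frv[OF graph_t_y[OF s]] gN_def by (rule u(1))
  show "gprod (graph_t t s \<theta>) (normal_t t s \<theta>) (pd {S..} i (graph_t t) s \<theta>) = 0"
    unfolding graph_t_pd[OF s] gprod_frv[OF graph_t_y[OF s]] gN_def
    using u(2,3)[of \<theta>] exhaust_2[of i] by auto
qed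

lemma normal_t_continuous: "continuous_on ({0..1} \<times> {S..} \<times> UNIV) (\<lambda>(t, s, \<theta>). normal_t t s \<theta>)"
proof -
  let ?A = "{0..1} \<times> {S..} \<times> (UNIV :: real set)"
  have D: "D0 \<alpha> s \<theta> J \<noteq> 0" if "s \<in> {S..}" for s \<theta> J
    using D0_pos[OF \<alpha>, of s \<theta> J] that S by auto
  have "continuous_on UNIV (\<lambda>z. catenoid \<alpha> (fst z) (snd z) $ 2)"
    using catenoid_continuous[OF \<alpha>] by (intro continuous_intros) (simp add: case_prod_beta)
  then have "continuous_on ?A (\<lambda>z. catenoid \<alpha> (fst (snd z)) (snd (snd z)) $ 2)"
    by (rule continuous_on_compose2[where g = "\<lambda>z. catenoid \<alpha> (fst z) (snd z) $ 2"]) (auto intro!: continuous_intros)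
  then have "continuous_on ?A (\<lambda>z. catenoid \<alpha> (fst (snd z)) (snd (snd z)) $ 2 *
      inverse (D0 \<alpha> (fst (snd z)) (snd (snd z)) (\<lambda>i. fst z * j (fst (snd z)) (snd (snd z)) i)))"
    using D cD by (intro continuous_on_mult continuous_on_inverse) (auto simp: case_prod_beta)
  then have y: "continuous_on ?A (\<lambda>z. graph_t (fst z) (fst (snd z)) (snd (snd z)) $ 2)"
    by (rule continuous_on_cong[THEN iffD1, rotated 2]) (auto simp: graph_t_y_eq)
  have "\<forall>k. continuous_on ?A (\<lambda>z. normal_t (fst z) (fst (snd z)) (snd (snd z)) $ k)"
    unfolding forall_3 frv_nth using cN
    by (intro conjI continuous_on_mult y) (simp_all add: case_prod_beta)
  then show ?thesis
    using continuous_on_vec_lambda[of ?A "\<lambda>k z. normal_t (fst z) (fst (snd z)) (snd (snd z)) $ k"]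
    by (simp add: case_prod_beta)
qed

lemma normal_t_zero:
  assumes "s \<in> {S..}"
  shows "normal_t 0 s \<theta> = cat_normal \<alpha> s \<theta>" "graph_t 0 s \<theta> $ 2 = catenoid \<alpha> s \<theta> $ 2"
proof -
  show y: "graph_t 0 s \<theta> $ 2 = catenoid \<alpha> s \<theta> $ 2"
    using graph_t_y_eq[OF assms, of 0 \<theta>] zero_jet(3)[OF refl, of \<alpha> s \<theta>] by simp
  show "normal_t 0 s \<theta> = cat_normal \<alpha> s \<theta>"
    unfolding y cat_normal_eq[OF \<alpha>] using gN_zero[OF \<alpha>] by simp
qed

text \<open>The normalized cross products along the rays t w are continuous in all variables. They
  start at the normal of the catenoid because \<open>nfr\<close> is the cross product of its frame
  in the same order.\<close>

lemma deformed_normal_exists: "deformed_normal \<alpha> S w (normal_t 1)"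
  unfolding deformed_normal_def
  by (rule exI[of _ normal_t])
    (use normal_t_continuous normal_t_unit normal_t_zero in auto)

text \<open>Over a fixed point a competing family differs from the cross product normal by a sign
  that is continuous in t on [0, 1] and equals 1 at t = 0.\<close>

lemma deformed_normal_unique:
  assumes "deformed_normal \<alpha> S w n" "s \<in> {S..}"
  shows "n s \<theta> = normal_t 1 s \<theta>"
proof -
  note s = assms(2)
  obtain N where cont: "continuous_on ({0..1} \<times> {S..} \<times> UNIV) (\<lambda>(t, s, \<theta>). N t s \<theta>)"
    and N0: "\<forall>s\<ge>S. \<forall>\<theta>. N 0 s \<theta> = cat_normal \<alpha> s \<theta>"
    and un: "\<forall>t\<in>{0..1}. unit_normal {S..} (graph_t t) (N t)" and N1: "N 1 = n"
    using assms(1) unfolding deformed_normal_def by blast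
  have "\<exists>m. N t s \<theta> = frv (graph_t t s \<theta> $ 2) m" for t by (rule frv_surj[OF graph_t_y[OF s]]) blast
  then obtain m where m: "\<And>t. N t s \<theta> = frv (graph_t t s \<theta> $ 2) (m t)" by metis
  let ?N = "\<lambda>t. gN \<alpha> s \<theta> (\<lambda>i. t * j s \<theta> i)"
  have mm: "m t = ?N t \<or> m t = - ?N t" if t: "t \<in> {0..1}" for t
  proof (rule unit_normal_frame[of _ _ "gA 1 \<alpha> s \<theta> (\<lambda>i. t * j s \<theta> i)" "gA 2 \<alpha> s \<theta> (\<lambda>i. t * j s \<theta> i)"])
    have "gprod (graph_t t s \<theta>) (N t s \<theta>) (N t s \<theta>) = 1"
      "gprod (graph_t t s \<theta>) (N t s \<theta>) (pd {S..} i (graph_t t) s \<theta>) = 0" for i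
      using un t s unfolding unit_normal_def by blast+
    note u = this[unfolded m graph_t_pd[OF s] gprod_frv[OF graph_t_y[OF s]]]
    show "m t \<bullet> m t = 1" "m t \<bullet> gA 1 \<alpha> s \<theta> (\<lambda>i. t * j s \<theta> i) = 0" "m t \<bullet> gA 2 \<alpha> s \<theta> (\<lambda>i. t * j s \<theta> i) = 0"
      using u(1) u(2)[of 1] u(2)[of 2] by auto
  qed (use unit_cross_unit[OF nz[OF t s]] nz[OF t s] in \<open>simp_all add: gN_def\<close>)
  have un1: "?N t \<bullet> ?N t = 1" if "t \<in> {0..1}" for t
    using unit_cross_unit(1)[OF nz[OF that s]] by (simp add: gN_def)
  have c: "continuous_on {0..1} (\<lambda>t. F t s \<theta> :: real^3)"
    if "continuous_on ({0..1} \<times> {S..} \<times> UNIV) (\<lambda>(t, s, \<theta>). F t s \<theta>)" for F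
  proof -
    have "continuous_on {0..1} (\<lambda>t. (t, s, \<theta>))" by (intro continuous_intros)
    from continuous_on_compose2[OF that this] s show ?thesis by auto
  qed
  have nzt: "frv y a = frv y b \<Longrightarrow> y \<noteq> 0 \<Longrightarrow> a = b" for y a b by (simp add: frv_inj)
  have "continuous_on {0..1} (\<lambda>t. m t \<bullet> ?N t)"
  proof -
    have cc: "continuous_on {0..1} (\<lambda>t. D0 \<alpha> s \<theta> (\<lambda>i. t * j s \<theta> i))"
    proof -
      have "continuous_on {0..1} (\<lambda>t. (t, s, \<theta>))" by (intro continuous_intros)
      from continuous_on_compose2[OF cD this] s show ?thesis by auto
    qed
    have D: "D0 \<alpha> s \<theta> J \<noteq> 0" for J using D0_pos[OF \<alpha>, of s \<theta> J] s S by auto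
    have "continuous_on {0..1} (\<lambda>t. catenoid \<alpha> s \<theta> $ 2 * inverse (D0 \<alpha> s \<theta> (\<lambda>i. t * j s \<theta> i)))"
      using D by (intro continuous_intros cc) auto
    then have y: "continuous_on {0..1} (\<lambda>t. graph_t t s \<theta> $ 2)"
      by (simp add: graph_t_y_eq[OF s])
    have "continuous_on {0..1} (\<lambda>t. gprod (graph_t t s \<theta>) (N t s \<theta>) (normal_t t s \<theta>))"
      unfolding gprod_eq using graph_t_y[OF s]
      by (intro continuous_intros y c[OF cont] c[OF normal_t_continuous]) auto
    then show ?thesis unfolding m gprod_frv[OF graph_t_y[OF s]] .
  qed
  moreover have "m t \<bullet> ?N t = 1 \<or> m t \<bullet> ?N t = - 1" if "t \<in> {0..1}" for t
    using mm[OF that] un1[OF that] by auto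
  ultimately have "m 1 \<bullet> ?N 1 = m 0 \<bullet> ?N 0"
    by (intro sign_constant[of "{0..1}" "\<lambda>t. m t \<bullet> ?N t"]) auto
  moreover have "m 0 = ?N 0"
  proof -
    have "frv (graph_t 0 s \<theta> $ 2) (m 0) = normal_t 0 s \<theta>"
      using m[of 0] N0 s normal_t_zero(1)[OF s, of \<theta>] by simp
    then show ?thesis by (rule nzt[OF _ graph_t_y[OF s]])
  qed
  ultimately have "m 1 \<bullet> ?N 1 = 1" using un1[of 0] by simp
  then have "m 1 = ?N 1" using mm[of 1] un1[of 1] by auto
  then show ?thesis using m[of 1] N1 by simp
qed

text \<open>A deformed normal is determined only on \<open>{S..}\<close>. All derivatives are taken
  within this set, so the mean curvature has the same value for every choice and the definite
  description is met.\<close>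

lemma mean_curvature_op_eq:
  assumes s: "s \<in> {S..}"
  shows "mean_curvature_op \<alpha> S w s \<theta> = gH \<alpha> s \<theta> (j s \<theta>) / 2"
proof -
  have mc: "mean_curvature {S..} (normal_graph \<alpha> w) n s \<theta> = gH \<alpha> s \<theta> (j s \<theta>) / 2"
    if "deformed_normal \<alpha> S w n" for n
    by (rule graph_mean_curvature[OF \<alpha> S j w _ _ s])
      (use nz[of 1] deformed_normal_unique[OF that] in auto)
  show ?thesis
    unfolding mean_curvature_op_def
    by (rule the_equality) (use mc deformed_normal_exists in \<open>auto intro!: exI[of _ "normal_t 1"]\<close>)
qed

end

section \<open>The linearization of the mean curvature\<close>

text \<open>The hypotheses hold at the zero jet. Orthogonality removes the derivative of the mixed
  term Q, and the value 1 turns the derivative of the power into -3 (X \<bullet> X') / |X|^2. When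
  the lemma is applied, the first variable is the ray parameter and the second a dummy.\<close>

lemma has_pd_twoH:
  fixes A B P Q R :: "real \<Rightarrow> real \<Rightarrow> real^3"
  assumes d: "has_pd I i A A' s \<theta>" "has_pd I i B B' s \<theta>" "has_pd I i P P' s \<theta>" "has_pd I i Q Q' s \<theta>"
      "has_pd I i R R' s \<theta>"
    and X: "X = cross3 (A s \<theta>) (B s \<theta>)" "X' = cross3 (A s \<theta>) B' + cross3 A' (B s \<theta>)" and nz: "X \<noteq> 0"
    and AB: "A s \<theta> \<bullet> B s \<theta> = 0" and H: "twoH (A s \<theta>) (B s \<theta>) (P s \<theta>) (Q s \<theta>) (R s \<theta>) = 1"
  shows "has_pd I i (\<lambda>s \<theta>. twoH (A s \<theta>) (B s \<theta>) (P s \<theta>) (Q s \<theta>) (R s \<theta>))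
    ((2 * (B s \<theta> \<bullet> B') * (P s \<theta> \<bullet> X) + (B s \<theta> \<bullet> B s \<theta>) * (P' \<bullet> X + P s \<theta> \<bullet> X')
      - (A' \<bullet> B s \<theta> + A s \<theta> \<bullet> B') * (Q s \<theta> \<bullet> X)
      + 2 * (A s \<theta> \<bullet> A') * (R s \<theta> \<bullet> X) + (A s \<theta> \<bullet> A s \<theta>) * (R' \<bullet> X + R s \<theta> \<bullet> X'))
      * (X \<bullet> X) powr (- 3 / 2) - 3 * (X \<bullet> X') / (X \<bullet> X)) s \<theta>"
proof -
  let ?g = "X \<bullet> X"
  have g: "0 < ?g" using nz by simp
  have dX: "has_pd I i (\<lambda>s \<theta>. cross3 (A s \<theta>) (B s \<theta>)) X' s \<theta>"
    unfolding X(2) by (rule has_pd_cross3[OF d(1,2)])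
  have "((\<lambda>x. x powr (- 3 / 2)) has_real_derivative (- 3 / 2) * ?g powr (- 3 / 2 - 1)) (at ?g)"
    using g by (auto intro!: derivative_eq_intros)
  then have pw: "has_pd I i (\<lambda>s \<theta>. (cross3 (A s \<theta>) (B s \<theta>) \<bullet> cross3 (A s \<theta>) (B s \<theta>)) powr (- 3 / 2))
      ((- 3 / 2) * ?g powr (- 3 / 2 - 1) * (X \<bullet> X' + X' \<bullet> X)) s \<theta>"
    unfolding X(1) by (rule has_pd_chain[where h = "\<lambda>x. x powr (- 3 / 2)", OF _ has_pd_inner[OF dX dX, unfolded X(1)]])
  let ?F = "(B s \<theta> \<bullet> B s \<theta>) * (P s \<theta> \<bullet> X) - (A s \<theta> \<bullet> B s \<theta>) * (Q s \<theta> \<bullet> X) + (A s \<theta> \<bullet> A s \<theta>) * (R s \<theta> \<bullet> X)"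
  have F: "?F * ?g powr (- 3 / 2) = 1" using H by (simp add: twoH_def X(1))
  have "?g powr (- 3 / 2 - 1) = ?g powr (- 3 / 2) / ?g" using g powr_diff[of ?g "- 3 / 2" 1] by simp
  then have "?F * ((- 3 / 2) * ?g powr (- 3 / 2 - 1) * (X \<bullet> X' + X' \<bullet> X))
      = (?F * ?g powr (- 3 / 2)) * (- 3 * (X \<bullet> X') / ?g)"
    by (simp add: inner_commute)
  then have e: "?F * ((- 3 / 2) * ?g powr (- 3 / 2 - 1) * (X \<bullet> X' + X' \<bullet> X)) = - 3 * (X \<bullet> X') / ?g"
    unfolding F by simp
  show ?thesis
    unfolding twoH_def
    apply (rule has_pd_eq)
     apply (rule has_pd_mult[OF has_pd_add[OF has_pd_diff[OF
        has_pd_mult[OF has_pd_inner[OF d(2,2)] has_pd_inner[OF d(3) dX]]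
        has_pd_mult[OF has_pd_inner[OF d(1,2)] has_pd_inner[OF d(4) dX]]]
        has_pd_mult[OF has_pd_inner[OF d(1,1)] has_pd_inner[OF d(5) dX]]] pw])
    unfolding X(1)[symmetric] e
    by (simp add: AB inner_commute algebra_simps)
qed

lemma sq_powr: "0 < L \<Longrightarrow> L\<^sup>2 powr (- 3 / 2) = inverse (L ^ 3)" for L :: real
proof -
  assume L: "0 < L"
  then have "L\<^sup>2 powr (- 3 / 2) = (L powr 2) powr (- 3 / 2)" by (simp add: powr_numeral)
  also have "\<dots> = inverse (L ^ 3)" using L by (simp only: powr_powr) (simp add: powr_minus powr_numeral)
  finally show ?thesis .
qed

lemma gH_zero:
  assumes \<alpha>: "0 < \<alpha>" and J: "J = (\<lambda>_. 0)"
  shows "gH \<alpha> s \<theta> J = 1"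
proof -
  define L where "L = lam 1 \<alpha> s \<theta> * lam 2 \<alpha> s \<theta>"
  have L: "0 < L" unfolding L_def using lam_pos[OF \<alpha>] by simp
  let ?n = "nfr \<alpha> s \<theta>" and ?h = "\<lambda>i k. covd i k \<alpha> s \<theta> \<bullet> nfr \<alpha> s \<theta>"
  have "gH \<alpha> s \<theta> J = ((lam 2 \<alpha> s \<theta>)\<^sup>2 * (L * ?h 1 1) + (lam 1 \<alpha> s \<theta>)\<^sup>2 * (L * ?h 2 2))
      * ((L *\<^sub>R ?n) \<bullet> (L *\<^sub>R ?n)) powr (- 3 / 2)"
    unfolding gH_def zero_jet[OF J] twoH_def tang_cross[OF \<alpha>] tang_inner[OF \<alpha>] L_def[symmetric]
      inner_scaleR_right by simp
  also have "(L *\<^sub>R ?n) \<bullet> (L *\<^sub>R ?n) = L\<^sup>2" by (simp add: nfr_unit[OF \<alpha>] power2_eq_square)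
  also have "(lam 2 \<alpha> s \<theta>)\<^sup>2 * (L * ?h 1 1) + (lam 1 \<alpha> s \<theta>)\<^sup>2 * (L * ?h 2 2)
      = L * ((lam 2 \<alpha> s \<theta>)\<^sup>2 * ?h 1 1 + (lam 1 \<alpha> s \<theta>)\<^sup>2 * ?h 2 2)" by (simp add: algebra_simps)
  also have "\<dots> = L ^ 3" unfolding catenoid_H[OF \<alpha>] by (simp add: L_def power2_eq_square power3_eq_cube)
  finally show ?thesis using L sq_powr[OF L] by simp
qed

text \<open>The variation field w n in frame components, since \<open>hlen\<close> times
  \<open>hdir\<close> is the normal, followed by its formal first and second derivatives.\<close>

definition gV :: "real \<Rightarrow> real \<Rightarrow> real \<Rightarrow> jet \<Rightarrow> real^3" where
  "gV \<alpha> s \<theta> J = (\<chi> k. W0 \<alpha> s \<theta> J * hd0 k \<alpha> s \<theta>)"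
definition gV1 :: "2 \<Rightarrow> real \<Rightarrow> real \<Rightarrow> real \<Rightarrow> jet \<Rightarrow> real^3" where
  "gV1 i \<alpha> s \<theta> J = (\<chi> k. W1 i \<alpha> s \<theta> J * hd0 k \<alpha> s \<theta> + W0 \<alpha> s \<theta> J * hd1 k i \<alpha> s \<theta>)"
definition gV2 :: "2 \<Rightarrow> 2 \<Rightarrow> real \<Rightarrow> real \<Rightarrow> real \<Rightarrow> jet \<Rightarrow> real^3" where
  "gV2 i j \<alpha> s \<theta> J = (\<chi> k. W2 i j \<alpha> s \<theta> J * hd0 k \<alpha> s \<theta> + W1 i \<alpha> s \<theta> J * hd1 k j \<alpha> s \<theta>
     + (W1 j \<alpha> s \<theta> J * hd1 k i \<alpha> s \<theta> + W0 \<alpha> s \<theta> J * hd2 k i j \<alpha> s \<theta>))"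

context
  fixes \<alpha> s \<theta> :: real and J :: jet
begin

abbreviation along :: "oper \<Rightarrow> real \<Rightarrow> real" where
  "along T t \<equiv> T \<alpha> s \<theta> (\<lambda>i. t * J i)"

lemma along_W:
  "along W0 t = t * W0 \<alpha> s \<theta> J" "along (W1 i) t = t * W1 i \<alpha> s \<theta> J" "along (W2 i j) t = t * W2 i j \<alpha> s \<theta> J"
  by (simp_all add: W0_def W1_def W2_def algebra_simps)

lemma along_zero:
  "along D0 0 = 1" "along (D1 i) 0 = 0" "along m0 0 = 0" "along (m1 i) 0 = 0" "along (A2 i) 0 = tang i \<alpha> s \<theta> $ 2"
  "along (D2 i j) 0 = 0"
  unfolding A2_def D0_def D1_def D2_def m0_def m1_def along_W by simp_all

lemmas along_const = along_zero[unfolded mult_zero_left]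

text \<open>At W = 0 the hyperbolic functions reduce to cosh = 1 and sinh = W to first order, so
  only terms linear in the jet remain. They assemble to the second component of the variation field
  and its derivatives.\<close>

lemma der_D: "(along D0 has_real_derivative - (gV \<alpha> s \<theta> J $ 2)) (at 0)"
  "(along (D1 i) has_real_derivative - (gV1 i \<alpha> s \<theta> J $ 2)) (at 0)"
  "(along (D2 i j) has_real_derivative - (gV2 i j \<alpha> s \<theta> J $ 2)) (at 0)"
  unfolding D0_def D1_def D2_def along_W gV_def gV1_def gV2_def vec_lambda_beta
  by (auto intro!: derivative_eq_intros simp: algebra_simps)

lemma der_m: "(along m0 has_real_derivative gV \<alpha> s \<theta> J $ 1) (at 0)"
  "(along (m1 i) has_real_derivative gV1 i \<alpha> s \<theta> J $ 1) (at 0)"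
  "(along (m2 i j) has_real_derivative gV2 i j \<alpha> s \<theta> J $ 1) (at 0)"
  unfolding m0_def m1_def m2_def along_W gV_def gV1_def gV2_def vec_lambda_beta
  by (auto intro!: derivative_eq_intros simp: algebra_simps)

lemma der_u: "(along (u1 i) has_real_derivative gV1 i \<alpha> s \<theta> J $ 3) (at 0)"
  "(along (u2 i j) has_real_derivative gV2 i j \<alpha> s \<theta> J $ 3) (at 0)"
  unfolding u1_def u2_def along_W gV1_def gV2_def vec_lambda_beta
  by (auto intro!: derivative_eq_intros simp: algebra_simps)

lemma der_A2: "(along (A2 i) has_real_derivative gV1 i \<alpha> s \<theta> J $ 2) (at 0)"
  "(along (A2' i j) has_real_derivative gV2 i j \<alpha> s \<theta> J $ 2) (at 0)"
  unfolding A2_def A2'_def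
  by (auto intro!: derivative_eq_intros der_D simp: along_const)

text \<open>With the last term moved to the other side this is \<nabla>_t Y_i = \<nabla>_i Y_t, the
  vanishing of torsion for the family of graphs.\<close>

lemma der_gA: "((\<lambda>t. gA i \<alpha> s \<theta> (\<lambda>i. t * J i)) has_vector_derivative
    (gV1 i \<alpha> s \<theta> J + gam (tang i \<alpha> s \<theta>) (gV \<alpha> s \<theta> J) - gam (gV \<alpha> s \<theta> J) (tang i \<alpha> s \<theta>))) (at 0)"
  unfolding has_vector_derivative_vec3 forall_3 gA_def vector_3 has_real_derivative_iff_has_vector_derivative[symmetric]
  by (auto intro!: derivative_eq_intros der_D der_m der_u der_A2 simp: along_const algebra_simps)

lemma der_gA': "((\<lambda>t. gA' i j \<alpha> s \<theta> (\<lambda>i. t * J i)) has_vector_derivative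
    (gV2 i j \<alpha> s \<theta> J + (gam (tang i \<alpha> s \<theta>) (gV1 j \<alpha> s \<theta> J) - gam (gV1 j \<alpha> s \<theta> J) (tang i \<alpha> s \<theta>))
      + (gam (tang' i j \<alpha> s \<theta>) (gV \<alpha> s \<theta> J) - gam (gV \<alpha> s \<theta> J) (tang' i j \<alpha> s \<theta>)))) (at 0)"
proof -
  have "along (A2' i j) 0 = tang' i j \<alpha> s \<theta> $ 2"
    unfolding A2'_def by (simp add: along_const)
  then show ?thesis
    unfolding has_vector_derivative_vec3 forall_3 gA'_def vector_3 has_real_derivative_iff_has_vector_derivative[symmetric]
    by (auto intro!: derivative_eq_intros der_D der_m der_u der_A2 simp: along_const algebra_simps)
qed

end

definition gv :: "2 \<Rightarrow> real \<Rightarrow> real \<Rightarrow> real \<Rightarrow> jet \<Rightarrow> real^3" where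
  "gv i \<alpha> s \<theta> J = gV1 i \<alpha> s \<theta> J + gam (tang i \<alpha> s \<theta>) (gV \<alpha> s \<theta> J)"

text \<open>The derivative in direction j of the components of \<open>gv i\<close>, before the
  connection term is added.\<close>

definition gz :: "2 \<Rightarrow> 2 \<Rightarrow> real \<Rightarrow> real \<Rightarrow> real \<Rightarrow> jet \<Rightarrow> real^3" where
  "gz i j \<alpha> s \<theta> J = gV2 i j \<alpha> s \<theta> J + gam (tang' i j \<alpha> s \<theta>) (gV \<alpha> s \<theta> J) + gam (tang i \<alpha> s \<theta>) (gV1 j \<alpha> s \<theta> J)"

text \<open>The curvature tensor R(u, v) a of the ambient space: that of the hyperbolic plane of
  curvature -1, applied to horizontal components.\<close>

definition curv :: "real^3 \<Rightarrow> real^3 \<Rightarrow> real^3 \<Rightarrow> real^3" where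
  "curv u v a = (u $ 1 * v $ 2 - v $ 1 * u $ 2) *\<^sub>R vector [- a $ 2, a $ 1, 0]"

text \<open>The derivative along the variation \<open>V\<close> is the covariant one up to the infinitesimal rotation
  \<open>gam V\<close>, under which the mean curvature is invariant; covariant derivatives commute up to curvature.\<close>

lemma der_gA_cov: "((\<lambda>t. gA i \<alpha> s \<theta> (\<lambda>i. t * J i)) has_vector_derivative
    (gv i \<alpha> s \<theta> J - gam (gV \<alpha> s \<theta> J) (tang i \<alpha> s \<theta>))) (at 0)"
  using der_gA by (simp add: gv_def)

lemma der_gC_cov: "((\<lambda>t. gC i j \<alpha> s \<theta> (\<lambda>i. t * J i)) has_vector_derivative
    (gz i j \<alpha> s \<theta> J + gam (tang j \<alpha> s \<theta>) (gv i \<alpha> s \<theta> J) + curv (gV \<alpha> s \<theta> J) (tang j \<alpha> s \<theta>) (tang i \<alpha> s \<theta>)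
      - gam (gV \<alpha> s \<theta> J) (covd i j \<alpha> s \<theta>))) (at 0)"
proof -
  have bb: "bounded_bilinear gam"
    by (simp add: bilinear_conv_bounded_bilinear[symmetric] bilinear_def linear_iff gam_add gam_scaleR)
  let ?a = "tang i \<alpha> s \<theta>" and ?b = "tang j \<alpha> s \<theta>" and ?V = "gV \<alpha> s \<theta> J"
  have z: "gA i \<alpha> s \<theta> (\<lambda>i. 0 * J i) = tang i \<alpha> s \<theta>" for i using zero_jet(1)[of "\<lambda>i. 0 * J i"] by simp
  have "((\<lambda>t. gC i j \<alpha> s \<theta> (\<lambda>i. t * J i)) has_vector_derivative
    (gV2 i j \<alpha> s \<theta> J + (gam ?a (gV1 j \<alpha> s \<theta> J) - gam (gV1 j \<alpha> s \<theta> J) ?a)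
      + (gam (tang' i j \<alpha> s \<theta>) ?V - gam ?V (tang' i j \<alpha> s \<theta>))
      + (gam ?b (gv i \<alpha> s \<theta> J - gam ?V ?a) + gam (gv j \<alpha> s \<theta> J - gam ?V ?b) ?a))) (at 0)"
    unfolding gC_def
    using has_vector_derivative_add[OF der_gA' bounded_bilinear.has_vector_derivative[OF bb der_gA_cov der_gA_cov],
        of i j \<alpha> s \<theta> J j \<alpha> s \<theta> J i \<alpha> s \<theta> J] by (simp only: z)
  moreover have "gV2 i j \<alpha> s \<theta> J + (gam ?a (gV1 j \<alpha> s \<theta> J) - gam (gV1 j \<alpha> s \<theta> J) ?a)
      + (gam (tang' i j \<alpha> s \<theta>) ?V - gam ?V (tang' i j \<alpha> s \<theta>))
      + (gam ?b (gv i \<alpha> s \<theta> J - gam ?V ?a) + gam (gv j \<alpha> s \<theta> J - gam ?V ?b) ?a)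
    = gz i j \<alpha> s \<theta> J + gam ?b (gv i \<alpha> s \<theta> J) + curv ?V ?b ?a - gam ?V (covd i j \<alpha> s \<theta>)"
    unfolding gz_def gv_def covd_def curv_def
    by (simp add: vec_eq_iff forall_3 algebra_simps)
  ultimately show ?thesis by simp
qed

text \<open>The covariant derivative of the unit normal of the catenoid.\<close>

definition dn :: "2 \<Rightarrow> real \<Rightarrow> real \<Rightarrow> real \<Rightarrow> real^3" where
  "dn i \<alpha> s \<theta> = nfr' i \<alpha> s \<theta> + gam (tang i \<alpha> s \<theta>) (nfr \<alpha> s \<theta>)"

text \<open>\<open>gam v\<close> is an infinitesimal rotation and therefore acts on cross products
  as a derivation.\<close>

lemma cross3_gam: "cross3 (gam v a) b + cross3 a (gam v b) = gam v (cross3 a b)"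
  by (simp add: cross3_def vec_eq_iff forall_3 algebra_simps)

section \<open>First variation of the mean curvature along the jet of a function\<close>

context
  fixes \<alpha> S :: real and j :: "real \<Rightarrow> real \<Rightarrow> jet"
  assumes \<alpha>: "0 < \<alpha>" and S: "0 < S" and j: "is_jet {S..} j"
begin

lemma pos_s: "s \<in> {S..} \<Longrightarrow> 0 < s"
  using S by auto

lemma nb: "s \<in> {S..} \<Longrightarrow> at s within {S..} \<noteq> bot"
  using at_within_atLeast_neq_bot by auto

lemma gV_eq: "s \<in> {S..} \<Longrightarrow> gV \<alpha> s \<theta> (j s \<theta>) = j s \<theta> 0 *\<^sub>R nfr \<alpha> s \<theta>"
  unfolding gV_def W0_def hd0_def hdir_unit(2)[OF \<alpha> pos_s, symmetric] by (simp add: vec_eq_iff)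

lemma has_pd_gV: "s \<in> {S..} \<Longrightarrow> has_pd {S..} i (\<lambda>s \<theta>. gV \<alpha> s \<theta> (j s \<theta>)) (gV1 i \<alpha> s \<theta> (j s \<theta>)) s \<theta>"
  unfolding has_pd_vec gV_def gV1_def vec_lambda_beta
  by (intro allI has_pd_mult has_pd_W0[OF \<alpha> S refl j] has_pd_coeffs[OF \<alpha> S refl j])

lemma has_pd_gV1: "s \<in> {S..} \<Longrightarrow> has_pd {S..} k (\<lambda>s \<theta>. gV1 i \<alpha> s \<theta> (j s \<theta>)) (gV2 i k \<alpha> s \<theta> (j s \<theta>)) s \<theta>"
  unfolding has_pd_vec gV1_def gV2_def vec_lambda_beta
  by (intro allI has_pd_add has_pd_mult has_pd_W0[OF \<alpha> S refl j] has_pd_W1[OF \<alpha> S refl j] has_pd_coeffs[OF \<alpha> S refl j])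

lemma gV1_eq:
  assumes "s \<in> {S..}"
  shows "gV1 i \<alpha> s \<theta> (j s \<theta>) = j s \<theta> (idx1 i) *\<^sub>R nfr \<alpha> s \<theta> + j s \<theta> 0 *\<^sub>R nfr' i \<alpha> s \<theta>"
proof -
  have "has_pd {S..} i (\<lambda>s \<theta>. j s \<theta> 0 *\<^sub>R nfr \<alpha> s \<theta>)
     (j s \<theta> 0 *\<^sub>R nfr' i \<alpha> s \<theta> + j s \<theta> (idx1 i) *\<^sub>R nfr \<alpha> s \<theta>) s \<theta>"
    by (rule has_pd_scaleR[OF has_pd_jet(1)[OF \<alpha> S refl j assms] has_pd_subset[OF has_pd_nfr[OF \<alpha>]]]) simp
  then have "has_pd {S..} i (\<lambda>s \<theta>. gV \<alpha> s \<theta> (j s \<theta>))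
     (j s \<theta> 0 *\<^sub>R nfr' i \<alpha> s \<theta> + j s \<theta> (idx1 i) *\<^sub>R nfr \<alpha> s \<theta>) s \<theta>"
    by (rule has_pd_cong) (use gV_eq assms in auto)
  from has_pd_unique[OF has_pd_gV[OF assms] this] show ?thesis
    using assms at_within_atLeast_neq_bot by (auto simp: add.commute)
qed

lemma dn_nfr: "dn i \<alpha> s \<theta> \<bullet> nfr \<alpha> s \<theta> = 0"
  using nfr_nfr'[OF \<alpha>, of s \<theta> i] by (simp add: dn_def inner_add_left gam_self inner_commute[of "nfr' i \<alpha> s \<theta>"])

lemma gv_eq:
  assumes "s \<in> {S..}"
  shows "gv i \<alpha> s \<theta> (j s \<theta>) = j s \<theta> (idx1 i) *\<^sub>R nfr \<alpha> s \<theta> + j s \<theta> 0 *\<^sub>R dn i \<alpha> s \<theta>"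
  unfolding gv_def gV1_eq[OF assms] gV_eq[OF assms] by (simp add: dn_def gam_scaleR scaleR_add_right)

lemma has_pd_gv: "s \<in> {S..} \<Longrightarrow> has_pd {S..} k (\<lambda>s \<theta>. gv i \<alpha> s \<theta> (j s \<theta>)) (gz i k \<alpha> s \<theta> (j s \<theta>)) s \<theta>"
proof -
  assume s: "s \<in> {S..}"
  have bb: "bounded_bilinear gam"
    by (simp add: bilinear_conv_bounded_bilinear[symmetric] bilinear_def linear_iff gam_add gam_scaleR)
  show ?thesis
    unfolding gv_def
    by (rule has_pd_eq[OF has_pd_add[OF has_pd_gV1[OF s]
        has_pd_bilinear[OF bb has_pd_subset[OF has_pd_tang[OF \<alpha>]] has_pd_gV[OF s]]]])
      (simp_all add: gz_def)
qed

text \<open>Differentiate the relation that \<nabla>_i (w n) has normal part w_i. As \<nabla>_i n is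
  tangential, its product with \<nabla>_i (w n) is w |\<nabla>_i n|^2.\<close>

lemma gz_normal:
  assumes s: "s \<in> {S..}"
  shows "(gz i i \<alpha> s \<theta> (j s \<theta>) + gam (tang i \<alpha> s \<theta>) (gv i \<alpha> s \<theta> (j s \<theta>))) \<bullet> nfr \<alpha> s \<theta>
   = j s \<theta> (idx2 i i) - j s \<theta> 0 * (dn i \<alpha> s \<theta> \<bullet> dn i \<alpha> s \<theta>)"
proof -
  have "has_pd {S..} i (\<lambda>s \<theta>. gv i \<alpha> s \<theta> (j s \<theta>) \<bullet> nfr \<alpha> s \<theta>)
     (gv i \<alpha> s \<theta> (j s \<theta>) \<bullet> nfr' i \<alpha> s \<theta> + gz i i \<alpha> s \<theta> (j s \<theta>) \<bullet> nfr \<alpha> s \<theta>) s \<theta>"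
    by (rule has_pd_inner[OF has_pd_gv[OF s] has_pd_subset[OF has_pd_nfr[OF \<alpha>]]]) simp
  moreover have "j s \<theta> (idx1 i) = gv i \<alpha> s \<theta> (j s \<theta>) \<bullet> nfr \<alpha> s \<theta>" if "s \<in> {S..}" for s \<theta>
    unfolding gv_eq[OF that] inner_add_left inner_scaleR_left dn_nfr by (simp add: nfr_unit[OF \<alpha>])
  then have "has_pd {S..} i (\<lambda>s \<theta>. gv i \<alpha> s \<theta> (j s \<theta>) \<bullet> nfr \<alpha> s \<theta>) (j s \<theta> (idx2 i i)) s \<theta>"
    by (intro has_pd_cong[OF has_pd_jet(2)[OF \<alpha> S refl j s] _ s]) auto
  ultimately have 1: "gz i i \<alpha> s \<theta> (j s \<theta>) \<bullet> nfr \<alpha> s \<theta> = j s \<theta> (idx2 i i) - gv i \<alpha> s \<theta> (j s \<theta>) \<bullet> nfr' i \<alpha> s \<theta>"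
    using has_pd_unique[OF _ _ nb[OF s]] by fastforce
  have "gam (tang i \<alpha> s \<theta>) (gv i \<alpha> s \<theta> (j s \<theta>)) \<bullet> nfr \<alpha> s \<theta>
     = - (gv i \<alpha> s \<theta> (j s \<theta>) \<bullet> gam (tang i \<alpha> s \<theta>) (nfr \<alpha> s \<theta>))"
    by (rule gam_skew)
  then have "(gz i i \<alpha> s \<theta> (j s \<theta>) + gam (tang i \<alpha> s \<theta>) (gv i \<alpha> s \<theta> (j s \<theta>))) \<bullet> nfr \<alpha> s \<theta>
     = j s \<theta> (idx2 i i) - gv i \<alpha> s \<theta> (j s \<theta>) \<bullet> dn i \<alpha> s \<theta>"
    unfolding dn_def inner_add_left inner_add_right 1 by simp
  also have "gv i \<alpha> s \<theta> (j s \<theta>) \<bullet> dn i \<alpha> s \<theta> = j s \<theta> 0 * (dn i \<alpha> s \<theta> \<bullet> dn i \<alpha> s \<theta>)"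
    unfolding gv_eq[OF s] using dn_nfr[of i s \<theta>]
    by (simp only: inner_add_left inner_scaleR_left inner_commute[of "nfr \<alpha> s \<theta>"])
  finally show ?thesis .
qed


text \<open>Four sources combine. The normal parts of the second derivatives of w n give the second
  derivatives of w; the tilt of the normal meets the tangential parts of \<open>covd\<close> and
  completes them to the Laplacian; the change of the metric together with |\<nabla> n|^2 leaves
  |h|^2; the curvature terms add up to the Ricci curvature.\<close>

lemma linearization:
  assumes s: "s \<in> {S..}" and w: "\<And>s \<theta>. s \<in> {S..} \<Longrightarrow> w s \<theta> = j s \<theta> 0"
  shows "((\<lambda>t. gH \<alpha> s \<theta> (\<lambda>i. t * j s \<theta> i)) has_real_derivative jacobi_op \<alpha> S w s \<theta>) (at 0)"
proof -
  define J where "J = j s \<theta>"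
  define l where "l = (\<lambda>i. lam i \<alpha> s \<theta>)"
  define E where "E = (\<lambda>i. tfr i \<alpha> s \<theta>)"
  define n where "n = nfr \<alpha> s \<theta>"
  define a where "a = (\<lambda>i. tang i \<alpha> s \<theta>)"
  define C where "C = (\<lambda>i k. covd i k \<alpha> s \<theta>)"
  define h where "h = (\<lambda>i k. C i k \<bullet> n)"
  define k where "k = (\<lambda>i. dn i \<alpha> s \<theta>)"
  define v where "v = (\<lambda>i. gv i \<alpha> s \<theta> J)"
  define V where "V = gV \<alpha> s \<theta> J"
  define Z where "Z = (\<lambda>i k. gz i k \<alpha> s \<theta> J + gam (a k) (v i) + curv V (a k) (a i))"
  define X where "X = cross3 (a 1) (a 2)"
  define DX where "DX = cross3 (a 1) (v 2) + cross3 (v 1) (a 2)"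
  define L where "L = l 1 * l 2"
  have V: "V = J 0 *\<^sub>R n" unfolding V_def J_def n_def by (rule gV_eq[OF s])
  have v: "v i = J (idx1 i) *\<^sub>R n + J 0 *\<^sub>R k i" for i
    unfolding v_def J_def n_def k_def by (rule gv_eq[OF s])
  have a: "a i = l i *\<^sub>R E i" for i by (simp add: a_def l_def E_def tang_def)
  have lp: "0 < l i" for i unfolding l_def by (rule lam_pos[OF \<alpha>])
  have EE: "E i \<bullet> E m = (if i = m then 1 else 0)" "cross3 (E 1) (E 2) = n" for i m
    unfolding E_def n_def by (rule tfr_orthonormal[OF \<alpha>])+
  have nE: "n \<bullet> n = 1" "n \<bullet> E i = 0" "E i \<bullet> n = 0" for i
    unfolding E_def n_def by (rule nfr_unit[OF \<alpha>])+
  have cE: "cross3 (E 2) n = E 1" "cross3 n (E 1) = E 2"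
    unfolding E_def n_def by (rule tfr_cross_nfr[OF \<alpha>])+
  have kn: "k i \<bullet> n = 0" "n \<bullet> k i = 0" for i
    using dn_nfr[of i s \<theta>] by (simp_all add: k_def n_def inner_commute)
  have ak: "a i \<bullet> k m = - h i m" for i m
    unfolding a_def k_def h_def C_def n_def dn_def by (rule tang_dn[OF \<alpha>])
  have h21: "h 2 1 = h 1 2" by (simp add: h_def C_def covd_sym[OF \<alpha>])
  have H: "(l 2)\<^sup>2 * h 1 1 + (l 1)\<^sup>2 * h 2 2 = (l 1)\<^sup>2 * (l 2)\<^sup>2"
    unfolding l_def h_def C_def n_def by (rule catenoid_H[OF \<alpha>])
  have X: "X = L *\<^sub>R n" unfolding X_def L_def by (simp add: a cross_mult_left cross_mult_right EE)
  have L: "0 < L" unfolding L_def using lp by simp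
  have av: "a i \<bullet> v m = - (J 0 * h i m)" for i m
    unfolding v inner_add_right inner_scaleR_right ak by (simp add: a nE)
  \<comment> \<open>Expansion in the orthonormal frame. The normal components form a product of two
    triple products, which is the Gram determinant of x, E 1, E 2 against y, E 1, E 2.\<close>
  have frame: "x \<bullet> y = (x \<bullet> E 1) * (y \<bullet> E 1) + (x \<bullet> E 2) * (y \<bullet> E 2) + (x \<bullet> n) * (y \<bullet> n)" for x y
  proof -
    have "(x \<bullet> cross3 (E 1) (E 2)) * (y \<bullet> cross3 (E 1) (E 2))
      = (x \<bullet> y) * ((E 1 \<bullet> E 1) * (E 2 \<bullet> E 2) - (E 1 \<bullet> E 2) * (E 1 \<bullet> E 2))
        - (x \<bullet> E 1) * ((y \<bullet> E 1) * (E 2 \<bullet> E 2) - (E 1 \<bullet> E 2) * (y \<bullet> E 2))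
        + (x \<bullet> E 2) * ((y \<bullet> E 1) * (E 1 \<bullet> E 2) - (E 1 \<bullet> E 1) * (y \<bullet> E 2))"
      by (simp add: inner_3 cross3_def algebra_simps)
    then show ?thesis unfolding EE by simp
  qed
  \<comment> \<open>The reciprocal lengths become variables with a polynomial relation, so that the
    final identities are again ideal memberships.\<close>
  have "\<exists>x1 x2. x1 * l 1 = 1 \<and> x2 * l 2 = 1" using lp[of 1] lp[of 2] by (metis left_inverse less_irrefl)
  then obtain x1 x2 where x: "x1 * l 1 = 1" "x2 * l 2 = 1" by blast
  have kE: "k i \<bullet> E 1 = - (x1 * h 1 i)" "k i \<bullet> E 2 = - (x2 * h 2 i)" for i
  proof -
    have "l m * (k i \<bullet> E m) = - h m i" for m using ak[of m i] by (simp add: a inner_commute)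
    from this[of 1] this[of 2] x
    show "k i \<bullet> E 1 = - (x1 * h 1 i)" "k i \<bullet> E 2 = - (x2 * h 2 i)" by algebra+
  qed
  have kk: "k i \<bullet> k i = (x1 * h 1 i)\<^sup>2 + (x2 * h 2 i)\<^sup>2" for i
    by (subst frame) (simp add: kE kn power2_eq_square)
  \<comment> \<open>The cross product tilts against the gradient of w. Its normal part, computed
    next, is the change of area: minus w times the area element, because the principal curvatures
    sum to 1.\<close>
  have hor: "DX \<bullet> E 1 = - (J 1 * l 2)" "DX \<bullet> E 2 = - (J 2 * l 1)"
  proof -
    have m: "cross3 y z \<bullet> e = y \<bullet> cross3 z e" "cross3 y z \<bullet> e = z \<bullet> cross3 e y" for y z e
      by (simp_all add: inner_3 cross3_def algebra_simps)
    have "DX \<bullet> E 1 = a 1 \<bullet> cross3 (v 2) (E 1) + v 1 \<bullet> cross3 (a 2) (E 1)"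
      unfolding DX_def inner_add_left m(1) ..
    also have "a 1 \<bullet> cross3 (v 2) (E 1) = 0" unfolding a by (simp add: inner_3 cross3_def algebra_simps)
    also have "cross3 (a 2) (E 1) = - (l 2 *\<^sub>R n)"
      unfolding a EE(2)[symmetric] by (simp add: cross_mult_left cross_skew[of "E 2" "E 1"])
    finally show "DX \<bullet> E 1 = - (J 1 * l 2)" by (simp add: v inner_add_left kn nE idx1_def)
    have "DX \<bullet> E 2 = v 2 \<bullet> cross3 (E 2) (a 1) + a 2 \<bullet> cross3 (E 2) (v 1)"
      unfolding DX_def inner_add_left m(2) ..
    also have "a 2 \<bullet> cross3 (E 2) (v 1) = 0" unfolding a by (simp add: inner_3 cross3_def algebra_simps)
    also have "cross3 (E 2) (a 1) = - (l 1 *\<^sub>R n)"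
      unfolding a EE(2)[symmetric] by (simp add: cross_mult_right cross_skew[of "E 2" "E 1"])
    finally show "DX \<bullet> E 2 = - (J 2 * l 1)" by (simp add: v inner_add_left kn nE idx1_def)
  qed
  have ver: "DX \<bullet> n = - (J 0 * L)"
  proof -
    have m: "cross3 y z \<bullet> e = y \<bullet> cross3 z e" "cross3 y z \<bullet> e = z \<bullet> cross3 e y" for y z e
      by (simp_all add: inner_3 cross3_def algebra_simps)
    have "DX \<bullet> n = v 2 \<bullet> cross3 n (a 1) + v 1 \<bullet> cross3 (a 2) n"
      unfolding DX_def inner_add_left m(2)[of "a 1"] m(1)[of "v 1"] ..
    also have "\<dots> = l 1 * (v 2 \<bullet> E 2) + l 2 * (v 1 \<bullet> E 1)"
      unfolding a by (simp add: cross_mult_left cross_mult_right cE)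
    also have "\<dots> = - (J 0 * (l 1 * (x2 * h 2 2) + l 2 * (x1 * h 1 1)))"
      unfolding v inner_add_left inner_scaleR_left kE nE by (simp add: algebra_simps)
    also have "l 1 * (x2 * h 2 2) + l 2 * (x1 * h 1 1) = L"
      using x H unfolding L_def by algebra
    finally show ?thesis .
  qed
  have PDX: "u \<bullet> DX = - (J 1 * l 2 * (u \<bullet> E 1)) - J 2 * l 1 * (u \<bullet> E 2) - J 0 * L * (u \<bullet> n)" for u
    unfolding frame[of u DX] hor ver by (simp add: algebra_simps)
  have XDX: "X \<bullet> DX = - (J 0 * L\<^sup>2)" unfolding PDX X by (simp add: nE power2_eq_square)
  \<comment> \<open>The sectional curvature of a plane is minus the square of the vertical component
    of its unit normal; for the plane spanned by n and one frame vector this normal is the other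
    frame vector, up to sign.\<close>
  have curvn: "curv V (a 1) (a 1) \<bullet> n = - (J 0 * (l 1)\<^sup>2 * (E 2 $ 3)\<^sup>2)"
    "curv V (a 2) (a 2) \<bullet> n = - (J 0 * (l 2)\<^sup>2 * (E 1 $ 3)\<^sup>2)"
  proof -
    have e: "E 1 $ 3 = E 2 $ 1 * n $ 2 - E 2 $ 2 * n $ 1" "E 2 $ 3 = n $ 1 * E 1 $ 2 - n $ 2 * E 1 $ 1"
      using arg_cong[OF cE(1), of "\<lambda>u. u $ 3"] arg_cong[OF cE(2), of "\<lambda>u. u $ 3"] by (simp_all add: cross3_def)
    show "curv V (a 1) (a 1) \<bullet> n = - (J 0 * (l 1)\<^sup>2 * (E 2 $ 3)\<^sup>2)"
      "curv V (a 2) (a 2) \<bullet> n = - (J 0 * (l 2)\<^sup>2 * (E 1 $ 3)\<^sup>2)"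
      unfolding e V a curv_def by (simp_all add: inner_3 power2_eq_square algebra_simps)
  qed
  have Zn: "Z i i \<bullet> n = J (idx2 i i) - J 0 * (k i \<bullet> k i) + curv V (a i) (a i) \<bullet> n" for i
    using gz_normal[OF s, of i \<theta>] unfolding Z_def v_def a_def J_def n_def k_def
    by (simp only: inner_add_left[of _ "curv _ _ _"])
  \<comment> \<open>Together with \<open>unit\<close> this turns the sum of the two sectional
    curvatures into the Ricci curvature of the normal.\<close>
  have vertical: "(E 1 $ 3)\<^sup>2 + (E 2 $ 3)\<^sup>2 + (n $ 3)\<^sup>2 = 1"
    using frame[of "axis 3 1" "axis 3 1"] by (simp add: inner_3 axis_def power2_eq_square)
  have unit: "(n $ 1)\<^sup>2 + (n $ 2)\<^sup>2 + (n $ 3)\<^sup>2 = 1" using nE(1) by (simp add: inner_3 power2_eq_square)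
  have z: "gA i \<alpha> s \<theta> (\<lambda>i. 0 * J i) = a i" "gC i m \<alpha> s \<theta> (\<lambda>i. 0 * J i) = C i m" for i m
    using zero_jet[of "\<lambda>i. 0 * J i"] by (simp_all add: a_def C_def)
  have dA: "has_pd UNIV 1 (\<lambda>t _. gA i \<alpha> s \<theta> (\<lambda>i. t * J i)) (v i - gam V (a i)) 0 0" for i
    using der_gA_cov[of i \<alpha> s \<theta> J] unfolding has_pd_def v_def V_def a_def by simp
  have dC: "has_pd UNIV 1 (\<lambda>t _. gC i m \<alpha> s \<theta> (\<lambda>i. t * J i)) (Z i m - gam V (C i m)) 0 0" for i m
    using der_gC_cov[of i m \<alpha> s \<theta> J] unfolding has_pd_def Z_def v_def V_def a_def C_def by simp
  have nu: "(X \<bullet> X) powr (- 3 / 2) = x1 ^ 3 * x2 ^ 3" "X \<bullet> X = L\<^sup>2"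
  proof -
    show XX: "X \<bullet> X = L\<^sup>2" by (simp add: X nE power2_eq_square)
    have "L\<^sup>2 powr (- 3 / 2) = inverse (L ^ 3)" by (rule sq_powr[OF L])
    also have "\<dots> = x1 ^ 3 * x2 ^ 3"
      by (rule inverse_unique) (use x in \<open>unfold L_def, algebra\<close>)
    finally show "(X \<bullet> X) powr (- 3 / 2) = x1 ^ 3 * x2 ^ 3" unfolding XX .
  qed
  \<comment> \<open>Skewness of \<open>gam V\<close> in the two shapes that occur in the derivative
    of \<open>twoH\<close>.\<close>
  have rot: "p \<bullet> (q - gam V p) = p \<bullet> q"
    "(p - gam V u) \<bullet> y + u \<bullet> (q - gam V y) = p \<bullet> y + u \<bullet> q" for p q u y
    by (simp_all add: inner_3 algebra_simps)
  have t1: "twoH (a 1) (a 2) (C 1 1) (C 1 2 + C 2 1) (C 2 2) = 1"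
    using gH_zero[OF \<alpha> refl, of s \<theta>] by (simp add: gH_def zero_jet[OF refl] a_def C_def)
  have X': "cross3 (a 1) (v 2 - gam V (a 2)) + cross3 (v 1 - gam V (a 1)) (a 2) = DX - gam V X"
    unfolding DX_def X_def cross3_gam[symmetric] by (simp add: cross3_def vec_eq_iff forall_3 algebra_simps)
  have d: "has_pd UNIV 1 (\<lambda>t _. gH \<alpha> s \<theta> (\<lambda>i. t * J i))
    ((2 * (a 2 \<bullet> v 2) * (C 1 1 \<bullet> X) + (a 2 \<bullet> a 2) * (Z 1 1 \<bullet> X + C 1 1 \<bullet> DX)
      - (v 1 \<bullet> a 2 + a 1 \<bullet> v 2) * ((C 1 2 + C 2 1) \<bullet> X)
      + 2 * (a 1 \<bullet> v 1) * (C 2 2 \<bullet> X) + (a 1 \<bullet> a 1) * (Z 2 2 \<bullet> X + C 2 2 \<bullet> DX))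
      * (X \<bullet> X) powr (- 3 / 2) - 3 * (X \<bullet> DX) / (X \<bullet> X)) 0 0"
    unfolding gH_def
    apply (rule has_pd_eq)
     apply (rule has_pd_twoH[OF dA dA dC has_pd_add[OF dC dC] dC, unfolded z, OF X_def X'[symmetric]])
    subgoal using L nE(1) unfolding X by auto
    subgoal by (simp add: a EE)
    subgoal by (rule t1)
    by (simp only: rot)
  have j2: "idx2 1 1 = 3" "idx2 2 2 = 5" by (simp_all add: idx2_def)
  define p where "p = cp \<alpha> s \<theta>"
  define K where "K = cq \<alpha> s \<theta> * (1 + p) * sin \<theta> * cos \<theta>"
  define g where "g = cq \<alpha> s \<theta> * sin \<theta> * cos \<theta> / p"
  define \<tau> where "\<tau> = tanh s"
  have lq: "l 1 = p * l 2" unfolding l_def p_def by (rule lam_quot[OF \<alpha>])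
  have pp: "p \<noteq> 0" using atoms_nz(3)[OF \<alpha>, of s \<theta>] by (simp add: p_def)
  \<comment> \<open>Christoffel symbols of the orthogonal coordinates. In the weighted sum below the
    terms with \<tau> and g cancel, and what remains is K = - p p_\<theta>, the first order term of
    the Laplacian.\<close>
  have CE: "C 1 1 \<bullet> E 1 = l 1 * \<tau>" "C 1 1 \<bullet> E 2 = - (l 1 * g * l 1 * x2)"
    "C 2 2 \<bullet> E 1 = - (l 2 * \<tau> * l 2 * x1)" "C 2 2 \<bullet> E 2 = l 2 * (g + K / p\<^sup>2)"
  proof -
    have "x1 = inverse (l 1)" "x2 = inverse (l 2)" using x by (simp_all add: inverse_unique mult.commute)
    then show "C 1 1 \<bullet> E 1 = l 1 * \<tau>" "C 1 1 \<bullet> E 2 = - (l 1 * g * l 1 * x2)"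
      "C 2 2 \<bullet> E 1 = - (l 2 * \<tau> * l 2 * x1)" "C 2 2 \<bullet> E 2 = l 2 * (g + K / p\<^sup>2)"
      unfolding C_def E_def covd_inner[OF \<alpha>]
      by (simp_all add: dlam_def l_def \<tau>_def g_def K_def p_def divide_inverse)
  qed
  obtain r where r: "r * p = 1" using pp by (metis left_inverse)
  have Kr: "K / p\<^sup>2 = K * r\<^sup>2"
    using r pp by (simp add: field_simps) algebra
  have sx: "a 1 \<bullet> a 1 = (l 1)\<^sup>2" "a 2 \<bullet> a 2 = (l 2)\<^sup>2" by (simp_all add: a EE power2_eq_square)
  have hC: "C i m \<bullet> n = h i m" for i m by (simp add: h_def)
  have hX: "C i m \<bullet> X = L * h i m" for i m by (simp add: X h_def)
  have ZX: "Z i i \<bullet> X = L * (Z i i \<bullet> n)" for i by (simp add: X)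
  have va: "v 1 \<bullet> a 2 = - (J 0 * h 1 2)" using av[of 2 1] by (simp add: inner_commute h21)
  have "jacobi_op \<alpha> S w s \<theta> = (J 3 + p\<^sup>2 * J 5 - K * J 2) * x1\<^sup>2
      + ((h 1 1)\<^sup>2 * x1 ^ 4 + 2 * (h 1 2)\<^sup>2 * (x1\<^sup>2 * x2\<^sup>2) + (h 2 2)\<^sup>2 * x2 ^ 4) * J 0
      - ((n $ 1)\<^sup>2 + (n $ 2)\<^sup>2) * J 0"
  proof -
    have s': "S \<le> s" using s by simp
    have w1: "has_pd {S..} i w (j s \<theta> (idx1 i)) s \<theta>" if "S \<le> s" for i s \<theta>
      by (rule has_pd_cong[OF has_pd_jet(1)[OF \<alpha> S refl j]]) (use that w in auto)
    have xi: "x1 = inverse (l 1)" "x2 = inverse (l 2)" using x by (simp_all add: inverse_unique mult.commute)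
    have lap: "laplace_beltrami {S..} (catenoid \<alpha>) w s \<theta> = (J 3 + p\<^sup>2 * J 5 - K * J 2) * x1\<^sup>2"
      using catenoid_laplace[OF \<alpha> s' w1 has_pd_jet(2)[OF \<alpha> S refl j s], of \<theta>]
      by (simp add: J_def p_def K_def idx1_def j2 xi l_def divide_inverse power_inverse)
    show ?thesis
      unfolding jacobi_op_def lap catenoid_sqnorm[OF \<alpha> s'] catenoid_ricci[OF \<alpha>] w[OF s]
      by (simp add: J_def xi h_def C_def n_def l_def divide_inverse power_inverse algebra_simps)
  qed
  also have "\<dots> = (2 * (a 2 \<bullet> v 2) * (C 1 1 \<bullet> X) + (a 2 \<bullet> a 2) * (Z 1 1 \<bullet> X + C 1 1 \<bullet> DX)
      - (v 1 \<bullet> a 2 + a 1 \<bullet> v 2) * ((C 1 2 + C 2 1) \<bullet> X)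
      + 2 * (a 1 \<bullet> v 1) * (C 2 2 \<bullet> X) + (a 1 \<bullet> a 1) * (Z 2 2 \<bullet> X + C 2 2 \<bullet> DX))
      * (X \<bullet> X) powr (- 3 / 2) - 3 * (X \<bullet> DX) / (X \<bullet> X)" (is "?l = ?F * _ - ?G")
  proof -
    have G: "?G = - 3 * J 0" unfolding XDX nu using L by simp
    have e: "(l 2)\<^sup>2 * (c1 - J 1 * l 2 * (l 1 * \<tau>) + J 2 * l 1 * (l 1 * g * l 1 * x2))
        + (l 1)\<^sup>2 * (c2 + J 1 * l 2 * (l 2 * \<tau> * l 2 * x1) - J 2 * l 1 * (l 2 * (g + K * r\<^sup>2)))
      = (l 2)\<^sup>2 * c1 + (l 1)\<^sup>2 * c2 - J 2 * l 1 ^ 3 * l 2 * K * r\<^sup>2" for c1 c2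
      using x by algebra
    have F: "?F = L * (- 4 * J 0 * h 1 1 * h 2 2 + 4 * J 0 * (h 1 2)\<^sup>2
        + (l 2)\<^sup>2 * (J 3 - J 0 * ((x1 * h 1 1)\<^sup>2 + (x2 * h 1 2)\<^sup>2) - J 0 * (l 1)\<^sup>2 * (E 2 $ 3)\<^sup>2)
        + (l 1)\<^sup>2 * (J 5 - J 0 * ((x1 * h 1 2)\<^sup>2 + (x2 * h 2 2)\<^sup>2) - J 0 * (l 2)\<^sup>2 * (E 1 $ 3)\<^sup>2)
        - J 0 * L\<^sup>2 - J 2 * (l 1)\<^sup>2 * K * r\<^sup>2)"
    proof -
      have "?F = - 4 * J 0 * L * h 1 1 * h 2 2 + 4 * J 0 * L * (h 1 2)\<^sup>2
        + ((l 2)\<^sup>2 * (L * (Z 1 1 \<bullet> n) + C 1 1 \<bullet> DX) + (l 1)\<^sup>2 * (L * (Z 2 2 \<bullet> n) + C 2 2 \<bullet> DX))"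
        unfolding av va sx inner_add_left hX ZX h21 by (simp add: power2_eq_square algebra_simps)
      also have "(l 2)\<^sup>2 * (L * (Z 1 1 \<bullet> n) + C 1 1 \<bullet> DX) + (l 1)\<^sup>2 * (L * (Z 2 2 \<bullet> n) + C 2 2 \<bullet> DX)
        = (l 2)\<^sup>2 * (L * (Z 1 1 \<bullet> n) - J 0 * L * h 1 1) + (l 1)\<^sup>2 * (L * (Z 2 2 \<bullet> n) - J 0 * L * h 2 2)
          - J 2 * l 1 ^ 3 * l 2 * K * r\<^sup>2"
        unfolding e[symmetric] PDX CE Kr hC by (simp add: algebra_simps)
      also have "\<dots> = L * ((l 2)\<^sup>2 * (Z 1 1 \<bullet> n) + (l 1)\<^sup>2 * (Z 2 2 \<bullet> n)
          - J 0 * ((l 2)\<^sup>2 * h 1 1 + (l 1)\<^sup>2 * h 2 2) - J 2 * (l 1)\<^sup>2 * K * r\<^sup>2)"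
        unfolding L_def by (simp add: power2_eq_square power3_eq_cube algebra_simps)
      finally show ?thesis
        unfolding H Zn kk curvn h21 j2 by (simp add: L_def power2_eq_square algebra_simps)
    qed
    \<comment> \<open>Diagonal entries of the shape operator. From A + B = 1 follows A^2 + B^2 = 1 -
      2 A B, which reconciles the products A B from the change of the metric with |h|^2.\<close>
    define A where "A = h 1 1 * x1\<^sup>2"
    define B where "B = h 2 2 * x2\<^sup>2"
    have AB: "A + B = 1" unfolding A_def B_def using H x by algebra
    have hAB: "h 1 1 = A * (l 1)\<^sup>2" "h 2 2 = B * (l 2)\<^sup>2" unfolding A_def B_def using x by algebra+
    have x2p: "x2 = p * x1" "x1 = r * x2" using x lq r by algebra+
    have "?F * (x1 ^ 3 * x2 ^ 3) = - 4 * J 0 * A * B + 4 * J 0 * (h 1 2)\<^sup>2 * x1\<^sup>2 * x2\<^sup>2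
       + x1\<^sup>2 * J 3 - J 0 * (A\<^sup>2 + (h 1 2)\<^sup>2 * x1\<^sup>2 * x2\<^sup>2) - J 0 * (E 2 $ 3)\<^sup>2
       + x2\<^sup>2 * J 5 - J 0 * (B\<^sup>2 + (h 1 2)\<^sup>2 * x1\<^sup>2 * x2\<^sup>2) - J 0 * (E 1 $ 3)\<^sup>2
       - J 0 - J 2 * K * (r * x2)\<^sup>2"
      unfolding F L_def hAB using x by algebra
    also have "\<dots> = ?l - 3 * J 0"
      unfolding x2p(2)[symmetric] hAB using x x2p(1) AB vertical unit by algebra
    finally show ?thesis unfolding nu(1) G by simp
  qed
  finally show ?thesis using d unfolding has_pd_def J_def has_real_derivative_iff_has_vector_derivative by simp
qed

end

section \<open>Jets and Hoelder norms\<close>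

text \<open>Second differences over squares to the right of s and above \<theta> use only one-sided
  derivatives in s, so the boundary s = S is included. Mean values in both orders give equal mixed
  derivatives at two nearby points, and continuity concludes.\<close>

lemma clairaut:
  fixes f :: "real \<Rightarrow> real \<Rightarrow> real"
  assumes f: "\<And>i s \<theta>. S \<le> s \<Longrightarrow> has_pd {S..} i f (g i s \<theta>) s \<theta>"
    and g: "\<And>i k s \<theta>. S \<le> s \<Longrightarrow> has_pd {S..} k (g i) (h i k s \<theta>) s \<theta>"
    and c: "\<And>i k. continuous_on ({S..} \<times> UNIV) (\<lambda>(s, \<theta>). h i k s \<theta>)"
    and s: "S \<le> s"
  shows "h 1 2 s \<theta> = h 2 1 s \<theta>"
proof -
  have d1: "((\<lambda>t. u t \<theta>) has_derivative (\<lambda>x. x * D)) (at t within {a..b})"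
    if "has_pd {S..} 1 u D t \<theta>" "S \<le> a" for u D t \<theta> a b
    using has_vector_derivative_within_subset[of "\<lambda>t. u t \<theta>" D t "{S..}" "{a..b}"] that
    by (auto simp: has_pd_def has_vector_derivative_def)
  have d2: "((\<lambda>t. u s t) has_derivative (\<lambda>x. x * D)) (at t within {a..b})"
    if "has_pd {S..} 2 u D s t" for u D s t a b
    using that by (auto simp: has_pd_def has_vector_derivative_def intro: has_derivative_at_withinI)
  have ex: "\<exists>x y x' y'. x \<in> {s..s+r} \<and> y \<in> {\<theta>..\<theta>+r} \<and> x' \<in> {s..s+r} \<and> y' \<in> {\<theta>..\<theta>+r} \<and>
      h 1 2 x y = h 2 1 x' y'" if r: "0 < r" for r
  proof -
    have "\<exists>x\<in>{s<..<s+r}. (f (s + r) (\<theta> + r) - f (s + r) \<theta>) - (f s (\<theta> + r) - f s \<theta>)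
        = (s + r - s) * g 1 x (\<theta> + r) - (s + r - s) * g 1 x \<theta>"
      by (rule mvt_simple[of s "s + r" "\<lambda>x. f x (\<theta> + r) - f x \<theta>"
            "\<lambda>x y. y * g 1 x (\<theta> + r) - y * g 1 x \<theta>"])
        (use r s in \<open>auto intro!: has_derivative_diff d1 f\<close>)
    then obtain x where x: "x \<in> {s<..<s+r}" "(f (s + r) (\<theta> + r) - f (s + r) \<theta>) - (f s (\<theta> + r) - f s \<theta>)
        = r * (g 1 x (\<theta> + r) - g 1 x \<theta>)" by (auto simp: algebra_simps)
    have "\<exists>y\<in>{\<theta><..<\<theta>+r}. g 1 x (\<theta> + r) - g 1 x \<theta> = (\<theta> + r - \<theta>) * h 1 2 x y"
      by (rule mvt_simple[of \<theta> "\<theta> + r" "g 1 x" "\<lambda>t y. y * h 1 2 x t"])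
        (use r s x(1) in \<open>auto intro!: d2 g\<close>)
    then obtain y where y: "y \<in> {\<theta><..<\<theta>+r}" "g 1 x (\<theta> + r) - g 1 x \<theta> = r * h 1 2 x y" by auto
    have "\<exists>y\<in>{\<theta><..<\<theta>+r}. (f (s + r) (\<theta> + r) - f s (\<theta> + r)) - (f (s + r) \<theta> - f s \<theta>)
        = (\<theta> + r - \<theta>) * g 2 (s + r) y - (\<theta> + r - \<theta>) * g 2 s y"
      by (rule mvt_simple[of \<theta> "\<theta> + r" "\<lambda>y. f (s + r) y - f s y" "\<lambda>t y. y * g 2 (s + r) t - y * g 2 s t"])
        (use r s in \<open>auto intro!: has_derivative_diff d2 f\<close>)
    then obtain y' where y': "y' \<in> {\<theta><..<\<theta>+r}" "(f (s + r) (\<theta> + r) - f s (\<theta> + r)) - (f (s + r) \<theta> - f s \<theta>)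
        = r * (g 2 (s + r) y' - g 2 s y')" by (auto simp: algebra_simps)
    have "\<exists>x\<in>{s<..<s+r}. g 2 (s + r) y' - g 2 s y' = (s + r - s) * h 2 1 x y'"
      by (rule mvt_simple[of s "s + r" "\<lambda>x. g 2 x y'" "\<lambda>t y. y * h 2 1 t y'"])
        (use r s in \<open>auto intro!: d1 g\<close>)
    then obtain x' where x': "x' \<in> {s<..<s+r}" "g 2 (s + r) y' - g 2 s y' = r * h 2 1 x' y'" by auto
    have "r * (r * h 1 2 x y) = r * (r * h 2 1 x' y')"
      using x(2) y(2) y'(2) x'(2) by (simp add: algebra_simps)
    then have "h 1 2 x y = h 2 1 x' y'" using r by simp
    then show ?thesis using x(1) y(1) x'(1) y'(1) by (intro exI[of _ x] exI[of _ y] exI[of _ x'] exI[of _ y']) auto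
  qed
  show ?thesis
  proof (rule ccontr)
    assume ne: "h 1 2 s \<theta> \<noteq> h 2 1 s \<theta>"
    define e where "e = \<bar>h 1 2 s \<theta> - h 2 1 s \<theta>\<bar> / 2"
    have e: "0 < e" using ne by (simp add: e_def)
    have near: "\<exists>d>0. \<forall>x y. S \<le> x \<longrightarrow> dist (x, y) (s, \<theta>) < d \<longrightarrow> \<bar>h i k x y - h i k s \<theta>\<bar> < e" for i k
    proof -
      have "(s, \<theta>) \<in> {S..} \<times> UNIV" using s by simp
      with c[of i k, unfolded continuous_on_iff] e
      have "\<exists>d>0. \<forall>z\<in>{S..} \<times> UNIV. dist z (s, \<theta>) < d \<longrightarrow>
          dist (case z of (s, \<theta>) \<Rightarrow> h i k s \<theta>) (case (s, \<theta>) of (s, \<theta>) \<Rightarrow> h i k s \<theta>) < e" by blast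
      then show ?thesis by (force simp: dist_real_def)
    qed
    obtain d where d: "0 < d" "\<And>x y. S \<le> x \<Longrightarrow> dist (x, y) (s, \<theta>) < d \<Longrightarrow> \<bar>h 1 2 x y - h 1 2 s \<theta>\<bar> < e"
      using near[of 1 2] by blast
    obtain d' where d': "0 < d'" "\<And>x y. S \<le> x \<Longrightarrow> dist (x, y) (s, \<theta>) < d' \<Longrightarrow> \<bar>h 2 1 x y - h 2 1 s \<theta>\<bar> < e"
      using near[of 2 1] by blast
    define r where "r = min d d' / 3"
    have r: "0 < r" "2 * r < d" "2 * r < d'" using d(1) d'(1) by (auto simp: r_def)
    have dist: "dist (x, y) (s, \<theta>) \<le> 2 * r" if "x \<in> {s..s+r}" "y \<in> {\<theta>..\<theta>+r}" for x y
    proof -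
      have "dist (x, y) (s, \<theta>) \<le> \<bar>x - s\<bar> + \<bar>y - \<theta>\<bar>"
        using sqrt_sum_squares_le_sum_abs[of "x - s" "y - \<theta>"] by (simp add: dist_Pair_Pair dist_real_def)
      then show ?thesis using that by auto
    qed
    obtain x y x' y' where z: "x \<in> {s..s+r}" "y \<in> {\<theta>..\<theta>+r}" "x' \<in> {s..s+r}" "y' \<in> {\<theta>..\<theta>+r}"
      "h 1 2 x y = h 2 1 x' y'" using ex[OF r(1)] by blast
    have "\<bar>h 1 2 x y - h 1 2 s \<theta>\<bar> < e" "\<bar>h 2 1 x' y' - h 2 1 s \<theta>\<bar> < e"
      using d(2)[of x y] d'(2)[of x' y'] dist[OF z(1,2)] dist[OF z(3,4)] r z s by auto
    then show False using z(5) unfolding e_def by argo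
  qed
qed

section \<open>Jets of functions of class C^2 and their Hoelder bounds\<close>

definition jet_of :: "real set \<Rightarrow> (real \<Rightarrow> real \<Rightarrow> real) \<Rightarrow> real \<Rightarrow> real \<Rightarrow> jet" where
  "jet_of I w s \<theta> i = (if i = 0 then w s \<theta> else if i = 1 then pd I 1 w s \<theta> else if i = 2 then pd I 2 w s \<theta>
     else if i = 3 then pd I 1 (pd I 1 w) s \<theta> else if i = 4 then pd I 1 (pd I 2 w) s \<theta>
     else pd I 2 (pd I 2 w) s \<theta>)"

lemma has_pd_Ck:
  assumes "Ck (Suc n) {S..} w" "S \<le> s"
  shows "has_pd {S..} i w (pd {S..} i w s \<theta>) s \<theta>"
  using assms by (auto simp: has_pd_def pd_def vector_derivative_works)

lemma is_jet_jet_of: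
  assumes w: "Ck 2 {S..} w"
  shows "is_jet {S..} (jet_of {S..} w)"
proof -
  let ?p = "pd {S..}"
  have w1: "Ck 1 {S..} (?p i w)" for i using w by (simp add: numeral_2_eq_2)
  have c: "continuous_on ({S..} \<times> UNIV) (\<lambda>(s, \<theta>). ?p k (?p i w) s \<theta>)" for i k
    using w1[of i] by simp
  have 1: "has_pd {S..} i w (?p i w s \<theta>) s \<theta>" "has_pd {S..} k (?p i w) (?p k (?p i w) s \<theta>) s \<theta>"
    if "S \<le> s" for i k s \<theta>
    using has_pd_Ck[of 1 S w s i \<theta>] has_pd_Ck[of 0 S "?p i w" s k \<theta>] w w1[of i] that
    by (simp_all add: numeral_2_eq_2)
  have sym: "?p 2 (?p 1 w) s \<theta> = ?p 1 (?p 2 w) s \<theta>" if "S \<le> s" for s \<theta>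
    using clairaut[where f = w and g = "\<lambda>i. ?p i w" and h = "\<lambda>i k. ?p k (?p i w)", OF 1 c that, of \<theta>] .
  have j: "(\<lambda>s \<theta>. jet_of {S..} w s \<theta> 0) = w" "(\<lambda>s \<theta>. jet_of {S..} w s \<theta> (idx1 i)) = ?p i w" for i
    using exhaust_2[of i] by (auto simp: jet_of_def idx1_def fun_eq_iff)
  have j2: "jet_of {S..} w s \<theta> (idx2 i k) = ?p k (?p i w) s \<theta>" if "S \<le> s" for i k s \<theta>
    using exhaust_2[of i] exhaust_2[of k] sym[OF that] by (auto simp: jet_of_def idx2_def)
  show ?thesis
    unfolding is_jet_def j using 1 j2 j(2) by (auto simp: fun_eq_iff)
qed

lemma is_jet_diff: "is_jet I j \<Longrightarrow> is_jet I k \<Longrightarrow> is_jet I (\<lambda>s \<theta> i. j s \<theta> i - k s \<theta> i)"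
  unfolding is_jet_def by (intro ballI allI conjI has_pd_diff) auto

lemma is_jet_subset: "is_jet J j \<Longrightarrow> I \<subseteq> J \<Longrightarrow> is_jet I j"
  unfolding is_jet_def by (intro ballI allI conjI; rule has_pd_subset[of J]) auto

lemma hol_lipschitz:
  assumes \<beta>: "0 < \<beta>" "\<beta> < 1" and f: "\<And>i s \<theta>. s \<in> {a..b} \<Longrightarrow> has_pd {a..b} i f (g i s \<theta>) s \<theta>"
    and g: "\<And>i s \<theta>. s \<in> {a..b} \<Longrightarrow> \<bar>g i s \<theta>\<bar> \<le> r" and r: "\<And>s \<theta>. s \<in> {a..b} \<Longrightarrow> \<bar>f s \<theta>\<bar> \<le> r"
    and "0 \<le> r"
  shows "hol \<beta> {a..b} f (2 * r)"
proof (rule holI)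
  show "\<bar>f s \<theta>\<bar> \<le> 2 * r" if "s \<in> {a..b}" for s \<theta> using r[OF that, of \<theta>] \<open>0 \<le> r\<close> by linarith
  fix s \<theta> s' \<theta>' :: real assume s: "s \<in> {a..b}" "s' \<in> {a..b}"
  let ?d = "dist (s, \<theta>) (s', \<theta>')"
  have dd: "\<bar>s - s'\<bar> \<le> ?d" "\<bar>\<theta> - \<theta>'\<bar> \<le> ?d"
    using dist_fst_le[of "(s, \<theta>)" "(s', \<theta>')"] dist_snd_le[of "(s, \<theta>)" "(s', \<theta>')"] by (simp_all add: dist_real_def)
  have "\<bar>f s \<theta> - f s' \<theta>\<bar> \<le> r * \<bar>s - s'\<bar>"
    using field_differentiable_bound[of "{a..b}" "\<lambda>t. f t \<theta>" "\<lambda>t. g 1 t \<theta>" r s s'] f[of _ 1 \<theta>] g s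
    by (simp add: has_pd_def has_real_derivative_iff_has_vector_derivative)
  moreover have "\<bar>f s' \<theta> - f s' \<theta>'\<bar> \<le> r * \<bar>\<theta> - \<theta>'\<bar>"
    using field_differentiable_bound[of UNIV "f s'" "g 2 s'" r \<theta> \<theta>'] f[OF s(2), of 2] g s
    by (simp add: has_pd_def has_real_derivative_iff_has_vector_derivative)
  ultimately have 1: "\<bar>f s \<theta> - f s' \<theta>'\<bar> \<le> 2 * r * ?d"
    using mult_left_mono[OF dd(1) \<open>0 \<le> r\<close>] mult_left_mono[OF dd(2) \<open>0 \<le> r\<close>] by linarith
  show "\<bar>f s \<theta> - f s' \<theta>'\<bar> \<le> 2 * r * ?d powr \<beta>"
  proof (cases "?d \<le> 1")
    case True
    have "?d \<le> ?d powr \<beta>"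
    proof (cases "?d = 0")
      case False
      then have "?d powr 1 \<le> ?d powr \<beta>" using True \<beta> by (intro powr_mono') auto
      then show ?thesis by simp
    qed simp
    then show ?thesis using 1 mult_left_mono[of ?d "?d powr \<beta>" "2 * r"] \<open>0 \<le> r\<close> by linarith
  next
    case False
    then have "1 \<le> ?d powr \<beta>" using \<beta> by (simp add: ge_one_powr_ge_zero)
    then have "2 * r \<le> 2 * r * ?d powr \<beta>" using \<open>0 \<le> r\<close> mult_left_mono[of 1 "?d powr \<beta>" "2 * r"] by simp
    moreover have "\<bar>f s \<theta> - f s' \<theta>'\<bar> \<le> 2 * r"
      using r[OF s(1), of \<theta>] r[OF s(2), of \<theta>'] by linarith
    ultimately show ?thesis by linarith
  qed
qed

text \<open>The norm contains Hoelder quotients of second derivatives only; those of the lower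
  entries come from Lipschitz bounds, which cost the factor 2. The norm differentiates within the
  window, and uniqueness of one-sided derivatives identifies its terms with the entries of a jet
  restricted from a longer interval.\<close>

lemma jet_bd_of_norm:
  assumes \<beta>: "0 < \<beta>" "\<beta> < 1" and j: "is_jet {s0..s0+1} j"
    and u: "\<And>s \<theta>. s \<in> {s0..s0+1} \<Longrightarrow> u s \<theta> = j s \<theta> 0"
    and r: "holder_norm 2 \<beta> {s0..s0+1} u \<le> ennreal r" "0 \<le> r"
  shows "jet_bd \<beta> {s0..s0+1} j (2 * r)"
proof -
  let ?I = "{s0..s0+1}"
  have nb: "at s within ?I \<noteq> bot" if "s \<in> ?I" for s using at_within_Icc_neq_bot[of s0 "s0 + 1" s] that by auto
  have jd: "has_pd ?I i (\<lambda>s \<theta>. j s \<theta> 0) (j s \<theta> (idx1 i)) s \<theta>"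
    "has_pd ?I k (\<lambda>s \<theta>. j s \<theta> (idx1 i)) (j s \<theta> (idx2 i k)) s \<theta>" if "s \<in> ?I" for i k s \<theta>
    using j that unfolding is_jet_def by blast+
  have p1: "pd ?I i u s \<theta> = j s \<theta> (idx1 i)" if "s \<in> ?I" for i s \<theta>
    by (rule pd_eq[OF has_pd_cong[OF jd(1)] nb]) (use that u in auto)
  have p2: "pd ?I k (pd ?I i u) s \<theta> = j s \<theta> (idx2 i k)" if "s \<in> ?I" for i k s \<theta>
    by (rule pd_eq[OF has_pd_cong[OF jd(2)[of _ k i]] nb]) (use that p1 in auto)
  have m: "multi_pd ?I 0 0 u s \<theta> = j s \<theta> 0" "multi_pd ?I 1 0 u s \<theta> = j s \<theta> 1" "multi_pd ?I 0 1 u s \<theta> = j s \<theta> 2"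
    "multi_pd ?I 2 0 u s \<theta> = j s \<theta> 3" "multi_pd ?I 1 1 u s \<theta> = j s \<theta> 4" "multi_pd ?I 0 2 u s \<theta> = j s \<theta> 5"
    if "s \<in> ?I" for s \<theta>
    using u[OF that] p1[OF that, of 1] p1[OF that, of 2] p2[OF that, of 1 1] p2[OF that, of 1 2] p2[OF that, of 2 2]
    by (simp_all add: multi_pd_def idx1_def idx2_def numeral_2_eq_2)
  have fin: "finite {(a, b). a + b \<le> n}" "finite {(a, b). a + b = n}" for n :: nat
    by (rule finite_subset[of _ "{..n} \<times> {..n}"]; auto)+
  have sup: "\<bar>multi_pd ?I a b u s \<theta>\<bar> \<le> r" if "a + b \<le> 2" "s \<in> ?I" for a b s \<theta>
  proof -
    have "ennreal \<bar>multi_pd ?I a b u s \<theta>\<bar> \<le> (SUP (s, \<theta>)\<in>?I \<times> UNIV. ennreal \<bar>multi_pd ?I a b u s \<theta>\<bar>)"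
      by (rule SUP_upper2[of "(s, \<theta>)"]) (use that in auto)
    also have "\<dots> \<le> (\<Sum>(a, b)\<in>{(a, b). a + b \<le> 2}. SUP (s, \<theta>)\<in>?I \<times> UNIV. ennreal \<bar>multi_pd ?I a b u s \<theta>\<bar>)"
      using member_le_sum[of "(a, b)" "{(a, b). a + b \<le> 2}"
          "\<lambda>(a, b). SUP (s, \<theta>)\<in>?I \<times> UNIV. ennreal \<bar>multi_pd ?I a b u s \<theta>\<bar>"] that fin by simp
    also have "\<dots> \<le> holder_norm 2 \<beta> ?I u" unfolding holder_norm_def by simp
    also have "\<dots> \<le> ennreal r" by (rule r(1))
    finally show ?thesis using r(2) by simp
  qed
  have top: "hol \<beta> ?I (multi_pd ?I a b u) r" if ab: "a + b = 2" for a b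
  proof (rule holI)
    show "\<bar>multi_pd ?I a b u s \<theta>\<bar> \<le> r" if "s \<in> ?I" for s \<theta> using sup ab that by simp
    fix s \<theta> s' \<theta>' :: real assume s: "s \<in> ?I" "s' \<in> ?I"
    let ?m = "multi_pd ?I a b u" and ?d = "dist (s, \<theta>) (s', \<theta>')"
    have "ennreal (\<bar>?m s \<theta> - ?m s' \<theta>'\<bar> / ?d powr \<beta>) \<le> holder_seminorm \<beta> ?I ?m"
      unfolding holder_seminorm_def by (rule SUP_upper2[of "((s, \<theta>), (s', \<theta>'))"]) (use s in auto)
    also have "\<dots> \<le> (\<Sum>(a, b)\<in>{(a, b). a + b = 2}. holder_seminorm \<beta> ?I (multi_pd ?I a b u))"
      using member_le_sum[of "(a, b)" "{(a, b). a + b = 2}"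
          "\<lambda>(a, b). holder_seminorm \<beta> ?I (multi_pd ?I a b u)"] ab fin by simp
    also have "\<dots> \<le> holder_norm 2 \<beta> ?I u" unfolding holder_norm_def by simp
    also have "\<dots> \<le> ennreal r" by (rule r(1))
    finally have q: "\<bar>?m s \<theta> - ?m s' \<theta>'\<bar> / ?d powr \<beta> \<le> r" using r(2) by simp
    show "\<bar>?m s \<theta> - ?m s' \<theta>'\<bar> \<le> r * ?d powr \<beta>"
    proof (cases "(s, \<theta>) = (s', \<theta>')")
      case False
      then have "0 < ?d powr \<beta>" by simp
      then show ?thesis using q by (simp add: divide_le_eq)
    qed (use r in auto)
  qed
  have b: "\<bar>j s \<theta> i\<bar> \<le> r" if "s \<in> ?I" "i < 6" for s \<theta> i
  proof -
    have "i \<in> {0, 1, 2, 3, 4, 5}" using that(2) by auto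
    then show ?thesis
      using sup[of 0 0, OF _ that(1), of \<theta>] sup[of 1 0, OF _ that(1), of \<theta>] sup[of 0 1, OF _ that(1), of \<theta>]
        sup[of 2 0, OF _ that(1), of \<theta>] sup[of 1 1, OF _ that(1), of \<theta>] sup[of 0 2, OF _ that(1), of \<theta>]
      unfolding m[OF that(1)] by auto
  qed
  have id: "idx1 i < 6" "idx2 i k < 6" for i k by (simp_all add: idx1_def idx2_def)
  have l0: "hol \<beta> ?I (\<lambda>s \<theta>. j s \<theta> 0) (2 * r)"
    by (rule hol_lipschitz[OF \<beta> jd(1)]) (use b id r in auto)
  have l1: "hol \<beta> ?I (\<lambda>s \<theta>. j s \<theta> (idx1 i)) (2 * r)" for i
    by (rule hol_lipschitz[OF \<beta> jd(2)]) (use b id r in auto)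
  have l2: "hol \<beta> ?I (\<lambda>s \<theta>. j s \<theta> i) (2 * r)" if "i \<in> {3, 4, 5}" for i
  proof -
    have "hol \<beta> ?I (\<lambda>s \<theta>. j s \<theta> i) r"
      using hol_cong[OF top[of 2 0] m(4)] hol_cong[OF top[of 1 1] m(5)] hol_cong[OF top[of 0 2] m(6)] that by auto
    then show ?thesis by (rule hol_mono) (use r in simp)
  qed
  show ?thesis
    unfolding jet_bd_def
  proof (intro allI impI)
    fix i :: nat assume "i < 6"
    then consider "i = 0" | "i = idx1 1" | "i = idx1 2" | "i \<in> {3, 4, 5}" by (force simp: idx1_def)
    then show "hol \<beta> ?I (\<lambda>s \<theta>. j s \<theta> i) (2 * r)" using l0 l1 l2 by cases auto
  qed
qed

lemma norm_of_hol:
  assumes u: "hol \<beta> I u K" and K: "0 \<le> K"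
  shows "holder_norm 0 \<beta> I u \<le> ennreal (2 * K)"
proof -
  have e: "{(a::nat, b::nat). a + b \<le> 0} = {(0, 0)}" "{(a::nat, b::nat). a + b = 0} = {(0, 0)}" by auto
  have m: "multi_pd I 0 0 u = u" by (simp add: multi_pd_def)
  have "(SUP (s, \<theta>)\<in>I \<times> UNIV. ennreal \<bar>u s \<theta>\<bar>) \<le> ennreal K"
    by (rule SUP_least) (use hol_bound[OF u] in \<open>auto intro!: ennreal_leI\<close>)
  moreover have "holder_seminorm \<beta> I u \<le> ennreal K"
    unfolding holder_seminorm_def
  proof (rule SUP_least, clarify)
    fix s \<theta> s' \<theta>' :: real assume s: "s \<in> I" "s' \<in> I"
    \<comment> \<open>At coinciding points the quotient is 0 / 0 = 0.\<close>
    have "\<bar>u s \<theta> - u s' \<theta>'\<bar> / dist (s, \<theta>) (s', \<theta>') powr \<beta> \<le> K"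
      using hol_diff[OF u s, of \<theta> \<theta>'] K by (cases "(s, \<theta>) = (s', \<theta>')") (auto simp: divide_le_eq)
    then show "ennreal (\<bar>u (fst (s, \<theta>)) (snd (s, \<theta>)) - u (fst (s', \<theta>')) (snd (s', \<theta>'))\<bar> /
        dist (s, \<theta>) (s', \<theta>') powr \<beta>) \<le> ennreal K" by (simp add: ennreal_leI)
  qed
  ultimately have "holder_norm 0 \<beta> I u \<le> ennreal K + ennreal K"
    unfolding holder_norm_def e by (simp add: m add_mono)
  then show ?thesis using K by (simp add: ennreal_plus[symmetric] del: ennreal_plus)
qed

section \<open>The expansion\<close>

text \<open>One \<delta> serves for the immersions and for the continuity of the normal and of the
  height; the ray t j stays in the same ball because |t| \<le> 1.\<close>

lemma op_eq_gH:
  assumes \<beta>: "0 < \<beta>" "\<beta> < 1"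
  shows "\<exists>\<delta>>0. \<forall>\<alpha> S j w. end_pt \<alpha> S \<longrightarrow> is_jet {S..} j \<longrightarrow> (\<forall>s\<ge>S. jet_bd \<beta> {s..s+1} j \<delta>) \<longrightarrow>
    (\<forall>s\<ge>S. \<forall>\<theta>. w s \<theta> = j s \<theta> 0) \<longrightarrow>
    (\<forall>s\<ge>S. \<forall>\<theta>. mean_curvature_op \<alpha> S w s \<theta> = gH \<alpha> s \<theta> (j s \<theta>) / 2)"
proof -
  obtain d0 where d0: "0 < d0" "\<And>\<alpha> s \<theta> J. end_pt \<alpha> s \<Longrightarrow> \<forall>i<6. \<bar>J i\<bar> \<le> d0 \<Longrightarrow>
      cross3 (gA 1 \<alpha> s \<theta> J) (gA 2 \<alpha> s \<theta> J) \<noteq> 0"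
    using gA_immersed[OF \<beta>] by blast
  have N: "good \<beta> (\<lambda>\<alpha> s \<theta> J. gN \<alpha> s \<theta> J $ k)" for k
    using vgood_gN[OF \<beta>] by (simp add: vgood_def)
  note cont = good_continuous[OF _ \<beta>(1)]
  have "\<forall>k. \<exists>d>0. \<forall>\<alpha> S j. end_pt \<alpha> S \<longrightarrow> (\<forall>s\<ge>S. jet_bd \<beta> {s..s+1} j d) \<longrightarrow>
      continuous_on ({0..1} \<times> {S..} \<times> UNIV) (\<lambda>(t, s, \<theta>). gN \<alpha> s \<theta> (\<lambda>i. t * j s \<theta> i) $ k)"
    using cont[OF N] by blast
  then obtain dN where dN: "\<And>k. 0 < dN k" "\<And>k \<alpha> S j. end_pt \<alpha> S \<Longrightarrow> \<forall>s\<ge>S. jet_bd \<beta> {s..s+1} j (dN k) \<Longrightarrow>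
      continuous_on ({0..1} \<times> {S..} \<times> UNIV) (\<lambda>(t, s, \<theta>). gN \<alpha> s \<theta> (\<lambda>i. t * j s \<theta> i) $ k)"
    unfolding choice_iff by blast
  obtain dD where dD: "0 < dD" "\<And>\<alpha> S j. end_pt \<alpha> S \<Longrightarrow> \<forall>s\<ge>S. jet_bd \<beta> {s..s+1} j dD \<Longrightarrow>
      continuous_on ({0..1} \<times> {S..} \<times> UNIV) (\<lambda>(t, s, \<theta>). D0 \<alpha> s \<theta> (\<lambda>i. t * j s \<theta> i))"
    using cont[OF good_D(1)[OF \<beta>]] by blast
  define \<delta> where "\<delta> = min (min d0 dD) (Min (range dN))"
  have \<delta>: "0 < \<delta>" "\<delta> \<le> d0" "\<delta> \<le> dD" "\<delta> \<le> dN k" for k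
    unfolding \<delta>_def using d0(1) dD(1) dN(1) by (auto simp: min_le_iff_disj)
  have "mean_curvature_op \<alpha> S w s \<theta> = gH \<alpha> s \<theta> (j s \<theta>) / 2"
    if e: "end_pt \<alpha> S" and j: "is_jet {S..} j" and jb: "\<forall>s\<ge>S. jet_bd \<beta> {s..s+1} j \<delta>"
      and w: "\<forall>s\<ge>S. \<forall>\<theta>. w s \<theta> = j s \<theta> 0" and s: "S \<le> s" for \<alpha> S j w s \<theta>
  proof (rule mean_curvature_op_eq[OF _ _ j])
    have jm: "\<forall>s\<ge>S. jet_bd \<beta> {s..s+1} j d" if "\<delta> \<le> d" for d using jb jet_bd_mono that by blast
    show "0 < \<alpha>" "0 < S" using end_pt_pos[OF e] by auto
    show "cross3 (gA 1 \<alpha> s \<theta> (\<lambda>i. t * j s \<theta> i)) (gA 2 \<alpha> s \<theta> (\<lambda>i. t * j s \<theta> i)) \<noteq> 0"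
      if t: "t \<in> {0..1}" and s: "s \<in> {S..}" for t s \<theta>
    proof (rule d0(2))
      show "end_pt \<alpha> s" using end_pt_mono[OF e] s by simp
      show "\<forall>i<6. \<bar>t * j s \<theta> i\<bar> \<le> d0"
      proof (intro allI impI)
        fix i :: nat assume "i < 6"
        then have "\<bar>j s \<theta> i\<bar> \<le> d0"
          using jm[OF \<delta>(2)] s hol_bound[of \<beta> "{s..s+1}" "\<lambda>s \<theta>. j s \<theta> i" d0 s \<theta>] by (auto simp: jet_bd_def)
        then show "\<bar>t * j s \<theta> i\<bar> \<le> d0"
          using t mult_mono[of "\<bar>t\<bar>" 1 "\<bar>j s \<theta> i\<bar>" d0] by (simp add: abs_mult)
      qed
    qed
    show "continuous_on ({0..1} \<times> {S..} \<times> UNIV) (\<lambda>(t, s, \<theta>). gN \<alpha> s \<theta> (\<lambda>i. t * j s \<theta> i) $ k)" for k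
      by (rule dN(2)[OF e jm[OF \<delta>(4)]])
    show "continuous_on ({0..1} \<times> {S..} \<times> UNIV) (\<lambda>(t, s, \<theta>). D0 \<alpha> s \<theta> (\<lambda>i. t * j s \<theta> i))"
      by (rule dD(2)[OF e jm[OF \<delta>(3)]])
  qed (use w s in auto)
  then show ?thesis using \<delta>(1) by blast
qed

text \<open>The ray through the zero jet is constant, and its derivative has been identified with
  the Jacobi operator.\<close>

lemma jacobi_op_zero:
  assumes "0 < \<alpha>" "0 < S" "S \<le> s"
  shows "jacobi_op \<alpha> S (\<lambda>s \<theta>. 0) s \<theta> = 0"
proof -
  have "is_jet {S..} (\<lambda>s \<theta> i. 0)" by (simp add: is_jet_def has_pd_const)
  from linearization[OF assms(1,2) this, of s "\<lambda>s \<theta>. 0" \<theta>] assms(3)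
  have "((\<lambda>t::real. gH \<alpha> s \<theta> (\<lambda>i. 0)) has_real_derivative jacobi_op \<alpha> S (\<lambda>s \<theta>. 0) s \<theta>) (at 0)" by simp
  then show ?thesis by (rule DERIV_unique) simp
qed

lemma admissible_jet:
  assumes \<beta>: "0 < \<beta>" "\<beta> < 1" and v: "admissible \<beta> \<delta> S v" and s: "S \<le> s"
    and r: "holder_norm 2 \<beta> {s..s+1} v \<le> ennreal r" "0 \<le> r"
  shows "jet_bd \<beta> {s..s+1} (jet_of {S..} v) (2 * r)"
proof (rule jet_bd_of_norm[OF \<beta> _ _ r])
  show "is_jet {s..s+1} (jet_of {S..} v)"
    by (rule is_jet_subset[OF is_jet_jet_of]) (use v s in \<open>auto simp: admissible_def holder_loc_def\<close>)
qed (simp add: jet_of_def)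

theorem proposition3p1:
  fixes \<beta> :: real
  assumes "0 < \<beta>" and "\<beta> < 1"
  shows "\<exists>\<epsilon>0>0. \<exists>\<delta>>0. \<exists>C>0. \<forall>\<epsilon> \<alpha> S :: real.
    0 < \<epsilon> \<and> \<epsilon> < \<epsilon>0 \<and> 0 < \<alpha> \<and> cat_eps \<alpha> = \<epsilon> \<and> 0 < S \<and> \<epsilon> * cosh S = 1 \<longrightarrow>
    (\<exists>Q :: (real \<Rightarrow> real \<Rightarrow> real) \<Rightarrow> (real \<Rightarrow> real \<Rightarrow> real).
      (\<forall>w. admissible \<beta> \<delta> S w \<longrightarrow>
         (\<forall>s\<ge>S. \<forall>\<theta>. mean_curvature_op \<alpha> S w s \<theta>
                     = 1/2 + 1/2 * jacobi_op \<alpha> S w s \<theta> + Q w s \<theta>)) \<and>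
      (\<forall>s\<ge>S. \<forall>\<theta>. Q (\<lambda>s \<theta>. 0) s \<theta> = 0) \<and>
      (\<forall>v w. admissible \<beta> \<delta> S v \<longrightarrow> admissible \<beta> \<delta> S w \<longrightarrow>
         (\<forall>s\<ge>S. holder_norm 0 \<beta> {s..s+1} (\<lambda>s \<theta>. Q v s \<theta> - Q w s \<theta>)
            \<le> ennreal C * (holder_norm 2 \<beta> {s..s+1} v + holder_norm 2 \<beta> {s..s+1} w)
               * holder_norm 2 \<beta> {s..s+1} (\<lambda>s \<theta>. v s \<theta> - w s \<theta>))))"
proof -
  note \<beta> = assms
  obtain d1 where d1: "0 < d1" "\<And>\<alpha> S j w s \<theta>. end_pt \<alpha> S \<Longrightarrow> is_jet {S..} j \<Longrightarrow>
      \<forall>s\<ge>S. jet_bd \<beta> {s..s+1} j d1 \<Longrightarrow> \<forall>s\<ge>S. \<forall>\<theta>. w s \<theta> = j s \<theta> 0 \<Longrightarrow> S \<le> s \<Longrightarrow>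
      mean_curvature_op \<alpha> S w s \<theta> = gH \<alpha> s \<theta> (j s \<theta>) / 2"
    using op_eq_gH[OF \<beta>] by blast
  from good_remainder[OF good_gH[OF \<beta>]] obtain d2 C where d2: "0 < d2" "1 \<le> C" and
    rem: "\<forall>\<alpha> s0 j k a b e Lj Lk. end_pt \<alpha> s0 \<longrightarrow>
      jet_bd \<beta> {s0..s0+1} j a \<longrightarrow> jet_bd \<beta> {s0..s0+1} k b \<longrightarrow>
      jet_bd \<beta> {s0..s0+1} (\<lambda>s \<theta> i. j s \<theta> i - k s \<theta> i) e \<longrightarrow> a \<le> d2 \<longrightarrow> b \<le> d2 \<longrightarrow>
      (\<forall>s\<in>{s0..s0+1}. \<forall>\<theta>. ((\<lambda>t. gH \<alpha> s \<theta> (\<lambda>i. t * j s \<theta> i)) has_real_derivative Lj s \<theta>) (at 0)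
         \<and> ((\<lambda>t. gH \<alpha> s \<theta> (\<lambda>i. t * k s \<theta> i)) has_real_derivative Lk s \<theta>) (at 0)) \<longrightarrow>
      hol \<beta> {s0..s0+1} (\<lambda>s \<theta>. gH \<alpha> s \<theta> (j s \<theta>) - gH \<alpha> s \<theta> (k s \<theta>) - (Lj s \<theta> - Lk s \<theta>)) (C * (a + b) * e)"
    by (elim exE conjE) rule
  \<comment> \<open>A norm bound \<delta> yields jets bounded by 2 \<delta>, hence the
    halving.\<close>
  define \<delta> where "\<delta> = min d1 d2 / 2"
  have \<delta>: "0 < \<delta>" "2 * \<delta> \<le> d1" "2 * \<delta> \<le> d2" using d1(1) d2(1) by (auto simp: \<delta>_def)
  \<comment> \<open>The expansion holds by this choice; the content is the estimate. The Jacobi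
    operator linearizes the sum of the principal curvatures, so half of it is subtracted.\<close>
  define Q where "Q = (\<lambda>\<alpha> S w s \<theta>. mean_curvature_op \<alpha> S w s \<theta> - 1/2 - 1/2 * jacobi_op \<alpha> S w s \<theta>)"
  have Q0: "Q \<alpha> S (\<lambda>s \<theta>. 0) s \<theta> = 0" if e: "end_pt \<alpha> S" and s: "S \<le> s" for \<alpha> S s \<theta>
  proof -
    have p: "0 < \<alpha>" "0 < S" using end_pt_pos[OF e] by auto
    have "is_jet {S..} (\<lambda>s \<theta> i. 0)" by (simp add: is_jet_def has_pd_const)
    from d1(2)[OF e this, of "\<lambda>s \<theta>. 0" s \<theta>] s d1(1)
    have "mean_curvature_op \<alpha> S (\<lambda>s \<theta>. 0) s \<theta> = gH \<alpha> s \<theta> (\<lambda>_. 0) / 2" by (simp add: jet_bd_zero)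
    then show ?thesis unfolding Q_def jacobi_op_zero[OF p s] gH_zero[OF p(1) refl] by simp
  qed
  have main: "holder_norm 0 \<beta> {s..s+1} (\<lambda>s \<theta>. Q \<alpha> S v s \<theta> - Q \<alpha> S w s \<theta>)
      \<le> ennreal (8 * C) * (holder_norm 2 \<beta> {s..s+1} v + holder_norm 2 \<beta> {s..s+1} w)
         * holder_norm 2 \<beta> {s..s+1} (\<lambda>s \<theta>. v s \<theta> - w s \<theta>)"
    if e: "end_pt \<alpha> S" and v: "admissible \<beta> \<delta> S v" and w: "admissible \<beta> \<delta> S w" and s: "S \<le> s"
    for \<alpha> S v w s
  proof -
    have p: "0 < \<alpha>" "0 < S" using end_pt_pos[OF e] by auto
    let ?I = "{s..s+1}" and ?j = "jet_of {S..} v" and ?k = "jet_of {S..} w"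
    have sub: "?I \<subseteq> {S..}" using s by auto
    have jet: "is_jet {S..} (jet_of {S..} u)" if "admissible \<beta> \<delta> S u" for u
      by (rule is_jet_jet_of) (use that in \<open>simp add: admissible_def holder_loc_def\<close>)
    have j0: "jet_of {S..} u s \<theta> 0 = u s \<theta>" for u s \<theta> by (simp add: jet_of_def)
    have op: "mean_curvature_op \<alpha> S u t \<theta> = gH \<alpha> t \<theta> (jet_of {S..} u t \<theta>) / 2"
      if u: "admissible \<beta> \<delta> S u" and t: "S \<le> t" for u t \<theta>
    proof (rule d1(2)[OF e jet[OF u] _ _ t])
      show "\<forall>s\<ge>S. jet_bd \<beta> {s..s+1} (jet_of {S..} u) d1"
      proof (intro allI impI)
        fix s assume "S \<le> s"
        from admissible_jet[OF \<beta> u this, of \<delta>] this u \<delta>(1)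
        have "jet_bd \<beta> {s..s+1} (jet_of {S..} u) (2 * \<delta>)" by (simp add: admissible_def)
        then show "jet_bd \<beta> {s..s+1} (jet_of {S..} u) d1" by (rule jet_bd_mono) (rule \<delta>(2))
      qed
    qed (simp add: j0)
    have lin: "((\<lambda>t. gH \<alpha> x \<theta> (\<lambda>i. t * jet_of {S..} u x \<theta> i)) has_real_derivative jacobi_op \<alpha> S u x \<theta>) (at 0)"
      if "admissible \<beta> \<delta> S u" "x \<in> ?I" for u x \<theta>
      by (rule linearization[OF p jet[OF that(1)]]) (use that sub in \<open>auto simp: j0\<close>)
    \<comment> \<open>The factor 1/2 between \<open>gH\<close> and the mean curvature cancels the
      factor 2 from adding sup and quotient in the norm.\<close>
    have bound: "holder_norm 0 \<beta> ?I (\<lambda>s \<theta>. Q \<alpha> S v s \<theta> - Q \<alpha> S w s \<theta>) \<le> ennreal (C * (a' + b') * e')"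
      if "jet_bd \<beta> ?I ?j a'" "jet_bd \<beta> ?I ?k b'" "jet_bd \<beta> ?I (\<lambda>s \<theta> i. ?j s \<theta> i - ?k s \<theta> i) e'"
        "a' \<le> d2" "b' \<le> d2" for a' b' e'
    proof -
      have nn: "0 \<le> a'" "0 \<le> b'" "0 \<le> e'" using that jet_bd_nonneg by blast+
      have "hol \<beta> ?I (\<lambda>s \<theta>. gH \<alpha> s \<theta> (?j s \<theta>) - gH \<alpha> s \<theta> (?k s \<theta>)
          - (jacobi_op \<alpha> S v s \<theta> - jacobi_op \<alpha> S w s \<theta>)) (C * (a' + b') * e')"
        by (rule rem[rule_format, OF end_pt_mono[OF e s] that]) (use lin[OF v] lin[OF w] in auto)
      from hol_cmult[OF this, of "1/2"]
      have "hol \<beta> ?I (\<lambda>s \<theta>. Q \<alpha> S v s \<theta> - Q \<alpha> S w s \<theta>) (\<bar>1/2\<bar> * (C * (a' + b') * e'))"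
        by (rule hol_cong) (use s in \<open>simp add: Q_def op[OF v] op[OF w] field_simps\<close>)
      from norm_of_hol[OF this] nn d2 show ?thesis by simp
    qed
    have fin: "\<exists>a\<ge>0. a \<le> \<delta> \<and> holder_norm 2 \<beta> ?I u = ennreal a" if "admissible \<beta> \<delta> S u" for u
    proof -
      have h: "holder_norm 2 \<beta> ?I u \<le> ennreal \<delta>" using that s by (simp add: admissible_def)
      then have "holder_norm 2 \<beta> ?I u < top" by (rule le_less_trans) simp
      then obtain a where a: "0 \<le> a" "holder_norm 2 \<beta> ?I u = ennreal a"
        by (cases "holder_norm 2 \<beta> ?I u") auto
      then show ?thesis using h \<delta>(1) by auto
    qed
    obtain a where a: "0 \<le> a" "a \<le> \<delta>" "holder_norm 2 \<beta> ?I v = ennreal a" using fin[OF v] by blast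
    obtain b where b: "0 \<le> b" "b \<le> \<delta>" "holder_norm 2 \<beta> ?I w = ennreal b" using fin[OF w] by blast
    have jv: "jet_bd \<beta> ?I ?j (2 * a)" by (rule admissible_jet[OF \<beta> v s]) (use a in auto)
    have jw: "jet_bd \<beta> ?I ?k (2 * b)" by (rule admissible_jet[OF \<beta> w s]) (use b in auto)
    show ?thesis
    proof (cases "holder_norm 2 \<beta> ?I (\<lambda>s \<theta>. v s \<theta> - w s \<theta>) = top")
      case True
      show ?thesis
      \<comment> \<open>An infinite last factor makes the right-hand side infinite unless v and w
        both have norm 0. Then 0 times infinity is 0 and the left-hand side must vanish; the crude
        bound 2 a + 2 b = 0 on the difference of the jets shows this.\<close>
      proof (cases "a + b = 0")
        case z: True
        then have "a = 0" "b = 0" using a b by auto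
        moreover have "jet_bd \<beta> ?I (\<lambda>s \<theta> i. ?j s \<theta> i - ?k s \<theta> i) (2 * a + 2 * b)"
          using jv jw hol_sub unfolding jet_bd_def by blast
        ultimately show ?thesis using bound[OF jv jw] d2(1) by auto
      next
        case False
        then have "0 < 8 * C * (a + b)" using a b d2 by simp
        then show ?thesis
          unfolding True a(3) b(3) using a b d2 False
          by (simp add: ennreal_plus[symmetric] ennreal_mult[symmetric] ennreal_mult_top del: ennreal_plus)
      qed
    next
      case False
      then obtain r where r: "0 \<le> r" "holder_norm 2 \<beta> ?I (\<lambda>s \<theta>. v s \<theta> - w s \<theta>) = ennreal r"
        by (cases "holder_norm 2 \<beta> ?I (\<lambda>s \<theta>. v s \<theta> - w s \<theta>)") auto
      have "jet_bd \<beta> ?I (\<lambda>s \<theta> i. ?j s \<theta> i - ?k s \<theta> i) (2 * r)"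
        by (rule jet_bd_of_norm[OF \<beta> is_jet_subset[OF is_jet_diff[OF jet[OF v] jet[OF w]] sub],
              where u = "\<lambda>s \<theta>. v s \<theta> - w s \<theta>"]) (use r in \<open>auto simp: j0\<close>)
      from bound[OF jv jw this] a b \<delta>
      have "holder_norm 0 \<beta> ?I (\<lambda>s \<theta>. Q \<alpha> S v s \<theta> - Q \<alpha> S w s \<theta>) \<le> ennreal (C * (2 * a + 2 * b) * (2 * r))"
        by simp
      \<comment> \<open>The two factors 2 from the passage to jets amount to 4 C, so 8 C leaves
        room.\<close>
      also have "\<dots> \<le> ennreal (8 * C * (a + b) * r)"
        using a b r d2 by (intro ennreal_leI) (simp add: algebra_simps)
      also have "\<dots> = ennreal (8 * C) * (ennreal a + ennreal b) * ennreal r"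
        using a b r d2 by (simp add: ennreal_mult ennreal_plus[symmetric] del: ennreal_plus)
      finally show ?thesis unfolding a(3) b(3) r(2) .
    qed
  qed
  show ?thesis
  proof (rule exI[of _ "1/2"], rule conjI[OF _ exI[of _ \<delta>]], simp, rule conjI[OF \<delta>(1) exI[of _ "8 * C"]],
      intro conjI allI impI)
    fix \<epsilon> \<alpha> S :: real
    assume h: "0 < \<epsilon> \<and> \<epsilon> < 1/2 \<and> 0 < \<alpha> \<and> cat_eps \<alpha> = \<epsilon> \<and> 0 < S \<and> \<epsilon> * cosh S = 1"
    \<comment> \<open>The value 1/2 chosen for the bound on \<epsilon> is the one in
      \<open>end_pt\<close>, and \<epsilon> cosh S = 1 is its last condition with equality.\<close>
    then have e: "end_pt \<alpha> S" by (auto simp: end_pt_def)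
    show "\<exists>Q :: (real \<Rightarrow> real \<Rightarrow> real) \<Rightarrow> (real \<Rightarrow> real \<Rightarrow> real).
      (\<forall>w. admissible \<beta> \<delta> S w \<longrightarrow>
         (\<forall>s\<ge>S. \<forall>\<theta>. mean_curvature_op \<alpha> S w s \<theta> = 1/2 + 1/2 * jacobi_op \<alpha> S w s \<theta> + Q w s \<theta>)) \<and>
      (\<forall>s\<ge>S. \<forall>\<theta>. Q (\<lambda>s \<theta>. 0) s \<theta> = 0) \<and>
      (\<forall>v w. admissible \<beta> \<delta> S v \<longrightarrow> admissible \<beta> \<delta> S w \<longrightarrow>
         (\<forall>s\<ge>S. holder_norm 0 \<beta> {s..s+1} (\<lambda>s \<theta>. Q v s \<theta> - Q w s \<theta>)
            \<le> ennreal (8 * C) * (holder_norm 2 \<beta> {s..s+1} v + holder_norm 2 \<beta> {s..s+1} w)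
               * holder_norm 2 \<beta> {s..s+1} (\<lambda>s \<theta>. v s \<theta> - w s \<theta>)))"
      by (rule exI[of _ "Q \<alpha> S"]) (use Q0[OF e] main[OF e] in \<open>auto simp: Q_def\<close>)
  qed (use d2 in simp)
qed


end
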